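(* Let $\mathcal X$ be a Lévy process as described in the context, in one of the Cases A, B, C. For every $q>0$ and $r\ge0$, $$\mathbb E\bigl[e^{-r(-I_{e_q})}\bigr]=a(q)\,\widehat W_q(r),$$ and, if $\mathbb E[\mathcal X(1)]>0$, then for every $r\ge0$, $$\mathbb E\bigl[e^{-r(-I_\infty)}\bigr]=a(0)\,\widehat W_0(r).$$ Hence, for $q\ge0$ (with $\mathbb E[\mathcal X(1)]>0$ if $q=0$), $a(q)W_q$ is the (generalized) density of $-I_{e_q}$ (of $-I_\infty$ if $q=0$).
   Context: Process. $\mathcal X(t)=ct+\gamma\mathcal B(t)+\mathcal Z(t)-\mathcal S(t)$, $t\ge0$, with independent components: $c\ge0$, $\gamma\ge0$; $\mathcal B$ is a Brownian motion with variance parameter $2$ (so $\mathbb E[e^{r\gamma\mathcal B(1)}]=e^{\gamma^2r^2}$); $\mathcal Z$ is a compound Poisson process with Lévy measure $\lambda_1f_1(x)dx$, $\lambda_1>0$, where $f_1$ is a probability density on $(0,\infty)$ with Laplace transform $\widehat f_1(r)=Q(r)/\prod_{i=1}^N(\alpha_i+r)^{n_i}$, $0<\alpha_1<\dots<\alpha_N$ real, $n_i\in\mathbb N$, $n_1+\dots+n_N=m$, $Q$ a polynomial of degree at most $m-1$; $\mathcal S$ is a pure jump Lévy process with only positive jumps, Lévy measure $\nu_{\mathcal S}$ and Laplace exponent $\Psi_{\mathcal S}(r)=-\log\mathbb E[e^{-r\mathcal S(1)}]=\int_{0+}^\infty(1-e^{-rx}-rxh(x))\nu_{\mathcal S}(dx)$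 ($h$ a truncation function). Put $$\Psi_{\mathcal X}(r)=cr+\gamma^2r^2+\lambda_1\Bigl(\frac{Q(-r)}{\prod_{j=1}^N(\alpha_j-r)^{n_j}}-1\Bigr)-\Psi_{\mathcal S}(r).$$ Cases. A: $c=\gamma=0$ and $\mathcal S$ is either a driftless subordinator that is not compound Poisson, or a compound Poisson process with $\mathbb E[\mathcal X(1)]>0$. B: $c>0$, $\gamma=0$, $\mathcal S$ a driftless subordinator. C: any other case except $c=\gamma=0$ with $\mathcal S$ compound Poisson and $\mathbb E[\mathcal X(1)]\le0$; in Case C it is assumed that $\int_{0+}^\infty(x^2\wedge x)\nu_{\mathcal S}(dx)<\infty$. When $\mathcal S$ is a driftless subordinator, $\Psi_{\mathcal S}(r)$ is $G_{\mathcal S}(r)=\int_{0+}^\infty(1-e^{-rx})\nu_{\mathcal S}(dx)$. Roots. For $q>0$, let $\beta_1(q),\dots,\beta_R(q)$ be the distinct roots of $\Psi_{\mathcal X}(r)-q=0$ in $\{\mathrm{Re}\,z>0\}$ ($\Psi_{\mathcal X}$ being continued meromorphically there), with multiplicities $k_1,\dots,k_R$; $\sum_jk_j=m$ in Case A and $m+1$ in Cases B, C; $\beta_1(q)$ is the unique real root in $(0,\alpha_1)$ and $k_1=1$. For $q=0$ one assumes $\mathbb E[\mathcal X(1)]>0$, and all quantities are understood as limits $q\downarrow0$; $\beta_1(0)=0$ is a simple root. Notation. $I_t=\inf_{0\le s\le t}\mathcal X(s)$, $I_\infty=\inf_{s\ge0}\mathcal X(s)$; $e_q$ is an exponential variable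 with parameter $q>0$ independent of $\mathcal X$. $$\kappa(q,r)=\frac{\prod_{j=1}^R(\beta_j(q)+r)^{k_j}}{\prod_{l=1}^N(\alpha_l+r)^{n_l}},\qquad \widehat W_q(r)=\frac{\kappa(q,-r)}{q-\Psi_{\mathcal X}(r)}\ (r\ge0),$$ $a(q)=q/\kappa(q,0)$ for $q>0$ and $a(0)=\lim_{q\downarrow0}a(q)$. Expressions in $r$ with removable singularities are extended by continuity. $W_q$ is the inverse Laplace transform of $\widehat W_q$; "generalized density" means that the law may have an atom at $0$, represented by a multiple of the Dirac delta. It is known (Lewis and Mordecki) that for $q>0$ the supremum $S_{e_q}=\sup_{0\le s\le e_q}\mathcal X(s)$ satisfies $\mathbb E[e^{-rS_{e_q}}]=\kappa(q,0)/\kappa(q,r)$, $r\ge0$.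
   Formalization: In Case A the form "atom at 0 plus density" is claimed only if the Lévy measure of S is absolutely continuous (it fails e.g. for c=γ=0 and S Poisson with unit jumps, where −I has an atom at 1); otherwise W_q is a measure on [0,∞) and a(q)W_q is shown to be the law of −I. *)

theory Defs
  imports "HOL-Probability.Probability" "HOL-Complex_Analysis.Complex_Analysis"
begin

section \<open>Processes\<close>

definition cadlag :: "(real \<Rightarrow> real) \<Rightarrow> bool" where
  "cadlag f \<longleftrightarrow>
     (\<forall>t\<ge>0. (f \<longlongrightarrow> f t) (at_right t)) \<and>
     (\<forall>t>0. \<exists>l. (f \<longlongrightarrow> l) (at_left t))"

text \<open>Path regularity is required for every outcome, so that running infima are random variables
  although \<open>M\<close> need not be complete.\<close>

definition levy_process :: "'a measure \<Rightarrow> (real \<Rightarrow> 'a \<Rightarrow> real) \<Rightarrow> bool" where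
  "levy_process M X \<longleftrightarrow>
     prob_space M \<and>
     (\<forall>t\<ge>0. X t \<in> borel_measurable M) \<and>
     (AE \<omega> in M. X 0 \<omega> = 0) \<and>
     (\<forall>(\<tau> :: nat \<Rightarrow> real) n. 0 \<le> \<tau> 0 \<and> mono_on {..n} \<tau> \<longrightarrow>
        prob_space.indep_vars M (\<lambda>_. borel) (\<lambda>i \<omega>. X (\<tau> (Suc i)) \<omega> - X (\<tau> i) \<omega>) {..<n}) \<and>
     (\<forall>s\<ge>0. \<forall>t\<ge>0. distr M borel (\<lambda>\<omega>. X (s + t) \<omega> - X s \<omega>) = distr M borel (X t)) \<and>
     (\<forall>\<omega>\<in>space M. cadlag (\<lambda>t. X t \<omega>))"

text \<open>Brownian motion with variance parameter 2: variance \<open>2 * t\<close> at time \<open>t\<close>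
  (\<open>normal_density\<close> takes the standard deviation).\<close>

definition brownian_motion2 :: "'a measure \<Rightarrow> (real \<Rightarrow> 'a \<Rightarrow> real) \<Rightarrow> bool" where
  "brownian_motion2 M B \<longleftrightarrow>
     levy_process M B \<and>
     (\<forall>t>0. distributed M lborel (B t) (\<lambda>x. ennreal (normal_density 0 (sqrt (2 * t)) x))) \<and>
     (\<forall>\<omega>\<in>space M. continuous_on {0..} (\<lambda>t. B t \<omega>))"

text \<open>\<open>T i\<close> are the inter-arrival times of the underlying Poisson process, \<open>Y i\<close> the jump sizes;
  the \<open>i\<close>-th jump occurs at time \<open>T 0 + \<dots> + T i\<close>. The Levy measure is \<open>l * f(x) dx\<close>.\<close>

definition compound_poisson ::
    "'a measure \<Rightarrow> real \<Rightarrow> (real \<Rightarrow> real) \<Rightarrow> (real \<Rightarrow> 'a \<Rightarrow> real) \<Rightarrow> bool" where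
  "compound_poisson M l f Z \<longleftrightarrow>
     levy_process M Z \<and>
     (\<exists>(T :: nat \<Rightarrow> 'a \<Rightarrow> real) (Y :: nat \<Rightarrow> 'a \<Rightarrow> real).
        prob_space.indep_vars M (\<lambda>_. borel) (case_sum T Y) UNIV \<and>
        (\<forall>i. distributed M lborel (T i) (\<lambda>x. ennreal (exponential_density l x))) \<and>
        (\<forall>i. distributed M lborel (Y i) (\<lambda>x. ennreal (f x))) \<and>
        (AE \<omega> in M. \<forall>t\<ge>0. Z t \<omega> = (\<Sum>i | (\<Sum>j\<le>i. T j \<omega>) \<le> t. Y i \<omega>)))"

definition process_events :: "'a measure \<Rightarrow> (real \<Rightarrow> 'a \<Rightarrow> real) \<Rightarrow> 'a set set" where
  "process_events M X =
     sigma_sets (space M) {X t -` A \<inter> space M | t A. 0 \<le> t \<and> A \<in> sets borel}"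

definition running_inf :: "(real \<Rightarrow> 'a \<Rightarrow> real) \<Rightarrow> real \<Rightarrow> 'a \<Rightarrow> real" where
  "running_inf X t \<omega> = (INF s\<in>{0..t}. X s \<omega>)"

text \<open>When the expectation of \<open>X 1\<close> is positive, the infimum is finite almost surely.\<close>

definition global_inf :: "(real \<Rightarrow> 'a \<Rightarrow> real) \<Rightarrow> 'a \<Rightarrow> real" where
  "global_inf X \<omega> = (INF s\<in>{0..}. X s \<omega>)"

definition indep_exponential ::
    "'a measure \<Rightarrow> (real \<Rightarrow> 'a \<Rightarrow> real) \<Rightarrow> real \<Rightarrow> ('a \<Rightarrow> real) \<Rightarrow> bool" where
  "indep_exponential M X q e \<longleftrightarrow>
     distributed M lborel e (\<lambda>x. ennreal (exponential_density q x)) \<and>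
     prob_space.indep_set M (process_events M X) {e -` A \<inter> space M | A. A \<in> sets borel}"


section \<open>The model\<close>

text \<open>\<open>drift\<close>, \<open>gauss\<close>, \<open>up_rate\<close>, \<open>up_density\<close> are \<open>c\<close>, \<open>\<gamma>\<close>, \<open>\<lambda>\<^sub>1\<close>, \<open>f\<^sub>1\<close>; the Laplace transform of
  \<open>f\<^sub>1\<close> has numerator \<open>numer\<close> and poles at \<open>- pole i\<close> of order \<open>pole_order i\<close>, \<open>1 \<le> i \<le> npoles\<close>;
  \<open>down_measure\<close> is the Levy measure of \<open>S\<close> and \<open>trunc\<close> the truncation function \<open>h\<close>.\<close>

record model =
  drift :: real
  gauss :: real
  up_rate :: real
  up_density :: "real \<Rightarrow> real"
  numer :: "real poly"
  npoles :: nat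
  pole :: "nat \<Rightarrow> real"
  pole_order :: "nat \<Rightarrow> nat"
  down_measure :: "real measure"
  trunc :: "real \<Rightarrow> real"

text \<open>The defining integral converges for \<open>Re z \<ge> 0\<close>, so it is its own analytic continuation.\<close>

definition Psi_S :: "model \<Rightarrow> complex \<Rightarrow> complex" where
  "Psi_S p z =
     (LINT x|down_measure p. 1 - exp (- z * of_real x) - z * of_real x * of_real (trunc p x))"

definition G_S :: "model \<Rightarrow> complex \<Rightarrow> complex" where
  "G_S p z = (LINT x|down_measure p. 1 - exp (- z * of_real x))"

definition Psi_X :: "model \<Rightarrow> complex \<Rightarrow> complex" where
  "Psi_X p z =
     of_real (drift p) * z + of_real ((gauss p)\<^sup>2) * z\<^sup>2
     + of_real (up_rate p) *
         (poly (map_poly of_real (numer p)) (- z)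
            / (\<Prod>j=1..npoles p. (of_real (pole p j) - z) ^ pole_order p j) - 1)
     - Psi_S p z"

definition valid_up_jumps :: "model \<Rightarrow> bool" where
  "valid_up_jumps p \<longleftrightarrow>
     0 < up_rate p \<and>
     up_density p \<in> borel_measurable borel \<and>
     (\<forall>x. 0 \<le> up_density p x) \<and> (\<forall>x\<le>0. up_density p x = 0) \<and>
     has_bochner_integral lborel (up_density p) 1 \<and>
     1 \<le> npoles p \<and>
     (\<forall>i\<in>{1..npoles p}. 0 < pole p i \<and> 1 \<le> pole_order p i) \<and>
     strict_mono_on {1..npoles p} (pole p) \<and>
     degree (numer p) \<le> (\<Sum>i=1..npoles p. pole_order p i) - 1 \<and>
     (\<forall>r\<ge>0. (LBINT x. exp (- r * x) * up_density p x)
        = poly (numer p) r / (\<Prod>i=1..npoles p. (pole p i + r) ^ pole_order p i)) \<and>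
     \<comment> \<open>the fraction is in lowest terms, i.e. \<open>pole_order\<close> really is the order of the pole\<close>
     (\<forall>i\<in>{1..npoles p}. poly (numer p) (- pole p i) \<noteq> 0)"

text \<open>The truncation function may be any bounded nonnegative one that makes the integral converge:
  \<open>h = 0\<close> for subordinators, \<open>h = indicator {0<..<1}\<close> in general, \<open>h = 1\<close> if \<open>S\<close> has a finite mean.
  Convergence of the integral at \<open>r = 1\<close> implies convergence on \<open>Re z \<ge> 0\<close>.\<close>

definition valid_down_jumps :: "model \<Rightarrow> bool" where
  "valid_down_jumps p \<longleftrightarrow>
     sets (down_measure p) = sets borel \<and>
     emeasure (down_measure p) {..0} = 0 \<and>
     (\<integral>\<^sup>+x. ennreal (min 1 (x\<^sup>2)) \<partial>down_measure p) < \<infinity> \<and>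
     trunc p \<in> borel_measurable borel \<and>
     (\<exists>K. \<forall>x. 0 \<le> trunc p x \<and> trunc p x \<le> K) \<and>
     integrable (down_measure p) (\<lambda>x. 1 - exp (- x) - x * trunc p x)"

definition down_process :: "'a measure \<Rightarrow> model \<Rightarrow> (real \<Rightarrow> 'a \<Rightarrow> real) \<Rightarrow> bool" where
  "down_process M p S \<longleftrightarrow>
     levy_process M S \<and>
     (AE \<omega> in M. \<forall>t>0. \<forall>l. ((\<lambda>s. S s \<omega>) \<longlongrightarrow> l) (at_left t) \<longrightarrow> l \<le> S t \<omega>) \<and>
     (\<forall>r\<ge>0. complex_of_real (prob_space.expectation M (\<lambda>\<omega>. exp (- r * S 1 \<omega>)))
        = exp (- Psi_S p (of_real r)))"

definition levy_model ::
    "'a measure \<Rightarrow> model \<Rightarrow> (real \<Rightarrow> 'a \<Rightarrow> real) \<Rightarrow> (real \<Rightarrow> 'a \<Rightarrow> real) \<Rightarrow> (real \<Rightarrow> 'a \<Rightarrow> real)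
      \<Rightarrow> (real \<Rightarrow> 'a \<Rightarrow> real) \<Rightarrow> bool" where
  "levy_model M p B Z S X \<longleftrightarrow>
     prob_space M \<and>
     0 \<le> drift p \<and> 0 \<le> gauss p \<and> valid_up_jumps p \<and> valid_down_jumps p \<and>
     brownian_motion2 M B \<and>
     compound_poisson M (up_rate p) (up_density p) Z \<and>
     down_process M p S \<and>
     prob_space.indep_sets M
       (\<lambda>k. process_events M ([B, Z, S] ! k)) {..<3::nat} \<and>
     X = (\<lambda>t \<omega>. drift p * t + gauss p * B t \<omega> + Z t \<omega> - S t \<omega>)"

definition driftless_subordinator :: "model \<Rightarrow> bool" where
  "driftless_subordinator p \<longleftrightarrow>
     (\<integral>\<^sup>+x. ennreal (min 1 x) \<partial>down_measure p) < \<infinity> \<and>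
     (\<forall>r\<ge>0. Psi_S p (of_real r) = G_S p (of_real r))"

definition down_compound_poisson :: "model \<Rightarrow> bool" where
  "down_compound_poisson p \<longleftrightarrow>
     driftless_subordinator p \<and> emeasure (down_measure p) UNIV < \<infinity>"

text \<open>\<open>positive_mean\<close> includes integrability, as the Bochner integral of a non-integrable function
  is 0. If \<open>S\<close> is compound Poisson and there is neither drift nor Gaussian part, the positive part of
  \<open>X 1\<close> is integrable, so the negation says that the mean is in \<open>[-\<infinity>, 0]\<close>.\<close>

definition positive_mean :: "'a measure \<Rightarrow> (real \<Rightarrow> 'a \<Rightarrow> real) \<Rightarrow> bool" where
  "positive_mean M X \<longleftrightarrow> prob_space.expectation M (X 1) > 0"

definition case_A :: "'a measure \<Rightarrow> model \<Rightarrow> (real \<Rightarrow> 'a \<Rightarrow> real) \<Rightarrow> bool" where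
  "case_A M p X \<longleftrightarrow>
     drift p = 0 \<and> gauss p = 0 \<and>
     ((driftless_subordinator p \<and> \<not> down_compound_poisson p) \<or>
      (down_compound_poisson p \<and> positive_mean M X))"

definition case_B :: "model \<Rightarrow> bool" where
  "case_B p \<longleftrightarrow> drift p > 0 \<and> gauss p = 0 \<and> driftless_subordinator p"

definition case_C :: "'a measure \<Rightarrow> model \<Rightarrow> (real \<Rightarrow> 'a \<Rightarrow> real) \<Rightarrow> bool" where
  "case_C M p X \<longleftrightarrow>
     \<not> case_A M p X \<and> \<not> case_B p \<and>
     \<not> (drift p = 0 \<and> gauss p = 0 \<and> down_compound_poisson p \<and> \<not> positive_mean M X) \<and>
     (\<integral>\<^sup>+x. ennreal (min (x\<^sup>2) x) \<partial>down_measure p) < \<infinity>"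


section \<open>The functions \<open>\<kappa>\<close>, \<open>W\<close> and \<open>a\<close>\<close>

text \<open>The poles have to be excluded explicitly because division by zero is total.\<close>

definition roots :: "model \<Rightarrow> real \<Rightarrow> complex set" where
  "roots p q =
     {z. Re z > 0 \<and> z \<notin> (\<lambda>j. of_real (pole p j)) ` {1..npoles p} \<and> Psi_X p z = of_real q}"

definition root_mult :: "model \<Rightarrow> real \<Rightarrow> complex \<Rightarrow> nat" where
  "root_mult p q b = nat (zorder (\<lambda>z. Psi_X p z - of_real q) b)"

text \<open>For real arguments the product over the roots is real, since the roots come in conjugate
  pairs of equal multiplicity.\<close>

definition kappa_pos :: "model \<Rightarrow> real \<Rightarrow> real \<Rightarrow> real" where
  "kappa_pos p q r =
     Re (\<Prod>b\<in>roots p q. (b + of_real r) ^ root_mult p q b)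
       / (\<Prod>l=1..npoles p. (pole p l + r) ^ pole_order p l)"

definition kappa :: "model \<Rightarrow> real \<Rightarrow> real \<Rightarrow> real" where
  "kappa p q r =
     (if q > 0 then kappa_pos p q r else Lim (at_right 0) (\<lambda>q'. kappa_pos p q' r))"

text \<open>The limit is the continuous extension over the zeros of the denominator and over the poles;
  elsewhere it is the value of the quotient. \<open>Psi_X\<close> is real on the real line.\<close>

definition W_hat :: "model \<Rightarrow> real \<Rightarrow> real \<Rightarrow> real" where
  "W_hat p q r =
     Lim (at r within {0..}) (\<lambda>s. kappa p q (- s) / (q - Re (Psi_X p (of_real s))))"

definition a_coef :: "model \<Rightarrow> real \<Rightarrow> real" where
  "a_coef p q =
     (if q > 0 then q / kappa p q 0 else Lim (at_right 0) (\<lambda>q'. q' / kappa p q' 0))"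

text \<open>Inverse Laplace transforms are taken among Borel measures on the half-line \<open>[0,\<infinity>)\<close>, which
  include the nonnegative functions with an additional multiple of the Dirac measure at 0. For
  driftless \<open>X\<close> and \<open>S\<close> with a non-diffuse Levy measure the inverse transform need not be of that
  special form, see \<open>generalized_density\<close> below.\<close>

definition inverse_laplace :: "(real \<Rightarrow> real) \<Rightarrow> real measure \<Rightarrow> bool" where
  "inverse_laplace F W \<longleftrightarrow>
     sets W = sets borel \<and> emeasure W {..<0} = 0 \<and>
     (\<forall>r\<ge>0. has_bochner_integral W (\<lambda>x. exp (- r * x)) (F r))"

definition W_measure :: "model \<Rightarrow> real \<Rightarrow> real measure" where
  "W_measure p q = (THE W. inverse_laplace (W_hat p q) W)"

text \<open>\<open>\<mu>\<close> is \<open>w0\<close> times the Dirac measure at 0 plus \<open>w(x) dx\<close> on the positive half-line.\<close>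

definition generalized_density :: "real measure \<Rightarrow> real \<Rightarrow> (real \<Rightarrow> real) \<Rightarrow> bool" where
  "generalized_density \<mu> w0 w \<longleftrightarrow>
     0 \<le> w0 \<and> w \<in> borel_measurable borel \<and> (\<forall>x. 0 \<le> w x) \<and>
     (\<forall>A\<in>sets borel. emeasure \<mu> A =
        ennreal w0 * indicator A 0 + (\<integral>\<^sup>+x\<in>A \<inter> {0<..}. ennreal (w x) \<partial>lborel))"

text \<open>\<open>Y\<close> is minus the infimum of \<open>X\<close> up to an independent exponential time of rate \<open>q\<close>; for
  \<open>q = 0\<close> it is minus the global infimum.\<close>

definition neg_infimum ::
    "'a measure \<Rightarrow> (real \<Rightarrow> 'a \<Rightarrow> real) \<Rightarrow> real \<Rightarrow> ('a \<Rightarrow> real) \<Rightarrow> bool" where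
  "neg_infimum M X q Y \<longleftrightarrow>
     (q > 0 \<and> (\<exists>e. indep_exponential M X q e \<and> Y = (\<lambda>\<omega>. - running_inf X (e \<omega>) \<omega>))) \<or>
     (q = 0 \<and> positive_mean M X \<and> Y = (\<lambda>\<omega>. - global_inf X \<omega>))"

end

theory Submission
 imports Defs "HOL-Computational_Algebra.Fundamental_Theorem_Algebra"
begin

text \<open>
The minimum and the excess over the minimum of a random walk at an independent geometric time factor
its generating function; along dyadic grids this gives
\<open>E exp (z I) * E exp (z (X - I)) * (q - \<psi> z) = q\<close> on the imaginary axis, for \<open>X\<close> and its running infimum
\<open>I\<close> at an exponential time of rate \<open>q\<close>. With the poles of \<open>\<psi>\<close> cleared, the two sides continue to
opposite half-planes, and renewal bounds give polynomial growth; by Liouville's theorem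
\<open>g(z) = E exp (z I) * (q - \<psi> z) * \<Prod>(\<alpha>\<^sub>j - z)\<close> is a polynomial, whose zeros in \<open>Re z > 0\<close> are the roots. This
identifies \<open>E exp (r I)\<close> as a multiple of \<open>W_hat\<close>. For \<open>q = 0\<close> one lets \<open>q\<close> decrease to 0: the
polynomials have bounded degree, so their coefficients converge, and the real root near 0 together
with the positive mean shows that no mass escapes to infinity. For the densities, comparing two values
of \<open>q\<close> (or two points \<open>r\<close> and \<open>r + 1\<close>) in this identity cancels everything except transforms of
absolutely continuous measures, so that the singular part away from 0 vanishes.
\<close>

section \<open>Laplace transforms of measures\<close>

text \<open>The exponent is available for \<open>Re z \<ge> 0\<close> only: the Levy measure of
  \<open>S\<close> is general, and nothing continues the exponent across the imaginary axis. On the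
  left the only information is \<open>E exp (z (X - I))\<close>, and the obstacle is a possible fast
  growth of its reciprocal. Characteristic functions do not exclude it; the renewal structure of the
  ladder times does, with linear growth whose constant survives the passage along the grids. Linear
  growth costs at most one degree over the product of the pole factors, whence the alternative of m
  or m + 1 roots, decided by the sign of \<open>q - \<psi>\<close> at large real arguments. The
  number \<open>a(q)\<close> is the leading coefficient of the polynomial up to sign. As
  \<open>q\<close> decreases to 0, a loss of degree is excluded by a bound on the roots uniform in
  \<open>q\<close>, and a loss of mass by the slope of the limit polynomial at 0. For the densities,
  singular parts at two rates are proportional with a ratio controlled by the monotonicity of
  \<open>a\<close>, and at large rates the mass concentrates at 0. If \<open>X\<close> is a
  driftless pure jump process of bounded variation, absolute continuity of the Levy measure of
  \<open>S\<close> takes over.\<close>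

lemma holomorphic_param_integral:
 fixes f :: "complex \<Rightarrow> 'a \<Rightarrow> complex"
 assumes S: "open S"
  and hol: "\<And>x. x \<in> space M \<Longrightarrow> (\<lambda>z. f z x) holomorphic_on S"
  and meas: "\<And>z. z \<in> S \<Longrightarrow> f z \<in> borel_measurable M"
  and dom: "\<And>z0. z0 \<in> S \<Longrightarrow> \<exists>r>0. \<exists>g::'a \<Rightarrow> real. integrable M g \<and>
        (\<forall>z\<in>ball z0 r \<inter> S. \<forall>x\<in>space M. norm (f z x) \<le> g x)"
 shows "(\<lambda>z. \<integral>x. f z x \<partial>M) holomorphic_on S"
 unfolding holomorphic_on_open[OF S]
proof
 fix z0 assume z0: "z0 \<in> S"
 obtain r g where r: "r > 0" and g: "integrable M g"
  and bd: "\<And>z x. z \<in> ball z0 r \<inter> S \<Longrightarrow> x \<in> space M \<Longrightarrow> norm (f z x) \<le> g x"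
  using dom[OF z0] by blast
 obtain r1 where r1: "r1 > 0" "ball z0 r1 \<subseteq> S"
  using S z0 by (auto simp: open_contains_ball)
 define e where "e = min r r1 / 3"
 have e: "e > 0" using r r1 by (auto simp: e_def)
 have sub: "cball \<xi> e \<subseteq> ball z0 r \<inter> S" if "\<xi> \<in> ball z0 e" for \<xi>
 proof
  fix y assume "y \<in> cball \<xi> e"
  then have "dist z0 y < 2 * e" using that dist_triangle[of z0 y \<xi>] by auto
  then have "dist z0 y < r" "dist z0 y < r1" using r r1 by (auto simp: e_def)
  then show "y \<in> ball z0 r \<inter> S" using r1 by auto
 qed
 \<comment> \<open>Cauchy's inequality on a disc of radius \<open>e\<close> turns the local majorant
   \<open>g\<close> of \<open>f\<close> into the majorant \<open>g / e\<close> of its derivative,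
   and hence of the difference quotients that dominated convergence has to control.\<close>
 have deriv_bd: "norm (deriv (\<lambda>z. f z x) \<xi>) \<le> g x / e" if "\<xi> \<in> ball z0 e" "x \<in> space M" for \<xi> x
 proof -
  have h: "(\<lambda>z. f z x) holomorphic_on cball \<xi> e"
   using hol[OF that(2)] sub[OF that(1)] by (meson holomorphic_on_subset le_inf_iff)
  have "norm ((deriv ^^ 1) (\<lambda>z. f z x) \<xi>) \<le> fact 1 * g x / e ^ 1"
   by (rule Cauchy_inequality)
     (use h e bd sub[OF that(1)] that in \<open>auto intro!: holomorphic_on_imp_continuous_on
      intro: holomorphic_on_subset simp: dist_norm subset_iff\<close>)
  then show ?thesis by simp
 qed
 have lip: "norm (f w x - f z0 x) \<le> g x / e * norm (w - z0)" if "w \<in> ball z0 e" "x \<in> space M" for w x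
 proof (rule field_differentiable_bound[where S = "ball z0 e"])
  show "((\<lambda>z. f z x) has_field_derivative deriv (\<lambda>z. f z x) z) (at z within ball z0 e)"
   if "z \<in> ball z0 e" for z
  proof -
   have "z \<in> S" using sub[OF that] e by auto
   then show ?thesis
    using hol[OF \<open>x \<in> space M\<close>] S holomorphic_derivI has_field_derivative_at_within by blast
  qed
 qed (use that e deriv_bd in auto)
 define D where "D = (\<lambda>x. deriv (\<lambda>z. f z x) z0)"
 have "((\<lambda>w. ((\<integral>x. f w x \<partial>M) - (\<integral>x. f z0 x \<partial>M)) / (w - z0)) \<longlongrightarrow> (\<integral>x. D x \<partial>M)) (at z0)"
  unfolding tendsto_at_iff_sequentially
 proof (intro allI impI)
  fix W assume W: "\<forall>i. W i \<in> UNIV - {z0}" "W \<longlonglongrightarrow> z0"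
  have "\<forall>\<^sub>F i in sequentially. W i \<in> ball z0 e"
   using W(2) e by (metis centre_in_ball open_ball topological_tendstoD)
  then obtain n0 where n0: "\<And>i. i \<ge> n0 \<Longrightarrow> W i \<in> ball z0 e"
   by (auto simp: eventually_sequentially)
  define V where "V i = W (i + n0)" for i
  have V: "V i \<in> ball z0 e" "V i \<noteq> z0" "V i \<in> S" for i
   using W(1) n0[of "i + n0"] sub[of "V i"] e by (auto simp: V_def)
  have Vl: "V \<longlonglongrightarrow> z0" using W(2) unfolding V_def by (rule LIMSEQ_ignore_initial_segment)
  have intf: "integrable M (f w)" if "w \<in> ball z0 e" for w
  proof (rule Bochner_Integration.integrable_bound[OF g])
   have "w \<in> cball w e" using e by simp
   then have "w \<in> ball z0 r \<inter> S" using sub[OF that] by blast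
   then show "f w \<in> borel_measurable M" "AE x in M. norm (f w x) \<le> norm (g x)"
    using meas bd by (auto intro!: AE_I2 order.trans[OF bd])
  qed
  have q: "(\<lambda>i. \<integral>x. (f (V i) x - f z0 x) / (V i - z0) \<partial>M) \<longlonglongrightarrow> (\<integral>x. D x \<partial>M)"
  proof (rule integral_dominated_convergence[where w = "\<lambda>x. g x / e"])
   have lim: "(\<lambda>i. (f (V i) x - f z0 x) / (V i - z0)) \<longlonglongrightarrow> D x" if "x \<in> space M" for x
   proof -
    have "((\<lambda>z. f z x) has_field_derivative D x) (at z0)"
     unfolding D_def using hol[OF that] S z0 holomorphic_derivI by blast
    then have "((\<lambda>w. (f w x - f z0 x) / (w - z0)) \<longlongrightarrow> D x) (at z0)"
     by (simp add: has_field_derivative_iff)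
    then show ?thesis unfolding tendsto_at_iff_sequentially using V Vl by (auto simp: o_def)
   qed
   then show "AE x in M. (\<lambda>i. (f (V i) x - f z0 x) / (V i - z0)) \<longlonglongrightarrow> D x" by auto
   show m: "(\<lambda>x. (f (V i) x - f z0 x) / (V i - z0)) \<in> borel_measurable M" for i
    using meas[OF V(3)] meas[OF z0] by measurable
   show "D \<in> borel_measurable M"
    by (rule borel_measurable_LIMSEQ_metric[OF m lim])
   show "integrable M (\<lambda>x. g x / e)" using g by auto
   show "AE x in M. norm ((f (V i) x - f z0 x) / (V i - z0)) \<le> g x / e" for i
    using lip[OF V(1)] V(2) by (auto intro!: AE_I2 simp: norm_divide divide_le_eq)
  qed
  have "(\<lambda>i. ((\<integral>x. f (V i) x \<partial>M) - (\<integral>x. f z0 x \<partial>M)) / (V i - z0)) \<longlonglongrightarrow> (\<integral>x. D x \<partial>M)"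
  proof (rule Lim_transform_eventually[OF q], rule always_eventually, rule allI)
   fix i
   show "(\<integral>x. (f (V i) x - f z0 x) / (V i - z0) \<partial>M)
     = ((\<integral>x. f (V i) x \<partial>M) - (\<integral>x. f z0 x \<partial>M)) / (V i - z0)"
    using intf[OF V(1)[of i]] intf[of z0] e by simp
  qed
  then show "((\<lambda>w. ((\<integral>x. f w x \<partial>M) - (\<integral>x. f z0 x \<partial>M)) / (w - z0)) \<circ> W) \<longlonglongrightarrow> (\<integral>x. D x \<partial>M)"
   unfolding V_def o_def by (rule LIMSEQ_offset)
 qed
 then show "\<exists>f'. ((\<lambda>z. \<integral>x. f z x \<partial>M) has_field_derivative f') (at z0)"
  by (auto simp: has_field_derivative_iff)
qed

lemma continuous_param_integral:
 fixes f :: "'b::metric_space \<Rightarrow> 'a \<Rightarrow> 'c::{banach,second_countable_topology}"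
 assumes cont: "\<And>x. x \<in> space M \<Longrightarrow> continuous_on S (\<lambda>z. f z x)"
  and meas: "\<And>z. z \<in> S \<Longrightarrow> f z \<in> borel_measurable M"
  and dom: "\<And>z0. z0 \<in> S \<Longrightarrow> \<exists>r>0. \<exists>g::'a \<Rightarrow> real. integrable M g \<and>
        (\<forall>z\<in>ball z0 r \<inter> S. \<forall>x\<in>space M. norm (f z x) \<le> g x)"
 shows "continuous_on S (\<lambda>z. \<integral>x. f z x \<partial>M)"
 unfolding continuous_on_sequentially
proof (intro allI ballI impI, elim conjE)
 fix W z0 assume z0: "z0 \<in> S" and W: "\<forall>n. W n \<in> S" "W \<longlonglongrightarrow> z0"
 obtain r g where r: "r > 0" and g: "integrable M g"
  and bd: "\<And>z x. z \<in> ball z0 r \<inter> S \<Longrightarrow> x \<in> space M \<Longrightarrow> norm (f z x) \<le> g x"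
  using dom[OF z0] by blast
 have "\<forall>\<^sub>F i in sequentially. W i \<in> ball z0 r"
  using W(2) r by (metis centre_in_ball open_ball topological_tendstoD)
 then obtain n0 where n0: "\<And>i. i \<ge> n0 \<Longrightarrow> W i \<in> ball z0 r"
  by (auto simp: eventually_sequentially)
 define V where "V i = W (i + n0)" for i
 have V: "V i \<in> ball z0 r \<inter> S" for i
  using W(1) n0[of "i + n0"] by (auto simp: V_def)
 have Vl: "V \<longlonglongrightarrow> z0" using W(2) unfolding V_def by (rule LIMSEQ_ignore_initial_segment)
 have "(\<lambda>i. \<integral>x. f (V i) x \<partial>M) \<longlonglongrightarrow> (\<integral>x. f z0 x \<partial>M)"
 proof (rule integral_dominated_convergence[where w = g])
  show "AE x in M. (\<lambda>i. f (V i) x) \<longlonglongrightarrow> f z0 x"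
  proof (rule AE_I2)
   fix x assume "x \<in> space M"
   from cont[OF this] show "(\<lambda>i. f (V i) x) \<longlonglongrightarrow> f z0 x"
    unfolding continuous_on_sequentially using V Vl z0 by (auto simp: o_def)
  qed
 qed (use meas V z0 g bd in auto)
 then show "((\<lambda>z. \<integral>x. f z x \<partial>M) \<circ> W) \<longlonglongrightarrow> (\<integral>x. f z0 x \<partial>M)"
  unfolding V_def o_def by (rule LIMSEQ_offset)
qed

lemma scale_measure_eq_density: "scale_measure c M = density M (\<lambda>_. c)"
 by (rule measure_eqI) (auto simp: emeasure_density_const)

lemma open_right_halfplane: "open {z. Re z > 0}"
 using open_halfspace_Re_gt[of 0] by simp

text \<open>The positive reals accumulate at 1, so the identity theorem settles the open half-plane;
  continuity carries the equality to the boundary. This is the passage from real Laplace transforms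
  to characteristic functions on the imaginary axis.\<close>

lemma right_halfplane_identity:
 fixes f g :: "complex \<Rightarrow> complex"
 assumes cf: "continuous_on {z. Re z \<ge> 0} f" and cg: "continuous_on {z. Re z \<ge> 0} g"
  and hf: "f holomorphic_on {z. Re z > 0}" and hg: "g holomorphic_on {z. Re z > 0}"
  and eq: "\<And>r. r > 0 \<Longrightarrow> f (of_real r) = g (of_real r)"
  and z: "Re z \<ge> 0"
 shows "f z = g z"
proof -
 let ?H = "{z. Re z > 0}"
 have H: "f w = g w" if "Re w > 0" for w
 proof -
  have "f w - g w = 0"
  proof (rule analytic_continuation[where f = "\<lambda>z. f z - g z" and S = ?H and U = "of_real ` {0<..}" and \<xi> = 1])
   show "(\<lambda>z. f z - g z) holomorphic_on ?H" by (intro holomorphic_intros hf hg)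
   show "connected ?H" using convex_halfspace_Re_gt convex_connected by blast
   show "(1::complex) islimpt of_real ` {0<..}"
    unfolding islimpt_sequential
   proof (intro exI conjI allI)
    show "complex_of_real (1 + 1 / Suc n) \<in> complex_of_real ` {0<..} - {1}" for n
    proof -
     have "1 + 1 / real (Suc n) > 0" "1 + 1 / real (Suc n) \<noteq> 1"
      by (simp_all add: add_pos_pos)
     then show ?thesis
      using of_real_eq_1_iff by (metis DiffI greaterThan_iff imageI singletonD)
    qed
    have "(\<lambda>n. complex_of_real (1 + 1 / Suc n)) \<longlonglongrightarrow> of_real (1 + 0)"
     by (intro tendsto_intros LIMSEQ_Suc[OF lim_1_over_n])
    then show "(\<lambda>n. complex_of_real (1 + 1 / Suc n)) \<longlonglongrightarrow> 1" by simp
   qed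
  qed (use that eq open_right_halfplane in auto)
  then show ?thesis by simp
 qed
 define V where "V n = z + of_real (1 / Suc n)" for n
 have V: "Re (V n) > 0" for n using z by (auto simp: V_def add_nonneg_pos)
 have "V \<longlonglongrightarrow> z + of_real 0" unfolding V_def by (intro tendsto_intros LIMSEQ_Suc[OF lim_1_over_n])
 then have Vl: "V \<longlonglongrightarrow> z" by simp
 have "(f \<circ> V) \<longlonglongrightarrow> f z" "(g \<circ> V) \<longlonglongrightarrow> g z"
  using cf cg Vl less_imp_le[OF V] z unfolding continuous_on_sequentially by auto
 moreover have "f \<circ> V = g \<circ> V" using H V by auto
 ultimately show ?thesis using LIMSEQ_unique by metis
qed

lemma laplace_measure_regular:
 assumes fin: "finite_measure M" and sets: "sets M = sets borel" and null: "emeasure M {..<0::real} = 0"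
 shows "continuous_on {z. Re z \<ge> 0} (\<lambda>z. \<integral>x. exp (- z * of_real x) \<partial>M)"
  and "(\<lambda>z. \<integral>x. exp (- z * of_real x) \<partial>M) holomorphic_on {z. Re z > 0}"
  and "Re z \<ge> 0 \<Longrightarrow> integrable M (\<lambda>x. exp (- z * of_real x))"
proof -
 interpret finite_measure M by fact
 note [measurable_cong] = sets
 \<comment> \<open>Cutting the kernel off on the negative half-line, a null set, makes the bound 1
   hold at every point, as the lemmas on parameter integrals demand, and not only almost
   everywhere.\<close>
 define k where "k z x = (if x \<ge> 0 then exp (- z * of_real x) else 0)" for z :: complex and x :: real
 have AE: "AE x in M. exp (- z * of_real x) = k z x" for z
  by (rule AE_I[where N = "{..<0}"]) (use null sets in \<open>auto simp: k_def\<close>)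
 have mk[measurable]: "k z \<in> borel_measurable M" for z unfolding k_def by measurable
 have eq: "(\<integral>x. exp (- z * of_real x) \<partial>M) = (\<integral>x. k z x \<partial>M)" for z
  by (intro integral_cong_AE AE) auto
 have bd: "norm (k z x) \<le> 1" if "Re z \<ge> 0" for z x
  using that by (auto simp: k_def)
 have dom: "\<exists>r>0. \<exists>g::real \<Rightarrow> real. integrable M g \<and>
        (\<forall>z\<in>ball z0 r \<inter> S. \<forall>x\<in>space M. norm (k z x) \<le> g x)"
  if "S \<subseteq> {z. Re z \<ge> 0}" for S z0
  using that bd by (intro exI[of _ "1::real"] conjI exI[of _ "\<lambda>_. 1::real"]) auto
 show "continuous_on {z. Re z \<ge> 0} (\<lambda>z. \<integral>x. exp (- z * of_real x) \<partial>M)"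
  unfolding eq
 proof (rule continuous_param_integral)
  show "continuous_on {z. Re z \<ge> 0} (\<lambda>z. k z x)" for x
   by (cases "x \<ge> 0") (auto simp: k_def intro!: continuous_intros)
 qed (use dom in auto)
 show "(\<lambda>z. \<integral>x. exp (- z * of_real x) \<partial>M) holomorphic_on {z. Re z > 0}"
  unfolding eq
 proof (rule holomorphic_param_integral)
  show "(\<lambda>z. k z x) holomorphic_on {z. Re z > 0}" for x
   by (cases "x \<ge> 0") (auto simp: k_def intro!: holomorphic_intros)
  show "\<exists>r>0. \<exists>g::real \<Rightarrow> real. integrable M g \<and>
    (\<forall>z\<in>ball z0 r \<inter> {z. Re z > 0}. \<forall>x\<in>space M. norm (k z x) \<le> g x)" for z0
   by (rule dom) auto
 qed (use open_right_halfplane in auto)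
 show "integrable M (\<lambda>x. exp (- z * of_real x))" if "Re z \<ge> 0"
 proof -
  have "integrable M (k z)" by (rule integrable_const_bound[of _ 1]) (use bd that in auto)
  then show ?thesis using AE[of z] by (subst integrable_cong_AE) auto
 qed
qed

text \<open>Equality on the real half-line extends to the imaginary axis. After division by the
  common total mass, Levy's uniqueness theorem for characteristic functions applies; the zero
  measure cannot be normalised and is treated apart.\<close>

theorem laplace_transform_unique:
 fixes M1 M2 :: "real measure"
 assumes M1: "finite_measure M1" "sets M1 = sets borel" "emeasure M1 {..<0} = 0"
  and M2: "finite_measure M2" "sets M2 = sets borel" "emeasure M2 {..<0} = 0"
  and eq: "\<And>r. r \<ge> 0 \<Longrightarrow> (\<integral>x. exp (- r * x) \<partial>M1) = (\<integral>x. exp (- r * x) \<partial>M2)"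
 shows "M1 = M2"
proof -
 interpret M1: finite_measure M1 by fact
 interpret M2: finite_measure M2 by fact
 have sp: "space M1 = UNIV" "space M2 = UNIV"
  using M1(2) M2(2) by (auto dest: sets_eq_imp_space_eq)
 define c where "c = measure M1 UNIV"
 have c2: "c = measure M2 UNIV" using eq[of 0] sp by (simp add: c_def)
 show ?thesis
 proof (cases "c = 0")
  case True
  have "emeasure M1 A = 0 \<and> emeasure M2 A = 0" for A
  proof -
   have "emeasure M1 UNIV = 0" "emeasure M2 UNIV = 0"
    using True c2 by (auto simp: c_def M1.emeasure_eq_measure M2.emeasure_eq_measure)
   then show ?thesis
    by (metis emeasure_mono emeasure_notin_sets sp le_zero_eq sets.top subset_UNIV)
  qed
  then show ?thesis using M1(2) M2(2) by (intro measure_eqI) auto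
 next
  case False
  then have c: "c > 0" by (simp add: c_def less_le)
  define N1 where "N1 = scale_measure (ennreal (1 / c)) M1"
  define N2 where "N2 = scale_measure (ennreal (1 / c)) M2"
  have rd: "real_distribution N1" "real_distribution N2"
  proof -
   have "emeasure N1 (space N1) = ennreal (1 / c * c)" "emeasure N2 (space N2) = ennreal (1 / c * c)"
    unfolding N1_def N2_def using sp c2 c
    by (simp_all add: space_scale_measure M1.emeasure_eq_measure M2.emeasure_eq_measure c_def
       flip: ennreal_mult)
   then have "prob_space N1" "prob_space N2"
    using c by (auto intro!: prob_spaceI)
   moreover have "sets N1 = sets borel" "sets N2 = sets borel"
    using M1(2) M2(2) by (simp_all add: N1_def N2_def)
   ultimately show "real_distribution N1" "real_distribution N2"
    unfolding real_distribution_def real_distribution_axioms_def by simp_all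
  qed
  have int_eq: "(\<integral>x. exp (- z * of_real x) \<partial>M1) = (\<integral>x. exp (- z * of_real x) \<partial>M2)"
   if "Re z \<ge> 0" for z :: complex
  proof (rule right_halfplane_identity[where z = z and
     f = "\<lambda>z. \<integral>x. exp (- z * of_real x) \<partial>M1" and g = "\<lambda>z. \<integral>x. exp (- z * of_real x) \<partial>M2"])
   fix r :: real assume "r > 0"
   have *: "(\<integral>x. exp (- complex_of_real r * of_real x) \<partial>M) = of_real (\<integral>x. exp (- r * x) \<partial>M)" for M :: "real measure"
   proof -
    have "exp (- complex_of_real r * of_real x) = complex_of_real (exp (- r * x))" for x
     by (metis exp_of_real of_real_minus of_real_mult)
    then show ?thesis by (simp only: integral_complex_of_real)
   qed
   show "(\<integral>x. exp (- complex_of_real r * of_real x) \<partial>M1) = (\<integral>x. exp (- complex_of_real r * of_real x) \<partial>M2)"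
    unfolding * using eq[of r] \<open>r > 0\<close> by simp
  qed (use that laplace_measure_regular[OF M1] laplace_measure_regular[OF M2] in auto)
  have ch: "char N1 = char N2"
  proof
   fix t
   have "char N t = of_real (1/c) * (\<integral>x. exp (- (- \<i> * of_real t) * of_real x) \<partial>M)"
    if "N = scale_measure (ennreal (1/c)) M" "sets M = sets borel" for N M
    unfolding char_def that(1) scale_measure_eq_density using c that(2)
    by (subst integral_density)
      (auto simp: measurable_cong_sets[OF that(2) refl] scaleR_conv_of_real mult_ac)
   then show "char N1 t = char N2 t"
    using int_eq[of "- \<i> * of_real t"] M1 M2 by (simp add: N1_def N2_def)
  qed
  have "N1 = N2" using Levy_uniqueness rd ch by blast
  then have s: "emeasure N1 A = emeasure N2 A" for A by simp
  show ?thesis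
  proof (rule measure_eqI)
   fix A assume "A \<in> sets M1"
   have "ennreal c * emeasure N1 A = emeasure M1 A" "ennreal c * emeasure N2 A = emeasure M2 A"
    unfolding N1_def N2_def using c by (simp_all add: mult.assoc[symmetric] flip: ennreal_mult)
   then show "emeasure M1 A = emeasure M2 A" using s by metis
  qed (use M1 M2 in auto)
 qed
qed

section \<open>Random walks and renewal sequences\<close>

lemma norm_exp_diff_le:
 fixes a b :: complex
 assumes "Re a \<le> 0" "Re b \<le> 0"
 shows "norm (exp a - exp b) \<le> norm (a - b)"
proof -
 have "norm (exp a - exp b) \<le> 1 * norm (a - b)"
  by (rule field_differentiable_bound[where S = "{z. Re z \<le> 0}" and f' = exp])
    (use assms in \<open>auto intro!: derivative_eq_intros simp: convex_halfspace_Re_le\<close>)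
 then show ?thesis by simp
qed

lemma one_minus_exp_ge:
 fixes x :: real
 assumes "x \<ge> 0"
 shows "x / (1 + x) \<le> 1 - exp (- x)"
proof -
 have "exp (- x) \<le> 1 / (1 + x)"
  using exp_ge_add_one_self[of x] assms by (simp add: exp_minus field_simps)
 then show ?thesis using assms by (simp add: field_simps)
qed

text \<open>The bound is a multiple of \<open>1 - exp s\<close>, the same expression at
  \<open>z = 1\<close>, so that after integration the value at 1 controls all \<open>z\<close>. For
  \<open>s \<le> - 1\<close> the trivial bound 2 is compared with
  \<open>1 - exp s \<ge> 1/2\<close>, whence the factor 4; for larger \<open>s\<close> the Lipschitz
  bound suffices.\<close>

lemma norm_one_minus_exp_le:
 assumes z: "Re z \<ge> 0" and s: "s \<le> 0"
 shows "norm (1 - exp (z * of_real s)) \<le> 4 * max 1 (norm z) * (1 - exp s)"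
proof -
 have Re: "Re (z * of_real s) \<le> 0" using z s by (simp add: mult_nonneg_nonpos)
 have n1: "norm (1 - exp (z * of_real s)) \<le> norm z * - s"
  using norm_exp_diff_le[of 0 "z * of_real s"] Re s by (simp add: norm_mult)
 have n2: "norm (1 - exp (z * of_real s)) \<le> 2"
 proof -
  have "norm (exp (z * of_real s)) \<le> 1" using Re by (simp add: norm_exp_eq_Re)
  then show ?thesis using norm_triangle_ineq4[of 1 "exp (z * of_real s)"] by (simp only: norm_one)
 qed
 have e: "- s / (1 - s) \<le> 1 - exp s" using one_minus_exp_ge[of "- s"] s by simp
 show ?thesis
 proof (cases "s \<le> - 1")
  case True
  then have "1/2 \<le> - s / (1 - s)" by (simp add: field_simps)
  then have "1/2 \<le> 1 - exp s" using e by linarith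
  then have "4 * max 1 (norm z) * (1/2) \<le> 4 * max 1 (norm z) * (1 - exp s)"
   by (intro mult_left_mono) auto
  moreover have "2 \<le> 4 * max 1 (norm z) * (1/2)" by simp
  ultimately show ?thesis using n2 by linarith
 next
  case False
  then have "- s / 2 \<le> - s / (1 - s)" using s by (intro divide_left_mono) auto
  then have "- s / 2 \<le> 1 - exp s" using e by linarith
  then have "norm z * (- s / 2) \<le> max 1 (norm z) * (1 - exp s)" using s by (intro mult_mono) auto
  moreover have "norm z * (- s / 2) * 4 \<ge> norm z * - s" using s by (simp add: mult_nonneg_nonpos2 mult_nonneg_nonpos)
  ultimately show ?thesis using n1 by linarith
 qed
qed

lemma summable_norm_gf:
 fixes f :: "nat \<Rightarrow> complex" and p :: real
 assumes "0 < p" "p < 1" "\<And>n. norm (f n) \<le> 1"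
 shows "summable (\<lambda>n. norm (of_real p ^ n * f n))"
proof (rule summable_comparison_test'[where g = "\<lambda>n. p ^ n" and N = 0])
 show "norm (norm (of_real p ^ n * f n)) \<le> p ^ n" for n
  using assms by (auto simp: norm_mult norm_power intro!: mult_left_le)
qed (use assms in auto)

lemma gf_mult:
 fixes f g :: "nat \<Rightarrow> complex" and p :: real
 assumes "0 < p" "p < 1" "\<And>n. norm (f n) \<le> 1" "\<And>n. norm (g n) \<le> 1"
 shows "(\<Sum>n. of_real p ^ n * f n) * (\<Sum>n. of_real p ^ n * g n)
    = (\<Sum>n. of_real p ^ n * (\<Sum>k\<le>n. f k * g (n - k)))"
proof -
 have eq: "(\<Sum>k\<le>n. (of_real p ^ k * f k) * (of_real p ^ (n - k) * g (n - k)))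
   = of_real p ^ n * (\<Sum>k\<le>n. f k * g (n - k))" for n
  unfolding sum_distrib_left
 proof (intro sum.cong refl)
  fix k assume "k \<in> {..n}"
  then have "(of_real p :: complex) ^ n = of_real p ^ k * of_real p ^ (n - k)"
   by (simp add: power_add[symmetric])
  then show "(of_real p ^ k * f k) * (of_real p ^ (n - k) * g (n - k)) = of_real p ^ n * (f k * g (n - k))"
   by simp
 qed
 show ?thesis
  unfolding eq[symmetric]
  by (rule Cauchy_product) (use summable_norm_gf assms in auto)
qed

text \<open>The renewal equation reads \<open>V = 1 + G * V\<close> for the generating
  functions.\<close>

lemma renewal_gf:
 fixes g v :: "nat \<Rightarrow> complex" and p :: real
 assumes p: "0 < p" "p < 1"
  and v0: "v 0 = 1" and v: "\<And>n. n \<ge> 1 \<Longrightarrow> v n = (\<Sum>k=1..n. g k * v (n - k))"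
  and vb: "\<And>n. norm (v n) \<le> 1" and gb: "\<And>n. norm (g n) \<le> 1" and g0: "g 0 = 0"
 shows "(\<Sum>n. of_real p ^ n * v n) * (1 - (\<Sum>n. of_real p ^ n * g n)) = 1"
proof -
 let ?V = "\<lambda>n. of_real p ^ n * v n" and ?G = "\<lambda>n. of_real p ^ n * g n"
 have conv: "of_real p ^ n * (\<Sum>k\<le>n. g k * v (n - k)) = (if n = 0 then 0 else ?V n)" for n
 proof (cases "n = 0")
  case False
  have "(\<Sum>k\<le>n. g k * v (n - k)) = (\<Sum>k=1..n. g k * v (n - k))"
   by (rule sum.mono_neutral_right) (use g0 in \<open>auto simp: not_le\<close>)
  then show ?thesis using False v[of n] by simp
 qed (simp add: g0)
 have "(\<Sum>k. ?G k) * (\<Sum>k. ?V k) = (\<Sum>n. of_real p ^ n * (\<Sum>k\<le>n. g k * v (n - k)))"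
  by (rule gf_mult[OF p gb vb])
 also have "\<dots> = (\<Sum>n. if n = 0 then 0 else ?V n)" unfolding conv ..
 also have "\<dots> = (\<Sum>n. ?V n) - 1"
 proof -
  have sV: "summable ?V" by (rule summable_norm_cancel[OF summable_norm_gf[OF p vb]])
  have "(\<lambda>n. ?V n - (if n = 0 then 1 else 0)) sums ((\<Sum>n. ?V n) - 1)"
   by (rule sums_diff[OF summable_sums[OF sV] sums_single[of 0 "\<lambda>_. 1"]])
  moreover have "(\<lambda>n. ?V n - (if n = 0 then 1 else 0)) = (\<lambda>n. if n = 0 then 0 else ?V n)"
   by (rule ext) (simp add: v0)
  ultimately have "(\<lambda>n. if n = 0 then 0 else ?V n) sums ((\<Sum>n. ?V n) - 1)" by metis
  then show ?thesis by (rule sums_unique[symmetric])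
 qed
 finally show ?thesis by (simp add: algebra_simps)
qed

text \<open>The normalised generating function \<open>V z / V 0\<close> of a renewal sequence driven by nonpositive
 steps is the reciprocal of \<open>1 + \<integral> (1 - e\<^sup>z\<^sup>s) \<mu>(ds)\<close> for some positive \<open>\<mu>\<close>; hence its reciprocal grows
 at most linearly, with a constant that is controlled by the value at \<open>z = 1\<close> alone.\<close>

lemma renewal_lower_bound:
 fixes N :: "'a measure" and E :: "nat \<Rightarrow> 'a \<Rightarrow> bool" and \<sigma> :: "nat \<Rightarrow> 'a \<Rightarrow> real" and p :: real
  and v g :: "nat \<Rightarrow> complex \<Rightarrow> complex"
 assumes N: "prob_space N"
  and E[measurable]: "\<And>k. Measurable.pred N (E k)" and \<sigma>[measurable]: "\<And>k. \<sigma> k \<in> borel_measurable N"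
  and neg: "\<And>k x. x \<in> space N \<Longrightarrow> E k x \<Longrightarrow> \<sigma> k x \<le> 0"
  and E0: "\<And>x. x \<in> space N \<Longrightarrow> \<not> E 0 x"
  and g: "\<And>k z. g k z = (\<integral>x. of_bool (E k x) * exp (z * of_real (\<sigma> k x)) \<partial>N)"
  and p: "0 < p" "p < 1"
  and v0: "\<And>z. v 0 z = 1"
  and v: "\<And>n z. n \<ge> 1 \<Longrightarrow> Re z \<ge> 0 \<Longrightarrow> v n z = (\<Sum>k=1..n. g k z * v (n - k) z)"
  and vb: "\<And>n z. Re z \<ge> 0 \<Longrightarrow> norm (v n z) \<le> 1"
  and z: "Re z \<ge> 0"
 defines "V \<equiv> \<lambda>z. (\<Sum>n. of_real p ^ n * v n z)"
 shows "V 0 \<noteq> 0"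
  and "1 \<le> norm (V z / V 0) * (1 + 4 * max 1 (norm z) * (1 / norm (V 1 / V 0) - 1))"
proof -
 interpret prob_space N by fact
 define G where "G z = (\<Sum>n. of_real p ^ n * g n z)" for z
 have bd: "norm (of_bool (E k x) * exp (z * of_real (\<sigma> k x))) \<le> 1" if "Re z \<ge> 0" "x \<in> space N" for k x z
  using neg[OF that(2)] that(1) by (auto simp: norm_exp_eq_Re mult_nonneg_nonpos)
 have int: "integrable N (\<lambda>x. of_bool (E k x) * exp (z * complex_of_real (\<sigma> k x)))" if "Re z \<ge> 0" for k z
  by (rule integrable_const_bound[where B = 1]) (use bd that in auto)
 have gb: "norm (g k z) \<le> 1" if "Re z \<ge> 0" for k z
 proof -
  have "norm (g k z) \<le> (\<integral>x. norm (of_bool (E k x) * exp (z * complex_of_real (\<sigma> k x))) \<partial>N)"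
   unfolding g by simp
  also have "\<dots> \<le> (\<integral>x. 1 \<partial>N)"
   by (rule integral_mono) (use bd that integrable_norm[OF int[OF that]] in auto)
  finally show ?thesis by (simp add: prob_space)
 qed
 have g00: "g 0 z = 0" for z unfolding g by (intro integral_eq_zero_AE AE_I2) (use E0 in auto)
 have VG: "V z * (1 - G z) = 1" if "Re z \<ge> 0" for z
  unfolding V_def G_def
  by (rule renewal_gf) (use p v0 v vb gb g00 that in auto)
 define gr where "gr k t = (\<integral>x. of_bool (E k x) * exp (t * \<sigma> k x) \<partial>N)" for k and t :: real
 have intr: "integrable N (\<lambda>x. of_bool (E k x) * exp (t * \<sigma> k x))" if "t \<ge> 0" for k t
  by (rule integrable_const_bound[where B = 1]) (use neg that in \<open>auto simp: mult_nonneg_nonpos\<close>)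
 have gr: "g k (of_real t) = of_real (gr k t)" for k t
 proof -
  have "of_bool (E k x) * exp (complex_of_real t * complex_of_real (\<sigma> k x))
    = of_real (of_bool (E k x) * exp (t * \<sigma> k x))" for x
   by (cases "E k x") (simp_all add: exp_of_real flip: of_real_mult)
  then show ?thesis unfolding g gr_def by (simp only: integral_complex_of_real)
 qed
 have gr_nn: "gr k t \<ge> 0" for k t unfolding gr_def by (intro integral_nonneg_AE) auto
 have grb: "\<bar>gr k t\<bar> \<le> 1" if "t \<ge> 0" for k t
  using gb[of "of_real t" k] that by (simp add: gr)
 have smr: "summable (\<lambda>n. p ^ n * gr n t)" if "t \<ge> 0" for t
  by (rule summable_comparison_test'[where g = "\<lambda>n. p ^ n" and N = 0])
    (use p grb[OF that] in \<open>auto simp: abs_mult intro!: mult_left_le\<close>)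
 define Gr where "Gr t = (\<Sum>n. p ^ n * gr n t)" for t
 have G_of_real: "G (of_real t) = of_real (Gr t)" if "t \<ge> 0" for t
  unfolding G_def Gr_def using smr[OF that] by (simp add: gr suminf_of_real flip: of_real_mult of_real_power)
 \<comment> \<open>At real arguments the renewal equation preserves nonnegativity. Since
   \<open>V * (1 - G) = 1\<close>, this forces \<open>Gr t < 1\<close>, and the norms at 0 and 1
   become plain real numbers.\<close>
 have vr: "\<exists>r\<ge>0. v n (of_real t) = of_real r" if "t \<ge> 0" for n t
 proof (induction n rule: less_induct)
  case (less n)
  show ?case
  proof (cases "n = 0")
   case False
   have "\<forall>m. \<exists>r. m < n \<longrightarrow> r \<ge> 0 \<and> v m (of_real t) = of_real r" using less by blast
   then obtain r where r: "\<And>m. m < n \<Longrightarrow> r m \<ge> 0 \<and> v m (of_real t) = of_real (r m)" by metis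
   have "v n (of_real t) = (\<Sum>k=1..n. of_real (gr k t) * v (n - k) (of_real t))"
    using v[of n "of_real t"] False that by (simp add: gr)
   also have "\<dots> = of_real (\<Sum>k=1..n. gr k t * r (n - k))"
    unfolding of_real_sum by (intro sum.cong refl) (use r False in auto)
   moreover have "(\<Sum>k=1..n. gr k t * r (n - k)) \<ge> 0"
    by (intro sum_nonneg mult_nonneg_nonneg gr_nn) (use r False in auto)
   ultimately show ?thesis by metis
  qed (auto simp: v0 intro: exI[of _ 1])
 qed
 have Gr_less: "Gr t < 1" if t: "t \<ge> 0" for t
 proof -
  obtain r where r: "\<And>n. r n \<ge> 0 \<and> v n (of_real t) = of_real (r n)" using vr[OF t] by metis
  have sr: "summable (\<lambda>n. p ^ n * r n)"
  proof (rule summable_comparison_test'[where g = "\<lambda>n. p ^ n" and N = 0])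
   show "norm (p ^ n * r n) \<le> p ^ n" for n
    using vb[of "of_real t" n] r[of n] t p by (auto simp: abs_mult intro!: mult_left_le)
  qed (use p in auto)
  have "V (of_real t) = of_real (\<Sum>n. p ^ n * r n)"
   unfolding V_def using sr by (simp add: r suminf_of_real flip: of_real_mult of_real_power)
  then have "of_real ((\<Sum>n. p ^ n * r n) * (1 - Gr t)) = (1::complex)"
   using VG[of "of_real t"] t by (simp add: G_of_real)
  then have "(\<Sum>n. p ^ n * r n) * (1 - Gr t) = 1" by (simp only: of_real_eq_1_iff)
  moreover have "(\<Sum>n. p ^ n * r n) \<ge> 0" by (rule suminf_nonneg[OF sr]) (use r p in auto)
  ultimately show ?thesis
   using mult_nonneg_nonpos[of "\<Sum>n. p ^ n * r n" "1 - Gr t"] by linarith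
 qed
 have G0: "G 0 = of_real (Gr 0)" and G1: "G 1 = of_real (Gr 1)"
  using G_of_real[of 0] G_of_real[of 1] by auto
 have VG0: "V 0 * of_real (1 - Gr 0) = 1" and VG1: "V 1 * of_real (1 - Gr 1) = 1"
  using VG[of 0] VG[of 1] by (simp_all add: G0 G1)
 show V0: "V 0 \<noteq> 0" using VG0 by auto
 have nV0: "norm (V 0) * (1 - Gr 0) = 1" and nV1: "norm (V 1) * (1 - Gr 1) = 1"
  using arg_cong[OF VG0, of norm] arg_cong[OF VG1, of norm] Gr_less[of 0] Gr_less[of 1]
  by (simp_all add: norm_mult del: of_real_diff)
 have nVz: "norm (V z) * norm (1 - G z) = 1"
  using arg_cong[OF VG[OF z], of norm] by (simp add: norm_mult)
 \<comment> \<open>Termwise, the increment between 0 and \<open>z\<close> is at most a fixed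
   multiple of the increment between 0 and 1, and this form is preserved by the sum.\<close>
 have diff: "norm (G 0 - G z) \<le> 4 * max 1 (norm z) * (Gr 0 - Gr 1)"
 proof -
  have each: "norm (g k 0 - g k z) \<le> 4 * max 1 (norm z) * (gr k 0 - gr k 1)" for k
  proof -
   have "g k 0 - g k z = (\<integral>x. of_bool (E k x) * (1 - exp (z * of_real (\<sigma> k x))) \<partial>N)"
    unfolding g using int[of 0 k] int[OF z, of k]
    by (subst Bochner_Integration.integral_diff[symmetric]) (auto simp: algebra_simps)
   also have "norm \<dots> \<le> (\<integral>x. norm (of_bool (E k x) * (1 - exp (z * of_real (\<sigma> k x)))) \<partial>N)"
    by simp
   also have "\<dots> \<le> (\<integral>x. 4 * max 1 (norm z) * (of_bool (E k x) * exp (0 * \<sigma> k x) - of_bool (E k x) * exp (1 * \<sigma> k x)) \<partial>N)"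
   proof (rule integral_mono)
    have "integrable N (\<lambda>x. of_bool (E k x) * (1 - exp (z * of_real (\<sigma> k x))))"
     using int[of 0 k] int[OF z, of k] Bochner_Integration.integrable_diff
     by (fastforce simp: algebra_simps)
    then show "integrable N (\<lambda>x. norm (of_bool (E k x) * (1 - exp (z * of_real (\<sigma> k x)))))"
     by (rule integrable_norm)
    show "integrable N (\<lambda>x. 4 * max 1 (norm z) * (of_bool (E k x) * exp (0 * \<sigma> k x) - of_bool (E k x) * exp (1 * \<sigma> k x)))"
     using intr[of 0 k] intr[of 1 k] by (intro integrable_mult_right Bochner_Integration.integrable_diff) auto
    show "norm (of_bool (E k x) * (1 - exp (z * of_real (\<sigma> k x))))
       \<le> 4 * max 1 (norm z) * (of_bool (E k x) * exp (0 * \<sigma> k x) - of_bool (E k x) * exp (1 * \<sigma> k x))"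
     if "x \<in> space N" for x
     using norm_one_minus_exp_le[OF z neg[OF that, of k]] by (auto simp: norm_mult)
   qed
   also have "\<dots> = 4 * max 1 (norm z) * (gr k 0 - gr k 1)"
    unfolding gr_def
    by (simp only: integral_mult_right_zero
       Bochner_Integration.integral_diff[OF intr[OF order_refl] intr[OF zero_le_one]])
   finally show ?thesis .
  qed
  have sg: "summable (\<lambda>n. of_real p ^ n * g n w)" if "Re w \<ge> 0" for w
   by (rule summable_norm_cancel[OF summable_norm_gf[OF p gb[OF that]]])
  have "G 0 - G z = (\<Sum>n. of_real p ^ n * g n 0 - of_real p ^ n * g n z)"
   unfolding G_def by (rule suminf_diff) (use sg z in auto)
  also have "norm \<dots> \<le> (\<Sum>n. 4 * max 1 (norm z) * (p ^ n * gr n 0 - p ^ n * gr n 1))"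
  proof (rule norm_suminf_le)
   show "norm (of_real p ^ n * g n 0 - of_real p ^ n * g n z) \<le> 4 * max 1 (norm z) * (p ^ n * gr n 0 - p ^ n * gr n 1)" for n
   proof -
    have "norm (of_real p ^ n * g n 0 - of_real p ^ n * g n z) = p ^ n * norm (g n 0 - g n z)"
     using p by (simp add: norm_mult norm_power flip: right_diff_distrib)
    also have "\<dots> \<le> p ^ n * (4 * max 1 (norm z) * (gr n 0 - gr n 1))"
     using p each by (intro mult_left_mono) auto
    finally show ?thesis by (simp add: algebra_simps)
   qed
   show "summable (\<lambda>n. 4 * max 1 (norm z) * (p ^ n * gr n 0 - p ^ n * gr n 1))"
    by (intro summable_mult summable_diff smr) auto
  qed
  also have "\<dots> = 4 * max 1 (norm z) * (Gr 0 - Gr 1)"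
   unfolding Gr_def using smr[of 0] smr[of 1]
   by (simp add: suminf_mult suminf_diff summable_diff)
  finally show ?thesis .
 qed
 have "norm (1 - G z) \<le> norm (1 - G 0) + norm (G 0 - G z)"
  using norm_triangle_ineq[of "1 - G 0" "G 0 - G z"] by simp
 also have "norm (1 - G 0) = 1 - Gr 0" using Gr_less[of 0] G0
  by (metis abs_of_pos diff_gt_0_iff_gt norm_of_real of_real_1 of_real_diff order_refl)
 finally have n: "norm (1 - G z) \<le> (1 - Gr 0) + 4 * max 1 (norm z) * (Gr 0 - Gr 1)" using diff by simp
 \<comment> \<open>With \<open>d0 = 1 / norm (V 0)\<close> and \<open>d1 = 1 / norm (V 1)\<close>,
   the difference \<open>Gr 0 - Gr 1\<close> is \<open>d1 - d0\<close>, and division by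
   \<open>d0\<close> turns it into the ratio at \<open>z = 1\<close> in the claim.\<close>
 define d0 d1 where "d0 = 1 - Gr 0" and "d1 = 1 - Gr 1"
 have d: "d0 > 0" "d1 > 0" using Gr_less[of 0] Gr_less[of 1] by (auto simp: d0_def d1_def)
 have e: "norm (V 0) = 1 / d0" "norm (V 1) = 1 / d1"
  using nV0 nV1 d by (simp_all add: d0_def d1_def field_simps)
 have "1 = norm (V z) * norm (1 - G z)" using nVz by simp
 also have "\<dots> \<le> norm (V z) * (d0 + 4 * max 1 (norm z) * (d1 - d0))"
  using n by (intro mult_left_mono) (auto simp: d0_def d1_def)
 also have "\<dots> = norm (V z / V 0) * (1 + 4 * max 1 (norm z) * (1 / norm (V 1 / V 0) - 1))"
  using d by (simp add: norm_divide e field_simps)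
 finally show "1 \<le> norm (V z / V 0) * (1 + 4 * max 1 (norm z) * (1 / norm (V 1 / V 0) - 1))" .
qed

section \<open>Minima and record times of a single path\<close>

definition psum :: "(nat \<Rightarrow> real) \<Rightarrow> nat \<Rightarrow> real" where
 "psum x n = (\<Sum>i<n. x i)"

definition pmin :: "(nat \<Rightarrow> real) \<Rightarrow> nat \<Rightarrow> real" where
 "pmin x n = Min (psum x ` {..n})"

definition shift_seq :: "nat \<Rightarrow> (nat \<Rightarrow> real) \<Rightarrow> nat \<Rightarrow> real" where
 "shift_seq k x i = x (i + k)"

text \<open>Strict here and weak in \<open>stays_nonneg\<close>: together they single out the first
  time at which the minimum is attained, so that a path splits at exactly one index.\<close>

definition strict_record_low :: "nat \<Rightarrow> (nat \<Rightarrow> real) \<Rightarrow> bool" where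
 "strict_record_low k x \<longleftrightarrow> (\<forall>j<k. psum x k < psum x j)"

definition stays_nonneg :: "nat \<Rightarrow> (nat \<Rightarrow> real) \<Rightarrow> bool" where
 "stays_nonneg l x \<longleftrightarrow> (\<forall>j\<le>l. 0 \<le> psum x j)"

text \<open>The first strict descending ladder time, the step between successive strict record
  lows.\<close>

definition first_negative :: "nat \<Rightarrow> (nat \<Rightarrow> real) \<Rightarrow> bool" where
 "first_negative k x \<longleftrightarrow> psum x k < 0 \<and> (\<forall>j<k. 0 \<le> psum x j)"

text \<open>Counterpart of \<open>first_negative\<close> for paths that stay nonnegative: followed
  by a path that never falls below its start, it marks the first minimiser over the times from 1
  on.\<close>

definition nonneg_low :: "nat \<Rightarrow> (nat \<Rightarrow> real) \<Rightarrow> bool" where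
 "nonneg_low k x \<longleftrightarrow> 1 \<le> k \<and> 0 \<le> psum x k \<and> (\<forall>j\<in>{1..<k}. psum x k < psum x j)"

lemma psum_0 [simp]: "psum x 0 = 0"
 by (simp add: psum_def)

lemma psum_shift: "psum (shift_seq k x) j = psum x (k + j) - psum x k"
 by (induction j) (auto simp: psum_def shift_seq_def add.commute)

lemma psum_cong: "(\<And>i. i < n \<Longrightarrow> x i = y i) \<Longrightarrow> psum x n = psum y n"
 by (simp add: psum_def)

lemma pmin_le: "k \<le> n \<Longrightarrow> pmin x n \<le> psum x k"
 unfolding pmin_def by (rule Min_le) auto

lemma pmin_attained: "\<exists>k\<le>n. psum x k = pmin x n"
proof -
 have "pmin x n \<in> psum x ` {..n}" unfolding pmin_def by (rule Min_in) auto
 then show ?thesis by auto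
qed

lemma sum_single:
 assumes "finite A" "k \<in> A" "\<And>j. j \<in> A \<Longrightarrow> j \<noteq> k \<Longrightarrow> f j = 0"
 shows "sum f A = (f k :: 'a::comm_monoid_add)"
 using sum.mono_neutral_right[of A "{k}" f] assms by auto

text \<open>Only the first minimiser \<open>k\<close> of the path contributes to the sum. The first
  factor of its term depends on the steps before \<open>k\<close>, the second on those from
  \<open>k\<close> on, which is what makes expectations factor later.\<close>

lemma argmin_decomposition:
 "exp (z * of_real (pmin x n) + w * of_real (psum x n - pmin x n))
  = (\<Sum>k\<le>n. (of_bool (strict_record_low k x) * exp (z * of_real (psum x k)))
    * (of_bool (stays_nonneg (n - k) (shift_seq k x))
       * exp (w * complex_of_real (psum (shift_seq k x) (n - k)))))"
proof -
 define K where "K = (LEAST k. k \<le> n \<and> psum x k = pmin x n)"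
 have K: "K \<le> n" "psum x K = pmin x n"
  using LeastI_ex[OF pmin_attained[of n x]] by (auto simp: K_def)
 have K_least: "K \<le> k" if "k \<le> n" "psum x k = pmin x n" for k
  unfolding K_def using that by (intro Least_le) auto
 have iff: "strict_record_low k x \<and> stays_nonneg (n - k) (shift_seq k x) \<longleftrightarrow> k = K" if k: "k \<le> n" for k
 proof
  assume a: "strict_record_low k x \<and> stays_nonneg (n - k) (shift_seq k x)"
  have min: "psum x k \<le> psum x j" if "j \<le> n" for j
  proof (cases "j < k")
   case False
   then show ?thesis using a that k
    by (auto simp: stays_nonneg_def psum_shift dest: spec[of _ "j - k"])
  qed (use a in \<open>auto simp: strict_record_low_def\<close>)
  then have "psum x k = pmin x n" using K pmin_le[OF k, of x] by (metis order_antisym)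
  then have "K \<le> k" using K_least k by auto
  moreover have "\<not> K < k" using a K \<open>psum x k = pmin x n\<close> by (auto simp: strict_record_low_def)
  ultimately show "k = K" by simp
 next
  assume k: "k = K"
  have "psum x K < psum x j" if "j < K" for j
  proof -
   have "psum x j \<noteq> pmin x n" using K_least[of j] K that by auto
   then show ?thesis using pmin_le[of j n x] K that by auto
  qed
  moreover have "0 \<le> psum x (K + j) - psum x K" if "j \<le> n - K" for j
   using pmin_le[of "K + j" n x] K that by auto
  ultimately show "strict_record_low k x \<and> stays_nonneg (n - k) (shift_seq k x)"
   unfolding k by (auto simp: strict_record_low_def stays_nonneg_def psum_shift)
 qed
 show ?thesis
 proof (subst sum_single[where k = K])
  fix j assume j: "j \<in> {..n}" "j \<noteq> K"
  then have "\<not> (strict_record_low j x \<and> stays_nonneg (n - j) (shift_seq j x))" using iff by auto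
  then show "(of_bool (strict_record_low j x) * exp (z * of_real (psum x j)))
    * (of_bool (stays_nonneg (n - j) (shift_seq j x))
       * exp (w * complex_of_real (psum (shift_seq j x) (n - j)))) = 0" by auto
 qed (use iff[of K] K in \<open>auto simp: psum_shift exp_add\<close>)
qed

text \<open>A strict record low at \<open>n \<ge> 1\<close> lies below the start, so the path has
  become negative by then. Cutting at the first such time leaves a path whose end is again a strict
  record low.\<close>

lemma strict_record_low_renewal:
 assumes n: "n \<ge> 1"
 shows "of_bool (strict_record_low n x) * exp (z * of_real (psum x n))
  = (\<Sum>k=1..n. (of_bool (first_negative k x) * exp (z * of_real (psum x k)))
    * (of_bool (strict_record_low (n - k) (shift_seq k x))
       * exp (z * complex_of_real (psum (shift_seq k x) (n - k)))))"
proof (cases "strict_record_low n x")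
 case True
 define K where "K = (LEAST k. psum x k < 0)"
 have neg: "psum x n < 0" using True n by (auto simp: strict_record_low_def dest: spec[of _ 0])
 have K: "psum x K < 0" unfolding K_def using neg by (rule LeastI)
 have Kn: "K \<le> n" unfolding K_def using neg by (rule Least_le)
 have K1: "K \<ge> 1" using K by (cases K) auto
 have "\<not> psum x j < 0" if "j < K" for j using not_less_Least that unfolding K_def by blast
 then have fn: "first_negative K x" using K by (auto simp: first_negative_def not_less)
 have uniq: "k = K" if "first_negative k x" for k
  using that fn by (metis first_negative_def linorder_neqE_nat not_le)
 have sr: "strict_record_low (n - K) (shift_seq K x)"
  using True Kn by (auto simp: strict_record_low_def psum_shift)
 show ?thesis
 proof (subst sum_single[where k = K])
  fix j assume "j \<noteq> K"
  then have "\<not> first_negative j x" using uniq by auto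
  then show "(of_bool (first_negative j x) * exp (z * of_real (psum x j)))
    * (of_bool (strict_record_low (n - j) (shift_seq j x))
       * exp (z * complex_of_real (psum (shift_seq j x) (n - j)))) = 0" by simp
 qed (use K1 Kn fn sr True in \<open>auto simp: psum_shift algebra_simps simp flip: exp_add\<close>)
next
 case False
 have "\<not> (first_negative k x \<and> strict_record_low (n - k) (shift_seq k x))" if k: "k \<in> {1..n}" for k
 proof
  assume a: "first_negative k x \<and> strict_record_low (n - k) (shift_seq k x)"
  have le: "psum x n \<le> psum x k"
   using a k by (cases "n = k") (auto simp: strict_record_low_def psum_shift dest!: spec[of _ 0])
  have "psum x n < psum x j" if "j < n" for j
  proof (cases "j < k")
   case True
   then show ?thesis using a le by (auto simp: first_negative_def intro: le_less_trans less_le_trans)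
  next
   case False
   then have "j - k < n - k" using that k by auto
   then show ?thesis using a False k by (auto simp: strict_record_low_def psum_shift dest!: spec[of _ "j - k"])
  qed
  then show False using False by (auto simp: strict_record_low_def)
 qed
 then have "(\<Sum>k=1..n. (of_bool (first_negative k x) * exp (z * of_real (psum x k)))
    * (of_bool (strict_record_low (n - k) (shift_seq k x))
       * exp (z * complex_of_real (psum (shift_seq k x) (n - k))))) = 0"
  by (intro sum.neutral) auto
 then show ?thesis using False by simp
qed

text \<open>The cut is at the first minimiser over the times 1 to \<open>n\<close>; time 0 is left
  out, since for a nonnegative path it would always be a minimiser. After the cut the path does not
  fall below its level there.\<close>

lemma stays_nonneg_renewal:
 assumes n: "n \<ge> 1"
 shows "of_bool (stays_nonneg n x) * exp (z * of_real (psum x n))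
  = (\<Sum>k=1..n. (of_bool (nonneg_low k x) * exp (z * of_real (psum x k)))
    * (of_bool (stays_nonneg (n - k) (shift_seq k x))
       * exp (z * complex_of_real (psum (shift_seq k x) (n - k)))))"
proof (cases "stays_nonneg n x")
 case True
 define m where "m = Min (psum x ` {1..n})"
 have m_le: "m \<le> psum x k" if "k \<in> {1..n}" for k unfolding m_def using that by (intro Min_le) auto
 have "m \<in> psum x ` {1..n}" unfolding m_def using n by (intro Min_in) auto
 then have ex: "\<exists>k. k \<in> {1..n} \<and> psum x k = m" by auto
 define K where "K = (LEAST k. k \<in> {1..n} \<and> psum x k = m)"
 have K: "K \<in> {1..n}" "psum x K = m" using LeastI_ex[OF ex] by (auto simp: K_def)
 have K_least: "K \<le> k" if "k \<in> {1..n}" "psum x k = m" for k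
  unfolding K_def using that by (intro Least_le) auto
 have iff: "nonneg_low k x \<and> stays_nonneg (n - k) (shift_seq k x) \<longleftrightarrow> k = K" if k: "k \<in> {1..n}" for k
 proof
  assume a: "nonneg_low k x \<and> stays_nonneg (n - k) (shift_seq k x)"
  have min: "psum x k \<le> psum x j" if "j \<in> {1..n}" for j
  proof (cases "j < k")
   case False
   then show ?thesis using a that k
    by (auto simp: stays_nonneg_def psum_shift dest: spec[of _ "j - k"])
  qed (use a that in \<open>auto simp: nonneg_low_def intro: less_imp_le\<close>)
  then have "psum x k = m" using K m_le[OF k] by (metis order_antisym)
  then have "K \<le> k" using K_least k by auto
  moreover have "\<not> K < k" using a K \<open>psum x k = m\<close> by (auto simp: nonneg_low_def)
  ultimately show "k = K" by simp
 next
  assume k: "k = K"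
  have "psum x K < psum x j" if "j \<in> {1..<K}" for j
  proof -
   have "psum x j \<noteq> m" using K_least[of j] K that by auto
   then show ?thesis using m_le[of j] K that by auto
  qed
  moreover have "0 \<le> psum x (K + j) - psum x K" if "j \<le> n - K" for j
   using m_le[of "K + j"] K that by auto
  moreover have "0 \<le> psum x K" using True K by (auto simp: stays_nonneg_def)
  ultimately show "nonneg_low k x \<and> stays_nonneg (n - k) (shift_seq k x)"
   unfolding k using K by (auto simp: nonneg_low_def stays_nonneg_def psum_shift)
 qed
 show ?thesis
 proof (subst sum_single[where k = K])
  fix j assume j: "j \<in> {1..n}" "j \<noteq> K"
  then have "\<not> (nonneg_low j x \<and> stays_nonneg (n - j) (shift_seq j x))" using iff by auto
  then show "(of_bool (nonneg_low j x) * exp (z * of_real (psum x j)))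
    * (of_bool (stays_nonneg (n - j) (shift_seq j x))
       * exp (z * complex_of_real (psum (shift_seq j x) (n - j)))) = 0" by auto
 qed (use iff[of K] K True in \<open>auto simp: psum_shift algebra_simps simp flip: exp_add\<close>)
next
 case False
 have "\<not> (nonneg_low k x \<and> stays_nonneg (n - k) (shift_seq k x))" if k: "k \<in> {1..n}" for k
 proof
  assume a: "nonneg_low k x \<and> stays_nonneg (n - k) (shift_seq k x)"
  have "0 \<le> psum x j" if "j \<le> n" for j
  proof (cases "j < k")
   case True
   then show ?thesis using a
    by (cases "j = 0") (auto simp: nonneg_low_def dest!: bspec[of _ _ j])
  next
   case False
   then have "0 \<le> psum x j - psum x k"
    using a k that by (auto simp: stays_nonneg_def psum_shift dest!: spec[of _ "j - k"])
   then show ?thesis using a by (auto simp: nonneg_low_def)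
  qed
  then show False using False by (auto simp: stays_nonneg_def)
 qed
 then have "(\<Sum>k=1..n. (of_bool (nonneg_low k x) * exp (z * of_real (psum x k)))
    * (of_bool (stays_nonneg (n - k) (shift_seq k x))
       * exp (z * complex_of_real (psum (shift_seq k x) (n - k))))) = 0"
  by (intro sum.neutral) auto
 then show ?thesis using False by simp
qed

section \<open>Walks with independent identically distributed steps\<close>

locale iid_walk = sequence_space \<mu> for \<mu> :: "real measure" +
 assumes sets_mu [simp, measurable_cong]: "sets \<mu> = sets borel"
begin

lemma measurable_psum [measurable]: "(\<lambda>x. psum x n) \<in> borel_measurable S"
proof -
 have "(\<lambda>x. x i) \<in> borel_measurable S" for i
  using measurable_component_singleton[of i UNIV "\<lambda>_. \<mu>"] by (simp add: measurable_cong_sets[OF refl sets_mu])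
 then show ?thesis unfolding psum_def by measurable
qed

lemma measurable_pmin [measurable]: "(\<lambda>x. pmin x n) \<in> borel_measurable S"
 unfolding pmin_def by (rule borel_measurable_Min) auto

lemma measurable_shift_seq [measurable]: "shift_seq k \<in> measurable S S"
proof -
 have "(\<lambda>x i. shift_seq k x i) \<in> measurable S S"
  by (rule measurable_PiM_single') (auto simp: shift_seq_def space_PiM)
 then show ?thesis by simp
qed

lemma measurable_walk_events [measurable]:
 "Measurable.pred S (strict_record_low k)" "Measurable.pred S (stays_nonneg k)"
 "Measurable.pred S (first_negative k)" "Measurable.pred S (nonneg_low k)"
 unfolding strict_record_low_def stays_nonneg_def first_negative_def nonneg_low_def by measurable

text \<open>\<open>comb_seq\<close> joins the first \<open>k\<close> entries of one sequence to the
  whole of another and preserves the product measure. After this change of variables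
  \<open>f\<close> sees only the first sequence and the shifted \<open>g\<close> only the
  second.\<close>

lemma integral_split:
 fixes f g :: "(nat \<Rightarrow> real) \<Rightarrow> complex"
 assumes f[measurable]: "f \<in> borel_measurable S" and g[measurable]: "g \<in> borel_measurable S"
  and fb: "\<And>x. norm (f x) \<le> 1" and gb: "\<And>x. norm (g x) \<le> 1"
  and dep: "\<And>x y. (\<And>i. i < k \<Longrightarrow> x i = y i) \<Longrightarrow> f x = f y"
 shows "(\<integral>x. f x * g (shift_seq k x) \<partial>S) = (\<integral>x. f x \<partial>S) * (\<integral>x. g x \<partial>S)"
proof -
 interpret PS: pair_prob_space S S by unfold_locales
 have s: "shift_seq k (comb_seq k \<omega> \<omega>') = \<omega>'" for \<omega> \<omega>' :: "nat \<Rightarrow> real"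
  by (auto simp: shift_seq_def comb_seq_def)
 have c: "f (comb_seq k \<omega> \<omega>') = f \<omega>" for \<omega> \<omega>'
  by (rule dep) (simp add: comb_seq_def)
 have "(\<integral>x. f x * g (shift_seq k x) \<partial>S)
   = (\<integral>x. f x * g (shift_seq k x) \<partial>distr (S \<Otimes>\<^sub>M S) S (\<lambda>(\<omega>, \<omega>'). comb_seq k \<omega> \<omega>'))"
  by (simp only: PiM_comb_seq)
 also have "\<dots> = (\<integral>y. f (fst y) * g (snd y) \<partial>(S \<Otimes>\<^sub>M S))"
  by (subst integral_distr) (auto simp: split_beta s c intro!: measurable_comb_seq)
 also have "\<dots> = (\<integral>x. (\<integral>y. f x * g y \<partial>S) \<partial>S)"
 proof -
  have "integrable (S \<Otimes>\<^sub>M S) (\<lambda>(x, y). f x * g y)"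
   by (rule PS.integrable_const_bound[where B = 1])
     (use fb gb in \<open>auto simp: split_beta norm_mult intro!: mult_le_one\<close>)
  from PS.integral_fst[OF this] show ?thesis by (simp only: case_prod_beta')
 qed
 also have "\<dots> = (\<integral>x. f x \<partial>S) * (\<integral>x. g x \<partial>S)" by simp
 finally show ?thesis .
qed

lemma norm_mult_le_1: "norm a \<le> 1 \<Longrightarrow> norm b \<le> 1 \<Longrightarrow> norm (a * b :: complex) \<le> 1"
 by (simp add: norm_mult mult_le_one)

lemma integrable_bounded:
 fixes f :: "(nat \<Rightarrow> real) \<Rightarrow> complex"
 assumes "f \<in> borel_measurable S" "\<And>x. norm (f x) \<le> 1"
 shows "integrable S f"
 using assms by (intro integrable_const_bound[where B = 1]) auto

lemma norm_integral_le_1: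
 fixes f :: "(nat \<Rightarrow> real) \<Rightarrow> complex"
 assumes "f \<in> borel_measurable S" "\<And>x. norm (f x) \<le> 1"
 shows "norm (\<integral>x. f x \<partial>S) \<le> 1"
proof -
 have "norm (\<integral>x. f x \<partial>S) \<le> (\<integral>x. norm (f x) \<partial>S)" by simp
 also have "\<dots> \<le> (\<integral>x. 1 \<partial>S)"
  using assms by (intro integral_mono integrable_norm integrable_bounded) auto
 finally show ?thesis by (simp add: P.prob_space)
qed

definition low_term :: "nat \<Rightarrow> complex \<Rightarrow> (nat \<Rightarrow> real) \<Rightarrow> complex" where
 "low_term k z x = of_bool (strict_record_low k x) * exp (z * of_real (psum x k))"

definition stay_term :: "nat \<Rightarrow> complex \<Rightarrow> (nat \<Rightarrow> real) \<Rightarrow> complex" where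
 "stay_term k z x = of_bool (stays_nonneg k x) * exp (z * of_real (psum x k))"

text \<open>Joint transform of the minimum and of the excess of the endpoint over it. For
  \<open>w = z\<close> the minimum cancels and the transform of the endpoint remains.\<close>

definition walk_transform :: "nat \<Rightarrow> complex \<Rightarrow> complex \<Rightarrow> complex" where
 "walk_transform n z w = (\<integral>x. exp (z * of_real (pmin x n) + w * of_real (psum x n - pmin x n)) \<partial>S)"

lemma measurable_terms [measurable]:
 "low_term k z \<in> borel_measurable S" "stay_term k z \<in> borel_measurable S"
 unfolding low_term_def stay_term_def by measurable

lemma norm_low_term: "Re z \<ge> 0 \<Longrightarrow> norm (low_term k z x) \<le> 1"
 by (cases "k = 0") (auto simp: low_term_def norm_mult strict_record_low_def mult_nonneg_nonpos
   dest!: spec[of _ 0])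

lemma norm_stay_term: "Re z \<le> 0 \<Longrightarrow> norm (stay_term k z x) \<le> 1"
 by (auto simp: stay_term_def norm_mult stays_nonneg_def mult_nonpos_nonneg)

lemma low_term_cong: "(\<And>i. i < k \<Longrightarrow> x i = y i) \<Longrightarrow> low_term k z x = low_term k z y"
 using psum_cong[of _ x y] by (simp add: low_term_def strict_record_low_def)

lemma events_cong:
 assumes "\<And>i. i < k \<Longrightarrow> x i = y i"
 shows "first_negative k x = first_negative k y" "nonneg_low k x = nonneg_low k y"
 using psum_cong[of _ x y] assms by (simp_all add: first_negative_def nonneg_low_def)

lemma walk_transform_eq_conv:
 assumes "Re z \<ge> 0" "Re w \<le> 0"
 shows "walk_transform n z w
  = (\<Sum>k\<le>n. (\<integral>x. low_term k z x \<partial>S) * (\<integral>x. stay_term (n - k) w x \<partial>S))"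
proof -
 have "walk_transform n z w = (\<integral>x. (\<Sum>k\<le>n. low_term k z x * stay_term (n - k) w (shift_seq k x)) \<partial>S)"
  unfolding walk_transform_def argmin_decomposition low_term_def stay_term_def ..
 also have "\<dots> = (\<Sum>k\<le>n. (\<integral>x. low_term k z x * stay_term (n - k) w (shift_seq k x) \<partial>S))"
  by (rule Bochner_Integration.integral_sum, rule integrable_bounded, measurable)
    (rule norm_mult_le_1[OF norm_low_term[OF assms(1)] norm_stay_term[OF assms(2)]])
 also have "\<dots> = (\<Sum>k\<le>n. (\<integral>x. low_term k z x \<partial>S) * (\<integral>x. stay_term (n - k) w x \<partial>S))"
 proof (intro sum.cong refl)
  fix k
  show "(\<integral>x. low_term k z x * stay_term (n - k) w (shift_seq k x) \<partial>S)
    = (\<integral>x. low_term k z x \<partial>S) * (\<integral>x. stay_term (n - k) w x \<partial>S)"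
  proof (rule integral_split[where f = "low_term k z" and g = "stay_term (n - k) w"])
   show "low_term k z x = low_term k z y" if "\<And>i. i < k \<Longrightarrow> x i = y i" for x y
    using that by (rule low_term_cong)
  qed (simp_all add: norm_low_term norm_stay_term assms)
 qed
 finally show ?thesis .
qed

lemma low_term_renewal:
 assumes "n \<ge> 1" "Re z \<ge> 0"
 shows "(\<integral>x. low_term n z x \<partial>S)
  = (\<Sum>k=1..n. (\<integral>x. of_bool (first_negative k x) * exp (z * of_real (psum x k)) \<partial>S)
     * (\<integral>x. low_term (n - k) z x \<partial>S))"
proof -
 let ?g = "\<lambda>k x. of_bool (first_negative k x) * exp (z * complex_of_real (psum x k))"
 have gb: "norm (?g k x) \<le> 1" for k x
  using assms by (auto simp: norm_mult first_negative_def mult_nonneg_nonpos)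
 have "(\<integral>x. low_term n z x \<partial>S) = (\<integral>x. (\<Sum>k=1..n. ?g k x * low_term (n - k) z (shift_seq k x)) \<partial>S)"
  unfolding low_term_def strict_record_low_renewal[OF assms(1)] ..
 also have "\<dots> = (\<Sum>k=1..n. (\<integral>x. ?g k x * low_term (n - k) z (shift_seq k x) \<partial>S))"
  by (rule Bochner_Integration.integral_sum, rule integrable_bounded, measurable)
    (rule norm_mult_le_1[OF gb norm_low_term[OF assms(2)]])
 also have "\<dots> = (\<Sum>k=1..n. (\<integral>x. ?g k x \<partial>S) * (\<integral>x. low_term (n - k) z x \<partial>S))"
 proof (intro sum.cong refl)
  fix k
  show "(\<integral>x. ?g k x * low_term (n - k) z (shift_seq k x) \<partial>S)
    = (\<integral>x. ?g k x \<partial>S) * (\<integral>x. low_term (n - k) z x \<partial>S)"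
  proof (rule integral_split[where f = "?g k" and g = "low_term (n - k) z"])
   show "?g k x = ?g k y" if "\<And>i. i < k \<Longrightarrow> x i = y i" for x y
    using events_cong[of k x y] psum_cong[of k x y] that by simp
   show "norm (?g k x) \<le> 1" for x by (rule gb)
   show "norm (low_term (n - k) z x) \<le> 1" for x using assms(2) by (rule norm_low_term)
  qed measurable
 qed
 finally show ?thesis .
qed

lemma stay_term_renewal:
 assumes "n \<ge> 1" "Re z \<le> 0"
 shows "(\<integral>x. stay_term n z x \<partial>S)
  = (\<Sum>k=1..n. (\<integral>x. of_bool (nonneg_low k x) * exp (z * of_real (psum x k)) \<partial>S)
     * (\<integral>x. stay_term (n - k) z x \<partial>S))"
proof -
 let ?g = "\<lambda>k x. of_bool (nonneg_low k x) * exp (z * complex_of_real (psum x k))"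
 have gb: "norm (?g k x) \<le> 1" for k x
  using assms by (auto simp: norm_mult nonneg_low_def mult_nonpos_nonneg)
 have "(\<integral>x. stay_term n z x \<partial>S) = (\<integral>x. (\<Sum>k=1..n. ?g k x * stay_term (n - k) z (shift_seq k x)) \<partial>S)"
  unfolding stay_term_def stays_nonneg_renewal[OF assms(1)] ..
 also have "\<dots> = (\<Sum>k=1..n. (\<integral>x. ?g k x * stay_term (n - k) z (shift_seq k x) \<partial>S))"
  by (rule Bochner_Integration.integral_sum, rule integrable_bounded, measurable)
    (rule norm_mult_le_1[OF gb norm_stay_term[OF assms(2)]])
 also have "\<dots> = (\<Sum>k=1..n. (\<integral>x. ?g k x \<partial>S) * (\<integral>x. stay_term (n - k) z x \<partial>S))"
 proof (intro sum.cong refl)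
  fix k
  show "(\<integral>x. ?g k x * stay_term (n - k) z (shift_seq k x) \<partial>S)
    = (\<integral>x. ?g k x \<partial>S) * (\<integral>x. stay_term (n - k) z x \<partial>S)"
  proof (rule integral_split[where f = "?g k" and g = "stay_term (n - k) z"])
   show "?g k x = ?g k y" if "\<And>i. i < k \<Longrightarrow> x i = y i" for x y
    using events_cong[of k x y] psum_cong[of k x y] that by simp
   show "norm (?g k x) \<le> 1" for x by (rule gb)
   show "norm (stay_term (n - k) z x) \<le> 1" for x using assms(2) by (rule norm_stay_term)
  qed measurable
 qed
 finally show ?thesis .
qed

lemma integral_exp_psum:
 assumes "Re z = 0"
 shows "(\<integral>x. exp (z * of_real (psum x n)) \<partial>S) = (\<integral>y. exp (z * of_real y) \<partial>\<mu>) ^ n"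
proof (induction n)
 case (Suc n)
 let ?f = "\<lambda>x. exp (z * complex_of_real (psum x n))" and ?g = "\<lambda>x. exp (z * complex_of_real (x 0))"
 have m0: "(\<lambda>x. x 0) \<in> borel_measurable S"
  using measurable_component_singleton[of 0 UNIV "\<lambda>_. \<mu>"] by (simp add: measurable_cong_sets[OF refl sets_mu])
 have "(\<integral>x. exp (z * of_real (psum x (Suc n))) \<partial>S) = (\<integral>x. ?f x * ?g (shift_seq n x) \<partial>S)"
  by (simp add: psum_def shift_seq_def algebra_simps exp_add)
 also have "\<dots> = (\<integral>x. ?f x \<partial>S) * (\<integral>x. ?g x \<partial>S)"
 proof (rule integral_split[where f = ?f and g = ?g])
  show "?f x = ?f y" if "\<And>i. i < n \<Longrightarrow> x i = y i" for x y
   using psum_cong[of n x y] that by simp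
 qed (use assms m0 in \<open>auto simp: norm_exp_eq_Re\<close>)
 also have "(\<integral>x. ?g x \<partial>S) = (\<integral>y. exp (z * of_real y) \<partial>distr S \<mu> (\<lambda>x. x 0))"
  by (subst integral_distr) auto
 also have "distr S \<mu> (\<lambda>x. x 0) = \<mu>" using PiM_component[of 0] by simp
 finally show ?case using Suc by simp
qed (simp add: P.prob_space)

text \<open>Summation against \<open>p ^ n\<close> turns the convolution over the time of the
  minimum into a product \<open>A z * B w\<close>. The choice \<open>w = z\<close> gives a geometric
  series in the characteristic function, and a zero argument gives \<open>Fm = A / A 0\<close> and
  \<open>Fp = B / B 0\<close>, so that the renewal bounds apply to both factors.\<close>

theorem walk_wiener_hopf:
 fixes p :: real
 assumes p: "0 < p" "p < 1"
 defines "Fm \<equiv> \<lambda>z. (1 - of_real p) * (\<Sum>n. of_real p ^ n * walk_transform n z 0)"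
  and "Fp \<equiv> \<lambda>w. (1 - of_real p) * (\<Sum>n. of_real p ^ n * walk_transform n 0 w)"
 shows "Re z = 0 \<Longrightarrow> Fm z * Fp z * (1 - of_real p * (\<integral>y. exp (z * of_real y) \<partial>\<mu>)) = 1 - of_real p"
  and "Re z \<ge> 0 \<Longrightarrow> 1 \<le> norm (Fm z) * (1 + 4 * max 1 (norm z) * (1 / norm (Fm 1) - 1))"
  and "Re w \<le> 0 \<Longrightarrow> 1 \<le> norm (Fp w) * (1 + 4 * max 1 (norm w) * (1 / norm (Fp (- 1)) - 1))"
proof -
 define a where "a n z = (\<integral>x. low_term n z x \<partial>S)" for n z
 define b where "b n z = (\<integral>x. stay_term n z x \<partial>S)" for n z
 define A where "A z = (\<Sum>n. of_real p ^ n * a n z)" for z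
 define B where "B z = (\<Sum>n. of_real p ^ n * b n z)" for z
 have ab: "norm (a n z) \<le> 1" if "Re z \<ge> 0" for n z
  unfolding a_def by (rule norm_integral_le_1) (use norm_low_term that in auto)
 have bb: "norm (b n z) \<le> 1" if "Re z \<le> 0" for n z
  unfolding b_def by (rule norm_integral_le_1) (use norm_stay_term that in auto)
 have AB: "A z * B w = (\<Sum>n. of_real p ^ n * walk_transform n z w)" if "Re z \<ge> 0" "Re w \<le> 0" for z w
  unfolding A_def B_def walk_transform_eq_conv[OF that] a_def[symmetric] b_def[symmetric]
  by (rule gf_mult) (use p ab bb that in auto)
 have geom: "(\<Sum>n. of_real p ^ n * c ^ n) * (1 - of_real p * c) = 1" if "norm c \<le> 1" for c :: complex
 proof -
  have n: "norm (of_real p * c) < 1"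
  proof -
   have "p * norm c \<le> p" using that p by (intro mult_left_le) auto
   then have "norm (of_real p * c) \<le> p" using p by (simp add: norm_mult)
   then show ?thesis using p by linarith
  qed
  then have "1 - of_real p * c \<noteq> 0" by auto
  then show ?thesis using suminf_geometric[OF n] by (simp add: power_mult_distrib)
 qed
 have diag: "walk_transform n z z = (\<integral>y. exp (z * of_real y) \<partial>\<mu>) ^ n" if "Re z = 0" for n z
  unfolding integral_exp_psum[OF that, symmetric] walk_transform_def by (simp add: algebra_simps)
 have nc: "norm (\<integral>y. exp (z * of_real y) \<partial>\<mu>) \<le> 1" if "Re z = 0" for z
 proof -
  have "(\<integral>x. exp (z * of_real (psum x 1)) \<partial>S) = (\<integral>y. exp (z * of_real y) \<partial>\<mu>)"
   using integral_exp_psum[OF that, of 1] by simp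
  moreover have "norm (\<integral>x. exp (z * of_real (psum x 1)) \<partial>S) \<le> 1"
   by (rule norm_integral_le_1) (use that in \<open>auto simp: norm_exp_eq_Re\<close>)
  ultimately show ?thesis by simp
 qed
 have AB_diag: "A z * B z * (1 - of_real p * (\<integral>y. exp (z * of_real y) \<partial>\<mu>)) = 1" if "Re z = 0" for z
  using AB[of z z] geom[OF nc[OF that]] that by (simp add: diag)
 have AB0: "A 0 * B 0 * (1 - of_real p) = 1"
  using AB_diag[of 0] P.prob_space by (simp add: M.prob_space)
 have Fm: "Fm z = A z / A 0" if "Re z \<ge> 0" for z
 proof -
  have "Fm z * A 0 = A z * (A 0 * B 0 * (1 - of_real p))"
   using AB[of z 0] that by (simp add: Fm_def mult_ac)
  moreover have "A 0 \<noteq> 0" using AB0 by auto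
  ultimately show ?thesis by (simp add: AB0 eq_divide_eq)
 qed
 have Fp: "Fp z = B z / B 0" if "Re z \<le> 0" for z
 proof -
  have "Fp z * B 0 = B z * (A 0 * B 0 * (1 - of_real p))"
   using AB[of 0 z] that by (simp add: Fp_def mult_ac)
  moreover have "B 0 \<noteq> 0" using AB0 by auto
  ultimately show ?thesis by (simp add: AB0 eq_divide_eq)
 qed
 show "Fm z * Fp z * (1 - of_real p * (\<integral>y. exp (z * of_real y) \<partial>\<mu>)) = 1 - of_real p" if z: "Re z = 0"
 proof -
  define c where "c = 1 - of_real p * (\<integral>y. exp (z * of_real y) \<partial>\<mu>)"
  have "Fm z * Fp z * c = (A z * B z * c) / (A 0 * B 0)" using Fm[of z] Fp[of z] z by simp
  also have "A z * B z * c = 1" unfolding c_def using z by (rule AB_diag)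
  also have "1 / (A 0 * B 0) = 1 - of_real p"
  proof -
   have "A 0 * B 0 \<noteq> 0" using AB0 by auto
   moreover have "(1 - of_real p) * (A 0 * B 0) = 1" using AB0 by (subst mult.commute)
   ultimately show ?thesis by (rule eq_divide_imp[symmetric])
  qed
  finally show ?thesis unfolding c_def .
 qed
 show "1 \<le> norm (Fm z) * (1 + 4 * max 1 (norm z) * (1 / norm (Fm 1) - 1))" if "Re z \<ge> 0"
 proof -
  have "1 \<le> norm (A z / A 0) * (1 + 4 * max 1 (norm z) * (1 / norm (A 1 / A 0) - 1))"
   unfolding A_def
  proof (rule renewal_lower_bound(2)[where N = S and E = first_negative and \<sigma> = "\<lambda>k x. psum x k" and v = a
     and g = "\<lambda>k z. \<integral>x. of_bool (first_negative k x) * exp (z * of_real (psum x k)) \<partial>S"])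
   show "a 0 z = 1" for z by (simp add: a_def low_term_def strict_record_low_def P.prob_space)
   show "a n z = (\<Sum>k=1..n. (\<integral>x. of_bool (first_negative k x) * exp (z * of_real (psum x k)) \<partial>S) * a (n - k) z)"
    if "n \<ge> 1" "Re z \<ge> 0" for n z
    unfolding a_def by (rule low_term_renewal[OF that])
   show "norm (a n z) \<le> 1" if "Re z \<ge> 0" for n z using that by (rule ab)
  qed (use p that P.prob_space_axioms in \<open>simp_all add: first_negative_def\<close>)
  then show ?thesis using Fm that by simp
 qed
 show "1 \<le> norm (Fp w) * (1 + 4 * max 1 (norm w) * (1 / norm (Fp (- 1)) - 1))" if w: "Re w \<le> 0"
 proof -
  \<comment> \<open>The ascending side fits the bound after a reflection, with
    \<open>- psum x k\<close> as step and \<open>- w\<close> as argument; the double signs are kept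
    to match that lemma.\<close>
  have "1 \<le> norm (B (- (- w)) / B (- 0)) * (1 + 4 * max 1 (norm (- w)) * (1 / norm (B (- 1) / B (- 0)) - 1))"
   unfolding B_def
  proof (rule renewal_lower_bound(2)[where N = S and E = nonneg_low and \<sigma> = "\<lambda>k x. - psum x k"
     and v = "\<lambda>n z. b n (- z)"
     and g = "\<lambda>k z. \<integral>x. of_bool (nonneg_low k x) * exp (z * of_real (- psum x k)) \<partial>S"])
   show "b 0 (- z) = 1" for z by (simp add: b_def stay_term_def stays_nonneg_def P.prob_space)
   show "b n (- z) = (\<Sum>k=1..n. (\<integral>x. of_bool (nonneg_low k x) * exp (z * of_real (- psum x k)) \<partial>S) * b (n - k) (- z))"
    if "n \<ge> 1" "Re z \<ge> 0" for n z
    using stay_term_renewal[OF that(1), of "- z"] that by (simp add: b_def)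
   show "norm (b n (- z)) \<le> 1" if "Re z \<ge> 0" for n z using that by (intro bb) simp
  qed (use p w P.prob_space_axioms in \<open>simp_all add: nonneg_low_def\<close>)
  then show ?thesis using Fp w by simp
 qed
qed

end

section \<open>Paths observed on dyadic grids\<close>

lemma cadlag_right: "cadlag f \<Longrightarrow> 0 \<le> t \<Longrightarrow> (f \<longlongrightarrow> f t) (at_right t)"
 by (simp add: cadlag_def)

text \<open>One-sided limits bound the path near each point, and bisection passes from local to
  global.\<close>

lemma cadlag_bounded:
 assumes f: "cadlag f" and t: "0 \<le> t"
 shows "bounded (f ` {0..t})"
proof -
 \<comment> \<open>\<open>cadlag\<close> says nothing about negative times, while the local step
   looks at intervals on both sides of a point, at 0 too.\<close>
 define Z where "Z = {0::real..}"
 have "bounded (f ` ({0..t} \<inter> Z))"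
  using t
 proof (induction rule: Bolzano)
  case (trans a b c)
  have "{a..c} \<inter> Z = ({a..b} \<inter> Z) \<union> ({b..c} \<inter> Z)" using trans by auto
  then show ?case using trans(1,2) by (simp only: image_Un bounded_Un)
 next
  case (local x)
  obtain b where b: "b > x" "\<And>y. x < y \<Longrightarrow> y < b \<Longrightarrow> dist (f y) (f x) < 1"
   using tendstoD[OF cadlag_right[OF f local(1)], of 1] by (auto simp: eventually_at_right_field)
  have "\<exists>a<x. \<exists>l. \<forall>y. 0 \<le> y \<longrightarrow> a < y \<longrightarrow> y < x \<longrightarrow> dist (f y) l < 1"
  proof (cases "x = 0")
   case True
   then show ?thesis by (intro exI[of _ "-1"]) auto
  next
   case False
   then have "x > 0" using local by auto
   then have "\<exists>l. (f \<longlongrightarrow> l) (at_left x)" using f by (simp add: cadlag_def)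
   then obtain l where "(f \<longlongrightarrow> l) (at_left x)" by blast
   from tendstoD[OF this, of 1] show ?thesis by (auto simp: eventually_at_left_field)
  qed
  then obtain a l where a: "a < x" "\<And>y. 0 \<le> y \<Longrightarrow> a < y \<Longrightarrow> y < x \<Longrightarrow> dist (f y) l < 1" by blast
  have "bounded (f ` ({u..v} \<inter> Z))" if "u \<le> x" "x \<le> v" "v - u < min (b - x) (x - a)" for u v
  proof (rule bounded_subset)
   show "bounded (cball (f x) 1 \<union> cball l 1)" by simp
   show "f ` ({u..v} \<inter> Z) \<subseteq> cball (f x) 1 \<union> cball l 1"
   proof
    fix z assume "z \<in> f ` ({u..v} \<inter> Z)"
    then obtain y where y: "z = f y" "u \<le> y" "y \<le> v" "0 \<le> y" by (auto simp: Z_def)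
    consider "y = x" | "x < y" | "y < x" by linarith
    then show "z \<in> cball (f x) 1 \<union> cball l 1"
    proof cases
     case 2
     then have "dist (f y) (f x) < 1" using that y by (intro b) auto
     then show ?thesis using y by (auto simp: dist_commute)
    next
     case 3
     then have "dist (f y) l < 1" using that y by (intro a) auto
     then show ?thesis using y by (auto simp: dist_commute)
    qed (use y in auto)
   qed
  qed
  then show ?case using a b by (intro exI[of _ "min (b - x) (x - a)"]) auto
 qed
 moreover have "{0..t} \<inter> Z = {0..t}" by (auto simp: Z_def)
 ultimately show ?thesis by simp
qed

lemma cadlag_bdd_below: "cadlag f \<Longrightarrow> 0 \<le> t \<Longrightarrow> bdd_below (f ` {0..t})"
 by (intro bounded_imp_bdd_below cadlag_bounded)

definition grid_index :: "nat \<Rightarrow> real \<Rightarrow> nat" where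
 "grid_index j t = Suc (nat \<lfloor>t * 2 ^ j\<rfloor>)"

definition grid_min :: "(real \<Rightarrow> real) \<Rightarrow> nat \<Rightarrow> nat \<Rightarrow> real" where
 "grid_min f j n = Min ((\<lambda>k. f (real k / 2 ^ j)) ` {..n})"

lemma grid_index_bounds:
 assumes "0 \<le> t"
 shows "t < real (grid_index j t) / 2 ^ j" "real (grid_index j t) / 2 ^ j \<le> t + 1 / 2 ^ j"
proof -
 have "0 \<le> \<lfloor>t * 2 ^ j\<rfloor>" using assms by simp
 then have e: "real (grid_index j t) = of_int \<lfloor>t * 2 ^ j\<rfloor> + 1" by (simp add: grid_index_def)
 show "t < real (grid_index j t) / 2 ^ j" unfolding e by (simp add: field_simps) linarith
 show "real (grid_index j t) / 2 ^ j \<le> t + 1 / 2 ^ j" unfolding e by (simp add: field_simps)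
qed

lemma grid_index_mono: "s \<le> t \<Longrightarrow> grid_index j s \<le> grid_index j t"
 unfolding grid_index_def by (intro Suc_le_mono[THEN iffD2] nat_mono floor_mono mult_right_mono) auto

lemma inverse_pow2_tendsto: "(\<lambda>j. 1 / (2::real) ^ j) \<longlonglongrightarrow> 0"
 by (simp add: LIMSEQ_divide_realpow_zero)

lemma grid_point_tendsto:
 assumes "0 \<le> t"
 shows "filterlim (\<lambda>j. real (grid_index j t) / 2 ^ j) (at_right t) sequentially"
proof (rule tendsto_imp_filterlim_at_right)
 show "(\<lambda>j. real (grid_index j t) / 2 ^ j) \<longlonglongrightarrow> t"
 proof (rule tendsto_sandwich[of "\<lambda>_. t" _ _ "\<lambda>j. t + 1 / 2 ^ j"])
  show "(\<lambda>j. t + 1 / 2 ^ j) \<longlonglongrightarrow> t"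
   using tendsto_add[OF tendsto_const[of t] inverse_pow2_tendsto] by simp
 qed (use grid_index_bounds[OF assms] in \<open>auto intro!: always_eventually less_imp_le\<close>)
qed (use grid_index_bounds(1)[OF assms] in auto)

lemma grid_end_tendsto:
 assumes "cadlag f" "0 \<le> t"
 shows "(\<lambda>j. f (real (grid_index j t) / 2 ^ j)) \<longlonglongrightarrow> f t"
 using filterlim_compose[OF cadlag_right[OF assms] grid_point_tendsto[OF assms(2)]] .

text \<open>The grid reaches slightly beyond \<open>t\<close>, so that right continuity recovers the value at \<open>t\<close> itself.\<close>

lemma grid_min_tendsto:
 assumes f: "cadlag f" and t: "0 \<le> t"
 shows "(\<lambda>j. grid_min f j (grid_index j t)) \<longlonglongrightarrow> (INF s\<in>{0..t}. f s)"
proof (rule LIMSEQ_I)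
 let ?I = "INF s\<in>{0..t}. f s"
 have bdd: "bdd_below (f ` {0..t})" using cadlag_bdd_below f t .
 have I_le: "?I \<le> f s" if "0 \<le> s" "s \<le> t" for s
  using bdd that by (intro cINF_lower) auto
 fix e :: real assume e: "e > 0"
 obtain b where b: "b > t" "\<And>y. t < y \<Longrightarrow> y < b \<Longrightarrow> dist (f y) (f t) < e"
  using tendstoD[OF cadlag_right[OF f t] e] by (auto simp: eventually_at_right_field)
 have "\<exists>s\<in>{0..t}. f s < ?I + e"
  using cINF_less_iff[of "{0..t}" f "?I + e"] bdd t e by auto
 then obtain s where s: "0 \<le> s" "s \<le> t" "f s < ?I + e" by auto
 have "\<forall>\<^sub>F y in at_right s. f y < ?I + e"
  using order_tendstoD(2)[OF cadlag_right[OF f s(1)] s(3)] .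
 then obtain c where c: "c > s" "\<And>y. s < y \<Longrightarrow> y < c \<Longrightarrow> f y < ?I + e"
  by (auto simp: eventually_at_right_field)
 have "\<forall>\<^sub>F j in sequentially. 1 / (2::real) ^ j < min (b - t) (c - s)"
  using order_tendstoD(2)[OF inverse_pow2_tendsto, of "min (b - t) (c - s)"] b c by simp
 then obtain n0 where n0: "\<And>j. j \<ge> n0 \<Longrightarrow> 1 / (2::real) ^ j < min (b - t) (c - s)"
  by (auto simp: eventually_sequentially)
 have "norm (grid_min f j (grid_index j t) - ?I) < e" if "j \<ge> n0" for j
 proof -
  have lower: "f (real k / 2 ^ j) > ?I - e" if k: "k \<le> grid_index j t" for k
  proof (cases "real k / 2 ^ j \<le> t")
   case True
   then show ?thesis using I_le[of "real k / 2 ^ j"] e by auto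
  next
   case False
   have "real k / 2 ^ j \<le> real (grid_index j t) / 2 ^ j" using k by (simp add: divide_right_mono)
   then have "real k / 2 ^ j < b" using grid_index_bounds(2)[OF t, of j] n0[OF \<open>j \<ge> n0\<close>] by simp
   then have "dist (f (real k / 2 ^ j)) (f t) < e" using False by (intro b) auto
   then show ?thesis using I_le[of t] t by (auto simp: dist_real_def)
  qed
  have "grid_min f j (grid_index j t) > ?I - e"
   unfolding grid_min_def using lower by (subst Min_gr_iff) auto
  moreover have "grid_min f j (grid_index j t) < ?I + e"
  proof -
   have "grid_min f j (grid_index j t) \<le> f (real (grid_index j s) / 2 ^ j)"
    unfolding grid_min_def using grid_index_mono[OF s(2)] by (intro Min_le) auto
   also have "\<dots> < ?I + e"
    using grid_index_bounds[OF s(1), of j] n0[OF that] by (intro c) auto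
   finally show ?thesis .
  qed
  ultimately show ?thesis by (simp add: abs_less_iff)
 qed
 then show "\<exists>n0. \<forall>j\<ge>n0. norm (grid_min f j (grid_index j t) - ?I) < e" by blast
qed

lemma running_inf_lower:
 assumes "cadlag (\<lambda>t. X t \<omega>)" "0 \<le> s" "s \<le> t"
 shows "running_inf X t \<omega> \<le> X s \<omega>"
 unfolding running_inf_def using assms cadlag_bdd_below[OF assms(1), of t]
 by (intro cINF_lower) auto

text \<open>The integral is split by the value of the random index. Independence enters only through
  \<open>E\<close>, a statement on expectations, which can be supplied on a product space as well as
  for an independent time on \<open>M\<close>.\<close>

lemma (in prob_space) random_index_sums:
 fixes f :: "nat \<Rightarrow> 'a \<Rightarrow> complex"
 assumes idx[measurable]: "idx \<in> measurable M (count_space UNIV)"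
  and f[measurable]: "\<And>n. f n \<in> borel_measurable M"
  and fb: "\<And>n x. x \<in> space M \<Longrightarrow> norm (f n x) \<le> 1"
  and E: "\<And>n. (\<integral>x. of_bool (idx x = n) * f n x \<partial>M) = of_real (prob {x \<in> space M. idx x = n}) * u n"
 shows "(\<lambda>n. of_real (prob {x \<in> space M. idx x = n}) * u n) sums (\<integral>x. f (idx x) x \<partial>M)"
proof -
 let ?F = "\<lambda>n x. of_bool (idx x = n) * f n x"
 have int: "integrable M (?F n)" for n
  by (rule integrable_const_bound[where B = 1]) (use fb in auto)
 have nF: "(\<integral>x. norm (?F n x) \<partial>M) \<le> prob {x \<in> space M. idx x = n}" for n
 proof -
  have "(\<integral>x. norm (?F n x) \<partial>M) \<le> (\<integral>x. indicator {x \<in> space M. idx x = n} x \<partial>M)"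
   by (rule integral_mono) (use int[of n] fb in \<open>auto simp: indicator_def integrable_norm
      intro!: integrable_const_bound[where B = 1]\<close>)
  then show ?thesis by simp
 qed
 have sp: "summable (\<lambda>n. prob {x \<in> space M. idx x = n})"
  by (rule sums_summable[OF finite_measure_UNION]) (auto simp: disjoint_family_on_def)
 have sm: "summable (\<lambda>n. \<integral>x. norm (?F n x) \<partial>M)"
  by (rule summable_comparison_test'[OF sp, where N = 0]) (use nF in auto)
 have ev: "?F n x = (if n = idx x then f (idx x) x else 0)" for n x by auto
 have "(\<lambda>n. \<integral>x. ?F n x \<partial>M) sums (\<integral>x. (\<Sum>n. ?F n x) \<partial>M)"
 proof (rule sums_integral[OF int _ sm], rule AE_I2)
  show "summable (\<lambda>n. norm (?F n x))" for x
   by (rule summable_finite[of "{idx x}"]) auto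
 qed
 moreover have "(\<Sum>n. ?F n x) = f (idx x) x" for x
  unfolding ev using suminf_finite[of "{idx x}" "\<lambda>n. if n = idx x then f (idx x) x else 0"] by simp
 ultimately show ?thesis by (simp add: E)
qed

lemma (in prob_space) exponential_interval:
 assumes D: "distributed M lborel T (\<lambda>x. ennreal (exponential_density l x))" and l: "0 < l"
  and ab: "0 \<le> a" "a \<le> b"
 shows "prob {x \<in> space M. a \<le> T x \<and> T x < b} = exp (- a * l) - exp (- b * l)"
proof -
 have T[measurable]: "T \<in> borel_measurable M" using distributed_measurable[OF D] by simp
 have null: "prob {x \<in> space M. T x = c} = 0" for c
 proof -
  have "emeasure M (T -` {c} \<inter> space M) = (\<integral>\<^sup>+x. ennreal (exponential_density l x) * indicator {c} x \<partial>lborel)"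
   by (rule distributed_emeasure[OF D]) simp
  also have "\<dots> = 0"
   by (subst nn_integral_0_iff_AE) (auto intro!: AE_mp[OF AE_lborel_singleton[of c] AE_I2])
  finally show ?thesis by (simp add: measure_def vimage_def Int_def conj_commute)
 qed
 have gt: "prob {x \<in> space M. c < T x} = exp (- c * l)" if "0 \<le> c" for c
  using exponential_distributedD_gt[OF D that l] by simp
 have ge: "prob {x \<in> space M. c \<le> T x} = exp (- c * l)" if "0 \<le> c" for c
 proof -
  have "prob {x \<in> space M. c \<le> T x} = prob ({x \<in> space M. c < T x} \<union> {x \<in> space M. T x = c})"
   by (intro arg_cong[where f = prob]) auto
  also have "\<dots> = prob {x \<in> space M. c < T x} + prob {x \<in> space M. T x = c}"
   by (rule finite_measure_Union) auto
  finally show ?thesis using gt[OF that] null by simp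
 qed
 have "prob {x \<in> space M. a \<le> T x \<and> T x < b} = prob ({x \<in> space M. a \<le> T x} - {x \<in> space M. b \<le> T x})"
  by (intro arg_cong[where f = prob]) auto
 also have "\<dots> = prob {x \<in> space M. a \<le> T x} - prob {x \<in> space M. b \<le> T x}"
  using ab by (intro finite_measure_Diff) auto
 finally show ?thesis using ge ab by simp
qed

text \<open>The integer part of a scaled exponential variable is geometric, so on the grid of mesh
  \<open>1 / 2 ^ j\<close> an exponential time becomes the geometric time at which a walk
  factors.\<close>

lemma (in prob_space) exponential_grid_index:
 assumes D: "distributed M lborel T (\<lambda>x. ennreal (exponential_density l x))" and l: "0 < l"
 shows "prob {x \<in> space M. nat \<lfloor>T x * 2 ^ j\<rfloor> = n} = (1 - exp (- l / 2 ^ j)) * exp (- l / 2 ^ j) ^ n"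
  and "AE x in M. 0 \<le> T x"
proof -
 have T[measurable]: "T \<in> borel_measurable M" using distributed_measurable[OF D] by simp
 have "prob {x \<in> space M. 0 < T x} = 1" using exponential_distributedD_gt[OF D order_refl l] by simp
 then have "AE x in M. 0 < T x" by (simp add: prob_Collect_eq_1)
 then show AE: "AE x in M. 0 \<le> T x" by eventually_elim simp
 have "prob {x \<in> space M. nat \<lfloor>T x * 2 ^ j\<rfloor> = n}
   = prob {x \<in> space M. real n / 2 ^ j \<le> T x \<and> T x < real (Suc n) / 2 ^ j}"
 proof (rule prob_eq_AE)
  show "AE x in M. (nat \<lfloor>T x * 2 ^ j\<rfloor> = n) = (real n / 2 ^ j \<le> T x \<and> T x < real (Suc n) / 2 ^ j)"
   using AE
  proof eventually_elim
   case (elim x)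
   then have "(nat \<lfloor>T x * 2 ^ j\<rfloor> = n) = (\<lfloor>T x * 2 ^ j\<rfloor> = int n)"
    by (metis floor_mono floor_of_int int_nat_eq mult_nonneg_nonneg nat_int of_int_0 zero_le_numeral zero_le_power)
   also have "\<dots> = (real n \<le> T x * 2 ^ j \<and> T x * 2 ^ j < real n + 1)"
    by (simp add: floor_eq_iff)
   also have "\<dots> = (real n / 2 ^ j \<le> T x \<and> T x < real (Suc n) / 2 ^ j)"
    by (simp add: field_simps)
   finally show ?case .
  qed
 qed auto
 also have "\<dots> = exp (- (real n / 2 ^ j) * l) - exp (- (real (Suc n) / 2 ^ j) * l)"
  by (rule exponential_interval[OF D l]) (auto simp: divide_right_mono)
 also have "exp (- (real n / 2 ^ j) * l) = exp (- l / 2 ^ j) ^ n"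
  by (simp add: exp_of_nat_mult[symmetric] algebra_simps)
 also have "exp (- (real (Suc n) / 2 ^ j) * l) = exp (- l / 2 ^ j) ^ Suc n"
  by (simp only: exp_of_nat_mult[symmetric]) (simp add: algebra_simps)
 finally show "prob {x \<in> space M. nat \<lfloor>T x * 2 ^ j\<rfloor> = n} = (1 - exp (- l / 2 ^ j)) * exp (- l / 2 ^ j) ^ n"
  by (simp add: algebra_simps)
qed

text \<open>One standard exponential variable serves all rates: divided by \<open>q\<close> it has
  rate \<open>q\<close>, and the resulting times are monotone in \<open>q\<close> outcome by
  outcome.\<close>

definition unit_exp :: "real measure" where
 "unit_exp = density lborel (\<lambda>x. ennreal (exponential_density 1 x))"

lemma sets_unit_exp [simp, measurable_cong]: "sets unit_exp = sets borel"
 by (simp add: unit_exp_def)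

lemma space_unit_exp [simp]: "space unit_exp = UNIV"
 by (simp add: unit_exp_def)

lemma prob_space_unit_exp: "prob_space unit_exp"
 unfolding unit_exp_def by (rule prob_space_exponential_density) simp

lemma distributed_unit_exp:
 assumes q: "0 < q"
 shows "distributed unit_exp lborel (\<lambda>v. v / q) (\<lambda>x. ennreal (exponential_density q x))"
 unfolding distributed_def
proof (intro conjI)
 have "distr unit_exp lborel (\<lambda>v. v / q) = distr (density lborel (\<lambda>x. ennreal (exponential_density 1 x))) borel (\<lambda>v. v / q)"
  unfolding unit_exp_def by (rule distr_cong) auto
 also have "\<dots> = density (density lborel (\<lambda>_. ennreal q)) (\<lambda>x. ennreal (exponential_density 1 (x * q)))"
 proof (rule measure_eqI)
  fix A :: "real set" assume "A \<in> sets (distr (density lborel (\<lambda>x. ennreal (exponential_density 1 x))) borel (\<lambda>v. v / q))"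
  then have A[measurable]: "A \<in> sets borel" by simp
  have "emeasure (distr (density lborel (\<lambda>x. ennreal (exponential_density 1 x))) borel (\<lambda>v. v / q)) A
    = (\<integral>\<^sup>+x. ennreal (exponential_density 1 x) * indicator A (x / q) \<partial>lborel)"
  proof -
   have "(\<lambda>v. v / q) -` A \<in> sets borel"
    using measurable_sets[OF _ A, of "\<lambda>v. v / q" borel] by simp
   then show ?thesis
    by (subst emeasure_distr) (auto simp: emeasure_density indicator_def intro!: nn_integral_cong)
  qed
  also have "\<dots> = ennreal \<bar>q\<bar> * (\<integral>\<^sup>+x. ennreal (exponential_density 1 (0 + q * x)) * indicator A ((0 + q * x) / q) \<partial>lborel)"
   by (rule nn_integral_real_affine) (use q in auto)
  also have "\<dots> = (\<integral>\<^sup>+x. ennreal q * (ennreal (exponential_density 1 (x * q)) * indicator A x) \<partial>lborel)"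
   using q by (simp add: nn_integral_cmult mult.commute)
  also have "\<dots> = emeasure (density (density lborel (\<lambda>_. ennreal q)) (\<lambda>x. ennreal (exponential_density 1 (x * q)))) A"
   by (simp add: emeasure_density nn_integral_density)
  finally show "emeasure (distr (density lborel (\<lambda>x. ennreal (exponential_density 1 x))) borel (\<lambda>v. v / q)) A
   = emeasure (density (density lborel (\<lambda>_. ennreal q)) (\<lambda>x. ennreal (exponential_density 1 (x * q)))) A" .
 qed simp
 also have "\<dots> = density lborel (\<lambda>x. ennreal q * ennreal (exponential_density 1 (x * q)))"
  by (rule density_density_eq) auto
 also have "\<dots> = density lborel (\<lambda>x. ennreal (exponential_density q x))"
  using q by (intro density_cong)
   (auto simp: exponential_density_def mult_less_0_iff zero_le_mult_iff not_less mult.commute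
     simp flip: ennreal_mult)
 finally show "distr unit_exp lborel (\<lambda>v. v / q) = density lborel (\<lambda>x. ennreal (exponential_density q x))" .
qed auto

lemma exp_diff_limit:
 fixes b :: complex
 shows "(\<lambda>j. (1 - exp (- b / 2 ^ j)) * 2 ^ j) \<longlonglongrightarrow> b"
proof (cases "b = 0")
 case False
 have "((\<lambda>h. (exp (0 + h) - exp 0) / h) \<longlongrightarrow> (exp 0 :: complex)) (at 0)"
  using DERIV_exp[of "0::complex"] by (simp only: DERIV_def)
 then have d: "((\<lambda>h. (exp h - 1) / h) \<longlongrightarrow> (1 :: complex)) (at 0)" by simp
 have x: "filterlim (\<lambda>j. - b / 2 ^ j) (at 0) sequentially"
 proof -
  have "(\<lambda>j. - b * of_real (1 / 2 ^ j)) \<longlonglongrightarrow> - b * of_real 0"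
   by (intro tendsto_mult tendsto_const tendsto_of_real inverse_pow2_tendsto)
  then have "(\<lambda>j. - b / 2 ^ j) \<longlonglongrightarrow> 0" by simp
  then show ?thesis using False by (simp add: filterlim_at)
 qed
 have "(\<lambda>j. b * ((exp (- b / 2 ^ j) - 1) / (- b / 2 ^ j))) \<longlonglongrightarrow> b * 1"
  by (intro tendsto_mult tendsto_const filterlim_compose[OF d x])
 moreover have "b * ((exp (- b / 2 ^ j) - 1) / (- b / 2 ^ j)) = (1 - exp (- b / 2 ^ j)) * 2 ^ j" for j
  using False by (simp add: field_simps)
 ultimately show ?thesis by simp
qed simp

lemma exp_quotient_limit:
 fixes a :: complex
 assumes q: "0 < q"
 shows "(\<lambda>j. (1 - exp (- a / 2 ^ j)) / (1 - exp (- of_real q / 2 ^ j))) \<longlonglongrightarrow> a / of_real q"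
proof -
 have "(\<lambda>j. ((1 - exp (- a / 2 ^ j)) * 2 ^ j) / ((1 - exp (- of_real q / 2 ^ j)) * 2 ^ j)) \<longlonglongrightarrow> a / of_real q"
  by (rule tendsto_divide[OF exp_diff_limit exp_diff_limit]) (use q in simp)
 then show ?thesis by simp
qed

section \<open>Levy processes on dyadic grids\<close>

locale levy_path = prob_space M for M :: "'a measure" +
 fixes X :: "real \<Rightarrow> 'a \<Rightarrow> real"
 assumes levy: "levy_process M X"
begin

lemma measurable_X [measurable]: "0 \<le> t \<Longrightarrow> X t \<in> borel_measurable M"
 using levy by (simp add: levy_process_def)

lemma measurable_grid [measurable]: "X (real k / 2 ^ j) \<in> borel_measurable M"
 by (rule measurable_X) simp

lemma X_0: "AE \<omega> in M. X 0 \<omega> = 0"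
 using levy by (simp add: levy_process_def)

lemma cadlag_X: "\<omega> \<in> space M \<Longrightarrow> cadlag (\<lambda>t. X t \<omega>)"
 using levy by (simp add: levy_process_def)

definition grid_step :: "nat \<Rightarrow> nat \<Rightarrow> 'a \<Rightarrow> real" where
 "grid_step j k \<omega> = X (real (Suc k) / 2 ^ j) \<omega> - X (real k / 2 ^ j) \<omega>"

definition step_law :: "nat \<Rightarrow> real measure" where
 "step_law j = distr M borel (X (1 / 2 ^ j))"

lemma measurable_grid_step [measurable]: "grid_step j k \<in> borel_measurable M"
 unfolding grid_step_def by (intro borel_measurable_diff measurable_grid)

lemma psum_grid_step: "psum (\<lambda>i. grid_step j i \<omega>) k = X (real k / 2 ^ j) \<omega> - X 0 \<omega>"
 by (induction k) (auto simp: psum_def grid_step_def)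

lemma indep_grid_steps: "indep_vars (\<lambda>_. borel) (grid_step j) UNIV"
proof -
 have fin: "indep_vars (\<lambda>_. borel) (grid_step j) {..<n}" for n
 proof -
  have "\<forall>(\<tau> :: nat \<Rightarrow> real) n. 0 \<le> \<tau> 0 \<and> mono_on {..n} \<tau> \<longrightarrow>
    indep_vars (\<lambda>_. borel) (\<lambda>i \<omega>. X (\<tau> (Suc i)) \<omega> - X (\<tau> i) \<omega>) {..<n}"
   using levy by (simp add: levy_process_def)
  from this[rule_format, of "\<lambda>k. real k / 2 ^ j" n]
  show ?thesis by (simp add: grid_step_def[abs_def] mono_on_def divide_right_mono)
 qed
 have "indep_sets (\<lambda>i. sigma_sets (space M) {grid_step j i -` A \<inter> space M |A. A \<in> sets borel}) UNIV"
 proof (subst indep_sets_finite_index_sets, intro allI impI)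
  fix J :: "nat set" assume "J \<subseteq> UNIV" "J \<noteq> {}" and J: "finite J"
  then obtain n where "J \<subseteq> {..<n}" using finite_nat_iff_bounded by auto
  then have "indep_vars (\<lambda>_. borel) (grid_step j) J" using fin indep_vars_subset by blast
  then show "indep_sets (\<lambda>i. sigma_sets (space M) {grid_step j i -` A \<inter> space M |A. A \<in> sets borel}) J"
   by (simp add: indep_vars_def)
 qed
 then show ?thesis by (simp add: indep_vars_def)
qed

lemma grid_step_law: "distr M borel (grid_step j k) = step_law j"
proof -
 have "\<forall>s\<ge>0. \<forall>t\<ge>0. distr M borel (\<lambda>\<omega>. X (s + t) \<omega> - X s \<omega>) = distr M borel (X t)"
  using levy by (simp add: levy_process_def)
 from this[rule_format, of "real k / 2 ^ j" "1 / 2 ^ j"] show ?thesis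
  by (simp add: step_law_def grid_step_def[abs_def] add_divide_distrib add.commute)
qed

lemma iid_walk_step_law: "iid_walk (step_law j)"
proof -
 interpret D: prob_space "step_law j" unfolding step_law_def by (rule prob_space_distr) (simp add: measurable_X)
 interpret product_prob_space "\<lambda>_::nat. step_law j" UNIV by unfold_locales
 show ?thesis by unfold_locales (simp add: step_law_def)
qed

lemma integral_grid_steps:
 fixes g :: "(nat \<Rightarrow> real) \<Rightarrow> complex"
 assumes g: "g \<in> borel_measurable (PiM UNIV (\<lambda>_. step_law j))"
 shows "(\<integral>\<omega>. g (\<lambda>i. grid_step j i \<omega>) \<partial>M) = (\<integral>x. g x \<partial>PiM UNIV (\<lambda>_. step_law j))"
proof -
 have s: "sets (PiM UNIV (\<lambda>_::nat. step_law j)) = sets (PiM UNIV (\<lambda>_. borel))"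
  by (intro sets_PiM_cong) (auto simp: step_law_def)
 have "distr M (PiM UNIV (\<lambda>_. borel)) (\<lambda>\<omega>. \<lambda>i\<in>UNIV. grid_step j i \<omega>)
   = PiM UNIV (\<lambda>i. distr M borel (grid_step j i))"
  using indep_grid_steps[of j] by (subst (asm) indep_vars_iff_distr_eq_PiM) auto
 then have d: "distr M (PiM UNIV (\<lambda>_. borel)) (\<lambda>\<omega> i. grid_step j i \<omega>) = PiM UNIV (\<lambda>_. step_law j)"
  by (simp add: grid_step_law restrict_def)
 have "(\<integral>x. g x \<partial>PiM UNIV (\<lambda>_. step_law j)) = (\<integral>x. g x \<partial>distr M (PiM UNIV (\<lambda>_. borel)) (\<lambda>\<omega> i. grid_step j i \<omega>))"
  by (simp only: d)
 also have "\<dots> = (\<integral>\<omega>. g (\<lambda>i. grid_step j i \<omega>) \<partial>M)"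
 proof (rule integral_distr)
  show "(\<lambda>\<omega> i. grid_step j i \<omega>) \<in> M \<rightarrow>\<^sub>M PiM UNIV (\<lambda>_. borel)"
   by (rule measurable_PiM_single') (auto simp: measurable_grid_step)
  show "g \<in> borel_measurable (PiM UNIV (\<lambda>_. borel))"
   using g by (simp add: measurable_cong_sets[OF s refl])
 qed
 finally show ?thesis ..
qed

definition grid_transform :: "nat \<Rightarrow> nat \<Rightarrow> complex \<Rightarrow> complex \<Rightarrow> complex" where
 "grid_transform j n z w = (\<integral>\<omega>. exp (z * of_real (grid_min (\<lambda>t. X t \<omega>) j n)
   + w * of_real (X (real n / 2 ^ j) \<omega> - grid_min (\<lambda>t. X t \<omega>) j n)) \<partial>M)"

lemma measurable_grid_min [measurable]: "(\<lambda>\<omega>. grid_min (\<lambda>t. X t \<omega>) j n) \<in> borel_measurable M"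
 unfolding grid_min_def by (rule borel_measurable_Min) auto

lemma grid_transform_eq: "grid_transform j n z w = iid_walk.walk_transform (step_law j) n z w"
proof -
 interpret W: iid_walk "step_law j" by (rule iid_walk_step_law)
 let ?g = "\<lambda>x. exp (z * of_real (pmin x n) + w * complex_of_real (psum x n - pmin x n))"
 have "grid_transform j n z w = (\<integral>\<omega>. ?g (\<lambda>i. grid_step j i \<omega>) \<partial>M)"
  unfolding grid_transform_def
 proof (rule integral_cong_AE)
  show "AE \<omega> in M. exp (z * of_real (grid_min (\<lambda>t. X t \<omega>) j n)
   + w * of_real (X (real n / 2 ^ j) \<omega> - grid_min (\<lambda>t. X t \<omega>) j n)) = ?g (\<lambda>i. grid_step j i \<omega>)"
   using X_0
  proof eventually_elim
   case (elim \<omega>)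
   have "psum (\<lambda>i. grid_step j i \<omega>) = (\<lambda>k. X (real k / 2 ^ j) \<omega>)"
    by (rule ext) (simp add: psum_grid_step elim)
   then show ?case by (simp add: pmin_def grid_min_def)
  qed
  show "(\<lambda>\<omega>. ?g (\<lambda>i. grid_step j i \<omega>)) \<in> borel_measurable M"
  proof (rule measurable_compose[of "\<lambda>\<omega> i. grid_step j i \<omega>" M "PiM UNIV (\<lambda>_. step_law j)" ?g])
   show "(\<lambda>\<omega> i. grid_step j i \<omega>) \<in> M \<rightarrow>\<^sub>M PiM UNIV (\<lambda>_. step_law j)"
    by (rule measurable_PiM_single')
      (use measurable_grid_step in \<open>auto simp: step_law_def measurable_cong_sets[OF refl sets_distr]\<close>)
  qed measurable
 qed measurable
 also have "\<dots> = W.walk_transform n z w"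
  unfolding W.walk_transform_def by (rule integral_grid_steps) measurable
 finally show ?thesis .
qed

lemma char_grid:
 "(\<integral>\<omega>. exp (\<i> * of_real u * of_real (X (real n / 2 ^ j) \<omega>)) \<partial>M)
  = (\<integral>\<omega>. exp (\<i> * of_real u * of_real (X (1 / 2 ^ j) \<omega>)) \<partial>M) ^ n"
proof -
 interpret W: iid_walk "step_law j" by (rule iid_walk_step_law)
 let ?g = "\<lambda>x. exp (\<i> * of_real u * complex_of_real (psum x n))"
 have "(\<integral>\<omega>. exp (\<i> * of_real u * of_real (X (real n / 2 ^ j) \<omega>)) \<partial>M) = (\<integral>\<omega>. ?g (\<lambda>i. grid_step j i \<omega>) \<partial>M)"
 proof (rule integral_cong_AE)
  show "AE \<omega> in M. exp (\<i> * of_real u * of_real (X (real n / 2 ^ j) \<omega>)) = ?g (\<lambda>i. grid_step j i \<omega>)"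
   using X_0 by eventually_elim (simp add: psum_grid_step)
  show "(\<lambda>\<omega>. ?g (\<lambda>i. grid_step j i \<omega>)) \<in> borel_measurable M"
   unfolding psum_def by measurable
 qed measurable
 also have "\<dots> = (\<integral>x. ?g x \<partial>PiM UNIV (\<lambda>_. step_law j))"
  by (rule integral_grid_steps) measurable
 also have "\<dots> = (\<integral>y. exp (\<i> * of_real u * of_real y) \<partial>step_law j) ^ n"
  by (rule W.integral_exp_psum) simp
 also have "(\<integral>y. exp (\<i> * of_real u * of_real y) \<partial>step_law j) = (\<integral>\<omega>. exp (\<i> * of_real u * of_real (X (1 / 2 ^ j) \<omega>)) \<partial>M)"
  unfolding step_law_def by (rule integral_distr) (auto simp: measurable_X)
 finally show ?thesis .
qed

text \<open>Integrability at the small time is part of the claim, so the computation is done with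
  nonnegative integrals: the one at time 1 is the \<open>2 ^ j\<close>-th power of the one at time
  \<open>1 / 2 ^ j\<close>, and a finite power has a finite base.\<close>

lemma laplace_root:
 assumes int: "integrable M (\<lambda>\<omega>. exp (- r * X 1 \<omega>))"
 shows "integrable M (\<lambda>\<omega>. exp (- r * X (1 / 2 ^ j) \<omega>))"
  and "(\<integral>\<omega>. exp (- r * X (1 / 2 ^ j) \<omega>) \<partial>M) ^ (2 ^ j) = (\<integral>\<omega>. exp (- r * X 1 \<omega>) \<partial>M)"
proof -
 let ?n = "2 ^ j :: nat"
 have Xm[measurable]: "X 1 \<in> borel_measurable M" "X (1 / 2 ^ j) \<in> borel_measurable M" by (auto simp: measurable_X)
 let ?c = "\<integral>\<^sup>+\<omega>. ennreal (exp (- r * X (1 / 2 ^ j) \<omega>)) \<partial>M"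
 have ind: "indep_vars (\<lambda>_. borel) (\<lambda>i \<omega>. ennreal (exp (- r * grid_step j i \<omega>))) {..<?n}"
  by (rule indep_vars_compose2[OF indep_vars_subset[OF indep_grid_steps]]) auto
 have step: "(\<integral>\<^sup>+\<omega>. ennreal (exp (- r * grid_step j i \<omega>)) \<partial>M) = ?c" for i
 proof -
  have "(\<integral>\<^sup>+\<omega>. ennreal (exp (- r * grid_step j i \<omega>)) \<partial>M) = (\<integral>\<^sup>+y. ennreal (exp (- r * y)) \<partial>distr M borel (grid_step j i))"
   by (subst nn_integral_distr) auto
  also have "\<dots> = ?c" unfolding grid_step_law step_law_def by (subst nn_integral_distr) auto
  finally show ?thesis .
 qed
 have "(\<integral>\<^sup>+\<omega>. ennreal (exp (- r * X 1 \<omega>)) \<partial>M) = (\<integral>\<^sup>+\<omega>. (\<Prod>i<?n. ennreal (exp (- r * grid_step j i \<omega>))) \<partial>M)"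
 proof (rule nn_integral_cong_AE)
  show "AE \<omega> in M. ennreal (exp (- r * X 1 \<omega>)) = (\<Prod>i<?n. ennreal (exp (- r * grid_step j i \<omega>)))"
   using X_0
  proof eventually_elim
   case (elim \<omega>)
   have "X 1 \<omega> = (\<Sum>i<?n. grid_step j i \<omega>)"
    using psum_grid_step[of j \<omega> ?n] elim by (simp add: psum_def)
   then show ?case by (simp add: sum_distrib_left exp_sum prod_ennreal)
  qed
 qed
 also have "\<dots> = (\<Prod>i<?n. \<integral>\<^sup>+\<omega>. ennreal (exp (- r * grid_step j i \<omega>)) \<partial>M)"
  by (rule indep_vars_nn_integral[OF _ ind]) auto
 also have "\<dots> = ?c ^ ?n" by (simp only: step prod_constant card_lessThan)
 finally have eq: "(\<integral>\<^sup>+\<omega>. ennreal (exp (- r * X 1 \<omega>)) \<partial>M) = ?c ^ ?n" .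
 have fin1: "(\<integral>\<^sup>+\<omega>. ennreal (exp (- r * X 1 \<omega>)) \<partial>M) = ennreal (\<integral>\<omega>. exp (- r * X 1 \<omega>) \<partial>M)"
  by (rule nn_integral_eq_integral[OF int]) auto
 have "?c \<noteq> \<top>"
 proof
  assume "?c = \<top>"
  then have "?c ^ ?n = \<top>" by (simp add: power_eq_top_ennreal)
  then show False using eq fin1 by simp
 qed
 then show int': "integrable M (\<lambda>\<omega>. exp (- r * X (1 / 2 ^ j) \<omega>))"
  by (intro integrableI_nonneg) (auto simp: less_top)
 have "?c = ennreal (\<integral>\<omega>. exp (- r * X (1 / 2 ^ j) \<omega>) \<partial>M)"
  by (rule nn_integral_eq_integral[OF int']) auto
 then have "ennreal ((\<integral>\<omega>. exp (- r * X (1 / 2 ^ j) \<omega>) \<partial>M) ^ ?n) = ennreal (\<integral>\<omega>. exp (- r * X 1 \<omega>) \<partial>M)"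
  using eq fin1 by (simp add: ennreal_power)
 then show "(\<integral>\<omega>. exp (- r * X (1 / 2 ^ j) \<omega>) \<partial>M) ^ ?n = (\<integral>\<omega>. exp (- r * X 1 \<omega>) \<partial>M)"
  by (simp add: ennreal_inj)
qed

end

lemma measurable_grid_index [measurable]: "grid_index j \<in> measurable borel (count_space UNIV)"
 unfolding grid_index_def by measurable

context levy_path
begin

text \<open>The indicator of \<open>X 0 \<omega> = 0\<close> is 1 almost surely; with it the bound 1
  holds for every outcome.\<close>

definition grid_term :: "nat \<Rightarrow> nat \<Rightarrow> complex \<Rightarrow> complex \<Rightarrow> 'a \<Rightarrow> complex" where
 "grid_term j n z w \<omega> = of_bool (X 0 \<omega> = 0) * exp (z * of_real (grid_min (\<lambda>t. X t \<omega>) j n)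
   + w * of_real (X (real n / 2 ^ j) \<omega> - grid_min (\<lambda>t. X t \<omega>) j n))"

lemma measurable_grid_term:
 assumes "\<And>t. 0 \<le> t \<Longrightarrow> X t \<in> borel_measurable N"
 shows "grid_term j n z w \<in> borel_measurable N"
proof -
 have [measurable]: "(\<lambda>\<omega>. grid_min (\<lambda>t. X t \<omega>) j n) \<in> borel_measurable N"
  unfolding grid_min_def using assms by (intro borel_measurable_Min) auto
 have [measurable]: "X 0 \<in> borel_measurable N" "X (real n / 2 ^ j) \<in> borel_measurable N"
  using assms by auto
 show ?thesis unfolding grid_term_def by measurable
qed

lemma norm_grid_term:
 assumes "Re z \<ge> 0" "Re w \<le> 0"
 shows "norm (grid_term j n z w \<omega>) \<le> 1"
proof (cases "X 0 \<omega> = 0")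
 case True
 have a: "grid_min (\<lambda>t. X t \<omega>) j n \<le> 0"
  unfolding grid_min_def using True by (intro order.trans[OF Min_le[of _ "X (real 0 / 2 ^ j) \<omega>"]])
   (auto intro!: image_eqI[of _ _ 0])
 have b: "grid_min (\<lambda>t. X t \<omega>) j n \<le> X (real n / 2 ^ j) \<omega>"
  unfolding grid_min_def by (intro Min_le) auto
 have "Re z * grid_min (\<lambda>t. X t \<omega>) j n + Re w * (X (real n / 2 ^ j) \<omega> - grid_min (\<lambda>t. X t \<omega>) j n) \<le> 0 + 0"
  using a b assms by (intro add_mono mult_nonneg_nonpos mult_nonpos_nonneg) auto
 then show ?thesis using True by (simp add: grid_term_def norm_exp_eq_Re)
qed (simp add: grid_term_def)

lemma integral_grid_term: "(\<integral>\<omega>. grid_term j n z w \<omega> \<partial>M) = grid_transform j n z w"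
 unfolding grid_transform_def
proof (rule integral_cong_AE)
 show "AE \<omega> in M. grid_term j n z w \<omega> = exp (z * of_real (grid_min (\<lambda>t. X t \<omega>) j n)
   + w * of_real (X (real n / 2 ^ j) \<omega> - grid_min (\<lambda>t. X t \<omega>) j n))"
  using X_0 by eventually_elim (simp add: grid_term_def)
qed (use measurable_grid_term[of M] measurable_X in measurable)

lemma norm_grid_transform: "Re z \<ge> 0 \<Longrightarrow> Re w \<le> 0 \<Longrightarrow> norm (grid_transform j n z w) \<le> 1"
proof -
 assume "Re z \<ge> 0" "Re w \<le> 0"
 note b = norm_grid_term[OF this]
 have "norm (\<integral>\<omega>. grid_term j n z w \<omega> \<partial>M) \<le> (\<integral>\<omega>. norm (grid_term j n z w \<omega>) \<partial>M)" by simp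
 also have "\<dots> \<le> (\<integral>\<omega>. 1 \<partial>M)"
  using b measurable_grid_term[of M j n z w] measurable_X
  by (intro integral_mono integrable_norm integrable_const_bound[where B = 1]) auto
 finally show ?thesis by (simp add: prob_space integral_grid_term)
qed

lemma grid_transform_0: "grid_transform j 0 z w = 1"
proof -
 have "grid_transform j 0 z w = (\<integral>\<omega>. 1 \<partial>M)"
  unfolding grid_transform_def
 proof (rule integral_cong_AE)
  show "AE \<omega> in M. exp (z * of_real (grid_min (\<lambda>t. X t \<omega>) j 0)
   + w * of_real (X (real 0 / 2 ^ j) \<omega> - grid_min (\<lambda>t. X t \<omega>) j 0)) = 1"
   using X_0 by eventually_elim (simp add: grid_min_def)
 qed measurable
 then show ?thesis by (simp add: prob_space)
qed

text \<open>An infimum over uncountably many times, up to a random time, is not measurable on its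
  face. Both quantities are pointwise limits of grid values taken at an index with countably many
  values.\<close>

lemma measurable_at_random_time:
 assumes T[measurable]: "T \<in> borel_measurable N" and \<pi>[measurable]: "\<pi> \<in> measurable N M"
  and T0: "\<And>x. x \<in> space N \<Longrightarrow> 0 \<le> T x"
 shows "(\<lambda>x. running_inf X (T x) (\<pi> x)) \<in> borel_measurable N"
  and "(\<lambda>x. X (T x) (\<pi> x)) \<in> borel_measurable N"
proof -
 have idx: "(\<lambda>x. grid_index j (T x)) \<in> measurable N (count_space UNIV)" for j by measurable
 have c: "cadlag (\<lambda>t. X t (\<pi> x))" if "x \<in> space N" for x
  using that measurable_space[OF \<pi>] by (intro cadlag_X)
 have m1: "(\<lambda>x. grid_min (\<lambda>t. X t (\<pi> x)) j (grid_index j (T x))) \<in> borel_measurable N" for j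
  by (rule measurable_compose_countable[OF _ idx, of "\<lambda>n x. grid_min (\<lambda>t. X t (\<pi> x)) j n"])
    (rule measurable_compose[OF \<pi> measurable_grid_min])
 have m2: "(\<lambda>x. X (real (grid_index j (T x)) / 2 ^ j) (\<pi> x)) \<in> borel_measurable N" for j
  by (rule measurable_compose_countable[OF _ idx, of "\<lambda>n x. X (real n / 2 ^ j) (\<pi> x)"])
    (rule measurable_compose[OF \<pi> measurable_grid])
 show "(\<lambda>x. running_inf X (T x) (\<pi> x)) \<in> borel_measurable N"
  unfolding running_inf_def
  by (rule borel_measurable_LIMSEQ_real[OF grid_min_tendsto[OF c T0] m1])
 show "(\<lambda>x. X (T x) (\<pi> x)) \<in> borel_measurable N"
  by (rule borel_measurable_LIMSEQ_real[OF grid_end_tendsto[OF c T0] m2])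
qed

text \<open>Kept abstract in \<open>N\<close>, \<open>T\<close> and \<open>\<pi>\<close>, since it
  is applied to the product of \<open>M\<close> with an exponential variable and to an independent
  exponential time on \<open>M\<close> itself; \<open>idx\<close> carries the exponential law and
  \<open>ind\<close> the independence.\<close>

lemma grid_limit:
 assumes N: "prob_space N" and T[measurable]: "T \<in> borel_measurable N" and \<pi>[measurable]: "\<pi> \<in> measurable N M"
  and T0: "\<And>x. x \<in> space N \<Longrightarrow> 0 \<le> T x" and X0: "AE x in N. X 0 (\<pi> x) = 0"
  and q: "0 < q" and z: "Re z \<ge> 0" and w: "Re w \<le> 0"
  and idx: "\<And>j n. measure N {x \<in> space N. nat \<lfloor>T x * 2 ^ j\<rfloor> = n} = (1 - exp (- q / 2 ^ j)) * exp (- q / 2 ^ j) ^ n"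
  and ind: "\<And>j n. (\<integral>x. of_bool (nat \<lfloor>T x * 2 ^ j\<rfloor> = n) * grid_term j (Suc n) z w (\<pi> x) \<partial>N)
     = of_real (measure N {x \<in> space N. nat \<lfloor>T x * 2 ^ j\<rfloor> = n}) * grid_transform j (Suc n) z w"
 shows "(\<lambda>j. (1 - of_real (exp (- q / 2 ^ j))) * (\<Sum>n. of_real (exp (- q / 2 ^ j)) ^ n * grid_transform j n z w))
   \<longlonglongrightarrow> (\<integral>x. exp (z * of_real (running_inf X (T x) (\<pi> x))
     + w * of_real (X (T x) (\<pi> x) - running_inf X (T x) (\<pi> x))) \<partial>N)" (is "_ \<longlonglongrightarrow> ?L")
proof -
 interpret N: prob_space N by fact
 note mT = measurable_at_random_time[OF T \<pi> T0]
 have mg[measurable]: "grid_term j n z w \<in> borel_measurable M" for j n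
  by (rule measurable_grid_term[OF measurable_X])
 define p where "p j = exp (- q / 2 ^ j)" for j :: nat
 have p: "0 < p j" "p j < 1" for j using q by (auto simp: p_def)
 define D where "D j = (\<integral>x. grid_term j (Suc (nat \<lfloor>T x * 2 ^ j\<rfloor>)) z w (\<pi> x) \<partial>N)" for j
 have S: "(\<lambda>n. (1 - of_real (p j)) * of_real (p j) ^ n * grid_transform j (Suc n) z w) sums D j" for j
 proof -
  have "(\<lambda>n. of_real (measure N {x \<in> space N. nat \<lfloor>T x * 2 ^ j\<rfloor> = n}) * grid_transform j (Suc n) z w) sums D j"
   unfolding D_def
   by (rule N.random_index_sums[where f = "\<lambda>n x. grid_term j (Suc n) z w (\<pi> x)" and idx = "\<lambda>x. nat \<lfloor>T x * 2 ^ j\<rfloor>"])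
     (use norm_grid_term[OF z w] ind in auto)
  then show ?thesis by (simp add: idx p_def)
 qed
 \<comment> \<open>The grid index is one more than a geometric variable. The missing term at index 0
   contributes \<open>1 - p j\<close>, which tends to 0.\<close>
 have eq: "(1 - of_real (p j)) * (\<Sum>n. of_real (p j) ^ n * grid_transform j n z w)
   = (1 - of_real (p j)) + of_real (p j) * D j" for j
 proof -
  let ?f = "\<lambda>n. of_real (p j) ^ n * grid_transform j n z w"
  have sf: "summable ?f"
   by (rule summable_norm_cancel[OF summable_norm_gf[OF p norm_grid_transform[OF z w]]])
  have "(\<lambda>n. of_real (p j) * ((1 - of_real (p j)) * of_real (p j) ^ n * grid_transform j (Suc n) z w)) sums (of_real (p j) * D j)"
   by (rule sums_mult[OF S])
  moreover have "(\<lambda>n. of_real (p j) * ((1 - of_real (p j)) * of_real (p j) ^ n * grid_transform j (Suc n) z w))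
    = (\<lambda>n. (1 - of_real (p j)) * ?f (Suc n))"
   by (rule ext) (simp add: algebra_simps)
  ultimately have "(\<lambda>n. (1 - of_real (p j)) * ?f (Suc n)) sums (of_real (p j) * D j)" by simp
  moreover have "(\<lambda>n. (1 - of_real (p j)) * ?f (Suc n)) sums ((1 - of_real (p j)) * (\<Sum>n. ?f (Suc n)))"
   by (intro sums_mult summable_sums) (use sf summable_Suc_iff[of ?f] in simp)
  ultimately have "of_real (p j) * D j = (1 - of_real (p j)) * (\<Sum>n. ?f (Suc n))"
   by (rule sums_unique2)
  also have "(\<Sum>n. ?f (Suc n)) = (\<Sum>n. ?f n) - 1"
   using suminf_split_head[OF sf] by (simp add: grid_transform_0)
  finally show ?thesis by (simp add: algebra_simps)
 qed
 have D_lim: "D \<longlonglongrightarrow> ?L"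
  unfolding D_def
 proof (rule integral_dominated_convergence[where w = "\<lambda>_. 1"])
  show "(\<lambda>x. exp (z * of_real (running_inf X (T x) (\<pi> x))
     + w * of_real (X (T x) (\<pi> x) - running_inf X (T x) (\<pi> x)))) \<in> borel_measurable N"
   using mT by measurable
  show "(\<lambda>x. grid_term j (Suc (nat \<lfloor>T x * 2 ^ j\<rfloor>)) z w (\<pi> x)) \<in> borel_measurable N" for j
   by (rule measurable_compose_countable[of "\<lambda>n x. grid_term j (Suc n) z w (\<pi> x)"]) measurable
  show "AE x in N. (\<lambda>j. grid_term j (Suc (nat \<lfloor>T x * 2 ^ j\<rfloor>)) z w (\<pi> x))
    \<longlonglongrightarrow> exp (z * of_real (running_inf X (T x) (\<pi> x))
     + w * of_real (X (T x) (\<pi> x) - running_inf X (T x) (\<pi> x)))"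
   using X0 AE_space[of N]
  proof eventually_elim
   case (elim x)
   have c: "cadlag (\<lambda>t. X t (\<pi> x))" using elim measurable_space[OF \<pi>] by (intro cadlag_X)
   have "(\<lambda>j. exp (z * of_real (grid_min (\<lambda>t. X t (\<pi> x)) j (grid_index j (T x)))
     + w * of_real (X (real (grid_index j (T x)) / 2 ^ j) (\<pi> x) - grid_min (\<lambda>t. X t (\<pi> x)) j (grid_index j (T x)))))
    \<longlonglongrightarrow> exp (z * of_real (INF s\<in>{0..T x}. X s (\<pi> x))
     + w * of_real (X (T x) (\<pi> x) - (INF s\<in>{0..T x}. X s (\<pi> x))))"
    by (intro tendsto_intros grid_min_tendsto[OF c] grid_end_tendsto[OF c] T0 elim)
   then show ?case
    using elim by (simp add: grid_term_def running_inf_def grid_index_def)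
  qed
  show "AE x in N. norm (grid_term j (Suc (nat \<lfloor>T x * 2 ^ j\<rfloor>)) z w (\<pi> x)) \<le> 1" for j
   using norm_grid_term[OF z w] by auto
 qed simp
 have p_lim: "(\<lambda>j. complex_of_real (p j)) \<longlonglongrightarrow> of_real 1"
 proof (intro tendsto_of_real)
  have "(\<lambda>j. exp (- q * (1 / 2 ^ j))) \<longlonglongrightarrow> exp (- q * 0)"
   by (intro tendsto_intros inverse_pow2_tendsto)
  moreover have "p = (\<lambda>j. exp (- q * (1 / 2 ^ j)))" by (rule ext) (simp add: p_def)
  ultimately show "p \<longlonglongrightarrow> 1" by simp
 qed
 have "(\<lambda>j. (1 - of_real (p j)) + of_real (p j) * D j) \<longlonglongrightarrow> (1 - of_real 1) + of_real 1 * ?L"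
  by (intro tendsto_add tendsto_diff tendsto_mult tendsto_const p_lim D_lim)
 then show ?thesis unfolding p_def[symmetric] eq by simp
qed

end

section \<open>Wiener-Hopf factorization at an exponential time\<close>

lemma laplace_of_real:
 "(\<integral>x. exp (- complex_of_real r * of_real x) \<partial>N) = of_real (\<integral>x. exp (- r * x) \<partial>N)"
proof -
 have "exp (- complex_of_real r * of_real x) = complex_of_real (exp (- r * x))" for x
  by (metis exp_of_real of_real_minus of_real_mult)
 then show ?thesis by (simp only: integral_complex_of_real)
qed

lemma laplace_integrable_real:
 assumes "finite_measure N" "sets N = sets borel" "emeasure N {..<0::real} = 0" "r \<ge> 0"
 shows "integrable N (\<lambda>x. exp (- r * x))"
proof -
 have "integrable N (\<lambda>x. Re (exp (- complex_of_real r * of_real x)))"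
  using laplace_measure_regular(3)[OF assms(1-3), of "of_real r"] assms(4) by (intro integrable_Re) auto
 moreover have "Re (exp (- complex_of_real r * of_real x)) = exp (- r * x)" for x
  by (metis Re_complex_of_real exp_of_real of_real_minus of_real_mult)
 ultimately show ?thesis by simp
qed

lemma laplace_pos:
 assumes "prob_space N" "sets N = sets borel" "emeasure N {..<0::real} = 0" "r \<ge> 0"
 shows "0 < (\<integral>x. exp (- r * x) \<partial>N)"
proof -
 interpret prob_space N by fact
 have "integrable N (\<lambda>x. exp (- r * x))" using laplace_integrable_real assms finite_measure_axioms by blast
 then have "(\<integral>x. - exp (- r * x) \<partial>N) < 0" by (intro expectation_less) auto
 then show ?thesis by simp
qed

context levy_path
begin

abbreviation "EM \<equiv> M \<Otimes>\<^sub>M unit_exp"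

text \<open>The absolute value keeps the time nonnegative at every point and not only almost surely,
  as measurability and path bounds require.\<close>

abbreviation "inf_at q x \<equiv> running_inf X (\<bar>snd x\<bar> / q) (fst x)"

definition inf_law :: "real \<Rightarrow> real measure" where
 "inf_law q = distr EM borel (\<lambda>x. - inf_at q x)"

definition exc_law :: "real \<Rightarrow> real measure" where
 "exc_law q = distr EM borel
   (\<lambda>x. X (\<bar>snd x\<bar> / q) (fst x) - inf_at q x)"

lemma prob_space_EM: "prob_space EM"
proof -
 interpret U: prob_space unit_exp by (rule prob_space_unit_exp)
 interpret pair_prob_space M unit_exp by unfold_locales
 show ?thesis by unfold_locales
qed

lemma X_0_EM: "AE x in EM. X 0 (fst x) = 0"
proof -
 interpret U: prob_space unit_exp by (rule prob_space_unit_exp)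
 interpret pair_prob_space M unit_exp by unfold_locales
 have [measurable]: "X 0 \<in> borel_measurable M" by (rule measurable_X) simp
 show ?thesis
 proof -
  have "(AE \<omega> in M. AE v in unit_exp. X 0 \<omega> = 0) \<longleftrightarrow> (AE x in EM. X 0 (fst x) = 0)"
   by (rule AE_pair_iff[where P = "\<lambda>\<omega> v. X 0 \<omega> = 0"]) measurable
  moreover have "AE \<omega> in M. AE v in unit_exp. X 0 \<omega> = 0" using X_0 by eventually_elim simp
  ultimately show ?thesis by blast
 qed
qed

lemma measurable_EM:
 assumes "0 < q"
 shows "(\<lambda>x. inf_at q x) \<in> borel_measurable EM"
  and "(\<lambda>x. X (\<bar>snd x\<bar> / q) (fst x)) \<in> borel_measurable EM"
proof -
 have m: "(\<lambda>x. \<bar>snd x\<bar> / q) \<in> borel_measurable EM" by measurable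
 have f: "fst \<in> measurable EM M" by measurable
 show "(\<lambda>x. inf_at q x) \<in> borel_measurable EM"
  "(\<lambda>x. X (\<bar>snd x\<bar> / q) (fst x)) \<in> borel_measurable EM"
  using measurable_at_random_time[OF m f] assms by auto
qed

lemma running_inf_le_0:
 assumes "\<omega> \<in> space M" "X 0 \<omega> = 0" "0 \<le> t"
 shows "running_inf X t \<omega> \<le> 0"
 using running_inf_lower[where X = X and \<omega> = \<omega>, OF cadlag_X[OF assms(1)], of 0 t] assms by simp

lemma inf_law_props:
 assumes q: "0 < q"
 shows "prob_space (inf_law q)" "sets (inf_law q) = sets borel" "emeasure (inf_law q) {..<0} = 0"
proof -
 interpret EM: prob_space "EM" by (rule prob_space_EM)
 have m: "(\<lambda>x. - inf_at q x) \<in> borel_measurable EM"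
  using measurable_EM(1)[OF q] by simp
 show "prob_space (inf_law q)" unfolding inf_law_def by (rule EM.prob_space_distr[OF m])
 show "sets (inf_law q) = sets borel" by (simp add: inf_law_def)
 have "AE x in EM. \<not> (- inf_at q x < 0)"
  using X_0_EM AE_space
 proof eventually_elim
  case (elim x)
  then show ?case using running_inf_le_0[of "fst x" "\<bar>snd x\<bar> / q"] q
   by (auto simp: space_pair_measure)
 qed
 then have "AE y in inf_law q. \<not> y < 0"
  unfolding inf_law_def by (subst AE_distr_iff[OF m]) auto
 then show "emeasure (inf_law q) {..<0} = 0"
  by (subst (asm) AE_iff_measurable[OF _ refl]) (auto simp: inf_law_def lessThan_def)
qed

lemma exc_law_props:
 assumes q: "0 < q"
 shows "prob_space (exc_law q)" "sets (exc_law q) = sets borel" "emeasure (exc_law q) {..<0} = 0"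
proof -
 interpret EM: prob_space "EM" by (rule prob_space_EM)
 have m: "(\<lambda>x. X (\<bar>snd x\<bar> / q) (fst x) - inf_at q x) \<in> borel_measurable EM"
  using measurable_EM[OF q] by simp
 show "prob_space (exc_law q)" unfolding exc_law_def by (rule EM.prob_space_distr[OF m])
 show "sets (exc_law q) = sets borel" by (simp add: exc_law_def)
 have "AE x in EM. \<not> (X (\<bar>snd x\<bar> / q) (fst x) - inf_at q x < 0)"
 proof (rule AE_I2)
  fix x assume "x \<in> space EM"
  then show "\<not> (X (\<bar>snd x\<bar> / q) (fst x) - inf_at q x < 0)"
   using running_inf_lower[where X = X and \<omega> = "fst x" and s = "\<bar>snd x\<bar> / q" and t = "\<bar>snd x\<bar> / q"]
    cadlag_X[of "fst x"] q
   by (auto simp: space_pair_measure)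
 qed
 then have "AE y in exc_law q. \<not> y < 0"
  unfolding exc_law_def by (subst AE_distr_iff[OF m]) auto
 then show "emeasure (exc_law q) {..<0} = 0"
  by (subst (asm) AE_iff_measurable[OF _ refl]) (auto simp: exc_law_def lessThan_def)
qed

lemma integral_EM_product:
 fixes g :: "'a \<Rightarrow> complex"
 assumes g[measurable]: "g \<in> borel_measurable M" and gb: "\<And>\<omega>. norm (g \<omega>) \<le> 1"
  and A[measurable]: "Measurable.pred unit_exp A"
 shows "(\<integral>x. of_bool (A (snd x)) * g (fst x) \<partial>EM)
  = of_real (measure EM {x \<in> space EM. A (snd x)}) * (\<integral>\<omega>. g \<omega> \<partial>M)"
  and "measure EM {x \<in> space EM. A (snd x)} = measure unit_exp {v \<in> space unit_exp. A v}"
proof -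
 interpret U: prob_space unit_exp by (rule prob_space_unit_exp)
 interpret PM: pair_prob_space M unit_exp by unfold_locales
 have P: "(\<integral>x. of_bool (A (snd x)) * h (fst x) \<partial>EM)
   = of_real (measure unit_exp {v \<in> space unit_exp. A v}) * (\<integral>\<omega>. h \<omega> \<partial>M)"
  if h[measurable]: "h \<in> borel_measurable M" and hb: "\<And>\<omega>. norm (h \<omega>) \<le> 1" for h :: "'a \<Rightarrow> complex"
 proof -
  have i: "integrable EM (\<lambda>(\<omega>, v). of_bool (A v) * h \<omega>)"
   by (rule PM.integrable_const_bound[where B = 1]) (use hb in auto)
  have A_int: "(\<integral>v. of_bool (A v) \<partial>unit_exp) = complex_of_real (measure unit_exp {v \<in> space unit_exp. A v})"
  proof -
   have "(\<integral>v. of_bool (A v) \<partial>unit_exp) = (\<integral>v. complex_of_real (indicator {v \<in> space unit_exp. A v} v) \<partial>unit_exp)"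
    by (intro Bochner_Integration.integral_cong) auto
   also have "\<dots> = of_real (\<integral>v. indicator {v \<in> space unit_exp. A v} v \<partial>unit_exp)"
    by (rule integral_complex_of_real)
   also have "\<dots> = of_real (measure unit_exp {v \<in> space unit_exp. A v})"
    using A by (subst Bochner_Integration.integral_indicator) (simp_all add: Int_absorb2)
   finally show ?thesis .
  qed
  have "(\<integral>x. of_bool (A (snd x)) * h (fst x) \<partial>EM)
    = (\<integral>\<omega>. (\<integral>v. of_bool (A v) * h \<omega> \<partial>unit_exp) \<partial>M)"
   using PM.integral_fst[OF i] by (simp only: case_prod_beta')
  also have "\<dots> = (\<integral>\<omega>. of_real (measure unit_exp {v \<in> space unit_exp. A v}) * h \<omega> \<partial>M)"
   by (simp only: integral_mult_left_zero A_int)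
  finally show ?thesis by simp
 qed
 have m: "{x \<in> space EM. A (snd x)} = space M \<times> {v \<in> space unit_exp. A v}"
  by (auto simp: space_pair_measure)
 show meq: "measure EM {x \<in> space EM. A (snd x)} = measure unit_exp {v \<in> space unit_exp. A v}"
  unfolding m measure_def using A by (subst U.emeasure_pair_measure_Times) (auto simp: emeasure_space_1)
 show "(\<integral>x. of_bool (A (snd x)) * g (fst x) \<partial>EM)
  = of_real (measure EM {x \<in> space EM. A (snd x)}) * (\<integral>\<omega>. g \<omega> \<partial>M)"
  unfolding meq by (rule P[OF g gb])
qed

lemma grid_limit_EM:
 assumes q: "0 < q" and z: "Re z \<ge> 0" and w: "Re w \<le> 0"
 shows "(\<lambda>j. (1 - of_real (exp (- q / 2 ^ j))) * (\<Sum>n. of_real (exp (- q / 2 ^ j)) ^ n * grid_transform j n z w))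
   \<longlonglongrightarrow> (\<integral>x. exp (z * of_real (inf_at q x)
     + w * of_real (X (\<bar>snd x\<bar> / q) (fst x) - inf_at q x)) \<partial>EM)"
proof (rule grid_limit[where \<pi> = fst and T = "\<lambda>x. \<bar>snd x\<bar> / q"])
 interpret U: prob_space unit_exp by (rule prob_space_unit_exp)
 fix j n
 have [measurable]: "Measurable.pred unit_exp (\<lambda>v. nat \<lfloor>\<bar>v\<bar> / q * 2 ^ j\<rfloor> = n)" by measurable
 have "measure unit_exp {v \<in> space unit_exp. nat \<lfloor>\<bar>v\<bar> / q * 2 ^ j\<rfloor> = n}
   = measure unit_exp {v \<in> space unit_exp. nat \<lfloor>v / q * 2 ^ j\<rfloor> = n}"
 proof (rule U.prob_eq_AE)
  show "AE v in unit_exp. (nat \<lfloor>\<bar>v\<bar> / q * 2 ^ j\<rfloor> = n) = (nat \<lfloor>v / q * 2 ^ j\<rfloor> = n)"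
   using U.exponential_grid_index(2)[OF distributed_unit_exp[OF q] q]
   by eventually_elim (use q in \<open>auto simp: zero_le_divide_iff\<close>)
 qed auto
 also have "\<dots> = (1 - exp (- q / 2 ^ j)) * exp (- q / 2 ^ j) ^ n"
  by (rule U.exponential_grid_index(1)[OF distributed_unit_exp[OF q] q])
 finally show "measure EM {x \<in> space EM. nat \<lfloor>\<bar>snd x\<bar> / q * 2 ^ j\<rfloor> = n}
   = (1 - exp (- q / 2 ^ j)) * exp (- q / 2 ^ j) ^ n"
  by (subst integral_EM_product(2)[where g = "\<lambda>_. 0"]) auto
 show "(\<integral>x. of_bool (nat \<lfloor>\<bar>snd x\<bar> / q * 2 ^ j\<rfloor> = n) * grid_term j (Suc n) z w (fst x) \<partial>EM)
   = of_real (measure EM {x \<in> space EM. nat \<lfloor>\<bar>snd x\<bar> / q * 2 ^ j\<rfloor> = n})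
    * grid_transform j (Suc n) z w"
  unfolding integral_grid_term[symmetric]
  by (rule integral_EM_product(1)) (use norm_grid_term[OF z w] measurable_grid_term[OF measurable_X] in auto)
qed (use q z w X_0_EM prob_space_EM in auto)

definition inf_transform :: "real \<Rightarrow> complex \<Rightarrow> complex" where
 "inf_transform q z = (\<integral>y. exp (- z * of_real y) \<partial>inf_law q)"

text \<open>The sign convention is opposite to that of \<open>inf_transform\<close>. Both laws live
  on the nonnegative half-line, so this transform is analytic for \<open>Re w < 0\<close> and the
  other for \<open>Re z > 0\<close>, and both take the same argument on the imaginary axis.\<close>

definition exc_transform :: "real \<Rightarrow> complex \<Rightarrow> complex" where
 "exc_transform q w = (\<integral>y. exp (w * of_real y) \<partial>exc_law q)"

lemma grid_limit_transforms:
 assumes q: "0 < q"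
 shows "Re z \<ge> 0 \<Longrightarrow> (\<lambda>j. (1 - of_real (exp (- q / 2 ^ j))) * (\<Sum>n. of_real (exp (- q / 2 ^ j)) ^ n * grid_transform j n z 0))
      \<longlonglongrightarrow> inf_transform q z"
  and "Re w \<le> 0 \<Longrightarrow> (\<lambda>j. (1 - of_real (exp (- q / 2 ^ j))) * (\<Sum>n. of_real (exp (- q / 2 ^ j)) ^ n * grid_transform j n 0 w))
      \<longlonglongrightarrow> exc_transform q w"
 using grid_limit_EM[OF q, of z 0] grid_limit_EM[OF q, of 0 w] measurable_EM[OF q]
 by (simp_all add: inf_transform_def exc_transform_def inf_law_def exc_law_def integral_distr)

lemma inf_transform_1: "0 < q \<Longrightarrow> inf_transform q 1 \<noteq> 0"
 using laplace_of_real[where r = 1 and N = "inf_law q"] laplace_pos[OF inf_law_props, of q 1]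
 by (simp add: inf_transform_def)

lemma exc_transform_1: "0 < q \<Longrightarrow> exc_transform q (- 1) \<noteq> 0"
 using laplace_of_real[where r = 1 and N = "exc_law q"] laplace_pos[OF exc_law_props, of q 1]
 by (simp add: exc_transform_def)

end

text \<open>The exponent is a given function and not a logarithm of the characteristic function.
  Requiring the formula at all times \<open>1 / 2 ^ j\<close> removes the ambiguity of
  branches.\<close>

locale levy_exponent = levy_path +
 fixes \<psi> :: "complex \<Rightarrow> complex"
 assumes exponent: "\<And>j t. (\<integral>\<omega>. exp (\<i> * of_real t * of_real (X (1 / 2 ^ j) \<omega>)) \<partial>M)
           = exp (\<psi> (\<i> * of_real t) / 2 ^ j)"
begin

lemma grid_wiener_hopf:
 fixes j :: nat
 assumes q: "0 < q"
 defines "p \<equiv> exp (- q / 2 ^ j)"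
 defines "Fm \<equiv> \<lambda>z. (1 - of_real p) * (\<Sum>n. of_real p ^ n * grid_transform j n z 0)"
  and "Fp \<equiv> \<lambda>w. (1 - of_real p) * (\<Sum>n. of_real p ^ n * grid_transform j n 0 w)"
 shows "Re z = 0 \<Longrightarrow> Fm z * Fp z * (1 - exp (- (of_real q - \<psi> z) / 2 ^ j)) = 1 - exp (- of_real q / 2 ^ j)"
  and "Re z \<ge> 0 \<Longrightarrow> 1 \<le> norm (Fm z) * (1 + 4 * max 1 (norm z) * (1 / norm (Fm 1) - 1))"
  and "Re w \<le> 0 \<Longrightarrow> 1 \<le> norm (Fp w) * (1 + 4 * max 1 (norm w) * (1 / norm (Fp (- 1)) - 1))"
proof -
 interpret W: iid_walk "step_law j" by (rule iid_walk_step_law)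
 have p: "0 < p" "p < 1" using q by (auto simp: p_def)
 note wh = W.walk_wiener_hopf[OF p, folded grid_transform_eq]
 show "Re z \<ge> 0 \<Longrightarrow> 1 \<le> norm (Fm z) * (1 + 4 * max 1 (norm z) * (1 / norm (Fm 1) - 1))"
  "Re w \<le> 0 \<Longrightarrow> 1 \<le> norm (Fp w) * (1 + 4 * max 1 (norm w) * (1 / norm (Fp (- 1)) - 1))"
  unfolding Fm_def Fp_def using wh(2,3) by blast+
 show "Fm z * Fp z * (1 - exp (- (of_real q - \<psi> z) / 2 ^ j)) = 1 - exp (- of_real q / 2 ^ j)" if z: "Re z = 0"
 proof -
  have zi: "z = \<i> * of_real (Im z)" using z by (simp add: complex_eq_iff)
  have "(\<integral>y. exp (z * of_real y) \<partial>step_law j) = (\<integral>\<omega>. exp (z * of_real (X (1 / 2 ^ j) \<omega>)) \<partial>M)"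
   unfolding step_law_def by (rule integral_distr) (auto simp: measurable_X)
  also have "\<dots> = exp (\<psi> z / 2 ^ j)" using exponent[of "Im z" j] zi by metis
  finally have c: "(\<integral>y. exp (z * of_real y) \<partial>step_law j) = exp (\<psi> z / 2 ^ j)" .
  have "complex_of_real p = exp (- of_real q / 2 ^ j)" by (simp add: p_def exp_of_real[symmetric])
  then have pc: "complex_of_real p * exp (\<psi> z / 2 ^ j) = exp (- (of_real q - \<psi> z) / 2 ^ j)"
   by (simp add: exp_add[symmetric] diff_divide_distrib)
  have "Fm z * Fp z * (1 - of_real p * exp (\<psi> z / 2 ^ j)) = 1 - of_real p"
   unfolding Fm_def Fp_def using wh(1)[OF z] by (simp only: c)
  then show ?thesis unfolding pc by (simp add: p_def exp_of_real[symmetric])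
 qed
qed

text \<open>Divided by \<open>1 - exp (- q / 2 ^ j)\<close>, the grid identity tends to the claim,
  since the quotient of the two exponential differences tends to \<open>(q - \<psi> z) / q\<close>.
  The lower bounds pass to the limit because their constants involve only the values at 1 and - 1,
  whose limits are nonzero.\<close>

theorem wiener_hopf:
 assumes q: "0 < q"
 shows "Re z = 0 \<Longrightarrow> inf_transform q z * exc_transform q z * (of_real q - \<psi> z) = of_real q"
  and "Re z \<ge> 0 \<Longrightarrow> 1 \<le> norm (inf_transform q z) * (1 + 4 * max 1 (norm z) * (1 / norm (inf_transform q 1) - 1))"
  and "Re w \<le> 0 \<Longrightarrow> 1 \<le> norm (exc_transform q w) * (1 + 4 * max 1 (norm w) * (1 / norm (exc_transform q (- 1)) - 1))"
proof -
 define Fm where "Fm j z = (1 - of_real (exp (- q / 2 ^ j))) * (\<Sum>n. of_real (exp (- q / 2 ^ j)) ^ n * grid_transform j n z 0)" for j z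
 define Fp where "Fp j w = (1 - of_real (exp (- q / 2 ^ j))) * (\<Sum>n. of_real (exp (- q / 2 ^ j)) ^ n * grid_transform j n 0 w)" for j w
 have Fm: "(\<lambda>j. Fm j z) \<longlonglongrightarrow> inf_transform q z" if "Re z \<ge> 0" for z
  unfolding Fm_def by (rule grid_limit_transforms(1)[OF q that])
 have Fp: "(\<lambda>j. Fp j w) \<longlonglongrightarrow> exc_transform q w" if "Re w \<le> 0" for w
  unfolding Fp_def by (rule grid_limit_transforms(2)[OF q that])
 note gw = grid_wiener_hopf[OF q, folded Fm_def Fp_def]
 show "inf_transform q z * exc_transform q z * (of_real q - \<psi> z) = of_real q" if z: "Re z = 0"
 proof -
  have "(\<lambda>j. Fm j z * Fp j z * ((1 - exp (- (of_real q - \<psi> z) / 2 ^ j)) / (1 - exp (- of_real q / 2 ^ j))))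
    \<longlonglongrightarrow> inf_transform q z * exc_transform q z * ((of_real q - \<psi> z) / of_real q)"
   by (intro tendsto_mult Fm Fp exp_quotient_limit q) (use z in auto)
  moreover have "Fm j z * Fp j z * ((1 - exp (- (of_real q - \<psi> z) / 2 ^ j)) / (1 - exp (- of_real q / 2 ^ j))) = 1" for j
  proof -
   have "exp (- complex_of_real q / 2 ^ j) = of_real (exp (- q / 2 ^ j))" by (simp add: exp_of_real[symmetric])
   moreover have "exp (- q / 2 ^ j) \<noteq> 1" using q by simp
   ultimately have "1 - exp (- complex_of_real q / 2 ^ j) \<noteq> 0" by (metis eq_iff_diff_eq_0 of_real_eq_1_iff)
   then show ?thesis unfolding times_divide_eq_right gw(1)[OF z] by (rule divide_self)
  qed
  ultimately have "inf_transform q z * exc_transform q z * ((of_real q - \<psi> z) / of_real q) = 1"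
   by (simp add: LIMSEQ_const_iff)
  then show ?thesis using q by (simp add: field_simps)
 qed
 show "1 \<le> norm (inf_transform q z) * (1 + 4 * max 1 (norm z) * (1 / norm (inf_transform q 1) - 1))" if z: "Re z \<ge> 0"
 proof (rule LIMSEQ_le_const)
  show "(\<lambda>j. norm (Fm j z) * (1 + 4 * max 1 (norm z) * (1 / norm (Fm j 1) - 1)))
    \<longlonglongrightarrow> norm (inf_transform q z) * (1 + 4 * max 1 (norm z) * (1 / norm (inf_transform q 1) - 1))"
   by (intro tendsto_intros Fm) (use z inf_transform_1[OF q] in auto)
 qed (use gw(2)[OF z] in auto)
 show "1 \<le> norm (exc_transform q w) * (1 + 4 * max 1 (norm w) * (1 / norm (exc_transform q (- 1)) - 1))" if w: "Re w \<le> 0"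
 proof (rule LIMSEQ_le_const)
  show "(\<lambda>j. norm (Fp j w) * (1 + 4 * max 1 (norm w) * (1 / norm (Fp j (- 1)) - 1)))
    \<longlonglongrightarrow> norm (exc_transform q w) * (1 + 4 * max 1 (norm w) * (1 / norm (exc_transform q (- 1)) - 1))"
   by (intro tendsto_intros Fp) (use w exc_transform_1[OF q] in auto)
 qed (use gw(3)[OF w] in auto)
qed

end

section \<open>Exponential times on the given probability space\<close>

abbreviation path_sigma :: "'a measure \<Rightarrow> (real \<Rightarrow> 'a \<Rightarrow> real) \<Rightarrow> 'a measure" where
 "path_sigma M X \<equiv> sigma (space M) {X t -` A \<inter> space M | t A. 0 \<le> t \<and> A \<in> sets borel}"

lemma process_events_eq_sets:
 "process_events M X = sets (path_sigma M X)"
 unfolding process_events_def by (subst sets_measure_of) auto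

lemma measurable_process_events:
 fixes X :: "real \<Rightarrow> 'a \<Rightarrow> real"
 assumes "0 \<le> t"
 shows "X t \<in> borel_measurable (path_sigma M X)"
proof (rule measurableI)
 fix A :: "real set" assume "A \<in> sets borel"
 then show "X t -` A \<inter> space (path_sigma M X)
   \<in> sets (path_sigma M X)"
  using assms by (subst space_measure_of, blast, subst sets_measure_of, blast, intro sigma_sets.Basic) auto
qed simp

lemma sigma_sets_preimage_subset:
 assumes "f \<in> measurable N K" "space N = \<Omega>"
 shows "sigma_sets \<Omega> {f -` A \<inter> \<Omega> | A. A \<in> sets K} \<subseteq> sets N"
 unfolding assms(2)[symmetric] using measurable_sets[OF assms(1)] by (intro sets.sigma_sets_subset) auto

context levy_path
begin

text \<open>The same grid transforms converge to the transform of this infimum and to that of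
  \<open>inf_law q\<close>. Uniqueness of Laplace transforms then identifies the laws without a
  disintegration of the joint law of path and time.\<close>

lemma inf_law_indep_exponential:
 assumes q: "0 < q" and e: "indep_exponential M X q e"
 shows "(\<lambda>\<omega>. running_inf X (e \<omega>) \<omega>) \<in> borel_measurable M"
  and "distr M borel (\<lambda>\<omega>. - running_inf X (e \<omega>) \<omega>) = inf_law q"
proof -
 have D: "distributed M lborel e (\<lambda>x. ennreal (exponential_density q x))"
  and ind: "indep_set (process_events M X) {e -` A \<inter> space M | A. A \<in> sets borel}"
  using e by (auto simp: indep_exponential_def)
 have e_meas[measurable]: "e \<in> borel_measurable M" using distributed_measurable[OF D] by simp
 have e0: "AE \<omega> in M. 0 \<le> e \<omega>" by (rule exponential_grid_index(2)[OF D q])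
 note mT = measurable_at_random_time[of "\<lambda>\<omega>. \<bar>e \<omega>\<bar>" M "\<lambda>\<omega>. \<omega>"]
 have m: "(\<lambda>\<omega>. running_inf X \<bar>e \<omega>\<bar> \<omega>) \<in> borel_measurable M" by (rule mT(1)) auto
 \<comment> \<open>For a negative time the index set is empty and \<open>Inf {}\<close> is a fixed
   real; such outcomes have probability 0 but matter for measurability.\<close>
 have "(\<lambda>\<omega>. running_inf X (e \<omega>) \<omega>) = (\<lambda>\<omega>. if e \<omega> < 0 then Inf {} else running_inf X \<bar>e \<omega>\<bar> \<omega>)"
  by (auto simp: running_inf_def)
 then show meas: "(\<lambda>\<omega>. running_inf X (e \<omega>) \<omega>) \<in> borel_measurable M" using m by simp
 have lim: "(\<lambda>j. (1 - of_real (exp (- q / 2 ^ j))) * (\<Sum>n. of_real (exp (- q / 2 ^ j)) ^ n * grid_transform j n z 0))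
   \<longlonglongrightarrow> (\<integral>\<omega>. exp (z * of_real (running_inf X \<bar>e \<omega>\<bar> \<omega>)
     + 0 * of_real (X \<bar>e \<omega>\<bar> \<omega> - running_inf X \<bar>e \<omega>\<bar> \<omega>)) \<partial>M)"
  if z: "Re z \<ge> 0" for z
 proof (rule grid_limit[where T = "\<lambda>\<omega>. \<bar>e \<omega>\<bar>" and \<pi> = "\<lambda>\<omega>. \<omega>"])
  fix j n
  let ?P = "\<lambda>\<omega>. nat \<lfloor>\<bar>e \<omega>\<bar> * 2 ^ j\<rfloor> = n"
  have "prob {\<omega> \<in> space M. ?P \<omega>} = prob {\<omega> \<in> space M. nat \<lfloor>e \<omega> * 2 ^ j\<rfloor> = n}"
  proof (rule prob_eq_AE)
   show "AE \<omega> in M. ?P \<omega> = (nat \<lfloor>e \<omega> * 2 ^ j\<rfloor> = n)" using e0 by eventually_elim simp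
  qed auto
  then show "prob {\<omega> \<in> space M. ?P \<omega>} = (1 - exp (- q / 2 ^ j)) * exp (- q / 2 ^ j) ^ n"
   using exponential_grid_index(1)[OF D q] by simp
  let ?g = "grid_term j (Suc n) z 0"
  let ?h = "\<lambda>\<omega>. of_bool (?P \<omega>) :: complex"
  have mg: "?g \<in> borel_measurable M" by (rule measurable_grid_term[OF measurable_X])
  have "indep_var borel ?g borel ?h"
   unfolding indep_var_eq
  proof (intro conjI)
   show "indep_set (sigma_sets (space M) {?g -` A \<inter> space M |A. A \<in> sets borel})
     (sigma_sets (space M) {?h -` A \<inter> space M |A. A \<in> sets borel})"
   proof -
    \<comment> \<open>\<open>grid_term\<close> evaluates the path at fixed times only, so
      \<open>?g\<close> is measurable for the sigma-algebra of the process, while \<open>?h\<close>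
      is measurable for that of \<open>e\<close>.\<close>
    let ?S = "path_sigma M X"
    let ?V = "vimage_algebra (space M) e borel"
    have "?g \<in> borel_measurable ?S" by (rule measurable_grid_term[OF measurable_process_events])
    then have 1: "sigma_sets (space M) {?g -` A \<inter> space M |A. A \<in> sets borel} \<subseteq> process_events M X"
     unfolding process_events_eq_sets
     by (rule sigma_sets_preimage_subset) (auto intro!: space_measure_of)
    have [measurable]: "e \<in> borel_measurable ?V"
     by (rule measurable_vimage_algebra1) (use e_meas in auto)
    have "?h \<in> borel_measurable ?V" by measurable
    then have "sigma_sets (space M) {?h -` A \<inter> space M |A. A \<in> sets borel} \<subseteq> sets ?V"
     by (rule sigma_sets_preimage_subset) simp
    also have "sets ?V = {e -` A \<inter> space M | A. A \<in> sets borel}"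
     by (rule sets_vimage_algebra2) auto
    finally have 2: "sigma_sets (space M) {?h -` A \<inter> space M |A. A \<in> sets borel} \<subseteq> {e -` A \<inter> space M | A. A \<in> sets borel}" .
    show ?thesis
     using ind 1 2 unfolding indep_set_def
     by (elim indep_sets_mono_sets) (auto split: bool.split)
   qed
  qed (use mg in measurable)
  then have "(\<integral>\<omega>. ?g \<omega> * ?h \<omega> \<partial>M) = (\<integral>\<omega>. ?g \<omega> \<partial>M) * (\<integral>\<omega>. ?h \<omega> \<partial>M)"
   by (rule indep_var_lebesgue_integral)
     (use mg norm_grid_term[OF z, of 0] in \<open>auto intro!: integrable_const_bound[where B = 1]\<close>)
  moreover have "(\<integral>\<omega>. ?h \<omega> \<partial>M) = of_real (prob {\<omega> \<in> space M. ?P \<omega>})"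
  proof -
   have "(\<integral>\<omega>. ?h \<omega> \<partial>M) = (\<integral>\<omega>. complex_of_real (indicator {\<omega> \<in> space M. ?P \<omega>} \<omega>) \<partial>M)"
    by (intro Bochner_Integration.integral_cong) auto
   also have "\<dots> = of_real (\<integral>\<omega>. indicator {\<omega> \<in> space M. ?P \<omega>} \<omega> \<partial>M)"
    by (rule integral_complex_of_real)
   finally show ?thesis by (subst (asm) Bochner_Integration.integral_indicator) (auto simp: Int_absorb2)
  qed
  ultimately show "(\<integral>\<omega>. of_bool (?P \<omega>) * ?g \<omega> \<partial>M) = of_real (prob {\<omega> \<in> space M. ?P \<omega>}) * grid_transform j (Suc n) z 0"
   by (simp add: integral_grid_term mult.commute)
 qed (use q z X_0 prob_space_axioms in auto)
 have tr: "(\<integral>\<omega>. exp (z * of_real (running_inf X \<bar>e \<omega>\<bar> \<omega>)) \<partial>M) = inf_transform q z" if "Re z \<ge> 0" for z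
  using LIMSEQ_unique[OF lim[OF that] grid_limit_transforms(1)[OF q that]] by simp
 let ?Y = "\<lambda>\<omega>. - running_inf X \<bar>e \<omega>\<bar> \<omega>"
 have mY: "?Y \<in> borel_measurable M" using m by simp
 have "distr M borel ?Y = inf_law q"
 proof (rule laplace_transform_unique)
  interpret Y: prob_space "distr M borel ?Y" by (rule prob_space_distr[OF mY])
  interpret I: prob_space "inf_law q" by (rule inf_law_props(1)[OF q])
  show "finite_measure (distr M borel ?Y)" "finite_measure (inf_law q)" by unfold_locales
  have "AE \<omega> in M. \<not> ?Y \<omega> < 0"
   using X_0 AE_space by eventually_elim (simp add: not_less running_inf_le_0)
  then have "AE y in distr M borel ?Y. \<not> y < 0" by (subst AE_distr_iff[OF mY]) auto
  then show "emeasure (distr M borel ?Y) {..<0} = 0"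
   by (subst (asm) AE_iff_measurable[OF _ refl]) (auto simp: lessThan_def)
  show "(\<integral>x. exp (- r * x) \<partial>distr M borel ?Y) = (\<integral>x. exp (- r * x) \<partial>inf_law q)" if "r \<ge> 0" for r
  proof -
   have "complex_of_real (\<integral>x. exp (- r * x) \<partial>distr M borel ?Y) = (\<integral>x. exp (- complex_of_real r * of_real x) \<partial>distr M borel ?Y)"
    by (rule laplace_of_real[symmetric])
   also have "\<dots> = (\<integral>\<omega>. exp (of_real r * of_real (running_inf X \<bar>e \<omega>\<bar> \<omega>)) \<partial>M)"
    by (subst integral_distr[OF mY]) auto
   also have "\<dots> = inf_transform q (of_real r)" by (rule tr) (use that in simp)
   also have "\<dots> = of_real (\<integral>x. exp (- r * x) \<partial>inf_law q)"
    unfolding inf_transform_def by (rule laplace_of_real)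
   finally show ?thesis by (simp only: of_real_eq_iff)
  qed
 qed (use inf_law_props[OF q] in auto)
 moreover have "distr M borel ?Y = distr M borel (\<lambda>\<omega>. - running_inf X (e \<omega>) \<omega>)"
 proof (rule distr_cong_AE)
  show "AE \<omega> in M. ?Y \<omega> = - running_inf X (e \<omega>) \<omega>" using e0 by eventually_elim simp
 qed (use m meas in auto)
 ultimately show "distr M borel (\<lambda>\<omega>. - running_inf X (e \<omega>) \<omega>) = inf_law q" by simp
qed

end

section \<open>The processes of the model\<close>

lemma (in prob_space) indep_var_of_indep_vars:
 assumes "indep_vars (\<lambda>_. borel) X I" "i \<in> I" "j \<in> I" "i \<noteq> j"
 shows "indep_var borel (X i) borel (X j)"
proof -
 have "indep_var (PiM {i} (\<lambda>_. borel)) (\<lambda>\<omega>. restrict (\<lambda>k. X k \<omega>) {i})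
   (PiM {j} (\<lambda>_. borel)) (\<lambda>\<omega>. restrict (\<lambda>k. X k \<omega>) {j})"
  by (rule indep_var_restrict[OF assms(1)]) (use assms in auto)
 then have "indep_var borel ((\<lambda>x. x i) \<circ> (\<lambda>\<omega>. restrict (\<lambda>k. X k \<omega>) {i}))
   borel ((\<lambda>x. x j) \<circ> (\<lambda>\<omega>. restrict (\<lambda>k. X k \<omega>) {j}))"
  by (rule indep_var_compose) (auto intro!: measurable_component_singleton)
 then show ?thesis by (simp add: comp_def)
qed

lemma (in prob_space) indep_vars_of_indep_processes:
 assumes ind: "indep_sets (\<lambda>k. process_events M (P k)) K"
  and f: "\<And>k. k \<in> K \<Longrightarrow> f k \<in> measurable (path_sigma M (P k)) borel"
 shows "indep_vars (\<lambda>_. borel) f K"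
 unfolding indep_vars_def
proof (intro conjI ballI)
 have sub: "sigma_sets (space M) {f k -` A \<inter> space M |A. A \<in> sets borel} \<subseteq> process_events M (P k)" if "k \<in> K" for k
  unfolding process_events_eq_sets
  by (rule sigma_sets_preimage_subset[OF f[OF that]]) (auto intro!: space_measure_of)
 show "indep_sets (\<lambda>i. sigma_sets (space M) {f i -` A \<inter> space M |A. A \<in> sets borel}) K"
  by (rule indep_sets_mono_sets[OF ind sub])
 fix k assume k: "k \<in> K"
 have ev: "process_events M (P k) \<subseteq> events" using ind k by (auto simp: indep_sets_def)
 show "random_variable borel (f k)"
 proof (rule measurableI)
  fix A :: "'c set" assume A: "A \<in> sets borel"
  have "f k -` A \<inter> space M \<in> sigma_sets (space M) {f k -` A \<inter> space M |A. A \<in> sets borel}"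
   using A by (intro sigma_sets.Basic) auto
  then show "f k -` A \<inter> space M \<in> events" using sub[OF k] ev by blast
 qed simp
qed

text \<open>A finite set of indices is sliced by its first component. Each slice gives an event of
  one process, so independence of the processes separates the slices, and independence within a
  process splits each slice.\<close>

lemma (in prob_space) indep_vars_product_index:
 fixes V :: "'k \<Rightarrow> 'i \<Rightarrow> 'a \<Rightarrow> real"
 assumes ind: "indep_sets (\<lambda>k. process_events M (P k)) K"
  and V: "\<And>k. k \<in> K \<Longrightarrow> indep_vars (\<lambda>_. borel) (V k) I"
  and f: "\<And>k i. k \<in> K \<Longrightarrow> i \<in> I \<Longrightarrow>
   V k i \<in> borel_measurable (path_sigma M (P k))"
 shows "indep_vars (\<lambda>_. borel) (\<lambda>(k, i). V k i) (K \<times> I)"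
 unfolding indep_vars_def2
proof (intro conjI ballI indep_setsI)
 have r: "V k i \<in> borel_measurable M" if "k \<in> K" "i \<in> I" for k i
  using V[OF that(1)] that(2) by (auto simp: indep_vars_def)
 show "random_variable borel (case p of (k, i) \<Rightarrow> V k i)" if "p \<in> K \<times> I" for p
  using that r by auto
 show "{(case p of (k, i) \<Rightarrow> V k i) -` A \<inter> space M |A. A \<in> sets borel} \<subseteq> events" if "p \<in> K \<times> I" for p
  using that r by (auto intro: measurable_sets)
 fix A J assume J: "J \<noteq> {}" "J \<subseteq> K \<times> I" "finite J"
  and A: "\<forall>p\<in>J. A p \<in> {(case p of (k, i) \<Rightarrow> V k i) -` A \<inter> space M |A. A \<in> sets borel}"
 then have "\<forall>p\<in>J. \<exists>C. C \<in> sets borel \<and> A p = (case p of (k, i) \<Rightarrow> V k i) -` C \<inter> space M" by blast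
 then obtain C where C: "\<And>p. p \<in> J \<Longrightarrow> C p \<in> sets borel \<and> A p = (case p of (k, i) \<Rightarrow> V k i) -` C p \<inter> space M" by metis
 define L where "L = fst ` J"
 define Jk where "Jk k = {i. (k, i) \<in> J}" for k
 have J_eq: "J = Sigma L Jk" by (auto simp: L_def Jk_def) (metis fst_conv image_eqI)
 have "Jk k \<subseteq> snd ` J" for k by (force simp: Jk_def)
 then have fin: "finite L" "finite (Jk k)" for k
  using J(3) finite_surj[of J "Jk k" snd] by (auto simp: L_def)
 have ne: "L \<noteq> {}" "k \<in> L \<Longrightarrow> Jk k \<noteq> {}" for k using J(1) by (auto simp: L_def Jk_def)
 have sub: "L \<subseteq> K" "k \<in> L \<Longrightarrow> Jk k \<subseteq> I" for k using J(2) by (auto simp: L_def Jk_def)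
 define D where "D k = (\<Inter>i\<in>Jk k. A (k, i))" for k
 have AV: "A (k, i) = V k i -` C (k, i) \<inter> space M" "C (k, i) \<in> sets borel" if "k \<in> L" "i \<in> Jk k" for k i
  using C[of "(k, i)"] that by (auto simp: Jk_def)
 have DP: "D k \<in> process_events M (P k)" if "k \<in> L" for k
 proof -
  have "A (k, i) \<in> process_events M (P k)" if "i \<in> Jk k" for i
  proof -
   have "V k i -` C (k, i) \<inter> space (path_sigma M (P k))
     \<in> process_events M (P k)"
    unfolding process_events_eq_sets
    using f[of k i] AV(2)[OF \<open>k \<in> L\<close> that] sub \<open>k \<in> L\<close> that by (intro measurable_sets) auto
   then show ?thesis using AV(1)[OF \<open>k \<in> L\<close> that] by (subst (asm) space_measure_of) auto
  qed
  then show ?thesis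
   unfolding D_def process_events_eq_sets using fin ne that by (intro sets.finite_INT) auto
 qed
 have "(\<Inter>p\<in>J. A p) = (\<Inter>k\<in>L. D k)" unfolding D_def J_eq by auto
 also have "prob \<dots> = (\<Prod>k\<in>L. prob (D k))"
  by (rule indep_setsD[OF ind sub(1) ne(1) fin(1)]) (use DP in auto)
 also have "\<dots> = (\<Prod>k\<in>L. \<Prod>i\<in>Jk k. prob (A (k, i)))"
 proof (rule prod.cong[OF refl])
  fix k assume k: "k \<in> L"
  have "prob (D k) = prob (\<Inter>i\<in>Jk k. V k i -` C (k, i) \<inter> space M)"
   unfolding D_def using AV k by simp
  also have "\<dots> = (\<Prod>i\<in>Jk k. prob (V k i -` C (k, i) \<inter> space M))"
   by (rule indep_varsD[OF V]) (use k sub ne fin AV in auto)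
  finally show "prob (D k) = (\<Prod>i\<in>Jk k. prob (A (k, i)))" using AV k by simp
 qed
 also have "\<dots> = (\<Prod>p\<in>J. prob (A p))"
  unfolding J_eq by (subst prod.Sigma) (use fin in auto)
 finally show "prob (\<Inter>p\<in>J. A p) = (\<Prod>p\<in>J. prob (A p))" .
qed

lemma cadlag_const: "cadlag (\<lambda>t. c * t)"
 unfolding cadlag_def by (auto intro!: tendsto_intros exI)

lemma cadlag_lincomb:
 assumes f: "cadlag f" and g: "cadlag g"
 shows "cadlag (\<lambda>t. a * f t + b * g t)"
 unfolding cadlag_def
proof (intro conjI allI impI)
 show "((\<lambda>t. a * f t + b * g t) \<longlongrightarrow> a * f t + b * g t) (at_right t)" if "0 \<le> t" for t
  by (intro tendsto_intros cadlag_right f g that)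
 fix t :: real assume "0 < t"
 then obtain l1 l2 where "(f \<longlongrightarrow> l1) (at_left t)" "(g \<longlongrightarrow> l2) (at_left t)"
  using f g unfolding cadlag_def by blast
 then have "((\<lambda>t. a * f t + b * g t) \<longlongrightarrow> a * l1 + b * l2) (at_left t)" by (intro tendsto_intros)
 then show "\<exists>l. ((\<lambda>t. a * f t + b * g t) \<longlongrightarrow> l) (at_left t)" by blast
qed

lemma lessThan_3: "{..<3::nat} = {0, 1, 2}" by auto

section \<open>The sum of the components is a Levy process\<close>

locale model_setting =
 fixes M :: "'a measure" and p :: model and B Z S X :: "real \<Rightarrow> 'a \<Rightarrow> real"
 assumes model: "levy_model M p B Z S X"
begin

sublocale prob_space M
 using model by (simp add: levy_model_def)

definition part :: "nat \<Rightarrow> real \<Rightarrow> 'a \<Rightarrow> real" where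
 "part k = [B, Z, S] ! k"

lemma part_simps: "part 0 = B" "part 1 = Z" "part (Suc 0) = Z" "part 2 = S"
 by (simp_all add: part_def)

lemma levy_part: "k \<in> {..<3} \<Longrightarrow> levy_process M (part k)"
 using model unfolding lessThan_3
 by (auto simp: part_simps levy_model_def brownian_motion2_def compound_poisson_def down_process_def)

lemma indep_parts: "indep_sets (\<lambda>k. process_events M (part k)) {..<3}"
 using model by (simp add: levy_model_def part_def)

lemma X_eq: "X t \<omega> = drift p * t + gauss p * part 0 t \<omega> + part 1 t \<omega> - part 2 t \<omega>"
 using model by (simp add: levy_model_def part_simps)

lemma measurable_part [measurable]: "k \<in> {..<3} \<Longrightarrow> 0 \<le> t \<Longrightarrow> part k t \<in> borel_measurable M"
 using levy_part by (auto simp: levy_process_def)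

text \<open>The increments of the three components form a family that is independent jointly in
  component and time. Regrouped by time, the blocks are independent, and each increment of
  \<open>X\<close> is a function of one block.\<close>

lemma indep_increments_X:
 fixes \<tau> :: "nat \<Rightarrow> real"
 assumes \<tau>: "0 \<le> \<tau> 0" "mono_on {..n} \<tau>"
 shows "indep_vars (\<lambda>_. borel) (\<lambda>i \<omega>. X (\<tau> (Suc i)) \<omega> - X (\<tau> i) \<omega>) {..<n}"
proof -
 have \<tau>0: "0 \<le> \<tau> i" if "i \<le> n" for i
  using monotone_onD[OF \<tau>(2), of 0 i] \<tau>(1) that by auto
 define V where "V k i \<omega> = part k (\<tau> (Suc i)) \<omega> - part k (\<tau> i) \<omega>" for k i \<omega>
 have V: "indep_vars (\<lambda>_. borel) (V k) {..<n}" if "k \<in> {..<3}" for k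
  using levy_part[OF that] \<tau> unfolding levy_process_def V_def[abs_def] by blast
 have "V k i \<in> borel_measurable (path_sigma M (part k))"
  if "i \<in> {..<n}" for k i
  unfolding V_def[abs_def] using \<tau>0[of i] \<tau>0[of "Suc i"] that
  by (intro borel_measurable_diff measurable_process_events) auto
 then have I: "indep_vars (\<lambda>_. borel) (\<lambda>(k, i). V k i) ({..<3} \<times> {..<n})"
  by (intro indep_vars_product_index[OF indep_parts V])
 have G: "indep_vars (\<lambda>i. PiM ({..<3} \<times> {i}) (\<lambda>_. borel))
   (\<lambda>i \<omega>. restrict (\<lambda>p. (case p of (k, i) \<Rightarrow> V k i) \<omega>) ({..<3} \<times> {i})) {..<n}"
  by (rule indep_vars_restrict[OF I]) (auto simp: disjoint_family_on_def)
 define h where "h i x = drift p * (\<tau> (Suc i) - \<tau> i) + gauss p * x (0::nat, i::nat) + x (1, i) - x (2, i)" for i x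
 have hm: "h i \<in> borel_measurable (PiM ({..<3} \<times> {i}) (\<lambda>_. borel))" for i
 proof -
  have [measurable]: "(\<lambda>x. x (k, i)) \<in> borel_measurable (PiM ({..<3} \<times> {i}) (\<lambda>_. borel))" if "k \<in> {..<3}" for k :: nat
   using that by (intro measurable_component_singleton) auto
  show ?thesis unfolding h_def by (intro borel_measurable_add borel_measurable_diff borel_measurable_times borel_measurable_const) auto
 qed
 have "indep_vars (\<lambda>_. borel) (\<lambda>i \<omega>. h i (restrict (\<lambda>p. (case p of (k, i) \<Rightarrow> V k i) \<omega>) ({..<3} \<times> {i}))) {..<n}"
  by (rule indep_vars_compose2[OF G hm])
 moreover have "(\<lambda>i \<omega>. h i (restrict (\<lambda>p. (case p of (k, i) \<Rightarrow> V k i) \<omega>) ({..<3} \<times> {i})))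
   = (\<lambda>i \<omega>. X (\<tau> (Suc i)) \<omega> - X (\<tau> i) \<omega>)"
  by (intro ext) (simp add: h_def V_def X_eq algebra_simps)
 ultimately show ?thesis by simp
qed

text \<open>By independence the joint law of the three increments is the product of their laws, and
  each of these is stationary.\<close>

lemma stationary_X:
 assumes s: "0 \<le> s" and t: "0 \<le> t"
 shows "distr M borel (\<lambda>\<omega>. X (s + t) \<omega> - X s \<omega>) = distr M borel (X t)"
proof -
 define W where "W k \<omega> = part k (s + t) \<omega> - part k s \<omega>" for k \<omega>
 have Wm: "W k \<in> borel_measurable M" if "k \<in> {..<3}" for k
  unfolding W_def[abs_def] using that s t by (intro borel_measurable_diff measurable_part) auto
 have iW: "indep_vars (\<lambda>_. borel) W {..<3}"
  unfolding W_def[abs_def] using s t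
  by (intro indep_vars_of_indep_processes[OF indep_parts] borel_measurable_diff measurable_process_events) auto
 have iP: "indep_vars (\<lambda>_. borel) (\<lambda>k. part k t) {..<3}"
  using t by (intro indep_vars_of_indep_processes[OF indep_parts] measurable_process_events) auto
 have same: "distr M borel (W k) = distr M borel (part k t)" if "k \<in> {..<3}" for k
  using levy_part[OF that] s t unfolding levy_process_def W_def[abs_def] by blast
 have ne: "{..<3::nat} \<noteq> {}" by (simp add: lessThan_empty_iff)
 have Pm: "part k t \<in> borel_measurable M" if "k \<in> {..<3}" for k using that t by (rule measurable_part)
 let ?PB = "PiM {..<3::nat} (\<lambda>_. borel :: real measure)"
 have "distr M ?PB (\<lambda>\<omega>. \<lambda>k\<in>{..<3}. W k \<omega>) = PiM {..<3} (\<lambda>k. distr M borel (W k))"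
  by (rule iffD1[OF indep_vars_iff_distr_eq_PiM'[OF ne Wm] iW])
 also have "\<dots> = PiM {..<3} (\<lambda>k. distr M borel (part k t))"
  by (intro PiM_cong same) auto
 also have "\<dots> = distr M ?PB (\<lambda>\<omega>. \<lambda>k\<in>{..<3}. part k t \<omega>)"
  by (rule iffD1[OF indep_vars_iff_distr_eq_PiM'[OF ne Pm] iP, symmetric])
 finally have j: "distr M ?PB (\<lambda>\<omega>. \<lambda>k\<in>{..<3}. W k \<omega>) = distr M ?PB (\<lambda>\<omega>. \<lambda>k\<in>{..<3}. part k t \<omega>)" .
 define h where "h x = drift p * t + gauss p * x (0::nat) + x 1 - x (2::nat)" for x
 have hm: "h \<in> borel_measurable ?PB"
  unfolding h_def[abs_def]
  by (intro borel_measurable_add borel_measurable_diff borel_measurable_times borel_measurable_const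
    measurable_component_singleton) auto
 have mW: "(\<lambda>\<omega>. \<lambda>k\<in>{..<3}. W k \<omega>) \<in> measurable M ?PB" using Wm by (intro measurable_restrict) auto
 have mP: "(\<lambda>\<omega>. \<lambda>k\<in>{..<3}. part k t \<omega>) \<in> measurable M ?PB" using t by (intro measurable_restrict) auto
 have "distr M borel (\<lambda>\<omega>. X (s + t) \<omega> - X s \<omega>) = distr M borel (h \<circ> (\<lambda>\<omega>. \<lambda>k\<in>{..<3}. W k \<omega>))"
  by (intro distr_cong) (auto simp: h_def W_def X_eq algebra_simps)
 also have "\<dots> = distr M borel (h \<circ> (\<lambda>\<omega>. \<lambda>k\<in>{..<3}. part k t \<omega>))"
  by (simp only: distr_distr[OF hm mW, symmetric] distr_distr[OF hm mP, symmetric] j)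
 also have "\<dots> = distr M borel (X t)"
  by (intro distr_cong) (auto simp: h_def X_eq)
 finally show ?thesis .
qed

lemma levy_process_X: "levy_process M X"
proof -
 have m: "X t \<in> borel_measurable M" if "0 \<le> t" for t
 proof -
  have "(\<lambda>\<omega>. X t \<omega>) \<in> borel_measurable M"
   unfolding X_eq using that
   by (intro borel_measurable_add borel_measurable_diff borel_measurable_times borel_measurable_const measurable_part) auto
  then show ?thesis by simp
 qed
 have z: "AE \<omega> in M. part k 0 \<omega> = 0" if "k \<in> {..<3}" for k
  using levy_part[OF that] by (simp add: levy_process_def)
 have "AE \<omega> in M. X 0 \<omega> = 0"
  using z[of 0] z[of 1] z[of 2] by (auto simp: X_eq)
 moreover have "cadlag (\<lambda>t. X t \<omega>)" if "\<omega> \<in> space M" for \<omega>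
 proof -
  have "cadlag (\<lambda>t. part k t \<omega>)" if "k \<in> {..<3}" for k
   using levy_part[OF that] \<open>\<omega> \<in> space M\<close> by (simp add: levy_process_def)
  then have c: "cadlag (\<lambda>t. part 0 t \<omega>)" "cadlag (\<lambda>t. part 1 t \<omega>)" "cadlag (\<lambda>t. part 2 t \<omega>)"
   by auto
  have "cadlag (\<lambda>t. drift p * t + gauss p * part 0 t \<omega>)"
   using cadlag_lincomb[OF cadlag_const[of "drift p"] c(1), of 1 "gauss p"] by simp
  from cadlag_lincomb[OF this c(2), of 1 1]
  have "cadlag (\<lambda>t. drift p * t + gauss p * part 0 t \<omega> + part 1 t \<omega>)" by simp
  from cadlag_lincomb[OF this c(3), of 1 "- 1"] show ?thesis by (simp add: X_eq)
 qed
 ultimately show ?thesis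
  unfolding levy_process_def using m indep_increments_X stationary_X prob_space_axioms by auto
qed

lemma char_X_factor:
 assumes h: "0 \<le> h"
 shows "(\<integral>\<omega>. exp (\<i> * of_real u * of_real (X h \<omega>)) \<partial>M)
  = exp (\<i> * of_real u * of_real (drift p * h))
   * (\<integral>\<omega>. exp (\<i> * of_real (u * gauss p) * of_real (B h \<omega>)) \<partial>M)
   * (\<integral>\<omega>. exp (\<i> * of_real u * of_real (Z h \<omega>)) \<partial>M)
   * (\<integral>\<omega>. exp (- \<i> * of_real u * of_real (S h \<omega>)) \<partial>M)"
proof -
 define c where "c k = (if k = 0 then u * gauss p else if k = 1 then u else - u)" for k :: nat
 let ?f = "\<lambda>k \<omega>. exp (\<i> * of_real (c k) * complex_of_real (part k h \<omega>))"
 have ind: "indep_vars (\<lambda>_. borel) ?f {..<3}"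
  using h measurable_process_events[OF h] indep_parts
  by (intro indep_vars_of_indep_processes[where P = part] measurable_compose[OF measurable_process_events[OF h]]) auto
 have int: "integrable M (?f k)" if "k \<in> {..<3}" for k
  using measurable_part[OF that h] by (intro integrable_const_bound[where B = 1]) (auto simp: norm_exp_eq_Re)
 have "(\<integral>\<omega>. exp (\<i> * of_real u * of_real (X h \<omega>)) \<partial>M)
   = (\<integral>\<omega>. exp (\<i> * of_real u * of_real (drift p * h)) * (\<Prod>k<3. ?f k \<omega>) \<partial>M)"
  by (intro Bochner_Integration.integral_cong refl)
    (simp add: lessThan_3 c_def X_eq algebra_simps flip: exp_add)
 also have "\<dots> = exp (\<i> * of_real u * of_real (drift p * h)) * (\<Prod>k<3. \<integral>\<omega>. ?f k \<omega> \<partial>M)"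
  using indep_vars_lebesgue_integral[OF _ ind int] by simp
 finally show ?thesis by (simp add: lessThan_3 c_def part_simps mult.assoc)
qed

lemma char_B:
 assumes h: "0 < h"
 shows "(\<integral>\<omega>. exp (\<i> * of_real u * of_real (B h \<omega>)) \<partial>M) = exp (- of_real (u\<^sup>2 * h))"
proof -
 let ?s = "sqrt (2 * h)"
 have s: "0 < ?s" using h by simp
 have "distributed M lborel (B h) (\<lambda>x. ennreal (normal_density 0 ?s x))"
  using model h by (simp add: levy_model_def brownian_motion2_def)
 then have D: "distributed M lborel (\<lambda>\<omega>. B h \<omega> / ?s) std_normal_density"
  using normal_standard_normal_convert[OF s, of "B h" 0] by simp
 then have d: "distr M borel (\<lambda>\<omega>. B h \<omega> / ?s) = std_normal_distribution"
  using distributed_distr_eq_density[OF D] distr_cong[of M M lborel borel] by (metis sets_lborel)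
 have m: "(\<lambda>\<omega>. B h \<omega> / ?s) \<in> borel_measurable M" using distributed_measurable[OF D] by simp
 have "(\<integral>\<omega>. exp (\<i> * of_real u * of_real (B h \<omega>)) \<partial>M)
   = (\<integral>\<omega>. exp (\<i> * of_real ((u * ?s) * (B h \<omega> / ?s))) \<partial>M)"
  using s by (intro Bochner_Integration.integral_cong refl) (simp add: mult.assoc)
 also have "\<dots> = char std_normal_distribution (u * ?s)"
  unfolding char_def d[symmetric] by (subst integral_distr[OF m]) auto
 also have "\<dots> = of_real (exp (- ((u * ?s)\<^sup>2) / 2))" by (simp add: char_std_normal_distribution)
 also have "(u * ?s)\<^sup>2 = u\<^sup>2 * (2 * h)" using h by (simp add: power_mult_distrib)
 finally show ?thesis by (simp add: exp_of_real[symmetric])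
qed

end

section \<open>Analytic properties of the jump exponents\<close>

lemma norm_exp_taylor2:
 fixes w :: complex
 assumes w: "Re w \<ge> 0"
 shows "norm (1 - exp (- w) - w) \<le> (norm w)\<^sup>2"
proof -
 let ?S = "{z. Re z \<ge> 0} \<inter> cball 0 (norm w)"
 have "norm ((1 - exp (- w) - w) - (1 - exp (- 0) - 0)) \<le> norm w * norm (w - 0)"
 proof (rule field_differentiable_bound[where S = ?S and f = "\<lambda>z. 1 - exp (- z) - z" and f' = "\<lambda>z. exp (- z) - 1"])
  show "convex ?S" by (intro convex_Int convex_cball convex_halfspace_Re_ge)
  show "((\<lambda>z. 1 - exp (- z) - z) has_field_derivative exp (- z) - 1) (at z within ?S)" for z
   by (auto intro!: derivative_eq_intros)
  show "norm (exp (- z) - 1) \<le> norm w" if "z \<in> ?S" for z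
   using norm_exp_diff_le[of "- z" 0] that by auto
 qed (use w in auto)
 then show ?thesis by (simp add: power2_eq_square)
qed

text \<open>The compensator \<open>z * (1 - exp (- x))\<close> replaces the truncation function: it
  is \<open>z * x\<close> to first order at 0 and bounded at infinity, so that the kernel is of
  order \<open>min 1 (x\<^sup>2)\<close>. Changing the compensator only adds a linear term with
  slope \<open>comp_drift\<close>.\<close>

definition comp_kernel :: "complex \<Rightarrow> real \<Rightarrow> complex" where
 "comp_kernel z x = 1 - exp (- z * of_real x) - z * of_real (1 - exp (- x))"

lemma norm_comp_kernel:
 assumes z: "Re z \<ge> 0" and x: "0 < x"
 shows "norm (comp_kernel z x) \<le> 2 * (1 + norm z)\<^sup>2 * min 1 (x\<^sup>2)"
proof (cases "x \<ge> 1")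
 case True
 then have m: "min 1 (x\<^sup>2) = 1" by (simp add: one_le_power)
 have "norm (exp (- z * of_real x)) \<le> 1" using z x by (simp add: norm_exp_eq_Re)
 moreover have "norm (z * of_real (1 - exp (- x))) \<le> norm z * 1"
  unfolding norm_mult norm_of_real using x by (intro mult_left_mono) auto
 ultimately have "norm (comp_kernel z x) \<le> (1 + 1) + norm z"
  unfolding comp_kernel_def
  by (smt (verit) norm_one norm_triangle_ineq4)
 also have "\<dots> \<le> 2 * (1 + norm z)\<^sup>2" by (simp add: power2_eq_square algebra_simps)
 finally show ?thesis by (simp add: m)
next
 case False
 then have m: "min 1 (x\<^sup>2) = x\<^sup>2" using x False by (intro min_absorb2 power_le_one) auto
 have a: "norm (1 - exp (- (z * of_real x)) - z * of_real x) \<le> (norm z * x)\<^sup>2"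
  using norm_exp_taylor2[of "z * of_real x"] z x by (simp add: norm_mult)
 have b: "norm (1 - exp (- complex_of_real x) - of_real x) \<le> x\<^sup>2"
  using norm_exp_taylor2[of "of_real x"] x by simp
 have eq: "comp_kernel z x = (1 - exp (- (z * of_real x)) - z * of_real x)
   - z * (1 - exp (- complex_of_real x) - of_real x)"
  by (simp add: comp_kernel_def algebra_simps exp_of_real[symmetric])
 have "norm (comp_kernel z x) \<le> norm (1 - exp (- (z * of_real x)) - z * of_real x)
   + norm (z * (1 - exp (- complex_of_real x) - of_real x))"
  unfolding eq by (rule norm_triangle_ineq4)
 also have "\<dots> \<le> (norm z * x)\<^sup>2 + norm z * x\<^sup>2"
  unfolding norm_mult[of z] using a b by (intro add_mono mult_left_mono) auto
 also have "\<dots> \<le> 2 * (1 + norm z)\<^sup>2 * x\<^sup>2"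
 proof -
  have "(norm z)\<^sup>2 + norm z \<le> 2 * (1 + norm z)\<^sup>2" by (simp add: power2_eq_square algebra_simps)
  from mult_right_mono[OF this, of "x\<^sup>2"] show ?thesis by (simp add: power_mult_distrib algebra_simps)
 qed
 finally show ?thesis by (simp only: m)
qed

lemma poly_map_of_real: "poly (map_poly of_real P) (complex_of_real x) = of_real (poly P x)"
 by (induction P) (auto simp: map_poly_pCons)

locale valid_model =
 fixes p :: model
 assumes up: "valid_up_jumps p" and down: "valid_down_jumps p"
  and drift_nonneg: "0 \<le> drift p" and gauss_nonneg: "0 \<le> gauss p"
begin

abbreviation "\<nu> \<equiv> down_measure p"

lemma sets_nu [simp, measurable_cong]: "sets \<nu> = sets borel"
 using down by (simp add: valid_down_jumps_def)

lemma space_nu [simp]: "space \<nu> = UNIV"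
 using sets_eq_imp_space_eq[OF sets_nu] by simp

lemma AE_nu: "AE x in \<nu>. 0 < x"
 using down by (intro AE_I[of _ _ "{..0}"]) (auto simp: valid_down_jumps_def)

lemma trunc_props:
 "trunc p \<in> borel_measurable borel" "0 \<le> trunc p x"
 using down by (auto simp: valid_down_jumps_def)

lemma measurable_trunc [measurable]: "trunc p \<in> borel_measurable borel"
 by (rule trunc_props)

lemma integrable_min_square: "integrable \<nu> (\<lambda>x. min 1 (x\<^sup>2))"
proof (rule integrableI_nonneg)
 show "(\<integral>\<^sup>+ x. ennreal (min 1 (x\<^sup>2)) \<partial>\<nu>) < \<infinity>" using down by (simp add: valid_down_jumps_def)
qed auto

lemma integrable_trunc: "integrable \<nu> (\<lambda>x. 1 - exp (- x) - x * trunc p x)"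
 using down by (simp add: valid_down_jumps_def)

definition comp_drift :: real where
 "comp_drift = (\<integral>x. 1 - exp (- x) - x * trunc p x \<partial>\<nu>)"

lemma measurable_comp_kernel [measurable]: "comp_kernel z \<in> borel_measurable borel"
 unfolding comp_kernel_def by measurable

lemma integrable_comp_kernel:
 assumes z: "Re z \<ge> 0"
 shows "integrable \<nu> (comp_kernel z)"
proof (rule Bochner_Integration.integrable_bound)
 show "integrable \<nu> (\<lambda>x. 2 * (1 + norm z)\<^sup>2 * min 1 (x\<^sup>2))"
  by (intro integrable_mult_right integrable_min_square)
 show "AE x in \<nu>. norm (comp_kernel z x) \<le> norm (2 * (1 + norm z)\<^sup>2 * min 1 (x\<^sup>2))"
  using AE_nu
 proof eventually_elim
  case (elim x)
  have "0 \<le> 2 * (1 + norm z)\<^sup>2 * min 1 (x\<^sup>2)" by simp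
  then show ?case using norm_comp_kernel[OF z elim] by (simp only: real_norm_def abs_of_nonneg)
 qed
qed simp

lemma Psi_S_eq:
 assumes z: "Re z \<ge> 0"
 shows "Psi_S p z = (\<integral>x. comp_kernel z x \<partial>\<nu>) + z * of_real comp_drift"
proof -
 have i: "integrable \<nu> (\<lambda>x. complex_of_real (1 - exp (- x) - x * trunc p x))"
  using integrable_trunc by (rule integrable_of_real)
 have "Psi_S p z = (\<integral>x. comp_kernel z x + z * of_real (1 - exp (- x) - x * trunc p x) \<partial>\<nu>)"
  unfolding Psi_S_def comp_kernel_def
  by (intro Bochner_Integration.integral_cong refl) (simp add: algebra_simps)
 also have "\<dots> = (\<integral>x. comp_kernel z x \<partial>\<nu>) + (\<integral>x. z * of_real (1 - exp (- x) - x * trunc p x) \<partial>\<nu>)"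
  by (intro Bochner_Integration.integral_add integrable_comp_kernel z integrable_mult_right i)
 also have "(\<integral>x. z * of_real (1 - exp (- x) - x * trunc p x) \<partial>\<nu>) = z * of_real comp_drift"
  unfolding comp_drift_def integral_complex_of_real[symmetric] by (rule integral_mult_right_zero)
 finally show ?thesis .
qed

lemma Psi_S_regular:
 "continuous_on {z. Re z \<ge> 0} (Psi_S p)" "Psi_S p holomorphic_on {z. Re z > 0}"
proof -
 \<comment> \<open>The kernel is set to 0 off the positive half-line, which carries all the mass, to
   obtain bounds at every point.\<close>
 define k where "k z x = (if x > 0 then comp_kernel z x else 0)" for z x
 have km[measurable]: "k z \<in> borel_measurable \<nu>" for z unfolding k_def by measurable
 have eq: "(\<integral>x. comp_kernel z x \<partial>\<nu>) = (\<integral>x. k z x \<partial>\<nu>)" for z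
  by (intro integral_cong_AE) (use AE_nu in \<open>auto simp: k_def\<close>)
 have dom: "\<exists>r>0. \<exists>g::real \<Rightarrow> real. integrable \<nu> g \<and> (\<forall>z\<in>ball z0 r \<inter> T. \<forall>x\<in>space \<nu>. norm (k z x) \<le> g x)"
  if "T \<subseteq> {z. Re z \<ge> 0}" for T z0
 proof (intro exI[of _ "1::real"] conjI exI[of _ "\<lambda>x. 2 * (2 + norm z0)\<^sup>2 * min 1 (x\<^sup>2)"] ballI)
  show "integrable \<nu> (\<lambda>x. 2 * (2 + norm z0)\<^sup>2 * min 1 (x\<^sup>2))"
   by (intro integrable_mult_right integrable_min_square)
  fix z x assume z: "z \<in> ball z0 1 \<inter> T"
  then have "norm z \<le> 1 + norm z0"
   using norm_triangle_ineq[of z0 "z - z0"] by (auto simp: dist_norm norm_minus_commute)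
  then have m1: "2 * (1 + norm z)\<^sup>2 * min 1 (x\<^sup>2) \<le> 2 * (2 + norm z0)\<^sup>2 * min 1 (x\<^sup>2)"
   by (intro mult_right_mono mult_left_mono power_mono) auto
  have m2: "norm (comp_kernel z x) \<le> 2 * (1 + norm z)\<^sup>2 * min 1 (x\<^sup>2)" if "x > 0"
   using norm_comp_kernel[OF _ that] z \<open>T \<subseteq> _\<close> by auto
  show "norm (k z x) \<le> 2 * (2 + norm z0)\<^sup>2 * min 1 (x\<^sup>2)"
  proof (cases "x > 0")
   case True
   then show ?thesis using order.trans[OF m2[OF True] m1] by (simp only: k_def if_True)
  qed (simp add: k_def)
 qed simp
 have c: "continuous_on {z. Re z \<ge> 0} (\<lambda>z. \<integral>x. k z x \<partial>\<nu>)"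
 proof (rule continuous_param_integral)
  show "continuous_on {z. Re z \<ge> 0} (\<lambda>z. k z x)" for x
   by (cases "x > 0") (auto simp: k_def comp_kernel_def intro!: continuous_intros)
 qed (use dom km in auto)
 have h: "(\<lambda>z. \<integral>x. k z x \<partial>\<nu>) holomorphic_on {z. Re z > 0}"
 proof (rule holomorphic_param_integral[OF open_right_halfplane])
  show "(\<lambda>z. k z x) holomorphic_on {z. Re z > 0}" for x
   by (cases "x > 0") (auto simp: k_def comp_kernel_def intro!: holomorphic_intros)
  show "\<exists>r>0. \<exists>g::real \<Rightarrow> real. integrable \<nu> g \<and> (\<forall>z\<in>ball z0 r \<inter> {z. Re z > 0}. \<forall>x\<in>space \<nu>. norm (k z x) \<le> g x)" for z0
   by (rule dom) auto
 qed (rule km)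
 have "continuous_on {z. Re z \<ge> 0} (\<lambda>z. (\<integral>x. k z x \<partial>\<nu>) + z * of_real comp_drift)"
  by (intro continuous_intros c)
 then show "continuous_on {z. Re z \<ge> 0} (Psi_S p)"
  by (rule continuous_on_eq) (simp add: Psi_S_eq eq)
 have "(\<lambda>z. (\<integral>x. k z x \<partial>\<nu>) + z * of_real comp_drift) holomorphic_on {z. Re z > 0}"
  by (intro holomorphic_intros h)
 then show "Psi_S p holomorphic_on {z. Re z > 0}"
  by (rule holomorphic_transform) (simp add: Psi_S_eq eq)
qed

lemma Psi_S_growth: "\<exists>C\<ge>0. \<forall>z. Re z \<ge> 0 \<longrightarrow> norm (Psi_S p z) \<le> C * (1 + norm z)\<^sup>2"
proof (intro exI conjI allI impI)
 let ?I = "\<integral>x. min 1 (x\<^sup>2) \<partial>\<nu>"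
 have I0: "0 \<le> ?I" by simp
 then show "0 \<le> 2 * ?I + \<bar>comp_drift\<bar>" by linarith
 fix z :: complex assume z: "Re z \<ge> 0"
 have "norm (\<integral>x. comp_kernel z x \<partial>\<nu>) \<le> (\<integral>x. norm (comp_kernel z x) \<partial>\<nu>)" by simp
 also have "\<dots> \<le> (\<integral>x. 2 * (1 + norm z)\<^sup>2 * min 1 (x\<^sup>2) \<partial>\<nu>)"
 proof (rule integral_mono_AE)
  show "AE x in \<nu>. norm (comp_kernel z x) \<le> 2 * (1 + norm z)\<^sup>2 * min 1 (x\<^sup>2)"
   using AE_nu by eventually_elim (rule norm_comp_kernel[OF z])
 qed (intro integrable_norm integrable_comp_kernel z integrable_mult_right integrable_min_square)+
 also have "\<dots> = 2 * ?I * (1 + norm z)\<^sup>2" by simp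
 finally have a: "norm (\<integral>x. comp_kernel z x \<partial>\<nu>) \<le> 2 * ?I * (1 + norm z)\<^sup>2" .
 have "norm z \<le> (1 + norm z)\<^sup>2" by (simp add: power2_eq_square algebra_simps)
 from mult_left_mono[OF this abs_ge_zero[of comp_drift]]
 have b: "norm (z * of_real comp_drift) \<le> \<bar>comp_drift\<bar> * (1 + norm z)\<^sup>2"
  by (simp only: norm_mult norm_of_real mult.commute)
 show "norm (Psi_S p z) \<le> (2 * ?I + \<bar>comp_drift\<bar>) * (1 + norm z)\<^sup>2"
  unfolding Psi_S_eq[OF z] using norm_triangle_ineq[of "\<integral>x. comp_kernel z x \<partial>\<nu>" "z * of_real comp_drift"] a b
  by (simp add: algebra_simps)
qed

definition Psi_S_real :: "real \<Rightarrow> real" where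
 "Psi_S_real r = Re (Psi_S p (of_real r))"

lemma Psi_S_of_real:
 assumes "0 \<le> r"
 shows "Psi_S p (of_real r) = of_real (Psi_S_real r)"
  and "Psi_S_real r = (\<integral>x. 1 - exp (- r * x) - r * (1 - exp (- x)) \<partial>\<nu>) + r * comp_drift"
proof -
 have "comp_kernel (of_real r) x = of_real (1 - exp (- r * x) - r * (1 - exp (- x)))" for x
  by (simp add: comp_kernel_def exp_of_real[symmetric])
 then have "(\<integral>x. comp_kernel (of_real r) x \<partial>\<nu>) = of_real (\<integral>x. 1 - exp (- r * x) - r * (1 - exp (- x)) \<partial>\<nu>)"
  by (simp only: integral_complex_of_real)
 then have e: "Psi_S p (of_real r) = of_real ((\<integral>x. 1 - exp (- r * x) - r * (1 - exp (- x)) \<partial>\<nu>) + r * comp_drift)"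
  using Psi_S_eq[of "of_real r"] assms by simp
 then show "Psi_S p (of_real r) = of_real (Psi_S_real r)" by (simp add: Psi_S_real_def)
 show "Psi_S_real r = (\<integral>x. 1 - exp (- r * x) - r * (1 - exp (- x)) \<partial>\<nu>) + r * comp_drift"
  unfolding Psi_S_real_def e by simp
qed

definition up_law :: "real measure" where
 "up_law = density lborel (\<lambda>x. ennreal (up_density p x))"

lemma up_law_props:
 "prob_space up_law" "sets up_law = sets borel" "emeasure up_law {..<0} = 0"
proof -
 have f[measurable]: "up_density p \<in> borel_measurable borel" and f0: "\<And>x. 0 \<le> up_density p x" "\<And>x. x \<le> 0 \<Longrightarrow> up_density p x = 0"
  and b: "has_bochner_integral lborel (up_density p) 1"
  using up by (auto simp: valid_up_jumps_def)
 have i: "integrable lborel (up_density p)" "integral\<^sup>L lborel (up_density p) = 1"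
  using b by (auto simp: has_bochner_integral_iff)
 have "(\<integral>\<^sup>+x. ennreal (up_density p x) \<partial>lborel) = ennreal 1"
  using nn_integral_eq_integral[OF i(1)] f0 i(2) by simp
 then show "prob_space up_law"
  by (intro prob_spaceI) (simp add: up_law_def emeasure_density)
 show "sets up_law = sets borel" by (simp add: up_law_def)
 show "emeasure up_law {..<0} = 0"
  unfolding up_law_def
  by (subst emeasure_density, simp, simp, subst nn_integral_0_iff_AE)
    (auto intro!: AE_I2 simp: indicator_def f0)
qed

definition up_transform :: "complex \<Rightarrow> complex" where
 "up_transform z = poly (map_poly of_real (numer p)) z / (\<Prod>j=1..npoles p. (of_real (pole p j) + z) ^ pole_order p j)"

lemma pole_pos: "j \<in> {1..npoles p} \<Longrightarrow> 0 < pole p j"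
 using up by (auto simp: valid_up_jumps_def)

text \<open>Given on the positive reals, the rational formula extends to the closed half-plane,
  whose boundary carries the characteristic function.\<close>

lemma up_transform_eq:
 assumes z: "Re z \<ge> 0"
 shows "(\<integral>x. exp (- z * of_real x) \<partial>up_law) = up_transform z"
proof -
 interpret U: prob_space up_law by (rule up_law_props)
 have fm: "finite_measure up_law" by unfold_locales
 note reg = laplace_measure_regular[OF fm up_law_props(2,3)]
 have nz: "of_real (pole p j) + z \<noteq> 0" if "j \<in> {1..npoles p}" "Re z \<ge> 0" for j z
 proof -
  have "Re (of_real (pole p j) + z) > 0" using pole_pos[OF that(1)] that(2) by simp
  then show ?thesis by (metis less_irrefl zero_complex.sel(1))
 qed
 have f[measurable]: "up_density p \<in> borel_measurable borel" and f0: "\<And>x. 0 \<le> up_density p x"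
  using up by (auto simp: valid_up_jumps_def)
 show ?thesis
 proof (rule right_halfplane_identity[OF reg(1) _ reg(2) _ _ z])
  show "continuous_on {z. Re z \<ge> 0} up_transform"
   unfolding up_transform_def using nz by (intro continuous_intros) auto
  show "up_transform holomorphic_on {z. Re z > 0}"
   unfolding up_transform_def using nz by (intro holomorphic_intros) (auto simp: less_imp_le)
  fix r :: real assume r: "r > 0"
  have "(\<integral>x. exp (- complex_of_real r * of_real x) \<partial>up_law) = of_real (\<integral>x. exp (- r * x) \<partial>up_law)"
   by (rule laplace_of_real)
  also have "(\<integral>x. exp (- r * x) \<partial>up_law) = (\<integral>x. up_density p x * exp (- r * x) \<partial>lborel)"
   unfolding up_law_def using f0 by (subst integral_density) auto
  also have "\<dots> = (LBINT x. exp (- r * x) * up_density p x)" by (simp add: mult.commute)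
  also have "\<dots> = poly (numer p) r / (\<Prod>i=1..npoles p. (pole p i + r) ^ pole_order p i)"
   using up r by (simp add: valid_up_jumps_def)
  also have "complex_of_real \<dots> = up_transform (of_real r)"
   by (simp add: up_transform_def poly_map_of_real)
  finally show "(\<integral>x. exp (- complex_of_real r * of_real x) \<partial>up_law) = up_transform (of_real r)" .
 qed
qed

lemma Psi_X_eq: "Psi_X p z = of_real (drift p) * z + of_real ((gauss p)\<^sup>2) * z\<^sup>2
  + of_real (up_rate p) * (up_transform (- z) - 1) - Psi_S p z"
 unfolding Psi_X_def up_transform_def by simp

end

section \<open>Characteristic functions of the jump processes\<close>

sublocale model_setting \<subseteq> V: valid_model p
 using model by unfold_locales (auto simp: levy_model_def)

context model_setting
begin

lemma levy_path_Z: "levy_path M Z" and levy_path_S: "levy_path M S" and levy_path_X: "levy_path M X"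
 using levy_part[of 1] levy_part[of 2] levy_process_X
 by (unfold_locales; simp add: part_simps)+

lemma compound_poisson_data:
 "\<exists>(T :: nat \<Rightarrow> 'a \<Rightarrow> real) Y. indep_vars (\<lambda>_. borel) (case_sum T Y) UNIV \<and>
  (\<forall>i. distributed M lborel (T i) (\<lambda>x. ennreal (exponential_density (up_rate p) x))) \<and>
  (\<forall>i. distributed M lborel (Y i) (\<lambda>x. ennreal (up_density p x))) \<and>
  (AE \<omega> in M. \<forall>t\<ge>0. Z t \<omega> = (\<Sum>i | (\<Sum>j\<le>i. T j \<omega>) \<le> t. Y i \<omega>))"
 using model unfolding levy_model_def compound_poisson_def by blast

lemma rate_pos: "0 < up_rate p"
 using V.up by (simp add: valid_up_jumps_def)

text \<open>By time \<open>h\<close> there is at most one jump, except possibly on the event that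
  the first two waiting times are both at most \<open>h\<close>. Its probability is the square of
  \<open>1 - exp (- up_rate p * h)\<close>, and on it two numbers of modulus at most 1 differ by at
  most 2.\<close>

lemma char_Z_expansion:
 assumes h: "0 \<le> h"
 shows "norm ((\<integral>\<omega>. exp (\<i> * of_real u * of_real (Z h \<omega>)) \<partial>M)
   - (1 + of_real (1 - exp (- up_rate p * h)) * (V.up_transform (- \<i> * of_real u) - 1)))
  \<le> 2 * (1 - exp (- up_rate p * h))\<^sup>2"
proof -
 obtain T Y :: "nat \<Rightarrow> 'a \<Rightarrow> real" where D: "indep_vars (\<lambda>_. borel) (case_sum T Y) UNIV \<and>
  (\<forall>i. distributed M lborel (T i) (\<lambda>x. ennreal (exponential_density (up_rate p) x))) \<and>
  (\<forall>i. distributed M lborel (Y i) (\<lambda>x. ennreal (up_density p x))) \<and>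
  (AE \<omega> in M. \<forall>t\<ge>0. Z t \<omega> = (\<Sum>i | (\<Sum>j\<le>i. T j \<omega>) \<le> t. Y i \<omega>))"
  using compound_poisson_data by blast
 then have ind: "indep_vars (\<lambda>_. borel) (case_sum T Y) UNIV"
  and T: "\<And>i. distributed M lborel (T i) (\<lambda>x. ennreal (exponential_density (up_rate p) x))"
  and Y: "\<And>i. distributed M lborel (Y i) (\<lambda>x. ennreal (up_density p x))"
  and Zeq: "AE \<omega> in M. \<forall>t\<ge>0. Z t \<omega> = (\<Sum>i | (\<Sum>j\<le>i. T j \<omega>) \<le> t. Y i \<omega>)"
  by simp_all
 have [measurable]: "T i \<in> borel_measurable M" "Y i \<in> borel_measurable M" for i
  using distributed_measurable[OF T] distributed_measurable[OF Y] by auto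
 have [measurable]: "Z h \<in> borel_measurable M" using levy_path.measurable_X[OF levy_path_Z h] .
 define a where "a = 1 - exp (- up_rate p * h)"
 define e where "e \<omega> = exp (\<i> * of_real u * complex_of_real (Y 0 \<omega>))" for \<omega>
 \<comment> \<open>\<open>G\<close> is the integrand for a path with at most one jump by time
   \<open>h\<close>.\<close>
 define G where "G \<omega> = 1 + of_bool (T 0 \<omega> \<le> h) * (e \<omega> - 1)" for \<omega>
 define A where "A = {\<omega> \<in> space M. T 0 \<omega> \<le> h \<and> T 1 \<omega> \<le> h}"
 have ne: "norm (e \<omega>) = 1" for \<omega> by (simp add: e_def norm_exp_eq_Re)
 have T_nonneg: "AE \<omega> in M. \<forall>i. 0 \<le> T i \<omega>"
  using exponential_grid_index(2)[OF T rate_pos] by (simp add: AE_all_countable)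
 have P: "prob {\<omega> \<in> space M. T i \<omega> \<le> h} = a" for i
 proof -
  have "prob {\<omega> \<in> space M. h < T i \<omega>} = exp (- h * up_rate p)"
   using exponential_distributedD_gt[OF T h rate_pos] by simp
  moreover have "{\<omega> \<in> space M. T i \<omega> \<le> h} = space M - {\<omega> \<in> space M. h < T i \<omega>}" by auto
  ultimately show ?thesis by (simp add: prob_compl a_def mult.commute)
 qed
 have ob: "(\<integral>\<omega>. of_bool (T 0 \<omega> \<le> h) \<partial>M) = complex_of_real a"
 proof -
  have "(\<integral>\<omega>. of_bool (T 0 \<omega> \<le> h) \<partial>M) = (\<integral>\<omega>. complex_of_real (indicator {\<omega> \<in> space M. T 0 \<omega> \<le> h} \<omega>) \<partial>M)"
   by (intro Bochner_Integration.integral_cong) auto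
  also have "\<dots> = of_real (\<integral>\<omega>. indicator {\<omega> \<in> space M. T 0 \<omega> \<le> h} \<omega> \<partial>M)"
   by (rule integral_complex_of_real)
  finally show ?thesis
   by (subst (asm) Bochner_Integration.integral_indicator) (auto simp: Int_absorb2 P)
 qed
 have em[measurable]: "e \<in> borel_measurable M" unfolding e_def[abs_def] by measurable
 have n2: "norm (e \<omega> - 1) \<le> 2" for \<omega>
  using norm_triangle_ineq4[of "e \<omega>" 1] ne[of \<omega>] by simp
 have ie: "integrable M (\<lambda>\<omega>. e \<omega> - 1)"
  by (rule integrable_const_bound[where B = 2]) (use n2 in auto)
 have ie': "integrable M e"
  by (rule integrable_const_bound[where B = 1]) (use ne in auto)
 have io: "integrable M (\<lambda>\<omega>. of_bool (T 0 \<omega> \<le> h) :: complex)"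
  by (rule integrable_const_bound[where B = 1]) auto
 have Ee: "(\<integral>\<omega>. e \<omega> \<partial>M) = V.up_transform (- \<i> * of_real u)"
 proof -
  have d: "distr M borel (Y 0) = V.up_law"
   using distributed_distr_eq_density[OF Y[of 0]] distr_cong[of M M lborel borel]
   unfolding V.up_law_def by (metis sets_lborel)
  have "(\<integral>\<omega>. e \<omega> \<partial>M) = (\<integral>x. exp (- (- \<i> * of_real u) * of_real x) \<partial>distr M borel (Y 0))"
   unfolding e_def by (subst integral_distr) auto
  also have "\<dots> = V.up_transform (- \<i> * of_real u)"
   unfolding d by (rule V.up_transform_eq) simp
  finally show ?thesis .
 qed
 have i01: "indep_var borel (T 0) borel (Y 0)" "indep_var borel (T 0) borel (T 1)"
  using indep_var_of_indep_vars[OF ind, of "Inl 0" "Inr 0"] indep_var_of_indep_vars[OF ind, of "Inl 0" "Inl 1"]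
  by auto
 have "indep_var borel ((\<lambda>t. of_bool (t \<le> h) :: complex) \<circ> T 0) borel ((\<lambda>y. exp (\<i> * of_real u * complex_of_real y) - 1) \<circ> Y 0)"
  by (rule indep_var_compose[OF i01(1)]) auto
 then have iv: "indep_var borel (\<lambda>\<omega>. of_bool (T 0 \<omega> \<le> h) :: complex) borel (\<lambda>\<omega>. e \<omega> - 1)"
  by (simp add: comp_def e_def)
 have EG: "(\<integral>\<omega>. G \<omega> \<partial>M) = 1 + of_real a * (V.up_transform (- \<i> * of_real u) - 1)"
 proof -
  have "(\<integral>\<omega>. G \<omega> \<partial>M) = 1 + (\<integral>\<omega>. of_bool (T 0 \<omega> \<le> h) * (e \<omega> - 1) \<partial>M)"
   unfolding G_def using indep_var_integrable[OF iv io ie] by (simp add: prob_space)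
  also have "(\<integral>\<omega>. of_bool (T 0 \<omega> \<le> h) * (e \<omega> - 1) \<partial>M) = of_real a * (V.up_transform (- \<i> * of_real u) - 1)"
   using indep_var_lebesgue_integral[OF iv io ie] ob ie' Ee by (simp add: prob_space)
  finally show ?thesis .
 qed
 have PA: "prob A = a\<^sup>2"
 proof -
  have "prob ((\<Inter>k\<in>{Inl 0, Inl 1}. case_sum T Y k -` {..h} \<inter> space M)) = (\<Prod>k\<in>{Inl 0, Inl 1}. prob (case_sum T Y k -` {..h} \<inter> space M))"
   by (rule indep_varsD[OF ind]) auto
  moreover have "(\<Inter>k\<in>{Inl 0, Inl 1}. case_sum T Y k -` {..h} \<inter> space M) = A" by (auto simp: A_def)
  moreover have "T i -` {..h} \<inter> space M = {\<omega> \<in> space M. T i \<omega> \<le> h}" for i by auto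
  ultimately show ?thesis by (simp add: P power2_eq_square)
 qed
 have Am[measurable]: "A \<in> events" unfolding A_def by measurable
 have diff: "AE \<omega> in M. norm (exp (\<i> * of_real u * of_real (Z h \<omega>)) - G \<omega>) \<le> 2 * indicator A \<omega>"
  using Zeq T_nonneg AE_space
 proof eventually_elim
  case (elim \<omega>)
  have Z: "Z h \<omega> = (\<Sum>i | (\<Sum>j\<le>i. T j \<omega>) \<le> h. Y i \<omega>)" using elim h by blast
  have T0: "T 0 \<omega> \<le> (\<Sum>j\<le>i. T j \<omega>)" for i
   using elim(2) member_le_sum[of 0 "{..i}" "\<lambda>j. T j \<omega>"] by auto
  have T1: "T 0 \<omega> + T 1 \<omega> \<le> (\<Sum>j\<le>i. T j \<omega>)" if "i \<noteq> 0" for i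
  proof -
   have "(\<Sum>j\<in>{0,1}. T j \<omega>) \<le> (\<Sum>j\<le>i. T j \<omega>)"
    using that elim(2) by (intro sum_mono2) auto
   then show ?thesis by simp
  qed
  show ?case
  proof (cases "\<omega> \<in> A")
   case True
   have "norm (G \<omega>) \<le> 1" using ne by (simp add: G_def)
   then have "norm (exp (\<i> * of_real u * of_real (Z h \<omega>)) - G \<omega>) \<le> 1 + 1"
    using norm_triangle_ineq4[of "exp (\<i> * of_real u * of_real (Z h \<omega>))" "G \<omega>"]
    by (simp add: norm_exp_eq_Re)
   then show ?thesis using True by simp
  next
   case False
   have "exp (\<i> * of_real u * of_real (Z h \<omega>)) = G \<omega>"
   proof (cases "T 0 \<omega> \<le> h")
    case True
    then have "T 1 \<omega> > h" using False elim by (auto simp: A_def)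
    have "\<not> (\<Sum>j\<le>i. T j \<omega>) \<le> h" if "i \<noteq> 0" for i
     using T1[OF that] elim(2)[rule_format, of 0] \<open>T 1 \<omega> > h\<close> by linarith
    then have "{i. (\<Sum>j\<le>i. T j \<omega>) \<le> h} = {0}"
     using True by (auto intro: ccontr)
    then show ?thesis using True by (simp add: Z G_def e_def)
   next
    case False
    then have "{i. (\<Sum>j\<le>i. T j \<omega>) \<le> h} = {}" using T0 by (auto simp: not_le intro: less_le_trans)
    then show ?thesis using False by (simp only: Z G_def) simp
   qed
   then show ?thesis by simp
  qed
 qed
 have iZ: "integrable M (\<lambda>\<omega>. exp (\<i> * of_real u * of_real (Z h \<omega>)))"
  by (rule integrable_const_bound[where B = 1]) (auto simp: norm_exp_eq_Re)
 have iG: "integrable M G"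
  unfolding G_def using indep_var_integrable[OF iv io ie] by auto
 have "norm ((\<integral>\<omega>. exp (\<i> * of_real u * of_real (Z h \<omega>)) \<partial>M) - (\<integral>\<omega>. G \<omega> \<partial>M))
   = norm (\<integral>\<omega>. exp (\<i> * of_real u * of_real (Z h \<omega>)) - G \<omega> \<partial>M)"
  using iZ iG by simp
 also have "\<dots> \<le> (\<integral>\<omega>. norm (exp (\<i> * of_real u * of_real (Z h \<omega>)) - G \<omega>) \<partial>M)" by simp
 also have "\<dots> \<le> (\<integral>\<omega>. 2 * indicator A \<omega> \<partial>M)"
 proof (rule integral_mono_AE)
  show "integrable M (\<lambda>\<omega>. 2 * indicator A \<omega> :: real)"
   by (rule integrable_const_bound[where B = 2]) (auto simp: indicator_def)
 qed (use iZ iG diff in auto)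
 also have "\<dots> = 2 * a\<^sup>2" using PA by simp
 finally show ?thesis unfolding EG a_def .
qed

text \<open>The characteristic function at \<open>1 / 2 ^ j\<close> is the \<open>2 ^ k\<close>-th
  power of the one at \<open>1 / 2 ^ (j + k)\<close>. Such powers of numbers of modulus at most 1
  differ by at most \<open>2 ^ k\<close> times the difference of the bases, and by the one-jump
  expansion that difference is of smaller order than \<open>1 / 2 ^ k\<close>.\<close>

lemma char_Z:
 "(\<integral>\<omega>. exp (\<i> * of_real u * of_real (Z (1 / 2 ^ j) \<omega>)) \<partial>M)
  = exp (of_real (up_rate p) * (V.up_transform (- \<i> * of_real u) - 1) / 2 ^ j)"
proof -
 interpret Zp: levy_path M Z by (rule levy_path_Z)
 interpret U: prob_space V.up_law by (rule V.up_law_props)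
 define F where "F = V.up_transform (- \<i> * of_real u) - 1"
 define x where "x = of_real (up_rate p) * F / 2 ^ j"
 define \<phi> where "\<phi> h = (\<integral>\<omega>. exp (\<i> * of_real u * of_real (Z h \<omega>)) \<partial>M)" for h
 define a where "a k = 1 - exp (- up_rate p * (1 / 2 ^ (j + k)))" for k
 have fm: "finite_measure V.up_law" by unfold_locales
 have ut: "V.up_transform (- \<i> * of_real u) = (\<integral>x. exp (- (- \<i> * of_real u) * complex_of_real x) \<partial>V.up_law)"
  by (rule V.up_transform_eq[symmetric]) simp
 have "norm (V.up_transform (- \<i> * of_real u)) \<le> (\<integral>x. norm (exp (- (- \<i> * of_real u) * complex_of_real x)) \<partial>V.up_law)"
  unfolding ut by (rule integral_norm_bound)
 also have "\<dots> = 1" using U.prob_space by (simp add: norm_exp_eq_Re)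
 finally have "Re (V.up_transform (- \<i> * of_real u)) \<le> 1"
  using complex_Re_le_cmod order.trans by blast
 then have ReF: "Re F \<le> 0" by (simp add: F_def)
 have Rex: "Re (x / 2 ^ k) \<le> 0" for k
 proof -
  have "x / 2 ^ k = (up_rate p / (2 ^ j * 2 ^ k)) *\<^sub>R F" by (simp add: x_def scaleR_conv_of_real)
  then have "Re (x / 2 ^ k) = up_rate p / (2 ^ j * 2 ^ k) * Re F" by (simp only: scaleR_complex.sel)
  moreover have "up_rate p / (2 ^ j * 2 ^ k) * Re F \<le> 0"
   by (rule mult_nonneg_nonpos) (use ReF rate_pos in auto)
  ultimately show ?thesis by (simp only:)
 qed
 have root: "\<phi> (1 / 2 ^ j) = \<phi> (1 / 2 ^ (j + k)) ^ (2 ^ k)" for k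
  using Zp.char_grid[of u "2 ^ k" "j + k"] by (simp add: \<phi>_def power_add)
 have n1: "norm (\<phi> h) \<le> 1" if "0 \<le> h" for h
 proof -
  have "norm (\<phi> h) \<le> (\<integral>\<omega>. norm (exp (\<i> * of_real u * complex_of_real (Z h \<omega>))) \<partial>M)"
   unfolding \<phi>_def by (rule integral_norm_bound)
  also have "\<dots> = prob (space M)" by (simp add: norm_exp_eq_Re)
  also have "\<dots> = 1" by (rule prob_space)
  finally show ?thesis .
 qed
 have bound: "norm (\<phi> (1 / 2 ^ j) - exp x) \<le> norm (2 ^ k * (of_real (a k) * F - (exp (x / 2 ^ k) - 1))) + 2 ^ k * (2 * (a k)\<^sup>2)" for k
 proof -
  have h0: "0 \<le> 1 / (2::real) ^ (j + k)" by simp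
  have "norm (\<phi> (1 / 2 ^ j) - exp x) = norm (\<phi> (1 / 2 ^ (j + k)) ^ (2 ^ k) - exp (x / 2 ^ k) ^ (2 ^ k))"
   by (simp add: root[of k] exp_of_nat_mult[symmetric])
  also have "\<dots> \<le> real (2 ^ k) * norm (\<phi> (1 / 2 ^ (j + k)) - exp (x / 2 ^ k))"
   by (rule norm_power_diff) (use n1[OF h0] Rex in \<open>auto simp: norm_exp_eq_Re\<close>)
  also have "\<dots> \<le> real (2 ^ k) * (norm (of_real (a k) * F - (exp (x / 2 ^ k) - 1)) + 2 * (a k)\<^sup>2)"
  proof (rule mult_left_mono)
   have e: "norm (\<phi> (1 / 2 ^ (j + k)) - (1 + of_real (a k) * F)) \<le> 2 * (a k)\<^sup>2"
    using char_Z_expansion[OF h0, of u] by (simp only: \<phi>_def a_def F_def)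
   have eq: "\<phi> (1 / 2 ^ (j + k)) - exp (x / 2 ^ k)
     = (of_real (a k) * F - (exp (x / 2 ^ k) - 1)) + (\<phi> (1 / 2 ^ (j + k)) - (1 + of_real (a k) * F))"
    by simp
   show "norm (\<phi> (1 / 2 ^ (j + k)) - exp (x / 2 ^ k))
     \<le> norm (of_real (a k) * F - (exp (x / 2 ^ k) - 1)) + 2 * (a k)\<^sup>2"
    unfolding eq by (rule order.trans[OF norm_triangle_ineq add_left_mono[OF e]])
  qed simp
  also have "\<dots> = norm (2 ^ k * (of_real (a k) * F - (exp (x / 2 ^ k) - 1))) + 2 ^ k * (2 * (a k)\<^sup>2)"
   by (simp add: norm_mult norm_power distrib_left)
  finally show ?thesis .
 qed
 have a_lim: "(\<lambda>k. complex_of_real (a k) * 2 ^ k) \<longlonglongrightarrow> of_real (up_rate p) / 2 ^ j"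
 proof -
  have "complex_of_real (a k) = 1 - exp (- (of_real (up_rate p) / 2 ^ j) / 2 ^ k)" for k
   by (simp add: a_def exp_of_real[symmetric] power_add)
  then show ?thesis using exp_diff_limit[of "of_real (up_rate p) / 2 ^ j"] by simp
 qed
 have x_lim: "(\<lambda>k. (exp (x / 2 ^ k) - 1) * 2 ^ k) \<longlonglongrightarrow> x"
  using tendsto_minus[OF exp_diff_limit[of "- x"]] by (simp add: algebra_simps)
 have a0: "a \<longlonglongrightarrow> 0"
 proof -
  have "(\<lambda>k. 1 - exp (- up_rate p * (1 / 2 ^ (k + j)))) \<longlonglongrightarrow> 1 - exp (- up_rate p * 0)"
   by (intro tendsto_intros LIMSEQ_ignore_initial_segment inverse_pow2_tendsto)
  then show ?thesis by (simp add: a_def[abs_def] add.commute)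
 qed
 have l1: "(\<lambda>k. norm (complex_of_real (a k) * 2 ^ k * F - (exp (x / 2 ^ k) - 1) * 2 ^ k)
   + norm (complex_of_real (a k) * 2 ^ k) * (2 * \<bar>a k\<bar>))
   \<longlonglongrightarrow> norm (of_real (up_rate p) / 2 ^ j * F - x) + norm (complex_of_real (up_rate p) / 2 ^ j) * (2 * \<bar>0\<bar>)"
  by (intro tendsto_intros a_lim x_lim a0)
 have "norm (\<phi> (1 / 2 ^ j) - exp x) \<le> 0"
 proof (rule LIMSEQ_le_const)
  show "(\<lambda>k. norm (complex_of_real (a k) * 2 ^ k * F - (exp (x / 2 ^ k) - 1) * 2 ^ k)
   + norm (complex_of_real (a k) * 2 ^ k) * (2 * \<bar>a k\<bar>)) \<longlonglongrightarrow> 0"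
   using l1 by (simp add: x_def)
  have "norm (2 ^ k * (of_real (a k) * F - (exp (x / 2 ^ k) - 1))) + 2 ^ k * (2 * (a k)\<^sup>2)
    = norm (complex_of_real (a k) * 2 ^ k * F - (exp (x / 2 ^ k) - 1) * 2 ^ k)
   + norm (complex_of_real (a k) * 2 ^ k) * (2 * \<bar>a k\<bar>)" for k
  proof -
   have "2 ^ k * (2 * (a k)\<^sup>2) = norm (complex_of_real (a k) * 2 ^ k) * (2 * \<bar>a k\<bar>)"
   proof -
    have "(a k)\<^sup>2 = \<bar>a k\<bar> * \<bar>a k\<bar>" by (simp add: power2_eq_square)
    then show ?thesis by (simp only: norm_mult norm_power norm_of_real norm_numeral mult_ac)
   qed
   then show ?thesis by (simp add: algebra_simps)
  qed
  then show "\<exists>N. \<forall>n\<ge>N. norm (\<phi> (1 / 2 ^ j) - exp x) \<le>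
    norm (complex_of_real (a n) * 2 ^ n * F - (exp (x / 2 ^ n) - 1) * 2 ^ n)
   + norm (complex_of_real (a n) * 2 ^ n) * (2 * \<bar>a n\<bar>)"
   using bound by metis
 qed
 then show ?thesis by (simp add: \<phi>_def x_def F_def)
qed

lemma integrable_exp_S:
 assumes r: "0 \<le> r"
 shows "integrable M (\<lambda>\<omega>. exp (- r * S 1 \<omega>))"
  and "(\<integral>\<omega>. exp (- r * S 1 \<omega>) \<partial>M) = exp (- V.Psi_S_real r)"
proof -
 have "complex_of_real (\<integral>\<omega>. exp (- r * S 1 \<omega>) \<partial>M) = exp (- Psi_S p (of_real r))"
  using model r unfolding levy_model_def down_process_def by blast
 also have "\<dots> = of_real (exp (- V.Psi_S_real r))"
  by (simp add: V.Psi_S_of_real(1)[OF r] exp_of_real[symmetric])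
 finally show e: "(\<integral>\<omega>. exp (- r * S 1 \<omega>) \<partial>M) = exp (- V.Psi_S_real r)" by (simp only: of_real_eq_iff)
 \<comment> \<open>A function that is not integrable has Bochner integral 0, whereas the value just
   found is positive.\<close>
 then show "integrable M (\<lambda>\<omega>. exp (- r * S 1 \<omega>))"
  using not_integrable_integral_eq by fastforce
qed

text \<open>At dyadic times the real Laplace transform is the positive root of the one at time 1,
  and analytic continuation leads to the imaginary axis. \<open>S\<close> may take negative values
  through compensation, so the majorant contains an exponential moment besides the constant
  1.\<close>

lemma char_S:
 "(\<integral>\<omega>. exp (- \<i> * of_real u * of_real (S (1 / 2 ^ j) \<omega>)) \<partial>M) = exp (- Psi_S p (\<i> * of_real u) / 2 ^ j)"
proof -
 interpret Sp: levy_path M S by (rule levy_path_S)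
 let ?h = "1 / 2 ^ j :: real"
 have Sm[measurable]: "S ?h \<in> borel_measurable M" by (rule Sp.measurable_X) simp
 have int: "integrable M (\<lambda>\<omega>. exp (- r * S ?h \<omega>))" if "0 \<le> r" for r
  by (rule Sp.laplace_root(1)[OF integrable_exp_S(1)[OF that]])
 have val: "(\<integral>\<omega>. exp (- r * S ?h \<omega>) \<partial>M) = exp (- V.Psi_S_real r / 2 ^ j)" if "0 \<le> r" for r
 proof (rule power_eq_imp_eq_base[where n = "2 ^ j"])
  show "(\<integral>\<omega>. exp (- r * S ?h \<omega>) \<partial>M) ^ 2 ^ j = exp (- V.Psi_S_real r / 2 ^ j) ^ 2 ^ j"
   unfolding Sp.laplace_root(2)[OF integrable_exp_S(1)[OF that]] integrable_exp_S(2)[OF that]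
   by (simp add: exp_of_nat_mult[symmetric])
 qed auto
 have dom: "\<exists>r>0. \<exists>g::'a \<Rightarrow> real. integrable M g \<and>
   (\<forall>z\<in>ball z0 r \<inter> K. \<forall>\<omega>\<in>space M. norm (exp (- z * of_real (S ?h \<omega>))) \<le> g \<omega>)"
  if K: "K \<subseteq> {z. Re z \<ge> 0}" for K z0
 proof (intro exI[of _ "1::real"] conjI exI[of _ "\<lambda>\<omega>. 1 + exp (- (norm z0 + 1) * S ?h \<omega>)"] ballI)
  show "integrable M (\<lambda>\<omega>. 1 + exp (- (norm z0 + 1) * S ?h \<omega>))"
   using int[of "norm z0 + 1"] by auto
  fix z \<omega> assume z: "z \<in> ball z0 1 \<inter> K"
  then have "norm z \<le> 1 + norm z0"
   using norm_triangle_ineq[of z0 "z - z0"] by (auto simp: dist_norm norm_minus_commute)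
  then have Re: "0 \<le> Re z" "Re z \<le> norm z0 + 1"
   using K z complex_Re_le_cmod[of z] by auto
  have "norm (exp (- z * of_real (S ?h \<omega>))) = exp (- (Re z * S ?h \<omega>))" by (simp add: norm_exp_eq_Re)
  also have "\<dots> \<le> 1 + exp (- (norm z0 + 1) * S ?h \<omega>)"
  proof (cases "S ?h \<omega> \<ge> 0")
   case True
   then have "exp (- (Re z * S ?h \<omega>)) \<le> 1" using Re by simp
   then show ?thesis using exp_ge_zero[of "- (norm z0 + 1) * S ?h \<omega>"] by linarith
  next
   case False
   then have "(norm z0 + 1) * S ?h \<omega> \<le> Re z * S ?h \<omega>"
    using mult_right_mono_neg[OF Re(2), of "S ?h \<omega>"] by simp
   then have "- (Re z * S ?h \<omega>) \<le> - (norm z0 + 1) * S ?h \<omega>"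
    by (simp only: mult_minus_left neg_le_iff_le)
   then have "exp (- (Re z * S ?h \<omega>)) \<le> exp (- (norm z0 + 1) * S ?h \<omega>)" by (simp only: exp_le_cancel_iff)
   then show ?thesis by linarith
  qed
  finally show "norm (exp (- z * of_real (S ?h \<omega>))) \<le> 1 + exp (- (norm z0 + 1) * S ?h \<omega>)" .
 qed simp
 have "(\<integral>\<omega>. exp (- z * of_real (S ?h \<omega>)) \<partial>M) = exp (- Psi_S p z / 2 ^ j)" if z: "Re z \<ge> 0" for z
 proof (rule right_halfplane_identity[where z = z and f = "\<lambda>z. \<integral>\<omega>. exp (- z * of_real (S ?h \<omega>)) \<partial>M"
    and g = "\<lambda>z. exp (- Psi_S p z / 2 ^ j)"])
  show "continuous_on {z. Re z \<ge> 0} (\<lambda>z. \<integral>\<omega>. exp (- z * of_real (S ?h \<omega>)) \<partial>M)"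
   by (rule continuous_param_integral) (use dom in \<open>auto intro!: continuous_intros\<close>)
  show "continuous_on {z. Re z \<ge> 0} (\<lambda>z. exp (- Psi_S p z / 2 ^ j))"
   by (intro continuous_intros V.Psi_S_regular) auto
  show "(\<lambda>z. \<integral>\<omega>. exp (- z * of_real (S ?h \<omega>)) \<partial>M) holomorphic_on {z. Re z > 0}"
  proof (rule holomorphic_param_integral[OF open_right_halfplane])
   show "\<exists>r>0. \<exists>g::'a \<Rightarrow> real. integrable M g \<and>
     (\<forall>z\<in>ball z0 r \<inter> {z. Re z > 0}. \<forall>\<omega>\<in>space M. norm (exp (- z * of_real (S ?h \<omega>))) \<le> g \<omega>)" for z0
    by (rule dom) auto
  qed (auto intro!: holomorphic_intros)
  show "(\<lambda>z. exp (- Psi_S p z / 2 ^ j)) holomorphic_on {z. Re z > 0}"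
   by (intro holomorphic_intros V.Psi_S_regular) auto
  fix r :: real assume r: "r > 0"
  have "exp (- complex_of_real r * of_real (S ?h \<omega>)) = of_real (exp (- r * S ?h \<omega>))" for \<omega>
   by (metis exp_of_real of_real_minus of_real_mult)
  then have "(\<integral>\<omega>. exp (- complex_of_real r * of_real (S ?h \<omega>)) \<partial>M) = of_real (\<integral>\<omega>. exp (- r * S ?h \<omega>) \<partial>M)"
   by (simp only: integral_complex_of_real)
  also have "\<dots> = exp (- Psi_S p (of_real r) / 2 ^ j)"
  proof -
   have "(\<integral>\<omega>. exp (- r * S ?h \<omega>) \<partial>M) = exp (- V.Psi_S_real r / 2 ^ j)" by (rule val) (use r in simp)
   then show ?thesis using r by (simp only:) (simp add: V.Psi_S_of_real(1) exp_of_real[symmetric])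
  qed
  finally show "(\<integral>\<omega>. exp (- complex_of_real r * of_real (S ?h \<omega>)) \<partial>M) = exp (- Psi_S p (of_real r) / 2 ^ j)" .
 qed (rule z)
 from this[of "\<i> * of_real u"] show ?thesis by simp
qed

sublocale levy_exponent M X "Psi_X p"
proof -
 interpret levy_path M X by (rule levy_path_X)
 show "levy_exponent M X (Psi_X p)"
 proof unfold_locales
  fix j :: nat and u :: real
  have "(\<integral>\<omega>. exp (\<i> * of_real u * of_real (X (1 / 2 ^ j) \<omega>)) \<partial>M)
   = exp (\<i> * of_real u * of_real (drift p * (1 / 2 ^ j)))
    * exp (- of_real ((u * gauss p)\<^sup>2 * (1 / 2 ^ j)))
    * exp (of_real (up_rate p) * (V.up_transform (- \<i> * of_real u) - 1) / 2 ^ j)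
    * exp (- Psi_S p (\<i> * of_real u) / 2 ^ j)"
   using char_X_factor[of "1 / 2 ^ j" u] char_B[of "1 / 2 ^ j" "u * gauss p"] char_Z[of u j] char_S[of u j] by simp
  also have "\<dots> = exp (Psi_X p (\<i> * of_real u) / 2 ^ j)"
   unfolding V.Psi_X_eq exp_add[symmetric]
   by (simp add: power2_eq_square add_divide_distrib diff_divide_distrib algebra_simps)
  finally show "(\<integral>\<omega>. exp (\<i> * of_real u * of_real (X (1 / 2 ^ j) \<omega>)) \<partial>M) = exp (Psi_X p (\<i> * of_real u) / 2 ^ j)" .
 qed
qed

end

section \<open>The polynomial with the roots as zeros\<close>

lemma poly_growth:
 fixes f :: "complex poly"
 shows "\<exists>C\<ge>0. \<forall>z. norm (poly f z) \<le> C * (1 + norm z) ^ degree f"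
proof (intro exI conjI allI)
 show "0 \<le> (\<Sum>i\<le>degree f. norm (coeff f i))" by (intro sum_nonneg) auto
 fix z
 have "norm (poly f z) \<le> (\<Sum>i\<le>degree f. norm (coeff f i * z ^ i))"
  unfolding poly_altdef by (rule norm_sum)
 also have "\<dots> \<le> (\<Sum>i\<le>degree f. norm (coeff f i) * (1 + norm z) ^ degree f)"
 proof (rule sum_mono)
  fix i assume i: "i \<in> {..degree f}"
  have "norm z ^ i \<le> (1 + norm z) ^ i" by (intro power_mono) auto
  also have "\<dots> \<le> (1 + norm z) ^ degree f" using i by (intro power_increasing) auto
  finally show "norm (coeff f i * z ^ i) \<le> norm (coeff f i) * (1 + norm z) ^ degree f"
   by (simp add: norm_mult norm_power mult_left_mono)
 qed
 finally show "norm (poly f z) \<le> (\<Sum>i\<le>degree f. norm (coeff f i)) * (1 + norm z) ^ degree f"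
  by (simp add: sum_distrib_right)
qed

text \<open>The negative real axis alone suffices, since the leading term dominates along
  it.\<close>

lemma degree_le_of_bound:
 fixes f :: "complex poly"
 assumes bd: "\<And>t. t \<ge> 1 \<Longrightarrow> norm (poly f (- of_real t)) \<le> C * t ^ n"
 shows "degree f \<le> n"
proof (rule ccontr)
 assume "\<not> degree f \<le> n"
 then have d: "degree f > n" by simp
 have inf: "filterlim (\<lambda>t. - complex_of_real t) at_infinity at_top"
  by (simp add: filterlim_at_infinity_conv_norm_at_top filterlim_abs_real)
 have "((\<lambda>t. norm (poly f (- of_real t) / (- of_real t) ^ degree f)) \<longlongrightarrow> norm (lead_coeff f)) at_top"
  by (intro tendsto_norm filterlim_compose[OF poly_divide_tendsto_aux inf])
 moreover have "((\<lambda>t. norm (poly f (- of_real t) / (- of_real t) ^ degree f)) \<longlongrightarrow> 0) at_top"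
 proof (rule tendsto_sandwich[of "\<lambda>_. 0" _ _ "\<lambda>t. \<bar>C\<bar> / t"])
  show "\<forall>\<^sub>F t in at_top. norm (poly f (- of_real t) / (- of_real t) ^ degree f) \<le> \<bar>C\<bar> / t"
   using eventually_ge_at_top[of 1]
  proof eventually_elim
   case (elim t)
   have "norm (poly f (- of_real t) / (- of_real t) ^ degree f) = norm (poly f (- of_real t)) / t ^ degree f"
    using elim by (simp add: norm_divide norm_power)
   also have "\<dots> \<le> (\<bar>C\<bar> * t ^ n) / t ^ degree f"
    using bd[OF elim] elim by (intro divide_right_mono) (auto intro: order.trans mult_right_mono)
   also have "\<dots> \<le> (\<bar>C\<bar> * t ^ n) / t ^ Suc n"
    using elim d by (intro divide_left_mono power_increasing mult_nonneg_nonneg) auto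
   also have "\<dots> = \<bar>C\<bar> / t" using elim by (simp add: field_simps)
   finally show ?case .
  qed
  show "((\<lambda>t. \<bar>C\<bar> / t) \<longlongrightarrow> 0) at_top"
   by (rule tendsto_divide_0[OF tendsto_const filterlim_at_top_imp_at_infinity[OF filterlim_ident]])
 qed auto
 ultimately have "norm (lead_coeff f) = 0" using tendsto_unique[OF trivial_limit_at_top_linorder] by blast
 then show False using d by auto
qed

lemma entire_poly_growth_imp_poly:
 fixes f :: "complex \<Rightarrow> complex"
 assumes "f holomorphic_on UNIV" and bd: "\<And>z. norm (f z) \<le> C * (1 + norm z) ^ n"
 shows "\<exists>g. \<forall>z. poly g z = f z"
proof -
 have "norm (f z) \<le> (\<bar>C\<bar> * 2 ^ n) * norm z ^ n" if "1 \<le> norm z" for z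
 proof -
  have "norm (f z) \<le> \<bar>C\<bar> * (1 + norm z) ^ n"
   using bd[of z] by (rule order.trans) (intro mult_right_mono, auto)
  also have "\<dots> \<le> \<bar>C\<bar> * (2 * norm z) ^ n" using that by (intro mult_left_mono power_mono) auto
  finally show ?thesis by (simp add: power_mult_distrib mult.assoc)
 qed
 from Liouville_polynomial[OF assms(1) this]
 have "f z = (\<Sum>k\<le>n. (deriv ^^ k) f 0 / fact k * z ^ k)" for z .
 then have "poly (\<Sum>k\<le>n. monom ((deriv ^^ k) f 0 / fact k) k) z = f z" for z
  by (simp add: poly_sum poly_monom)
 then show ?thesis by blast
qed

lemma real_poly_of_complex:
 fixes g :: "complex poly"
 assumes "\<And>r. poly g (complex_of_real r) \<in> \<real>"
 shows "map_poly of_real (map_poly Re g) = g"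
  and "poly g (of_real r) = of_real (poly (map_poly Re g) r)"
proof -
 have e: "poly (map_poly of_real (map_poly Re g)) (of_real r) = poly g (of_real r)" for r
 proof -
  have "Re (poly g (of_real r)) = poly (map_poly Re g) r"
   by (induction g) (auto simp: map_poly_pCons)
  moreover have "poly g (of_real r) = of_real (Re (poly g (of_real r)))"
   using assms[of r] by (simp add: complex_is_Real_iff complex_eq_iff)
  ultimately show ?thesis by (simp add: poly_map_of_real)
 qed
 have "map_poly of_real (map_poly Re g) - g = 0"
 proof (rule ccontr)
  assume "map_poly of_real (map_poly Re g) - g \<noteq> 0"
  then have "finite {z. poly (map_poly of_real (map_poly Re g) - g) z = 0}" by (rule poly_roots_finite)
  moreover have "range complex_of_real \<subseteq> {z. poly (map_poly of_real (map_poly Re g) - g) z = 0}"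
   using e by auto
  ultimately have "finite (range complex_of_real)" by (rule finite_subset[rotated])
  then show False using infinite_UNIV_char_0[where 'a = real] by (simp add: finite_image_iff inj_on_def)
 qed
 then show "map_poly of_real (map_poly Re g) = g" by simp
 show "poly g (of_real r) = of_real (poly (map_poly Re g) r)" using e[of r] by (simp add: poly_map_of_real)
qed

section \<open>Clearing the poles of the exponent\<close>

context valid_model
begin

lemma up_facts:
 "0 < up_rate p" "1 \<le> npoles p"
 "j \<in> {1..npoles p} \<Longrightarrow> 1 \<le> pole_order p j"
 "j \<in> {1..npoles p} \<Longrightarrow> poly (numer p) (- pole p j) \<noteq> 0"
 "degree (numer p) \<le> (\<Sum>i=1..npoles p. pole_order p i) - 1"
 using up unfolding valid_up_jumps_def by blast+

definition pole_count :: nat where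
 "pole_count = (\<Sum>j=1..npoles p. pole_order p j)"

definition pole_poly :: "complex poly" where
 "pole_poly = (\<Prod>j=1..npoles p. [: of_real (pole p j), - 1 :] ^ pole_order p j)"

definition pole_real :: "real \<Rightarrow> real" where
 "pole_real s = (\<Prod>j=1..npoles p. (pole p j - s) ^ pole_order p j)"

lemma poly_pole_poly: "poly pole_poly z = (\<Prod>j=1..npoles p. (of_real (pole p j) - z) ^ pole_order p j)"
 by (simp add: pole_poly_def poly_prod poly_power)

lemma poly_pole_poly_real: "poly pole_poly (of_real s) = of_real (pole_real s)"
 by (simp add: poly_pole_poly pole_real_def)

lemma degree_pole_poly: "degree pole_poly = pole_count"
 unfolding pole_poly_def pole_count_def
 by (subst degree_prod_eq_sum_degree) (auto simp: degree_power_eq)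

lemma pole_poly_nonzero_iff: "poly pole_poly z = 0 \<longleftrightarrow> z \<in> (\<lambda>j. of_real (pole p j)) ` {1..npoles p}"
proof -
 have "pole_order p j \<noteq> 0" if "j \<in> {1..npoles p}" for j
  using up_facts(3)[OF that] by simp
 then show ?thesis by (auto simp: poly_pole_poly)
qed

lemma pole_poly_left_nonzero: "Re z \<le> 0 \<Longrightarrow> poly pole_poly z \<noteq> 0"
proof
 assume z: "Re z \<le> 0" and "poly pole_poly z = 0"
 then obtain j where "j \<in> {1..npoles p}" "z = of_real (pole p j)" by (auto simp: pole_poly_nonzero_iff)
 then show False using pole_pos[of j] z by simp
qed

lemma pole_real_pos: "s \<le> 0 \<Longrightarrow> pole_real s > 0"
proof -
 assume s: "s \<le> 0"
 have "pole p j - s > 0" if "j \<in> {1..npoles p}" for j using pole_pos[OF that] s by linarith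
 then show ?thesis unfolding pole_real_def by (intro prod_pos ballI zero_less_power)
qed

text \<open>\<open>pole_poly\<close> times the exponent, with the denominators multiplied out
  beforehand. It is thus continuous at the poles too, where \<open>Psi_X\<close> only carries the
  value of a division by zero.\<close>

definition cleared_exponent :: "complex \<Rightarrow> complex" where
 "cleared_exponent z = poly pole_poly z * (of_real (drift p) * z + of_real ((gauss p)\<^sup>2) * z\<^sup>2
   - of_real (up_rate p) - Psi_S p z) + of_real (up_rate p) * poly (map_poly of_real (numer p)) (- z)"

lemma cleared_exponent_eq:
 assumes "poly pole_poly z \<noteq> 0"
 shows "cleared_exponent z = poly pole_poly z * Psi_X p z"
proof -
 have "Psi_X p z = of_real (drift p) * z + of_real ((gauss p)\<^sup>2) * z\<^sup>2
   + of_real (up_rate p) * (poly (map_poly of_real (numer p)) (- z) / poly pole_poly z - 1) - Psi_S p z"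
  unfolding Psi_X_def poly_pole_poly ..
 then show ?thesis using assms by (simp add: cleared_exponent_def field_simps)
qed

text \<open>The fraction is in lowest terms, so the numerator survives at a pole. Hence no zero of
  the polynomial constructed below can hide at a pole of the exponent.\<close>

lemma cleared_exponent_at_pole:
 assumes "j \<in> {1..npoles p}"
 shows "cleared_exponent (of_real (pole p j)) \<noteq> 0"
proof -
 have "poly pole_poly (of_real (pole p j)) = 0" using assms by (auto simp: pole_poly_nonzero_iff)
 moreover have "poly (map_poly of_real (numer p)) (- complex_of_real (pole p j)) = of_real (poly (numer p) (- pole p j))"
  by (metis of_real_minus poly_map_of_real)
 moreover note up_facts(1) up_facts(4)[OF assms]
 ultimately show ?thesis by (simp add: cleared_exponent_def)
qed

lemma cleared_exponent_regular:
 "continuous_on {z. Re z \<ge> 0} cleared_exponent" "cleared_exponent holomorphic_on {z. Re z > 0}"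
 unfolding cleared_exponent_def
 by (intro continuous_intros Psi_S_regular holomorphic_intros)+

lemma degree_numer: "degree (numer p) \<le> pole_count - 1" "pole_count \<ge> 1"
proof -
 show "degree (numer p) \<le> pole_count - 1" using up_facts(5) by (simp add: pole_count_def)
 have one: "1 \<in> {1..npoles p}" using up_facts(2) by simp
 then have "pole_order p 1 \<ge> 1" by (rule up_facts(3))
 moreover have "pole_order p 1 \<le> pole_count" using one unfolding pole_count_def by (intro member_le_sum) auto
 ultimately show "pole_count \<ge> 1" by simp
qed

text \<open>The two powers beyond \<open>pole_count\<close> come from the quadratic growth of the
  Gaussian term and of the bound for \<open>Psi_S\<close>.\<close>

lemma cleared_exponent_growth:
 "\<exists>C\<ge>0. \<forall>z. Re z \<ge> 0 \<longrightarrow> norm (cleared_exponent z) \<le> C * (1 + norm z) ^ (pole_count + 2)"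
proof -
 obtain C1 where C1: "C1 \<ge> 0" "\<And>z. norm (poly pole_poly z) \<le> C1 * (1 + norm z) ^ pole_count"
  using poly_growth[of pole_poly] by (auto simp: degree_pole_poly)
 obtain C2 where C2: "C2 \<ge> 0" "\<And>z. norm (poly (map_poly complex_of_real (numer p)) z) \<le> C2 * (1 + norm z) ^ degree (map_poly complex_of_real (numer p))"
  using poly_growth[of "map_poly complex_of_real (numer p)"] by auto
 obtain C3 where C3: "C3 \<ge> 0" "\<And>z. Re z \<ge> 0 \<Longrightarrow> norm (Psi_S p z) \<le> C3 * (1 + norm z)\<^sup>2"
  using Psi_S_growth by auto
 have l: "up_rate p > 0" by (rule up_facts)
 let ?D = "drift p + (gauss p)\<^sup>2 + up_rate p + C3"
 have "norm (cleared_exponent z) \<le> (C1 * ?D + up_rate p * C2) * (1 + norm z) ^ (pole_count + 2)" if z: "Re z \<ge> 0" for z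
 proof -
  let ?w = "1 + norm z"
  have w1: "1 \<le> ?w\<^sup>2" "norm z \<le> ?w\<^sup>2" "(norm z)\<^sup>2 \<le> ?w\<^sup>2" by (simp_all add: power2_eq_square algebra_simps)
  have "norm (of_real (drift p) * z + of_real ((gauss p)\<^sup>2) * z\<^sup>2 - of_real (up_rate p) - Psi_S p z)
    \<le> norm (of_real (drift p) * z) + norm (of_real ((gauss p)\<^sup>2) * z\<^sup>2) + norm (complex_of_real (up_rate p)) + norm (Psi_S p z)"
   using norm_triangle_ineq4[of "of_real (drift p) * z + of_real ((gauss p)\<^sup>2) * z\<^sup>2 - of_real (up_rate p)" "Psi_S p z"]
    norm_triangle_ineq4[of "of_real (drift p) * z + of_real ((gauss p)\<^sup>2) * z\<^sup>2" "of_real (up_rate p)"]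
    norm_triangle_ineq[of "of_real (drift p) * z" "of_real ((gauss p)\<^sup>2) * z\<^sup>2"] by linarith
  also have "\<dots> \<le> drift p * ?w\<^sup>2 + (gauss p)\<^sup>2 * ?w\<^sup>2 + up_rate p * ?w\<^sup>2 + C3 * ?w\<^sup>2"
  proof (intro add_mono)
   show "norm (of_real (drift p) * z) \<le> drift p * ?w\<^sup>2"
    using drift_nonneg w1 by (simp add: norm_mult mult_left_mono)
   show "norm (of_real ((gauss p)\<^sup>2) * z\<^sup>2) \<le> (gauss p)\<^sup>2 * ?w\<^sup>2"
    using w1 by (simp add: norm_mult norm_power mult_left_mono)
   show "norm (complex_of_real (up_rate p)) \<le> up_rate p * ?w\<^sup>2"
    using l w1 by simp
  qed (rule C3(2)[OF z])
  finally have a: "norm (of_real (drift p) * z + of_real ((gauss p)\<^sup>2) * z\<^sup>2 - of_real (up_rate p) - Psi_S p z) \<le> ?D * ?w\<^sup>2"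
   by (simp add: algebra_simps)
  have deg: "degree (map_poly complex_of_real (numer p)) \<le> pole_count + 2"
  proof -
   have "degree (map_poly complex_of_real (numer p)) \<le> degree (numer p)"
    by (rule degree_le) (simp add: coeff_map_poly coeff_eq_0)
   then show ?thesis using degree_numer by linarith
  qed
  have "norm (poly (map_poly of_real (numer p)) (- z)) \<le> C2 * ?w ^ degree (map_poly complex_of_real (numer p))"
   using C2(2)[of "- z"] by simp
  also have "\<dots> \<le> C2 * ?w ^ (pole_count + 2)"
   using C2(1) deg by (intro mult_left_mono power_increasing) auto
  finally have b: "norm (poly (map_poly of_real (numer p)) (- z)) \<le> C2 * ?w ^ (pole_count + 2)" .
  have "norm (cleared_exponent z) \<le> norm (poly pole_poly z) * norm (of_real (drift p) * z + of_real ((gauss p)\<^sup>2) * z\<^sup>2 - of_real (up_rate p) - Psi_S p z)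
    + up_rate p * norm (poly (map_poly of_real (numer p)) (- z))"
   using norm_triangle_ineq[of "poly pole_poly z * (of_real (drift p) * z + of_real ((gauss p)\<^sup>2) * z\<^sup>2 - of_real (up_rate p) - Psi_S p z)"
     "of_real (up_rate p) * poly (map_poly of_real (numer p)) (- z)"] l
   by (simp only: cleared_exponent_def norm_mult norm_of_real abs_of_pos)
  also have "\<dots> \<le> (C1 * ?w ^ pole_count) * (?D * ?w\<^sup>2) + up_rate p * (C2 * ?w ^ (pole_count + 2))"
   using C1 l a b by (intro add_mono mult_mono mult_left_mono) auto
  finally show ?thesis by (simp add: power_add algebra_simps power2_eq_square)
 qed
 moreover have "0 \<le> C1 * ?D + up_rate p * C2"
  using C1 C2 C3 l drift_nonneg by auto
 ultimately show ?thesis by blast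
qed

definition cleared_real :: "real \<Rightarrow> real" where
 "cleared_real s = pole_real s * (drift p * s + (gauss p)\<^sup>2 * s\<^sup>2 - up_rate p - Psi_S_real s)
   + up_rate p * poly (numer p) (- s)"

lemma cleared_exponent_of_real:
 assumes "0 \<le> s"
 shows "cleared_exponent (of_real s) = of_real (cleared_real s)"
proof -
 have "poly (map_poly of_real (numer p)) (- complex_of_real s) = of_real (poly (numer p) (- s))"
  by (metis of_real_minus poly_map_of_real)
 then show ?thesis
  by (simp add: cleared_exponent_def cleared_real_def poly_pole_poly_real Psi_S_of_real(1)[OF assms])
qed

lemma cleared_real_eq:
 assumes "0 \<le> s" "pole_real s \<noteq> 0"
 shows "cleared_real s = pole_real s * Re (Psi_X p (of_real s))"
proof -
 have "complex_of_real (cleared_real s) = of_real (pole_real s) * Psi_X p (of_real s)"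
  using cleared_exponent_eq[of "of_real s"] assms
  by (simp add: cleared_exponent_of_real poly_pole_poly_real)
 then have "cleared_real s = Re (of_real (pole_real s) * Psi_X p (of_real s))" by (metis Re_complex_of_real)
 then show ?thesis by simp
qed

end

section \<open>Gluing the two half-planes\<close>

context levy_path
begin

lemma inf_transform_regular:
 assumes q: "0 < q"
 shows "continuous_on {z. Re z \<ge> 0} (inf_transform q)" "inf_transform q holomorphic_on {z. Re z > 0}"
  and "Re z \<ge> 0 \<Longrightarrow> norm (inf_transform q z) \<le> 1"
  and "inf_transform q (of_real s) = of_real (\<integral>y. exp (- s * y) \<partial>inf_law q)"
proof -
 interpret I: prob_space "inf_law q" by (rule inf_law_props(1)[OF q])
 have fm: "finite_measure (inf_law q)" by unfold_locales
 note reg = laplace_measure_regular[OF fm inf_law_props(2,3)[OF q]]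
 show "continuous_on {z. Re z \<ge> 0} (inf_transform q)" "inf_transform q holomorphic_on {z. Re z > 0}"
  unfolding inf_transform_def using reg by blast+
 show "inf_transform q (of_real s) = of_real (\<integral>y. exp (- s * y) \<partial>inf_law q)"
  unfolding inf_transform_def by (rule laplace_of_real)
 show "norm (inf_transform q z) \<le> 1" if z: "Re z \<ge> 0"
 proof -
  have "norm (inf_transform q z) \<le> (\<integral>y. norm (exp (- z * complex_of_real y)) \<partial>inf_law q)"
   unfolding inf_transform_def by (rule integral_norm_bound)
  also have "\<dots> \<le> (\<integral>y. 1 \<partial>inf_law q)"
  proof (rule integral_mono_AE)
   have "AE y in inf_law q. 0 \<le> y"
    using inf_law_props(2,3)[OF q] by (intro AE_I[of _ _ "{..<0}"]) auto
   then show "AE y in inf_law q. norm (exp (- z * complex_of_real y)) \<le> 1"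
    by eventually_elim (use z in \<open>simp add: norm_exp_eq_Re\<close>)
   show "integrable (inf_law q) (\<lambda>y. norm (exp (- z * complex_of_real y)))"
    by (rule integrable_norm[OF reg(3)[OF z]])
  qed auto
  finally show ?thesis by (simp add: I.prob_space)
 qed
qed

lemma exc_transform_regular:
 assumes q: "0 < q"
 shows "continuous_on {z. Re z \<le> 0} (exc_transform q)" "exc_transform q holomorphic_on {z. Re z < 0}"
  and "Re z \<le> 0 \<Longrightarrow> norm (exc_transform q z) \<le> 1"
  and "exc_transform q (of_real s) = of_real (\<integral>y. exp (s * y) \<partial>exc_law q)"
  and "exc_transform q 0 = 1"
proof -
 interpret I: prob_space "exc_law q" by (rule exc_law_props(1)[OF q])
 have fm: "finite_measure (exc_law q)" by unfold_locales
 define L where "L z = (\<integral>y. exp (- z * complex_of_real y) \<partial>exc_law q)" for z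
 note reg = laplace_measure_regular[OF fm exc_law_props(2,3)[OF q], folded L_def]
 have eq: "exc_transform q z = L (- z)" for z by (simp add: exc_transform_def L_def)
 have "continuous_on {z. Re z \<le> 0} (\<lambda>z. L (- z))"
  by (rule continuous_on_compose2[OF reg(1)]) (auto intro: continuous_intros)
 then show "continuous_on {z. Re z \<le> 0} (exc_transform q)" by (simp add: eq[abs_def])
 have "(L \<circ> uminus) holomorphic_on {z. Re z < 0}"
  by (rule holomorphic_on_compose_gen[OF _ reg(2)]) (auto intro: holomorphic_intros)
 then show "exc_transform q holomorphic_on {z. Re z < 0}" by (simp add: eq[abs_def] comp_def)
 show "exc_transform q (of_real s) = of_real (\<integral>y. exp (s * y) \<partial>exc_law q)"
  using laplace_of_real[where r = "- s" and N = "exc_law q"] by (simp add: exc_transform_def)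
 show "exc_transform q 0 = 1" by (simp add: exc_transform_def I.prob_space)
 show "norm (exc_transform q z) \<le> 1" if z: "Re z \<le> 0"
 proof -
  have "norm (exc_transform q z) \<le> (\<integral>y. norm (exp (z * complex_of_real y)) \<partial>exc_law q)"
   unfolding exc_transform_def by (rule integral_norm_bound)
  also have "\<dots> \<le> (\<integral>y. 1 \<partial>exc_law q)"
  proof (rule integral_mono_AE)
   have "AE y in exc_law q. 0 \<le> y"
    using exc_law_props(2,3)[OF q] by (intro AE_I[of _ _ "{..<0}"]) auto
   then show "AE y in exc_law q. norm (exp (z * complex_of_real y)) \<le> 1"
    by eventually_elim (use z in \<open>simp add: norm_exp_eq_Re mult_nonpos_nonneg\<close>)
   show "integrable (exc_law q) (\<lambda>y. norm (exp (z * complex_of_real y)))"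
    using integrable_norm[OF laplace_measure_regular(3)[OF fm exc_law_props(2,3)[OF q], of "- z"]] z
    by (simp only: minus_minus uminus_complex.sel neg_0_le_iff_le)
  qed auto
  finally show ?thesis by (simp add: I.prob_space)
 qed
qed

end

context model_setting
begin

lemma inf_transform_nonzero: "0 < q \<Longrightarrow> Re z \<ge> 0 \<Longrightarrow> inf_transform q z \<noteq> 0"
 using wiener_hopf(2)[of q z] by auto

lemma exc_transform_nonzero: "0 < q \<Longrightarrow> Re z \<le> 0 \<Longrightarrow> exc_transform q z \<noteq> 0"
 using wiener_hopf(3)[of q z] by auto

text \<open>The factorization identity on the imaginary axis glues two functions that are holomorphic on the
 two half-planes to an entire function of polynomial growth, that is, to a polynomial.\<close>

lemma entire_factor:
 assumes q: "0 < q"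
 obtains g :: "complex poly" where
  "\<And>z. Re z \<ge> 0 \<Longrightarrow> poly g z = inf_transform q z * (of_real q * poly V.pole_poly z - V.cleared_exponent z)"
  "\<And>z. Re z \<le> 0 \<Longrightarrow> poly g z * exc_transform q z = of_real q * poly V.pole_poly z"
proof -
 define fr where "fr z = inf_transform q z * (of_real q * poly V.pole_poly z - V.cleared_exponent z)" for z
 define fl where "fl z = of_real q * poly V.pole_poly z / exc_transform q z" for z
 define G where "G z = (if Re z \<ge> 0 then fr z else fl z)" for z
 have agree: "fr z = fl z" if z: "Re z = 0" for z
 proof -
  have P: "poly V.pole_poly z \<noteq> 0" using V.pole_poly_left_nonzero z by simp
  have "fr z * exc_transform q z = poly V.pole_poly z * (inf_transform q z * exc_transform q z * (of_real q - Psi_X p z))"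
   by (simp add: fr_def V.cleared_exponent_eq[OF P] algebra_simps)
  also have "\<dots> = of_real q * poly V.pole_poly z" using wiener_hopf(1)[OF q z] by simp
  finally show ?thesis using exc_transform_nonzero[OF q, of z] z by (simp add: fl_def field_simps)
 qed
 have cr: "continuous_on {z. Re z \<ge> 0} fr"
  unfolding fr_def by (intro continuous_intros inf_transform_regular q V.cleared_exponent_regular)
 have cl: "continuous_on {z. Re z \<le> 0} fl"
  unfolding fl_def using exc_transform_nonzero[OF q] by (intro continuous_intros exc_transform_regular q) auto
 have "continuous_on ({z. Re z \<ge> 0} \<union> {z. Re z \<le> 0}) G"
  unfolding G_def
  by (rule continuous_on_cases[OF _ _ cr cl]) (use agree in \<open>auto simp: closed_halfspace_Re_ge closed_halfspace_Re_le\<close>)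
 moreover have "{z. Re z \<ge> 0} \<union> {z. Re z \<le> 0} = UNIV" by auto
 ultimately have cG: "continuous_on UNIV G" by simp
 have hr: "fr holomorphic_on {z. Re z > 0}"
  unfolding fr_def by (intro holomorphic_intros inf_transform_regular q V.cleared_exponent_regular)
 have hl: "fl holomorphic_on {z. Re z < 0}"
  unfolding fl_def using exc_transform_nonzero[OF q]
  by (intro holomorphic_intros exc_transform_regular q) auto
 have hG: "G holomorphic_on UNIV"
 proof (rule holomorphic_on_paste_across_line[where d = 1 and k = 0])
  have "G holomorphic_on {z. Re z < 0}" by (rule holomorphic_transform[OF hl]) (auto simp: G_def)
  then show "G holomorphic_on (UNIV \<inter> {z. 1 \<bullet> z < 0})" by (simp add: inner_complex_def)
  have "G holomorphic_on {z. Re z > 0}" by (rule holomorphic_transform[OF hr]) (auto simp: G_def)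
  then show "G holomorphic_on (UNIV \<inter> {z. 0 < 1 \<bullet> z})" by (simp add: inner_complex_def)
 qed (use cG in auto)
 obtain C1 where C1: "C1 \<ge> 0" "\<And>z. norm (poly V.pole_poly z) \<le> C1 * (1 + norm z) ^ V.pole_count"
  using poly_growth[of V.pole_poly] by (auto simp: V.degree_pole_poly)
 obtain C2 where C2: "C2 \<ge> 0" "\<And>z. Re z \<ge> 0 \<Longrightarrow> norm (V.cleared_exponent z) \<le> C2 * (1 + norm z) ^ (V.pole_count + 2)"
  using V.cleared_exponent_growth by auto
 \<comment> \<open>The constant of the lower bound for \<open>exc_transform\<close>: the reciprocal
   grows at most linearly in the left half-plane, one power beyond \<open>pole_poly\<close>.\<close>
 define K where "K = 1 / norm (exc_transform q (- 1)) - 1"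
 have K0: "K \<ge> 0"
  using exc_transform_regular(3)[OF q, of "- 1"] exc_transform_nonzero[OF q, of "- 1"]
  by (simp add: K_def le_divide_eq)
 have bound: "norm (G z) \<le> (q * C1 * (1 + 4 * K) + C2) * (1 + norm z) ^ (V.pole_count + 2)" for z
 proof -
  let ?w = "1 + norm z"
  have pw: "?w ^ V.pole_count \<le> ?w ^ (V.pole_count + 2)" "?w ^ (V.pole_count + 1) \<le> ?w ^ (V.pole_count + 2)"
   by (intro power_increasing; simp)+
  have P: "norm (of_real q * poly V.pole_poly z) \<le> q * C1 * ?w ^ V.pole_count"
   using C1(2)[of z] q by (simp add: norm_mult mult_left_mono)
  show ?thesis
  proof (cases "Re z \<ge> 0")
   case True
   have "norm (G z) \<le> 1 * norm (of_real q * poly V.pole_poly z - V.cleared_exponent z)"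
    using mult_right_mono[OF inf_transform_regular(3)[OF q True] norm_ge_zero]
    by (simp only: G_def fr_def if_True norm_mult True)
   also have "\<dots> \<le> norm (of_real q * poly V.pole_poly z) + norm (V.cleared_exponent z)"
    by (simp add: norm_triangle_ineq4)
   also have "\<dots> \<le> q * C1 * ?w ^ (V.pole_count + 2) + C2 * ?w ^ (V.pole_count + 2)"
   proof (rule add_mono[OF order.trans[OF P mult_left_mono[OF pw(1)]] C2(2)[OF True]])
    show "0 \<le> q * C1" using q C1(1) by simp
   qed
   also have "\<dots> \<le> (q * C1 * (1 + 4 * K) + C2) * ?w ^ (V.pole_count + 2)"
   proof -
    have "0 \<le> q * C1 * (4 * K) * ?w ^ (V.pole_count + 2)" using q C1(1) K0 by simp
    then show ?thesis by (simp add: algebra_simps)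
   qed
   finally show ?thesis .
  next
   case False
   then have z: "Re z \<le> 0" by simp
   have e: "1 \<le> norm (exc_transform q z) * (1 + 4 * max 1 (norm z) * K)"
    using wiener_hopf(3)[OF q z] by (simp add: K_def)
   have ne: "norm (exc_transform q z) > 0" using exc_transform_nonzero[OF q z] by simp
   have "norm (G z) = norm (of_real q * poly V.pole_poly z) / norm (exc_transform q z)"
    using False by (simp add: G_def fl_def norm_divide)
   also have "\<dots> \<le> norm (of_real q * poly V.pole_poly z) * (1 + 4 * max 1 (norm z) * K)"
    using mult_left_mono[OF e, of "norm (of_real q * poly V.pole_poly z)"] ne
    by (simp add: divide_le_eq mult_ac)
   also have "\<dots> \<le> (q * C1 * ?w ^ V.pole_count) * ((1 + 4 * K) * ?w)"
   proof (rule mult_mono[OF P])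
    have "max 1 (norm z) * K \<le> ?w * K" using K0 by (intro mult_right_mono) auto
    moreover have "(1 + 4 * K) * ?w = ?w + 4 * (?w * K)" by (simp add: algebra_simps)
    moreover have "1 \<le> ?w" by simp
    ultimately show "1 + 4 * max 1 (norm z) * K \<le> (1 + 4 * K) * ?w"
     unfolding mult.assoc by linarith
   qed (use q C1(1) K0 in auto)
   also have "\<dots> = q * C1 * (1 + 4 * K) * ?w ^ (V.pole_count + 1)" by simp
   also have "\<dots> \<le> q * C1 * (1 + 4 * K) * ?w ^ (V.pole_count + 2)"
    using q C1(1) K0 by (intro mult_left_mono pw) auto
   also have "\<dots> \<le> (q * C1 * (1 + 4 * K) + C2) * ?w ^ (V.pole_count + 2)"
    using C2(1) by (intro mult_right_mono) auto
   finally show ?thesis .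
  qed
 qed
 obtain g where g: "\<And>z. poly g z = G z"
  using entire_poly_growth_imp_poly[OF hG bound] by blast
 show thesis
 proof (rule that)
  show "poly g z = inf_transform q z * (of_real q * poly V.pole_poly z - V.cleared_exponent z)" if "Re z \<ge> 0" for z
   using that by (simp add: g G_def fr_def)
  show "poly g z * exc_transform q z = of_real q * poly V.pole_poly z" if "Re z \<le> 0" for z
  proof -
   have "poly g z = fl z" using that agree[of z] by (auto simp: g G_def)
   then show ?thesis using exc_transform_nonzero[OF q that] by (simp add: fl_def)
  qed
 qed
qed

text \<open>\<open>g\<close> vanishes exactly at the roots with their multiplicities, so it is a
  constant times the numerator of \<open>kappa_pos p q (- s)\<close>, and its value at 0 identifies
  the constant as \<open>a_coef p q\<close>. The bound in terms of the size of the roots prepares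
  the limit of vanishing rate, where it keeps the leading coefficient from tending to 0.\<close>

lemma root_polynomial:
 assumes q: "0 < q"
 shows "\<exists>g :: real poly. (degree g = V.pole_count \<or> degree g = Suc V.pole_count) \<and>
  a_coef p q = (- 1) ^ degree g * lead_coeff g \<and> 0 < a_coef p q \<and>
  (\<forall>s. kappa_pos p q (- s) = poly g s / (a_coef p q * V.pole_real s)) \<and>
  (\<forall>s\<ge>0. poly g s = (\<integral>y. exp (- s * y) \<partial>inf_law q) * (q * V.pole_real s - V.cleared_real s)) \<and>
  poly g 0 = q * V.pole_real 0 \<and>
  (\<forall>R. (\<forall>b\<in>roots p q. norm b \<le> R) \<longrightarrow> (\<forall>s\<ge>0. \<bar>poly g s\<bar> \<le> a_coef p q * (R + s) ^ degree g))"
proof -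
 obtain g where gr: "\<And>z. Re z \<ge> 0 \<Longrightarrow> poly g z = inf_transform q z * (of_real q * poly V.pole_poly z - V.cleared_exponent z)"
  and gl: "\<And>z. Re z \<le> 0 \<Longrightarrow> poly g z * exc_transform q z = of_real q * poly V.pole_poly z"
  using entire_factor[OF q] by blast
 have exc_ne: "exc_transform q z \<noteq> 0" if "Re z \<le> 0" for z by (rule exc_transform_nonzero[OF q that])
 have gl': "poly g z = of_real q * poly V.pole_poly z / exc_transform q z" if "Re z \<le> 0" for z
  using gl[OF that] exc_ne[OF that] by (simp add: field_simps)
 have g0: "poly g 0 = of_real (q * V.pole_real 0)"
  using gl[of 0] exc_transform_regular(5)[OF q] V.poly_pole_poly_real[of 0] by simp
 have g_ne: "g \<noteq> 0" using g0 V.pole_real_pos[of 0] q by auto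

 \<comment> \<open>On the nonpositive axis \<open>g\<close> is a quotient of positive numbers.
   Together with the values on the other half this makes the coefficients real; it also fixes the
   sign of the leading one.\<close>
 have real_pos: "\<exists>r>0. poly g (of_real s) = of_real r" if "s \<le> 0" for s
 proof -
  have "0 < (\<integral>y. exp (- (- s) * y) \<partial>exc_law q)"
   by (rule laplace_pos[OF exc_law_props[OF q]]) (use that in simp)
  then have e: "0 < (\<integral>y. exp (s * y) \<partial>exc_law q)" by simp
  have "poly g (of_real s) = of_real (q * V.pole_real s / (\<integral>y. exp (s * y) \<partial>exc_law q))"
   using gl'[of "of_real s"] that by (simp add: V.poly_pole_poly_real exc_transform_regular(4)[OF q])
  then show ?thesis using e V.pole_real_pos[OF that] q by (metis divide_pos_pos mult_pos_pos)
 qed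
 have right: "poly g (of_real s) = of_real ((\<integral>y. exp (- s * y) \<partial>inf_law q) * (q * V.pole_real s - V.cleared_real s))"
  if "s \<ge> 0" for s
  using gr[of "of_real s"] that
  by (simp add: V.poly_pole_poly_real V.cleared_exponent_of_real inf_transform_regular(4)[OF q])
 have real: "poly g (of_real s) \<in> \<real>" for s
  using real_pos[of s] right[of s] by (cases "s \<le> 0") auto
 define h where "h = map_poly Re g"
 note hg = real_poly_of_complex[OF real, folded h_def]
 have ch: "coeff g i = of_real (coeff h i)" for i
  using hg(1) by (metis coeff_map_poly of_real_0)
 have deg: "degree h = degree g"
 proof (rule order_antisym)
  show "degree h \<le> degree g" by (rule degree_le) (metis ch coeff_eq_0 of_real_eq_0_iff)
  show "degree g \<le> degree h" by (rule degree_le) (simp add: ch coeff_eq_0)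
 qed
 have lc: "lead_coeff g = of_real (lead_coeff h)" by (simp add: ch deg)

 \<comment> \<open>The reciprocal of \<open>exc_transform\<close> adds at most one to the degree of
   \<open>pole_poly\<close>.\<close>
 have upper: "degree g \<le> Suc V.pole_count"
 proof -
  obtain C1 where C1: "C1 \<ge> 0" "\<And>z. norm (poly V.pole_poly z) \<le> C1 * (1 + norm z) ^ V.pole_count"
   using poly_growth[of V.pole_poly] by (auto simp: V.degree_pole_poly)
  define K where "K = 1 / norm (exc_transform q (- 1)) - 1"
  have K0: "K \<ge> 0"
   using exc_transform_regular(3)[OF q, of "- 1"] exc_ne[of "- 1"] by (simp add: K_def le_divide_eq)
  show ?thesis
  proof (rule degree_le_of_bound[where C = "q * (C1 * 2 ^ V.pole_count) * (1 + 4 * K)"])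
   fix t :: real assume t: "t \<ge> 1"
   let ?z = "- complex_of_real t"
   have "1 \<le> norm (exc_transform q ?z) * (1 + 4 * max 1 (norm ?z) * K)"
    using wiener_hopf(3)[OF q, of ?z] t by (simp add: K_def)
   then have e: "1 \<le> norm (exc_transform q ?z) * (1 + 4 * t * K)" using t by simp
   have ne: "norm (exc_transform q ?z) > 0" using exc_ne[of ?z] t by simp
   have "norm (poly V.pole_poly ?z) \<le> C1 * (1 + t) ^ V.pole_count" using C1(2)[of ?z] t by simp
   also have "\<dots> \<le> C1 * (2 * t) ^ V.pole_count" using C1(1) t by (intro mult_left_mono power_mono) auto
   finally have P: "norm (poly V.pole_poly ?z) \<le> C1 * 2 ^ V.pole_count * t ^ V.pole_count"
    by (simp add: power_mult_distrib)
   have "norm (poly g ?z) = q * norm (poly V.pole_poly ?z) / norm (exc_transform q ?z)"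
    using gl'[of ?z] t q by (simp add: norm_divide norm_mult)
   also have "\<dots> \<le> q * norm (poly V.pole_poly ?z) * (1 + 4 * t * K)"
    using mult_left_mono[OF e, of "q * norm (poly V.pole_poly ?z)"] ne q by (simp add: divide_le_eq mult_ac)
   also have "\<dots> \<le> q * (C1 * 2 ^ V.pole_count * t ^ V.pole_count) * ((1 + 4 * K) * t)"
    using P q t K0 C1(1) by (intro mult_mono mult_left_mono) (auto simp: algebra_simps)
   finally show "norm (poly g ?z) \<le> q * (C1 * 2 ^ V.pole_count) * (1 + 4 * K) * t ^ Suc V.pole_count"
    by (simp add: mult_ac)
  qed
 qed
 \<comment> \<open>Conversely, \<open>exc_transform\<close> is at most 1 in modulus, so
   \<open>g\<close> dominates \<open>q * pole_poly\<close>.\<close>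
 have lower: "V.pole_count \<le> degree g"
 proof -
  obtain C where C: "C \<ge> 0" "\<And>z. norm (poly g z) \<le> C * (1 + norm z) ^ degree g" using poly_growth[of g] by auto
  have "degree V.pole_poly \<le> degree g"
  proof (rule degree_le_of_bound[where C = "C * 2 ^ degree g / q"])
   fix t :: real assume t: "t \<ge> 1"
   let ?z = "- complex_of_real t"
   have "q * norm (poly V.pole_poly ?z) = norm (poly g ?z) * norm (exc_transform q ?z)"
    using arg_cong[OF gl[of ?z], of norm] t q by (simp add: norm_mult)
   also have "\<dots> \<le> norm (poly g ?z)"
    using exc_transform_regular(3)[OF q, of ?z] t by (intro mult_left_le) auto
   also have "\<dots> \<le> C * (1 + t) ^ degree g" using C(2)[of ?z] t by simp
   also have "\<dots> \<le> C * (2 * t) ^ degree g" using C(1) t by (intro mult_left_mono power_mono) auto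
   finally show "norm (poly V.pole_poly ?z) \<le> C * 2 ^ degree g / q * t ^ degree g"
    using q by (simp add: field_simps power_mult_distrib)
  qed
  then show ?thesis by (simp add: V.degree_pole_poly)
 qed

 \<comment> \<open>For \<open>Re z \<le> 0\<close> the product with \<open>exc_transform\<close>
   equals \<open>q * pole_poly\<close>, which has no zero there; for \<open>Re z > 0\<close> the
   factor \<open>inf_transform\<close> is nonzero, so that only \<open>Psi_X p z = q\<close>
   remains.\<close>
 have zeros: "{z. poly g z = 0} = roots p q"
 proof (intro set_eqI iffI)
  fix z assume "z \<in> {z. poly g z = 0}"
  then have z: "poly g z = 0" by simp
  have Re: "Re z > 0"
  proof (rule ccontr)
   assume "\<not> Re z > 0"
   then show False using gl[of z] z V.pole_poly_left_nonzero[of z] q by simp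
  qed
  then have e: "of_real q * poly V.pole_poly z = V.cleared_exponent z"
   using gr[of z] z inf_transform_nonzero[OF q, of z] by simp
  have P: "poly V.pole_poly z \<noteq> 0"
  proof
   assume P: "poly V.pole_poly z = 0"
   then obtain j where j: "j \<in> {1..npoles p}" "z = of_real (pole p j)"
    by (auto simp: V.pole_poly_nonzero_iff)
   show False using e P V.cleared_exponent_at_pole[OF j(1)] j(2) by simp
  qed
  then have "Psi_X p z = of_real q" using e V.cleared_exponent_eq[OF P] by (simp add: mult.commute)
  then show "z \<in> roots p q" using Re P by (simp add: roots_def V.pole_poly_nonzero_iff)
 next
  fix z assume "z \<in> roots p q"
  then have "Re z > 0" "poly V.pole_poly z \<noteq> 0" "Psi_X p z = of_real q"
   by (auto simp: roots_def V.pole_poly_nonzero_iff)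
  then show "z \<in> {z. poly g z = 0}" using gr[of z] V.cleared_exponent_eq[of z] by simp
 qed
 \<comment> \<open>Near a root, \<open>g\<close> is \<open>Psi_X - q\<close> times the factor
   \<open>- pole_poly * inf_transform\<close>, which is holomorphic and nonzero, so the orders
   agree.\<close>
 have mult: "root_mult p q b = order b g" if b: "b \<in> roots p q" for b
 proof -
  obtain g1 where g1: "g = [:- b, 1:] ^ order b g * g1" "\<not> [:- b, 1:] dvd g1"
   using order_decomp[OF g_ne] by blast
  have g1b: "poly g1 b \<noteq> 0" using g1(2) by (simp add: poly_eq_0_iff_dvd)
  let ?S = "{z. Re z > 0} \<inter> - ((\<lambda>j. of_real (pole p j)) ` {1..npoles p})"
  have S: "open ?S" by (intro open_Int open_right_halfplane open_Compl finite_imp_closed) auto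
  have SP: "poly V.pole_poly w \<noteq> 0" if "w \<in> ?S" for w using that by (auto simp: V.pole_poly_nonzero_iff)
  have Sinf: "inf_transform q w \<noteq> 0" if "w \<in> ?S" for w using that inf_transform_nonzero[OF q, of w] by auto
  have "zorder (\<lambda>z. Psi_X p z - of_real q) b = int (order b g)"
  proof (rule zorder_eqI[OF S, where g = "\<lambda>w. - poly g1 w / (poly V.pole_poly w * inf_transform q w)"])
   show bS: "b \<in> ?S" using b by (auto simp: roots_def)
   show "(\<lambda>w. - poly g1 w / (poly V.pole_poly w * inf_transform q w)) holomorphic_on ?S"
    using SP Sinf
    by (intro holomorphic_intros holomorphic_on_subset[OF inf_transform_regular(2)[OF q]]) auto
   show "- poly g1 b / (poly V.pole_poly b * inf_transform q b) \<noteq> 0" using g1b SP[OF bS] Sinf[OF bS] by simp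
   show "Psi_X p w - of_real q = - poly g1 w / (poly V.pole_poly w * inf_transform q w) * (w - b) powi int (order b g)"
    if "w \<in> ?S" "w \<noteq> b" for w
   proof -
    have "poly g w = (w - b) ^ order b g * poly g1 w"
     by (subst g1(1)) (simp add: poly_power)
    moreover have "poly g w = - (Psi_X p w - of_real q) * (poly V.pole_poly w * inf_transform q w)"
     using gr[of w] that(1) V.cleared_exponent_eq[OF SP[OF that(1)]] by (simp add: algebra_simps)
    ultimately show ?thesis using SP[OF that(1)] Sinf[OF that(1)] by (simp add: field_simps)
   qed
  qed
  then show ?thesis by (simp add: root_mult_def)
 qed
 define D where "D z = (\<Prod>b\<in>roots p q. (b - z) ^ root_mult p q b)" for z
 have decomp: "smult (lead_coeff g) (\<Prod>b\<in>roots p q. [:- b, 1:] ^ root_mult p q b) = g"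
 proof -
  have "(\<Prod>b\<in>roots p q. [:- b, 1:] ^ root_mult p q b) = (\<Prod>b\<in>roots p q. [:- b, 1:] ^ order b g)"
   by (intro prod.cong refl) (simp add: mult)
  then show ?thesis using complex_poly_decompose[of g] zeros by simp
 qed
 have deg_sum: "degree g = (\<Sum>b\<in>roots p q. root_mult p q b)"
 proof -
  have "degree g = degree (\<Prod>b\<in>roots p q. [:- b, 1:] ^ root_mult p q b)"
   using g_ne by (subst decomp[symmetric]) simp
  also have "\<dots> = (\<Sum>b\<in>roots p q. root_mult p q b)"
   by (subst degree_prod_eq_sum_degree) (auto simp: degree_power_eq)
  finally show ?thesis .
 qed
 \<comment> \<open>The sign converts the factors \<open>z - b\<close> of a monic polynomial into the
   factors \<open>b - z\<close> of \<open>D\<close>.\<close>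
 define a where "a = (- 1) ^ degree h * lead_coeff h"
 have gD: "poly g z = of_real a * D z" for z
 proof -
  have "poly g z = lead_coeff g * (\<Prod>b\<in>roots p q. (z - b) ^ root_mult p q b)"
   by (subst decomp[symmetric]) (simp add: poly_prod poly_power)
  also have "(\<Prod>b\<in>roots p q. (z - b) ^ root_mult p q b) = (\<Prod>b\<in>roots p q. (- 1) ^ root_mult p q b * (b - z) ^ root_mult p q b)"
   by (intro prod.cong refl) (metis minus_diff_eq power_minus)
  also have "\<dots> = (- 1) ^ degree g * D z"
   by (simp add: prod.distrib D_def deg_sum power_sum)
  finally show ?thesis by (simp add: a_def lc deg)
 qed
 have a_ne: "a \<noteq> 0" using g_ne deg lc by (auto simp: a_def)
 have a_pos: "a > 0"
 proof -
  have inf: "filterlim (\<lambda>t. - t :: real) at_infinity at_top"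
   by (simp add: filterlim_at_infinity_conv_norm_at_top filterlim_abs_real)
  have "((\<lambda>t. poly h (- t) / (- t) ^ degree h) \<longlongrightarrow> lead_coeff h) at_top"
   by (rule filterlim_compose[OF poly_divide_tendsto_aux inf])
  then have "((\<lambda>t. (- 1) ^ degree h * (poly h (- t) / (- t) ^ degree h)) \<longlongrightarrow> a) at_top"
   unfolding a_def by (intro tendsto_mult tendsto_const)
  moreover have "\<forall>\<^sub>F t in at_top. 0 \<le> (- 1) ^ degree h * (poly h (- t) / (- t) ^ degree h)"
   using eventually_ge_at_top[of 1]
  proof eventually_elim
   case (elim t)
   obtain r where "r > 0" "poly g (of_real (- t)) = of_real r" using real_pos[of "- t"] elim by auto
   then have "poly h (- t) > 0" using hg(2)[of "- t"] by (metis of_real_eq_iff)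
   moreover have "(- 1) ^ degree h * (poly h (- t) / (- t) ^ degree h) = poly h (- t) / t ^ degree h"
    by (cases "even (degree h)") auto
   ultimately show ?case using elim by simp
  qed
  ultimately have "0 \<le> a" by (intro tendsto_lowerbound) auto
  then show ?thesis using a_ne by simp
 qed
 have Dr: "D (of_real s) = of_real (poly h s / a)" for s
  using gD[of "of_real s"] hg(2)[of s] a_ne by (simp add: field_simps)
 have kap: "kappa_pos p q (- s) = poly h s / (a * V.pole_real s)" for s
 proof -
  have "kappa_pos p q (- s) = Re (D (of_real s)) / V.pole_real s"
   by (simp add: kappa_pos_def D_def V.pole_real_def)
  then show ?thesis by (simp add: Dr)
 qed
 have h0: "poly h 0 = q * V.pole_real 0"
  using g0 hg(2)[of 0] by (metis of_real_0 of_real_eq_iff)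
 have "kappa_pos p q 0 = q / a"
  using kap[of 0] V.pole_real_pos[of 0] by (simp add: h0)
 then have ac: "a_coef p q = a" using q by (simp add: a_coef_def kappa_def)
 have rootbound: "\<bar>poly h s\<bar> \<le> a * (R + s) ^ degree h" if R: "\<forall>b\<in>roots p q. norm b \<le> R" and s: "s \<ge> 0" for R s
 proof -
  have "\<bar>poly h s\<bar> = norm (poly g (of_real s))" by (simp add: hg(2))
  also have "\<dots> = a * (\<Prod>b\<in>roots p q. norm (b - of_real s) ^ root_mult p q b)"
   using a_pos by (simp add: gD D_def norm_mult prod_norm[symmetric] norm_power)
  also have "\<dots> \<le> a * (\<Prod>b\<in>roots p q. (R + s) ^ root_mult p q b)"
  proof (intro mult_left_mono prod_mono conjI power_mono)
   show "norm (b - of_real s) \<le> R + s" if "b \<in> roots p q" for b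
    using norm_triangle_ineq4[of b "of_real s"] R that s by (auto intro: order.trans)
  qed (use a_pos in auto)
  also have "(\<Prod>b\<in>roots p q. (R + s) ^ root_mult p q b) = (R + s) ^ degree h"
   by (simp add: deg deg_sum power_sum)
  finally show ?thesis .
 qed
 show ?thesis
 proof (intro exI[of _ h] conjI allI impI)
  show "degree h = V.pole_count \<or> degree h = Suc V.pole_count" using upper lower deg by linarith
  show "poly h s = (\<integral>y. exp (- s * y) \<partial>inf_law q) * (q * V.pole_real s - V.cleared_real s)" if "0 \<le> s" for s
   using right[OF that] hg(2)[of s] by (metis of_real_eq_iff)
 qed (use ac a_pos kap h0 rootbound in \<open>auto simp: a_def\<close>)
qed

end

section \<open>Growth of the exponent\<close>

context valid_model
begin

lemma up_transform_tendsto_0: "((\<lambda>z. up_transform (- z)) \<longlongrightarrow> 0) at_infinity"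
proof -
 let ?N = "map_poly complex_of_real (numer p) \<circ>\<^sub>p [:0, - 1:]"
 have "degree (map_poly complex_of_real (numer p)) \<le> degree (numer p)"
  by (rule degree_le) (simp add: coeff_map_poly coeff_eq_0)
 then have "degree ?N < degree pole_poly"
  using degree_numer by (simp add: degree_pole_poly degree_pcompose)
 from poly_divide_tendsto_0_at_infinity[OF this]
 show ?thesis by (simp add: poly_pcompose up_transform_def poly_pole_poly)
qed

lemma up_transform_small: "\<exists>R. \<forall>z. R \<le> norm z \<longrightarrow> norm (up_transform (- z)) \<le> 1 / 2"
proof -
 have "\<forall>\<^sub>F z in at_infinity. dist (up_transform (- z)) 0 < 1 / 2"
  by (rule tendstoD[OF up_transform_tendsto_0]) simp
 then obtain R where "\<And>z. R \<le> norm z \<Longrightarrow> dist (up_transform (- z)) 0 < 1 / 2"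
  unfolding eventually_at_infinity by blast
 then show ?thesis by (intro exI[of _ R]) (auto intro: less_imp_le)
qed

lemma norm_one_minus_exp_bound:
 assumes "Re z \<ge> 0" "0 \<le> x"
 shows "norm (1 - exp (- z * of_real x)) \<le> 2" "norm (1 - exp (- z * of_real x)) \<le> norm z * x"
proof -
 have "norm (exp (- z * of_real x)) \<le> 1" using assms by (simp add: norm_exp_eq_Re)
 then show "norm (1 - exp (- z * of_real x)) \<le> 2"
  using norm_triangle_ineq4[of 1 "exp (- z * of_real x)"] by (simp only: norm_one)
 show "norm (1 - exp (- z * of_real x)) \<le> norm z * x"
  using norm_exp_diff_le[of 0 "- z * of_real x"] assms by (simp add: norm_mult)
qed

section \<open>Bounded and unbounded variation of the downward jumps\<close>

definition bounded_variation :: bool where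
 "bounded_variation \<longleftrightarrow> (\<integral>\<^sup>+x. ennreal (min 1 x) \<partial>\<nu>) < \<infinity>"

lemma integrable_min_1:
 assumes bounded_variation
 shows "integrable \<nu> (\<lambda>x. min 1 x)"
proof -
 have "integrable \<nu> (\<lambda>x. max 0 (min 1 x))"
 proof (rule integrableI_nonneg)
  have "(\<integral>\<^sup>+x. ennreal (max 0 (min 1 x)) \<partial>\<nu>) = (\<integral>\<^sup>+x. ennreal (min 1 x) \<partial>\<nu>)"
   by (intro nn_integral_cong) (simp add: max_def ennreal_neg)
  then show "(\<integral>\<^sup>+x. ennreal (max 0 (min 1 x)) \<partial>\<nu>) < \<infinity>"
   using assms by (simp add: bounded_variation_def)
 qed auto
 then show ?thesis
  by (rule integrable_cong_AE_imp) (use AE_nu in \<open>auto simp: max_def elim!: eventually_mono\<close>)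
qed

lemma one_minus_exp_le_min:
 assumes "Re z \<ge> 0" "0 < x"
 shows "norm (1 - exp (- z * of_real x)) \<le> (2 + norm z) * min 1 x"
proof (cases "x \<le> 1")
 case True
 have m: "min 1 x = x" using True by simp
 have "norm (1 - exp (- z * of_real x)) \<le> norm z * x"
  using assms by (intro norm_one_minus_exp_bound) auto
 also have "\<dots> \<le> (2 + norm z) * x" using assms by (intro mult_right_mono) auto
 finally show ?thesis by (simp only: m)
next
 case False
 then have m: "min 1 x = 1" by simp
 have "norm (1 - exp (- z * of_real x)) \<le> 2" using assms by (intro norm_one_minus_exp_bound) auto
 also have "2 \<le> 2 + norm z" by simp
 finally show ?thesis by (simp only: m mult_1_right)
qed

lemma integrable_one_minus_exp:
 assumes bv: bounded_variation and z: "Re z \<ge> 0"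
 shows "integrable \<nu> (\<lambda>x. 1 - exp (- z * of_real x))"
proof (rule Bochner_Integration.integrable_bound)
 show "integrable \<nu> (\<lambda>x. (2 + norm z) * min 1 x)" by (intro integrable_mult_right integrable_min_1 bv)
 show "AE x in \<nu>. norm (1 - exp (- z * of_real x)) \<le> norm ((2 + norm z) * min 1 x)"
  using AE_nu
 proof eventually_elim
  case (elim x)
  have "0 \<le> (2 + norm z) * min 1 x" using elim by simp
  then show ?case using one_minus_exp_le_min[OF z elim] by (simp only: real_norm_def abs_of_nonneg)
 qed
qed simp

text \<open>With bounded variation the truncation term is a linear drift: \<open>S\<close> drifts by
  \<open>- jump_drift\<close> and \<open>X\<close> by \<open>drift p + jump_drift\<close>, both
  summands being nonnegative.\<close>

definition jump_drift :: real where
 "jump_drift = (\<integral>x. x * trunc p x \<partial>\<nu>)"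

lemma Psi_S_bounded_variation:
 assumes bv: bounded_variation and z: "Re z \<ge> 0"
 shows "Psi_S p z = G_S p z - z * of_real jump_drift"
proof -
 have one: "integrable \<nu> (\<lambda>x. 1 - exp (- x))"
 proof -
  have "integrable \<nu> (\<lambda>x. Re (1 - exp (- 1 * complex_of_real x)))"
   by (rule integrable_Re[OF integrable_one_minus_exp[OF bv]]) simp
  moreover have "Re (1 - exp (- 1 * complex_of_real x)) = 1 - exp (- x)" for x
  proof -
   have "exp (- 1 * complex_of_real x) = of_real (exp (- x))"
    by (metis exp_of_real mult_minus1 of_real_minus)
   then show ?thesis by simp
  qed
  ultimately show ?thesis by simp
 qed
 have xh: "integrable \<nu> (\<lambda>x. x * trunc p x)"
  using Bochner_Integration.integrable_diff[OF one integrable_trunc] by simp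
 have i: "integrable \<nu> (\<lambda>x. z * complex_of_real (x * trunc p x))"
  using xh by (intro integrable_mult_right integrable_of_real)
 have "Psi_S p z = (\<integral>x. (1 - exp (- z * of_real x)) - z * of_real (x * trunc p x) \<partial>\<nu>)"
  unfolding Psi_S_def by (intro Bochner_Integration.integral_cong refl) simp
 also have "\<dots> = G_S p z - (\<integral>x. z * of_real (x * trunc p x) \<partial>\<nu>)"
  unfolding G_S_def by (rule Bochner_Integration.integral_diff[OF integrable_one_minus_exp[OF bv z] i])
 also have "(\<integral>x. z * of_real (x * trunc p x) \<partial>\<nu>) = z * of_real jump_drift"
  unfolding jump_drift_def integral_complex_of_real[symmetric] by (rule integral_mult_right_zero)
 finally show ?thesis .
qed

lemma jump_drift_nonneg: "0 \<le> jump_drift"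
 unfolding jump_drift_def
 by (intro integral_nonneg_AE eventually_mono[OF AE_nu]) (simp add: trunc_props)

lemma driftless_iff:
 "driftless_subordinator p \<longleftrightarrow> bounded_variation \<and> jump_drift = 0"
proof
 assume d: "driftless_subordinator p"
 then have bv: bounded_variation by (simp add: driftless_subordinator_def bounded_variation_def)
 have "\<forall>r\<ge>0. Psi_S p (of_real r) = G_S p (of_real r)" using d by (simp add: driftless_subordinator_def)
 from this[rule_format, of 1] have "Psi_S p 1 = G_S p 1" by simp
 then show "bounded_variation \<and> jump_drift = 0"
  using Psi_S_bounded_variation[OF bv, of 1] bv by simp
next
 assume "bounded_variation \<and> jump_drift = 0"
 then show "driftless_subordinator p"
  using Psi_S_bounded_variation by (auto simp: driftless_subordinator_def bounded_variation_def)
qed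

lemma Re_G_S_nonneg:
 assumes bv: bounded_variation and z: "Re z \<ge> 0"
 shows "0 \<le> Re (G_S p z)"
proof -
 have "Re (G_S p z) = (\<integral>x. Re (1 - exp (- z * of_real x)) \<partial>\<nu>)"
  unfolding G_S_def by (rule integral_Re[OF integrable_one_minus_exp[OF bv z], symmetric])
 also have "\<dots> \<ge> 0"
 proof (intro integral_nonneg_AE eventually_mono[OF AE_nu])
  fix x :: real assume "0 < x"
  then have "norm (exp (- z * of_real x)) \<le> 1" using z by (simp add: norm_exp_eq_Re)
  with complex_Re_le_cmod have "Re (exp (- z * of_real x)) \<le> 1" by (rule order.trans)
  then show "0 \<le> Re (1 - exp (- z * of_real x))" by simp
 qed
 finally show ?thesis .
qed

text \<open>The integrand is at most \<open>min 2 (norm z * x)\<close> in modulus. Divided by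
  \<open>norm z = t\<close> this is \<open>min (2 / t) x\<close>, which tends to 0 under the
  integrable majorant \<open>2 * min 1 x\<close>.\<close>

lemma G_S_sublinear:
 assumes bv: bounded_variation and e: "0 < e"
 shows "\<exists>R. \<forall>z. Re z \<ge> 0 \<longrightarrow> R \<le> norm z \<longrightarrow> norm (G_S p z) \<le> e * norm z"
proof -
 let ?f = "\<lambda>t x. max 0 (min (2 / t) x)"
 have "((\<lambda>t. \<integral>x. ?f t x \<partial>\<nu>) \<longlongrightarrow> (\<integral>x. 0 \<partial>\<nu>)) at_top"
 proof (rule integral_dominated_convergence_at_top[where w = "\<lambda>x. 2 * min 1 x"])
  show "integrable \<nu> (\<lambda>x. 2 * min 1 x)" by (intro integrable_mult_right integrable_min_1 bv)
  show "\<forall>\<^sub>F t in at_top. AE x in \<nu>. norm (?f t x) \<le> 2 * min 1 x"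
   using eventually_ge_at_top[of "1::real"]
  proof eventually_elim
   case (elim t)
   show ?case using AE_nu
   proof eventually_elim
    fix x :: real assume x: "0 < x"
    have "2 / t \<le> 2" using \<open>1 \<le> t\<close> by (simp add: divide_le_eq)
    then show "norm (?f t x) \<le> 2 * min 1 x" using x \<open>1 \<le> t\<close> by (auto simp: min_def max_def)
   qed
  qed
  show "AE x in \<nu>. ((\<lambda>t. ?f t x) \<longlongrightarrow> 0) at_top"
  proof (rule AE_I2)
   fix x :: real
   show "((\<lambda>t. ?f t x) \<longlongrightarrow> 0) at_top"
   proof (rule tendsto_sandwich[of "\<lambda>_. 0" _ _ "\<lambda>t. 2 / t"])
    show "\<forall>\<^sub>F t in at_top. ?f t x \<le> 2 / t"
     using eventually_gt_at_top[of "0::real"] by eventually_elim auto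
    show "((\<lambda>t::real. 2 / t) \<longlongrightarrow> 0) at_top"
     by (rule tendsto_divide_0[OF tendsto_const filterlim_at_top_imp_at_infinity[OF filterlim_ident]])
   qed auto
  qed
 qed auto
 then have "\<forall>\<^sub>F t in at_top. dist (\<integral>x. ?f t x \<partial>\<nu>) 0 < e" using tendstoD e by fastforce
 then obtain R where R: "\<And>t. t \<ge> R \<Longrightarrow> \<bar>\<integral>x. ?f t x \<partial>\<nu>\<bar> < e" by (auto simp: eventually_at_top_linorder)
 show ?thesis
 proof (intro exI[of _ "max 1 R"] allI impI)
  fix z :: complex assume z: "Re z \<ge> 0" "max 1 R \<le> norm z"
  have "norm (G_S p z) \<le> (\<integral>x. norm (1 - exp (- z * of_real x)) \<partial>\<nu>)"
   unfolding G_S_def by (rule integral_norm_bound)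
  also have "\<dots> \<le> (\<integral>x. norm z * ?f (norm z) x \<partial>\<nu>)"
  proof (rule integral_mono_AE)
   show "integrable \<nu> (\<lambda>x. norm (1 - exp (- z * of_real x)))"
    by (intro integrable_norm integrable_one_minus_exp bv z)
   show "integrable \<nu> (\<lambda>x. norm z * ?f (norm z) x)"
   proof (rule integrable_mult_right, rule Bochner_Integration.integrable_bound[of \<nu> "\<lambda>x. 2 * min 1 x"])
    show "integrable \<nu> (\<lambda>x. 2 * min 1 x)" by (intro integrable_mult_right integrable_min_1 bv)
    have t: "2 / norm z \<le> 2" using z by (simp add: divide_le_eq)
    show "AE x in \<nu>. norm (?f (norm z) x) \<le> norm (2 * min 1 x)"
     using AE_nu by eventually_elim (use t in \<open>auto simp: min_def max_def\<close>)
   qed auto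
   show "AE x in \<nu>. norm (1 - exp (- z * of_real x)) \<le> norm z * ?f (norm z) x"
    using AE_nu
   proof eventually_elim
    case (elim x)
    have nz: "norm z > 0" using z by linarith
    have "norm z * ?f (norm z) x = min 2 (norm z * x)"
     using nz elim by (auto simp: min_def max_def field_simps)
    then show ?case using norm_one_minus_exp_bound[OF z(1), of x] elim by simp
   qed
  qed
  also have "\<dots> = norm z * (\<integral>x. ?f (norm z) x \<partial>\<nu>)" by (rule integral_mult_right_zero)
  also have "\<dots> \<le> norm z * e" using R[of "norm z"] z by (intro mult_left_mono) auto
  finally show "norm (G_S p z) \<le> e * norm z" by (simp add: mult.commute)
 qed
qed

text \<open>Far out, the upward jumps contribute at most \<open>- up_rate p / 2\<close> to the real
  part, and the downward jumps nothing positive. Roots for \<open>q > 0\<close> therefore stay in a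
  bounded set.\<close>

lemma driftless_exponent_negative:
 assumes "drift p = 0" "gauss p = 0" "driftless_subordinator p"
 shows "\<exists>R. \<forall>z. Re z \<ge> 0 \<longrightarrow> R \<le> norm z \<longrightarrow> Re (Psi_X p z) < 0"
proof -
 obtain R where R: "\<And>z. R \<le> norm z \<Longrightarrow> norm (up_transform (- z)) \<le> 1 / 2"
  using up_transform_small by blast
 have bv: bounded_variation and d: "jump_drift = 0" using assms(3) by (auto simp: driftless_iff)
 show ?thesis
 proof (intro exI[of _ R] allI impI)
  fix z assume z: "Re z \<ge> 0" "R \<le> norm z"
  have "Re (Psi_X p z) = up_rate p * (Re (up_transform (- z)) - 1) - Re (G_S p z)"
   using Psi_S_bounded_variation[OF bv z(1)] by (simp add: Psi_X_eq assms d)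
  moreover have "Re (up_transform (- z)) - 1 \<le> - (1 / 2)"
   using complex_Re_le_cmod[of "up_transform (- z)"] R[OF z(2)] by linarith
  then have "up_rate p * (Re (up_transform (- z)) - 1) \<le> up_rate p * - (1 / 2)"
   using up_facts(1) by (intro mult_left_mono) auto
  ultimately show "Re (Psi_X p z) < 0" using Re_G_S_nonneg[OF bv z(1)] up_facts(1) by simp
 qed
qed

text \<open>Up to the constant \<open>comp_drift\<close>, the ratio \<open>- Psi_S p z / z\<close>
  is the integral of \<open>1 - exp (- x)\<close> with a correction that is pointwise small for
  large \<open>z\<close>. Without bounded variation the uncorrected integral is infinite, and
  monotone convergence makes this quantitative.\<close>

lemma Psi_S_unbounded_variation:
 assumes nbv: "\<not> bounded_variation"
 shows "\<exists>R\<ge>1. \<forall>z. Re z \<ge> 0 \<longrightarrow> R \<le> norm z \<longrightarrow> L \<le> Re (- Psi_S p z / z)"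
proof -
 have inf: "(\<integral>\<^sup>+x. ennreal (1 - exp (- x)) \<partial>\<nu>) = \<infinity>"
 proof -
  have "(\<integral>\<^sup>+x. ennreal (min 1 x) \<partial>\<nu>) \<le> (\<integral>\<^sup>+x. 2 * ennreal (1 - exp (- x)) \<partial>\<nu>)"
  proof (rule nn_integral_mono_AE, use AE_nu in eventually_elim)
   fix x :: real assume x: "0 < x"
   have "min 1 x / 2 \<le> x / (1 + x)"
    using x by (cases "x \<le> 1") (simp_all add: field_simps)
   from order.trans[OF this one_minus_exp_ge[OF less_imp_le[OF x]]]
   have "min 1 x \<le> 2 * (1 - exp (- x))" by simp
   then have "ennreal (min 1 x) \<le> ennreal (2 * (1 - exp (- x)))" by (rule ennreal_leI)
   also have "ennreal (2 * (1 - exp (- x))) = ennreal 2 * ennreal (1 - exp (- x))"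
    by (rule ennreal_mult) (use x in auto)
   finally show "ennreal (min 1 x) \<le> 2 * ennreal (1 - exp (- x))" by (simp only: ennreal_numeral)
  qed
  also have "\<dots> = 2 * (\<integral>\<^sup>+x. ennreal (1 - exp (- x)) \<partial>\<nu>)" by (rule nn_integral_cmult) simp
  finally show ?thesis using nbv
   by (auto simp: bounded_variation_def top_unique ennreal_mult_eq_top_iff not_less)
 qed
 define I where "I = (\<integral>x. min 1 (x\<^sup>2) \<partial>\<nu>)"
 \<comment> \<open>\<open>2 / Suc n\<close> bounds the correction for
   \<open>norm z \<ge> Suc n\<close>. The conversion to \<open>ennreal\<close> cuts off negative
   values, so the integrals of \<open>?B n\<close> increase to infinity.\<close>
 let ?B = "\<lambda>n x. ennreal (1 - exp (- x) - 2 / real (Suc n))"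
 have "(\<integral>\<^sup>+x. (SUP n. ?B n x) \<partial>\<nu>) = (SUP n. \<integral>\<^sup>+x. ?B n x \<partial>\<nu>)"
 proof (rule nn_integral_monotone_convergence_SUP)
  show "incseq ?B"
  proof (rule incseq_SucI, rule le_funI, rule ennreal_leI)
   fix n and x :: real
   have "2 / real (Suc (Suc n)) \<le> 2 / real (Suc n)" by (intro divide_left_mono) auto
   then show "1 - exp (- x) - 2 / real (Suc n) \<le> 1 - exp (- x) - 2 / real (Suc (Suc n))" by linarith
  qed
 qed auto
 moreover have "(SUP n. ?B n x) = ennreal (1 - exp (- x))" for x
 proof (rule LIMSEQ_unique)
  show "(\<lambda>n. ?B n x) \<longlonglongrightarrow> (SUP n. ?B n x)"
  proof (rule LIMSEQ_SUP, rule incseq_SucI, rule ennreal_leI)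
   fix n
   have "2 / real (Suc (Suc n)) \<le> 2 / real (Suc n)" by (intro divide_left_mono) auto
   then show "1 - exp (- x) - 2 / real (Suc n) \<le> 1 - exp (- x) - 2 / real (Suc (Suc n))" by linarith
  qed
  have "(\<lambda>n. 1 - exp (- x) - 2 * (1 / real (Suc n))) \<longlonglongrightarrow> 1 - exp (- x) - 2 * 0"
   by (intro tendsto_intros LIMSEQ_Suc[OF lim_1_over_n])
  then show "(\<lambda>n. ?B n x) \<longlonglongrightarrow> ennreal (1 - exp (- x))" by (intro tendsto_ennrealI) simp
 qed
 ultimately have sup: "(SUP n. \<integral>\<^sup>+x. ?B n x \<partial>\<nu>) = \<infinity>" using inf by simp
 have "ennreal (\<bar>L\<bar> + \<bar>comp_drift\<bar> + 2 * I) < (SUP n. \<integral>\<^sup>+x. ?B n x \<partial>\<nu>)"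
  unfolding sup by simp
 then obtain n where n: "ennreal (\<bar>L\<bar> + \<bar>comp_drift\<bar> + 2 * I) < (\<integral>\<^sup>+x. ?B n x \<partial>\<nu>)"
  by (auto simp: less_SUP_iff)
 show ?thesis
 proof (intro exI[of _ "real (Suc n)"] conjI allI impI)
  show "1 \<le> real (Suc n)" by simp
  fix z :: complex assume z: "Re z \<ge> 0" "real (Suc n) \<le> norm z"
  then have z1: "norm z \<ge> 1" and z0: "z \<noteq> 0" by auto
  define m where "m x = Re (- comp_kernel z x / z)" for x
  have im: "integrable \<nu> m"
   unfolding m_def using integrable_comp_kernel[OF z(1)] by (intro integrable_Re) auto
  have m_eq: "m x = 1 - exp (- x) - Re ((1 - exp (- z * of_real x)) / z)" for x
  proof -
   have "- comp_kernel z x / z = of_real (1 - exp (- x)) - (1 - exp (- z * of_real x)) / z"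
    unfolding comp_kernel_def using z0 by (simp add: field_simps)
   then show ?thesis by (simp add: m_def)
  qed
  have kr: "Re ((1 - exp (- z * of_real x)) / z) \<le> norm (1 - exp (- z * of_real x)) / norm z" for x
   using complex_Re_le_cmod[of "(1 - exp (- z * of_real x)) / z"] by (simp add: norm_divide)
  have lower1: "1 - exp (- x) - 2 / real (Suc n) \<le> m x" if "0 < x" for x
  proof -
   have "norm (1 - exp (- z * of_real x)) / norm z \<le> 2 / real (Suc n)"
    using norm_one_minus_exp_bound(1)[OF z(1), of x] that z(2) by (intro frac_le) auto
   then show ?thesis using kr[of x] by (simp add: m_eq)
  qed
  \<comment> \<open>For small \<open>x\<close> the bound \<open>lower1\<close> is close to a
    negative constant, and \<open>\<nu>\<close> may have infinite mass there; this second bound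
    keeps the negative part integrable.\<close>
  have lower2: "- 2 * min 1 (x\<^sup>2) \<le> m x" if x: "0 < x" for x
  proof (cases "x \<le> 1")
   case True
   have "norm (1 - exp (- z * of_real x)) / norm z \<le> x"
    using norm_one_minus_exp_bound(2)[OF z(1), of x] x z1 by (subst pos_divide_le_eq) (auto simp: mult.commute)
   then have "1 - exp (- x) - x \<le> m x" using kr[of x] by (simp add: m_eq)
   moreover have "norm (1 - exp (- complex_of_real x) - of_real x) \<le> x\<^sup>2"
    using norm_exp_taylor2[of "of_real x"] x by simp
   then have "\<bar>1 - exp (- x) - x\<bar> \<le> x\<^sup>2"
   proof -
    have "1 - exp (- complex_of_real x) - of_real x = of_real (1 - exp (- x) - x)"
     by (simp flip: exp_of_real)
    then show ?thesis using \<open>norm (1 - exp (- complex_of_real x) - of_real x) \<le> x\<^sup>2\<close> by (simp only: norm_of_real)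
   qed
   moreover have "min 1 (x\<^sup>2) = x\<^sup>2" using x True by (intro min_absorb2 power_le_one) auto
   ultimately show ?thesis by (smt (verit) zero_le_power2)
  next
   case False
   then have "min 1 (x\<^sup>2) = 1" by (intro min_absorb1 one_le_power) auto
   moreover have "2 / real (Suc n) \<le> 2" by (simp add: divide_le_eq)
   moreover have "0 \<le> 1 - exp (- x)" using x by simp
   ultimately show ?thesis using lower1[OF x] by linarith
  qed
  have s: "integrable \<nu> (\<lambda>x. m x + 2 * min 1 (x\<^sup>2))"
   by (intro Bochner_Integration.integrable_add im integrable_mult_right integrable_min_square)
  have nn: "AE x in \<nu>. 0 \<le> m x + 2 * min 1 (x\<^sup>2)"
   using AE_nu by eventually_elim (use lower2 in force)
  have "(\<integral>\<^sup>+x. ?B n x \<partial>\<nu>) \<le> (\<integral>\<^sup>+x. ennreal (m x + 2 * min 1 (x\<^sup>2)) \<partial>\<nu>)"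
  proof (rule nn_integral_mono_AE, use AE_nu in eventually_elim)
   fix x :: real assume "0 < x"
   have "0 \<le> min 1 (x\<^sup>2)" by simp
   then show "?B n x \<le> ennreal (m x + 2 * min 1 (x\<^sup>2))"
    using lower1[OF \<open>0 < x\<close>] by (intro ennreal_leI) linarith
  qed
  also have "\<dots> = ennreal (\<integral>x. m x + 2 * min 1 (x\<^sup>2) \<partial>\<nu>)"
   by (rule nn_integral_eq_integral[OF s nn])
  also have "(\<integral>x. m x + 2 * min 1 (x\<^sup>2) \<partial>\<nu>) = (\<integral>x. m x \<partial>\<nu>) + 2 * I"
   unfolding I_def
   by (subst Bochner_Integration.integral_add[OF im integrable_mult_right[OF integrable_min_square]]) simp
  finally have "ennreal (\<bar>L\<bar> + \<bar>comp_drift\<bar> + 2 * I) < ennreal ((\<integral>x. m x \<partial>\<nu>) + 2 * I)"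
   using n by (rule less_le_trans[rotated])
  moreover have "0 \<le> I" by (simp add: I_def)
  ultimately have "\<bar>L\<bar> + \<bar>comp_drift\<bar> + 2 * I < (\<integral>x. m x \<partial>\<nu>) + 2 * I"
   by (subst (asm) ennreal_less_iff) auto
  moreover have "Re (- Psi_S p z / z) = (\<integral>x. m x \<partial>\<nu>) - comp_drift"
  proof -
   have i: "integrable \<nu> (\<lambda>x. - comp_kernel z x / z)" using integrable_comp_kernel[OF z(1)] by auto
   have "(\<integral>x. m x \<partial>\<nu>) = Re (\<integral>x. - comp_kernel z x / z \<partial>\<nu>)"
    unfolding m_def by (rule integral_Re[OF i])
   also have "(\<integral>x. - comp_kernel z x / z \<partial>\<nu>) = - (\<integral>x. comp_kernel z x \<partial>\<nu>) / z" by simp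
   finally have e: "(\<integral>x. m x \<partial>\<nu>) = Re (- (\<integral>x. comp_kernel z x \<partial>\<nu>) / z)" .
   have "- Psi_S p z / z = - (\<integral>x. comp_kernel z x \<partial>\<nu>) / z - of_real comp_drift"
    unfolding Psi_S_eq[OF z(1)] using z0 by (simp add: field_simps)
   then show ?thesis by (simp only: e minus_complex.sel Re_complex_of_real)
  qed
  ultimately show "L \<le> Re (- Psi_S p z / z)" by linarith
 qed
qed

text \<open>After division by \<open>z\<close> the real part stays above a positive constant if the
  variation is unbounded, or if there is no Gaussian part and the total drift is positive. The
  Gaussian term \<open>(gauss p)\<^sup>2 * z\<close> has real part 0 on the imaginary axis, so with
  bounded variation it is recorded as a whole, up to a bounded remainder.\<close>

lemma exponent_div_cases:
 assumes "\<not> (drift p = 0 \<and> gauss p = 0 \<and> driftless_subordinator p)"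
 shows "(\<exists>e>0. \<exists>R\<ge>1. \<forall>z. Re z \<ge> 0 \<longrightarrow> R \<le> norm z \<longrightarrow> e \<le> Re (Psi_X p z / z)) \<or>
  (gauss p > 0 \<and> (\<exists>K. \<exists>R\<ge>1. \<forall>z. Re z \<ge> 0 \<longrightarrow> R \<le> norm z \<longrightarrow>
    norm (Psi_X p z / z - of_real ((gauss p)\<^sup>2) * z) \<le> K))"
proof -
 obtain R0 where R0: "\<And>z. R0 \<le> norm z \<Longrightarrow> norm (up_transform (- z)) \<le> 1 / 2"
  using up_transform_small by blast
 have l: "0 < up_rate p" by (rule up_facts)
 define \<rho> where "\<rho> z = of_real (up_rate p) * (up_transform (- z) - 1) / z" for z
 have split: "Psi_X p z / z = of_real (drift p) + of_real ((gauss p)\<^sup>2) * z + \<rho> z + (- Psi_S p z / z)" if "z \<noteq> 0" for z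
  using that by (simp add: Psi_X_eq \<rho>_def field_simps power2_eq_square)
 have rho: "norm (\<rho> z) \<le> 2 * up_rate p / norm z" if "R0 \<le> norm z" for z
 proof -
  have "norm (up_transform (- z) - 1) \<le> 2"
   using norm_triangle_ineq4[of "up_transform (- z)" 1] R0[OF that] by simp
  then have "up_rate p * norm (up_transform (- z) - 1) \<le> up_rate p * 2" using l by (intro mult_left_mono) auto
  then show ?thesis using l by (simp add: \<rho>_def norm_divide norm_mult divide_right_mono mult.commute)
 qed
 have Reg: "0 \<le> Re (of_real ((gauss p)\<^sup>2) * z)" if "Re z \<ge> 0" for z using that by simp
 show ?thesis
 proof (cases bounded_variation)
  case False
  obtain R where R: "R \<ge> 1" "\<And>z. Re z \<ge> 0 \<Longrightarrow> R \<le> norm z \<Longrightarrow> 1 + 2 * up_rate p \<le> Re (- Psi_S p z / z)"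
   using Psi_S_unbounded_variation[OF False, of "1 + 2 * up_rate p"] by blast
  have "1 \<le> Re (Psi_X p z / z)" if z: "Re z \<ge> 0" "max R R0 \<le> norm z" for z
  proof -
   have z0: "z \<noteq> 0" "norm z \<ge> 1" using z R(1) by auto
   have "2 * up_rate p / norm z \<le> 2 * up_rate p" using l z0 by (simp add: divide_le_eq)
   then have "- (2 * up_rate p) \<le> Re (\<rho> z)"
    using rho[of z] abs_Re_le_cmod[of "\<rho> z"] z by linarith
   then show ?thesis
    using split[OF z0(1)] R(2)[OF z(1)] Reg[OF z(1)] drift_nonneg z(2)
    by (simp only: plus_complex.sel Re_complex_of_real) linarith
  qed
  then have "\<exists>e>0. \<exists>R\<ge>1. \<forall>z. Re z \<ge> 0 \<longrightarrow> R \<le> norm z \<longrightarrow> e \<le> Re (Psi_X p z / z)"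
   using R(1) by (intro exI[of _ "1::real"] conjI exI[of _ "max R R0"]) auto
  then show ?thesis ..
 next
  case bv: True
  have SG: "- Psi_S p z / z = of_real jump_drift - G_S p z / z" if "Re z \<ge> 0" "z \<noteq> 0" for z
   using Psi_S_bounded_variation[OF bv that(1)] that(2) by (simp add: field_simps)
  show ?thesis
  proof (cases "gauss p = 0")
   case g0: True
   define \<delta> where "\<delta> = drift p + jump_drift"
   have d: "\<delta> > 0"
    using assms g0 bv drift_nonneg jump_drift_nonneg by (auto simp: \<delta>_def driftless_iff less_le)
   obtain R where R: "\<And>z. Re z \<ge> 0 \<Longrightarrow> R \<le> norm z \<Longrightarrow> norm (G_S p z) \<le> \<delta> / 4 * norm z"
    using G_S_sublinear[OF bv, of "\<delta> / 4"] d by auto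
   define R1 where "R1 = max (max R R0) (max 1 (8 * up_rate p / \<delta>))"
   have "\<delta> / 2 \<le> Re (Psi_X p z / z)" if z: "Re z \<ge> 0" "R1 \<le> norm z" for z
   proof -
    have z1: "R \<le> norm z" "R0 \<le> norm z" "1 \<le> norm z" "8 * up_rate p / \<delta> \<le> norm z"
     using z(2) by (auto simp: R1_def)
    then have z0: "z \<noteq> 0" by auto
    have "norm (G_S p z / z) \<le> \<delta> / 4" using R[OF z(1) z1(1)] z0 by (simp add: norm_divide divide_le_eq)
    then have a: "Re (G_S p z / z) \<le> \<delta> / 4" using complex_Re_le_cmod[of "G_S p z / z"] by linarith
    have nz: "0 < norm z" using z0 by simp
    have "8 * up_rate p \<le> norm z * \<delta>" using z1(4) d by (simp add: pos_divide_le_eq)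
    then have "2 * up_rate p / norm z \<le> \<delta> / 4" unfolding pos_divide_le_eq[OF nz] by (simp add: mult.commute)
    then have b: "- (\<delta> / 4) \<le> Re (\<rho> z)" using rho[OF z1(2)] abs_Re_le_cmod[of "\<rho> z"] by linarith
    have "Re (Psi_X p z / z) = \<delta> + Re (\<rho> z) - Re (G_S p z / z)"
     unfolding split[OF z0] SG[OF z(1) z0] by (simp only: plus_complex.sel minus_complex.sel Re_complex_of_real) (simp add: \<delta>_def g0)
    then show ?thesis using a b by linarith
   qed
   then have "\<exists>e>0. \<exists>R\<ge>1. \<forall>z. Re z \<ge> 0 \<longrightarrow> R \<le> norm z \<longrightarrow> e \<le> Re (Psi_X p z / z)"
    using d by (intro exI[of _ "\<delta> / 2"] conjI exI[of _ R1]) (auto simp: R1_def)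
   then show ?thesis ..
  next
   case False
   then have g: "gauss p > 0" using gauss_nonneg by simp
   obtain R where R: "\<And>z. Re z \<ge> 0 \<Longrightarrow> R \<le> norm z \<Longrightarrow> norm (G_S p z) \<le> 1 * norm z"
    using G_S_sublinear[OF bv, of 1] by auto
   have "norm (Psi_X p z / z - of_real ((gauss p)\<^sup>2) * z) \<le> drift p + 2 * up_rate p + jump_drift + 1"
    if z: "Re z \<ge> 0" "max (max R R0) 1 \<le> norm z" for z
   proof -
    have z1: "R \<le> norm z" "R0 \<le> norm z" "1 \<le> norm z" using z(2) by auto
    then have z0: "z \<noteq> 0" by auto
    have "norm (G_S p z / z) \<le> 1" using R[OF z(1) z1(1)] z0 by (simp add: norm_divide divide_le_eq)
    moreover have "norm (\<rho> z) \<le> 2 * up_rate p"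
    proof -
     have "2 * up_rate p / norm z \<le> 2 * up_rate p" using l z1(3) by (simp add: divide_le_eq)
     then show ?thesis using rho[OF z1(2)] by linarith
    qed
    moreover have "Psi_X p z / z - of_real ((gauss p)\<^sup>2) * z = of_real (drift p + jump_drift) + (\<rho> z - G_S p z / z)"
     unfolding split[OF z0] SG[OF z(1) z0] by simp
    moreover have "norm (of_real (drift p + jump_drift) + (\<rho> z - G_S p z / z))
      \<le> \<bar>drift p + jump_drift\<bar> + (norm (\<rho> z) + norm (G_S p z / z))"
     using norm_triangle_ineq[of "of_real (drift p + jump_drift)" "\<rho> z - G_S p z / z"]
      norm_triangle_ineq4[of "\<rho> z" "G_S p z / z"] by (simp only: norm_of_real)
    ultimately show ?thesis using drift_nonneg jump_drift_nonneg by simp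
   qed
   then have "\<exists>K. \<exists>R\<ge>1. \<forall>z. Re z \<ge> 0 \<longrightarrow> R \<le> norm z \<longrightarrow> norm (Psi_X p z / z - of_real ((gauss p)\<^sup>2) * z) \<le> K"
    by (intro exI[of _ "drift p + 2 * up_rate p + jump_drift + 1"] exI[of _ "max (max R R0) 1"]) auto
   then show ?thesis using g by blast
  qed
 qed
qed

text \<open>The bound on the modulus confines the roots to a bounded set for bounded
  \<open>q\<close>; the one on the positive axis decides signs for large real arguments.\<close>

lemma exponent_tends_to_infinity:
 assumes "\<not> (drift p = 0 \<and> gauss p = 0 \<and> driftless_subordinator p)"
 shows "\<exists>R. \<forall>z. Re z \<ge> 0 \<longrightarrow> R \<le> norm z \<longrightarrow> L \<le> norm (Psi_X p z)"
  and "\<exists>R. \<forall>s\<ge>R. L \<le> Re (Psi_X p (of_real s))"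
proof -
 have "\<exists>R\<ge>1. \<exists>e>0. \<forall>z. Re z \<ge> 0 \<longrightarrow> R \<le> norm z \<longrightarrow>
   e \<le> norm (Psi_X p z / z) \<and> (Im z = 0 \<longrightarrow> e \<le> Re (Psi_X p z / z))"
  using exponent_div_cases[OF assms]
 proof (elim disjE conjE exE)
  fix e R assume "0 < e" "1 \<le> R" "\<forall>z. 0 \<le> Re z \<longrightarrow> R \<le> norm z \<longrightarrow> e \<le> Re (Psi_X p z / z)"
  then show ?thesis
   by (intro exI[of _ R] conjI exI[of _ e]) (auto intro: order.trans complex_Re_le_cmod)
 next
  fix K R assume g: "0 < gauss p" and R: "1 \<le> R"
   and K: "\<forall>z. 0 \<le> Re z \<longrightarrow> R \<le> norm z \<longrightarrow> norm (Psi_X p z / z - of_real ((gauss p)\<^sup>2) * z) \<le> K"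
  let ?R = "max R ((K + 1) / (gauss p)\<^sup>2)"
  have "1 \<le> norm (Psi_X p z / z) \<and> (Im z = 0 \<longrightarrow> 1 \<le> Re (Psi_X p z / z))" if z: "Re z \<ge> 0" "?R \<le> norm z" for z
  proof -
   have k: "norm (Psi_X p z / z - of_real ((gauss p)\<^sup>2) * z) \<le> K" using K z by auto
   have gz: "(gauss p)\<^sup>2 * norm z \<ge> K + 1" using z(2) g by (simp add: field_simps)
   have "norm (of_real ((gauss p)\<^sup>2) * z) \<le> norm (Psi_X p z / z) + norm (Psi_X p z / z - of_real ((gauss p)\<^sup>2) * z)"
    using norm_triangle_ineq4[of "Psi_X p z / z" "Psi_X p z / z - of_real ((gauss p)\<^sup>2) * z"] by simp
   moreover have "norm (of_real ((gauss p)\<^sup>2) * z) = (gauss p)\<^sup>2 * norm z" by (simp add: norm_mult norm_power)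
   ultimately have a: "1 \<le> norm (Psi_X p z / z)" using k gz by linarith
   have b: "1 \<le> Re (Psi_X p z / z)" if "Im z = 0"
   proof -
    have "norm z = Re z" using that z(1) by (simp add: cmod_eq_Re)
    then have "Re (of_real ((gauss p)\<^sup>2) * z) = (gauss p)\<^sup>2 * norm z" by simp
    moreover have "\<bar>Re (Psi_X p z / z - of_real ((gauss p)\<^sup>2) * z)\<bar> \<le> K"
     using abs_Re_le_cmod k by (rule order.trans)
    ultimately show ?thesis using gz by (simp only: minus_complex.sel)
   qed
   show ?thesis using a b by blast
  qed
  then show ?thesis using R by (intro exI[of _ ?R] conjI exI[of _ "1::real"]) auto
 qed
 then obtain R e where R: "R \<ge> 1" and e: "e > 0"
  and bd: "\<And>z. Re z \<ge> 0 \<Longrightarrow> R \<le> norm z \<Longrightarrow> e \<le> norm (Psi_X p z / z)"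
  and bdr: "\<And>z. Re z \<ge> 0 \<Longrightarrow> R \<le> norm z \<Longrightarrow> Im z = 0 \<Longrightarrow> e \<le> Re (Psi_X p z / z)" by blast
 define R' where "R' = max R (\<bar>L\<bar> / e)"
 have L: "L \<le> e * t" if "R' \<le> t" for t
  using that e by (auto simp: R'_def field_simps)
 show "\<exists>R. \<forall>z. Re z \<ge> 0 \<longrightarrow> R \<le> norm z \<longrightarrow> L \<le> norm (Psi_X p z)"
 proof (intro exI[of _ R'] allI impI)
  fix z :: complex assume z: "Re z \<ge> 0" "R' \<le> norm z"
  then have "z \<noteq> 0" using R by (auto simp: R'_def)
  then have "norm (Psi_X p z) = norm (Psi_X p z / z) * norm z" by (simp add: norm_divide)
  also have "\<dots> \<ge> e * norm z" using bd[OF z(1)] z(2) by (intro mult_right_mono) (auto simp: R'_def)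
  finally show "L \<le> norm (Psi_X p z)" using L[OF z(2)] by linarith
 qed
 show "\<exists>R. \<forall>s\<ge>R. L \<le> Re (Psi_X p (of_real s))"
 proof (intro exI[of _ R'] allI impI)
  fix s assume s: "R' \<le> s"
  then have s1: "s \<ge> 1" "R \<le> s" using R by (auto simp: R'_def)
  have "e \<le> Re (Psi_X p (of_real s) / of_real s)" using bdr[of "of_real s"] s1 by simp
  also have "\<dots> = Re (Psi_X p (of_real s)) / s" by simp
  finally have "e * s \<le> Re (Psi_X p (of_real s))" using s1 by (simp add: le_divide_eq)
  then show "L \<le> Re (Psi_X p (of_real s))" using L[OF s] by linarith
 qed
qed

end

section \<open>The limit of vanishing killing rate\<close>

text \<open>The infimum of a set without lower bound is a default value, the same one for all such
  sets. Hence \<open>global_inf\<close> is constant on the paths that are unbounded below, which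
  makes it measurable on all of \<open>M\<close>.\<close>

lemma Inf_unbounded_real:
 fixes A :: "real set"
 assumes "\<not> bdd_below A"
 shows "Inf A = Inf UNIV"
proof -
 have 1: "\<not> (\<forall>x\<in>uminus ` A. x \<le> z)" for z
  using assms by (auto simp: bdd_below_def) (metis minus_le_iff)
 have 2: "\<not> (\<forall>x\<in>range (uminus :: real \<Rightarrow> real). x \<le> z)" for z
  by (metis gt_ex minus_minus not_less rangeI)
 show ?thesis
  unfolding Inf_real_def Sup_real_def by (simp only: 1 2)
qed

lemma running_inf_tendsto:
 assumes f: "cadlag (\<lambda>t. X t \<omega>)" and T: "filterlim T at_top F"
 shows "bdd_below ((\<lambda>t. X t \<omega>) ` {0..}) \<Longrightarrow> ((\<lambda>k. running_inf X (T k) \<omega>) \<longlongrightarrow> global_inf X \<omega>) F"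
  and "\<not> bdd_below ((\<lambda>t. X t \<omega>) ` {0..}) \<Longrightarrow> filterlim (\<lambda>k. running_inf X (T k) \<omega>) at_bot F"
proof -
 have up: "running_inf X t \<omega> \<le> X s \<omega>" if "0 \<le> s" "s \<le> t" for s t
  unfolding running_inf_def using that cadlag_bdd_below[OF f, of t] by (intro cINF_lower) auto
 { assume bd: "bdd_below ((\<lambda>t. X t \<omega>) ` {0..})"
  show "((\<lambda>k. running_inf X (T k) \<omega>) \<longlongrightarrow> global_inf X \<omega>) F"
  proof (rule order_tendstoI)
   fix a assume a: "a < global_inf X \<omega>"
   have "eventually (\<lambda>k. 0 \<le> T k) F" using T by (simp add: filterlim_at_top)
   then show "eventually (\<lambda>k. a < running_inf X (T k) \<omega>) F"
   proof eventually_elim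
    case (elim k)
    have "global_inf X \<omega> \<le> running_inf X (T k) \<omega>"
     unfolding global_inf_def running_inf_def using elim bd by (intro cINF_superset_mono) auto
    then show ?case using a by simp
   qed
  next
   fix a assume "global_inf X \<omega> < a"
   then obtain s where s: "0 \<le> s" "X s \<omega> < a"
    unfolding global_inf_def using bd by (subst (asm) cINF_less_iff) auto
   have "eventually (\<lambda>k. s \<le> T k) F" using T by (simp add: filterlim_at_top)
   then show "eventually (\<lambda>k. running_inf X (T k) \<omega> < a) F"
    by eventually_elim (use up[OF s(1)] s(2) in \<open>meson le_less_trans\<close>)
  qed }
 { assume nb: "\<not> bdd_below ((\<lambda>t. X t \<omega>) ` {0..})"
  show "filterlim (\<lambda>k. running_inf X (T k) \<omega>) at_bot F"
   unfolding filterlim_at_bot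
  proof
   fix a :: real
   obtain s where s: "0 \<le> s" "X s \<omega> < a"
    using nb unfolding bdd_below_def by (auto simp: not_le)
   have "eventually (\<lambda>k. s \<le> T k) F" using T by (simp add: filterlim_at_top)
   then show "eventually (\<lambda>k. running_inf X (T k) \<omega> \<le> a) F"
    by eventually_elim (use up[OF s(1)] s(2) in \<open>meson less_imp_le le_less_trans\<close>)
  qed }
qed

lemma running_inf_tendsto_0:
 assumes f: "cadlag (\<lambda>t. X t \<omega>)" and T: "(T \<longlongrightarrow> 0) F" "\<And>k. 0 \<le> T k"
 shows "((\<lambda>k. running_inf X (T k) \<omega>) \<longlongrightarrow> X 0 \<omega>) F"
proof (rule order_tendstoI)
 fix a assume a: "X 0 \<omega> < a"
 have "running_inf X (T k) \<omega> \<le> X 0 \<omega>" for k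
  unfolding running_inf_def using T(2)[of k] cadlag_bdd_below[OF f, of "T k"] by (intro cINF_lower) auto
 then show "eventually (\<lambda>k. running_inf X (T k) \<omega> < a) F"
  using a by (intro always_eventually allI) (rule le_less_trans)
next
 fix a assume a: "a < X 0 \<omega>"
 then obtain b where b: "a < b" "b < X 0 \<omega>" using dense by blast
 have "eventually (\<lambda>t. b < X t \<omega>) (at_right 0)"
  using cadlag_right[OF f order.refl] b(2) by (rule order_tendstoD)
 then obtain d where d: "0 < d" "\<And>t. 0 < t \<Longrightarrow> t < d \<Longrightarrow> b < X t \<omega>"
  unfolding eventually_at_right_field by blast
 have "eventually (\<lambda>k. T k < d) F" using T(1) d(1) by (rule order_tendstoD)
 then show "eventually (\<lambda>k. a < running_inf X (T k) \<omega>) F"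
 proof eventually_elim
  case (elim k)
  have "b \<le> running_inf X (T k) \<omega>"
   unfolding running_inf_def
  proof (rule cINF_greatest)
   fix t assume "t \<in> {0..T k}"
   then show "b \<le> X t \<omega>" using d(2)[of t] elim b(2) by (cases "t = 0") auto
  qed (use T(2)[of k] in auto)
  then show ?case using b(1) by simp
 qed
qed

section \<open>Infima at exponential times of small and of large rate\<close>

context levy_path
begin

definition inf_laplace :: "real \<Rightarrow> real \<Rightarrow> real" where
 "inf_laplace q s = (\<integral>y. exp (- s * y) \<partial>inf_law q)"

definition bounded_path :: "'a \<Rightarrow> bool" where
 "bounded_path \<omega> \<longleftrightarrow> bdd_below ((\<lambda>t. X t \<omega>) ` {0..})"

text \<open>Transform of a possibly defective law: on a path unbounded below the running infimum
  tends to minus infinity, so that its exponential tends to 0 for \<open>s > 0\<close>.\<close>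

definition lim_laplace :: "real \<Rightarrow> real" where
 "lim_laplace s = (\<integral>\<omega>. (if bounded_path \<omega> then exp (s * global_inf X \<omega>) else 0) \<partial>M)"

lemma measurable_running_inf [measurable]: "0 \<le> t \<Longrightarrow> (\<lambda>\<omega>. running_inf X t \<omega>) \<in> borel_measurable M"
 using measurable_at_random_time(1)[of "\<lambda>_. t" M "\<lambda>\<omega>. \<omega>"] by simp

text \<open>Countably many running infima decide boundedness, which makes it an event.\<close>

lemma bounded_path_iff:
 assumes "\<omega> \<in> space M"
 shows "bounded_path \<omega> \<longleftrightarrow> (\<exists>k::nat. \<forall>n::nat. - real k \<le> running_inf X (real n) \<omega>)"
proof
 assume "bounded_path \<omega>"
 then have bd: "bdd_below ((\<lambda>t. X t \<omega>) ` {0..})" by (simp add: bounded_path_def)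
 obtain k where k: "- global_inf X \<omega> \<le> real k" using real_arch_simple by blast
 have "- real k \<le> running_inf X (real n) \<omega>" for n
 proof -
  have "global_inf X \<omega> \<le> running_inf X (real n) \<omega>"
   unfolding global_inf_def running_inf_def using bd by (intro cINF_superset_mono) auto
  then show ?thesis using k by linarith
 qed
 then show "\<exists>k::nat. \<forall>n::nat. - real k \<le> running_inf X (real n) \<omega>" by blast
next
 assume "\<exists>k::nat. \<forall>n::nat. - real k \<le> running_inf X (real n) \<omega>"
 then obtain k :: nat where k: "\<And>n::nat. - real k \<le> running_inf X (real n) \<omega>" by blast
 show "bounded_path \<omega>"
  unfolding bounded_path_def
 proof (rule ccontr)
  assume "\<not> bdd_below ((\<lambda>t. X t \<omega>) ` {0..})"
  from running_inf_tendsto(2)[where X = X, OF cadlag_X[OF assms] filterlim_real_sequentially this]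
  have "eventually (\<lambda>n. running_inf X (real n) \<omega> \<le> - real k - 1) sequentially"
   unfolding filterlim_at_bot by blast
  then obtain n where "running_inf X (real n) \<omega> \<le> - real k - 1"
   unfolding eventually_sequentially by blast
  then show False using k[of n] by linarith
 qed
qed

lemma measurable_bounded_path [measurable]: "Measurable.pred M bounded_path"
proof -
 have "Measurable.pred M (\<lambda>\<omega>. \<exists>k::nat. \<forall>n::nat. - real k \<le> running_inf X (real n) \<omega>)"
  by measurable
 then show ?thesis
  using measurable_cong[of M bounded_path "\<lambda>\<omega>. \<exists>k::nat. \<forall>n::nat. - real k \<le> running_inf X (real n) \<omega>" "count_space UNIV"]
   bounded_path_iff by simp
qed

lemma measurable_global_inf [measurable]: "global_inf X \<in> borel_measurable M"
proof -
 have eq: "global_inf X \<omega> = (if bounded_path \<omega> then lim (\<lambda>n. running_inf X (real n) \<omega>) else Inf UNIV)"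
  if "\<omega> \<in> space M" for \<omega>
  using limI[OF running_inf_tendsto(1)[where X = X, OF cadlag_X[OF that] filterlim_real_sequentially]]
   Inf_unbounded_real[of "(\<lambda>t. X t \<omega>) ` {0..}"]
  by (auto simp: bounded_path_def global_inf_def)
 have "(\<lambda>\<omega>. if bounded_path \<omega> then lim (\<lambda>n. running_inf X (real n) \<omega>) else Inf UNIV) \<in> borel_measurable M"
  by measurable
 then show ?thesis
  using measurable_cong[of M "global_inf X" _ borel, OF eq] by simp
qed

lemma inf_laplace_EM:
 assumes q: "0 < q" and s: "0 \<le> s"
 shows "inf_laplace q s = (\<integral>x. exp (s * inf_at q x) \<partial>EM)"
  and "integrable EM (\<lambda>x. exp (s * inf_at q x))"
proof -
 note [measurable] = measurable_EM(1)[OF q]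
 show "inf_laplace q s = (\<integral>x. exp (s * inf_at q x) \<partial>EM)"
  unfolding inf_laplace_def inf_law_def by (subst integral_distr) auto
 interpret I: prob_space "inf_law q" by (rule inf_law_props[OF q])
 have "integrable (inf_law q) (\<lambda>y. exp (- s * y))"
  using inf_law_props(2,3)[OF q] s by (intro laplace_integrable_real I.finite_measure_axioms) auto
 then show "integrable EM (\<lambda>x. exp (s * inf_at q x))"
  unfolding inf_law_def by (subst (asm) integrable_distr_eq) auto
qed

text \<open>All rates share one exponential variable, and the larger rate stops earlier, where the
  running infimum is larger.\<close>

lemma inf_laplace_mono:
 assumes q: "0 < q" "q \<le> q'" and s: "0 \<le> s"
 shows "inf_laplace q s \<le> inf_laplace q' s"
proof -
 have q': "0 < q'" using q by simp
 show ?thesis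
  unfolding inf_laplace_EM(1)[OF q(1) s] inf_laplace_EM(1)[OF q' s]
 proof (rule integral_mono[OF inf_laplace_EM(2)[OF q(1) s] inf_laplace_EM(2)[OF q' s]])
  fix x assume "x \<in> space EM"
  then have x: "fst x \<in> space M" by (auto simp: space_pair_measure)
  have "\<bar>snd x\<bar> / q' \<le> \<bar>snd x\<bar> / q" using q q' by (intro divide_left_mono) auto
  then have "inf_at q x \<le> inf_at q' x"
   unfolding running_inf_def using q' cadlag_bdd_below[OF cadlag_X[OF x], of "\<bar>snd x\<bar> / q"] q
   by (intro cINF_superset_mono) auto
  then show "exp (s * inf_at q x) \<le> exp (s * inf_at q' x)"
   using s by (simp add: mult_left_mono)
 qed
qed

text \<open>At the value 0 of the exponential variable the time would stay 0 instead of growing as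
  \<open>q\<close> decreases.\<close>

lemma AE_EM_exp_nonzero: "AE x in EM. snd x \<noteq> 0"
proof -
 interpret E: prob_space unit_exp by (rule prob_space_unit_exp)
 interpret P: pair_prob_space M unit_exp ..
 have "AE v in lborel. v \<noteq> (0::real)"
  by (rule AE_lborel_singleton)
 then have "AE v in unit_exp. v \<noteq> 0"
  unfolding unit_exp_def by (subst AE_density) auto
 then have "AE x in M. AE y in unit_exp. y \<noteq> 0" by simp
 moreover have "(AE x in M. AE y in unit_exp. y \<noteq> 0) \<longleftrightarrow> (AE x in EM. snd x \<noteq> 0)"
  by (rule P.AE_pair_iff[where P = "\<lambda>x y. y \<noteq> 0"]) measurable
 ultimately show ?thesis by blast
qed

lemma inf_laplace_tendsto:
 assumes s: "0 < s"
 shows "((\<lambda>q. inf_laplace q s) \<longlongrightarrow> lim_laplace s) (at_right 0)"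
proof (rule tendsto_at_right_sequentially[where b = 1])
 show "(0::real) < 1" by simp
next
 fix Q :: "nat \<Rightarrow> real"
 assume Q0: "\<And>n. 0 < Q n" and "\<And>n. Q n < 1" "decseq Q" and Q: "Q \<longlonglongrightarrow> 0"
 interpret E: prob_space unit_exp by (rule prob_space_unit_exp)
 interpret P: pair_prob_space M unit_exp ..
 define h where "h \<omega> = (if bounded_path \<omega> then exp (s * global_inf X \<omega>) else 0)" for \<omega>
 have hm[measurable]: "h \<in> borel_measurable M" unfolding h_def by measurable
 have "(\<lambda>n. \<integral>x. exp (s * inf_at (Q n) x) \<partial>EM)
   \<longlonglongrightarrow> (\<integral>x. h (fst x) \<partial>EM)"
 proof (rule integral_dominated_convergence[where w = "\<lambda>_. 1"])
  show "(\<lambda>x. exp (s * inf_at (Q n) x)) \<in> borel_measurable EM" for n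
   using measurable_EM(1)[OF Q0[of n]] by measurable
  show "AE x in EM. (\<lambda>n. exp (s * inf_at (Q n) x)) \<longlonglongrightarrow> h (fst x)"
   using AE_EM_exp_nonzero AE_space
  proof eventually_elim
   case (elim x)
   then have x: "fst x \<in> space M" and v: "0 < \<bar>snd x\<bar>" by (auto simp: space_pair_measure)
   have "filterlim Q (at_right 0) sequentially"
    using Q Q0 by (simp add: filterlim_at less_imp_neq[symmetric] eventually_sequentiallyI)
   then have T: "filterlim (\<lambda>n. \<bar>snd x\<bar> / Q n) at_top sequentially"
    unfolding divide_inverse using v
    by (intro filterlim_tendsto_pos_mult_at_top[OF tendsto_const] filterlim_compose[OF filterlim_inverse_at_top_right])
   show ?case
   proof (cases "bounded_path (fst x)")
    case True
    then have "(\<lambda>n. inf_at (Q n) x) \<longlonglongrightarrow> global_inf X (fst x)"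
     using running_inf_tendsto(1)[where X = X, OF cadlag_X[OF x] T] by (simp add: bounded_path_def)
    then show ?thesis using True by (auto simp: h_def intro!: tendsto_intros)
   next
    case False
    then have "filterlim (\<lambda>n. inf_at (Q n) x) at_bot sequentially"
     using running_inf_tendsto(2)[where X = X, OF cadlag_X[OF x] T] by (simp add: bounded_path_def)
    then have "filterlim (\<lambda>n. s * inf_at (Q n) x) at_bot sequentially"
     using s by (intro filterlim_tendsto_pos_mult_at_bot[OF tendsto_const])
    then have "(\<lambda>n. exp (s * inf_at (Q n) x)) \<longlonglongrightarrow> 0"
     by (rule filterlim_compose[OF exp_at_bot])
    then show ?thesis using False by (simp add: h_def)
   qed
  qed
  show "AE x in EM. norm (exp (s * inf_at (Q n) x)) \<le> 1" for n
   using X_0_EM AE_space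
  proof eventually_elim
   case (elim x)
   then have "inf_at (Q n) x \<le> 0"
    using Q0[of n] by (intro running_inf_le_0) (auto simp: space_pair_measure)
   then show ?case using s by (simp add: mult_nonneg_nonpos)
  qed
 qed auto
 also have "(\<integral>x. h (fst x) \<partial>EM) = (\<integral>\<omega>. h \<omega> \<partial>distr EM M fst)"
  by (rule integral_distr[symmetric]) auto
 also have "\<dots> = (\<integral>\<omega>. h \<omega> \<partial>M)" by (simp add: E.distr_pair_fst)
 finally show "(\<lambda>n. inf_laplace (Q n) s) \<longlonglongrightarrow> lim_laplace s"
  using inf_laplace_EM(1)[OF Q0 less_imp_le[OF s]] by (simp add: lim_laplace_def h_def)
qed

lemma global_inf_le_0: "AE \<omega> in M. bounded_path \<omega> \<longrightarrow> global_inf X \<omega> \<le> 0"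
 using X_0
proof eventually_elim
 case (elim \<omega>)
 show ?case
 proof
  assume "bounded_path \<omega>"
  then have "global_inf X \<omega> \<le> X 0 \<omega>"
   unfolding global_inf_def bounded_path_def by (intro cINF_lower) auto
  then show "global_inf X \<omega> \<le> 0" using elim by simp
 qed
qed

lemma lim_laplace_le: "0 \<le> s \<Longrightarrow> lim_laplace s \<le> prob {\<omega> \<in> space M. bounded_path \<omega>}"
proof -
 assume s: "0 \<le> s"
 have 1: "AE \<omega> in M. (if bounded_path \<omega> then exp (s * global_inf X \<omega>) else 0) \<le> indicator {\<omega> \<in> space M. bounded_path \<omega>} \<omega>"
  using global_inf_le_0 AE_space
  by eventually_elim (use s in \<open>auto simp: mult_nonneg_nonpos\<close>)
 have "integrable M (\<lambda>\<omega>. if bounded_path \<omega> then exp (s * global_inf X \<omega>) else 0)"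
 proof (rule integrable_const_bound[where B = 1])
  show "AE \<omega> in M. norm (if bounded_path \<omega> then exp (s * global_inf X \<omega>) else 0) \<le> 1"
   using global_inf_le_0 by eventually_elim (use s in \<open>auto simp: mult_nonneg_nonpos\<close>)
 qed measurable
 then have "lim_laplace s \<le> (\<integral>\<omega>. indicator {\<omega> \<in> space M. bounded_path \<omega>} \<omega> \<partial>M)"
  unfolding lim_laplace_def by (rule integral_mono_AE) (use 1 in \<open>auto simp: integrable_indicator_iff emeasure_eq_measure\<close>)
 then show ?thesis by simp
qed

text \<open>Large rates shrink the time to 0, and by right continuity the infimum tends to
  \<open>X 0\<close>, which is 0 almost surely. The density argument compares a fixed rate with
  these.\<close>

lemma inf_law_tail_tendsto_0:
 assumes e: "0 < e"
 shows "(\<lambda>n. measure (inf_law (real (Suc n))) {e<..}) \<longlonglongrightarrow> 0"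
proof -
 have q: "0 < real (Suc n)" for n by simp
 interpret P: prob_space "EM" by (rule prob_space_EM)
 note [measurable] = measurable_EM(1)[OF q]
 have "(\<lambda>n. \<integral>x. indicat_real {e<..} (- inf_at (real (Suc n)) x) \<partial>EM)
   \<longlonglongrightarrow> (\<integral>x. 0 \<partial>EM)"
 proof (rule integral_dominated_convergence[where w = "\<lambda>_. 1"])
  show "AE x in EM. (\<lambda>n. indicat_real {e<..} (- inf_at (real (Suc n)) x)) \<longlonglongrightarrow> 0"
   using X_0_EM AE_space
  proof eventually_elim
   case (elim x)
   then have x: "fst x \<in> space M" by (auto simp: space_pair_measure)
   have "(\<lambda>n. \<bar>snd x\<bar> * (1 / real (Suc n))) \<longlonglongrightarrow> \<bar>snd x\<bar> * 0"
    by (intro tendsto_intros LIMSEQ_Suc[OF lim_1_over_n])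
   then have "(\<lambda>n. inf_at (real (Suc n)) x) \<longlonglongrightarrow> X 0 (fst x)"
    by (intro running_inf_tendsto_0 cadlag_X x) auto
   then have "eventually (\<lambda>n. - e < inf_at (real (Suc n)) x) sequentially"
    using elim(1) e by (intro order_tendstoD(1)) auto
   then show ?case
    by (intro tendsto_eventually) (auto elim!: eventually_mono simp: indicator_def)
  qed
  show "(\<lambda>x. indicat_real {e<..} (- inf_at (real (Suc n)) x))
    \<in> borel_measurable EM" for n
   by measurable
 qed (auto simp: indicator_def)
 moreover have "measure (inf_law (real (Suc n))) {e<..}
   = (\<integral>x. indicat_real {e<..} (- inf_at (real (Suc n)) x) \<partial>EM)" for n
 proof -
  interpret I: prob_space "inf_law (real (Suc n))" by (rule inf_law_props) simp
  have "measure (inf_law (real (Suc n))) {e<..} = (\<integral>y. indicat_real {e<..} y \<partial>inf_law (real (Suc n)))"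
   using inf_law_props(2)[OF q[of n]] by simp
  also have "\<dots> = (\<integral>x. indicat_real {e<..} (- inf_at (real (Suc n)) x) \<partial>EM)"
   unfolding inf_law_def by (rule integral_distr; measurable)
  finally show ?thesis .
 qed
 ultimately show ?thesis by simp
qed

end

section \<open>Convergence of polynomials of bounded degree\<close>

lemma poly_eq_sum_le:
 fixes g :: "real poly"
 assumes "degree g \<le> d"
 shows "poly g s = (\<Sum>i\<le>d. coeff g i * s ^ i)"
 unfolding poly_altdef using assms
 by (intro sum.mono_neutral_left) (auto simp: coeff_eq_0)

text \<open>Lagrange interpolation: for bounded degree the coefficients depend continuously on the values.\<close>

lemma poly_coeff_convergence:
 fixes G :: "real \<Rightarrow> real poly"
 assumes deg: "\<And>q. 0 < q \<Longrightarrow> degree (G q) \<le> d"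
  and lim: "\<And>s. 0 < s \<Longrightarrow> ((\<lambda>q. poly (G q) s) \<longlongrightarrow> L s) (at_right 0)"
 obtains G0 :: "real poly" where "degree G0 \<le> d"
  "\<And>i. ((\<lambda>q. coeff (G q) i) \<longlongrightarrow> coeff G0 i) (at_right 0)"
  "\<And>s. ((\<lambda>q. poly (G q) s) \<longlongrightarrow> poly G0 s) (at_right 0)"
  "\<And>s. 0 < s \<Longrightarrow> poly G0 s = L s"
proof -
 \<comment> \<open>The nodes \<open>1, ..., d + 1\<close> are positive because the limits are given
   for positive arguments only.\<close>
 define x where "x i = real (Suc i)" for i :: nat
 define b where "b i = (\<Prod>j\<in>{..d} - {i}. smult (1 / (x i - x j)) [:- x j, 1:])" for i
 have degb: "degree (b i) \<le> d" if "i \<le> d" for i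
 proof -
  have "degree (b i) \<le> (\<Sum>j\<in>{..d} - {i}. degree (smult (1 / (x i - x j)) [:- x j, 1:]))"
   unfolding b_def
   using degree_prod_sum_le[of "{..d} - {i}" "\<lambda>j. smult (1 / (x i - x j)) [:- x j, 1:]"]
   by (simp only: o_def finite_Diff finite_atMost simp_thms)
  also have "\<dots> \<le> (\<Sum>j\<in>{..d} - {i}. 1)" by (intro sum_mono) simp
  also have "\<dots> = d" using that by simp
  finally show ?thesis .
 qed
 have bval: "poly (b i) (x k) = (if k = i then 1 else 0)" if "i \<le> d" "k \<le> d" for i k
 proof (cases "k = i")
  case True
  have "poly (smult (1 / (x i - x j)) [:- x j, 1:]) (x k) = 1" if "j \<in> {..d} - {i}" for j
  proof -
   have "x i - x j \<noteq> 0" using that by (simp add: x_def)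
   then show ?thesis by (simp add: True divide_simps)
  qed
  then show ?thesis unfolding b_def poly_prod True using prod.neutral by (metis (mono_tags, lifting))
 next
  case False
  then show ?thesis unfolding b_def poly_prod using that
   by (auto intro!: prod_zero bexI[of _ k] simp: field_simps)
 qed
 have interp: "g = (\<Sum>i\<le>d. smult (poly g (x i)) (b i))" if g: "degree g \<le> d" for g
 proof (rule poly_eqI_degree)
  show "poly g t = poly (\<Sum>i\<le>d. smult (poly g (x i)) (b i)) t" if "t \<in> x ` {..d}" for t
  proof -
   from that obtain k where k: "t = x k" "k \<le> d" by auto
   have "poly (\<Sum>i\<le>d. smult (poly g (x i)) (b i)) t = (\<Sum>i\<le>d. poly g (x i) * (if k = i then 1 else 0))"
    unfolding poly_sum k(1) by (intro sum.cong) (auto simp: bval k(2))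
   also have "\<dots> = poly g t" using k by (simp add: if_distrib[of "(*) _"] cong: if_cong)
   finally show ?thesis by simp
  qed
  have c: "card (x ` {..d}) = Suc d"
   by (subst card_image) (auto simp: inj_on_def x_def)
  show "degree g < card (x ` {..d})" using g c by simp
  have "degree (\<Sum>i\<le>d. smult (poly g (x i)) (b i)) \<le> d"
   by (intro degree_sum_le order.trans[OF degree_smult_le] degb) auto
  then show "degree (\<Sum>i\<le>d. smult (poly g (x i)) (b i)) < card (x ` {..d})" using c by simp
 qed
 define G0 where "G0 = (\<Sum>i\<le>d. smult (L (x i)) (b i))"
 have ev: "eventually (\<lambda>q::real. 0 < q) (at_right 0)" by (simp add: eventually_at_right_less)
 have co: "((\<lambda>q. coeff (G q) i) \<longlongrightarrow> coeff G0 i) (at_right 0)" for i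
 proof (rule Lim_transform_eventually)
  show "((\<lambda>q. \<Sum>k\<le>d. poly (G q) (x k) * coeff (b k) i) \<longlongrightarrow> coeff G0 i) (at_right 0)"
   unfolding G0_def coeff_sum coeff_smult by (intro tendsto_intros lim) (simp add: x_def)
  show "eventually (\<lambda>q. (\<Sum>k\<le>d. poly (G q) (x k) * coeff (b k) i) = coeff (G q) i) (at_right 0)"
   using ev
  proof eventually_elim
   case (elim q)
   have "coeff (G q) i = coeff (\<Sum>k\<le>d. smult (poly (G q) (x k)) (b k)) i"
    by (rule arg_cong[OF interp[OF deg[OF elim]]])
   then show ?case by (simp add: coeff_sum)
  qed
 qed
 have deg0: "degree G0 \<le> d"
  unfolding G0_def by (intro degree_sum_le order.trans[OF degree_smult_le] degb) auto
 have val: "((\<lambda>q. poly (G q) s) \<longlongrightarrow> poly G0 s) (at_right 0)" for s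
 proof (rule Lim_transform_eventually)
  show "((\<lambda>q. \<Sum>i\<le>d. coeff (G q) i * s ^ i) \<longlongrightarrow> poly G0 s) (at_right 0)"
   unfolding poly_eq_sum_le[OF deg0] by (intro tendsto_intros co)
  show "eventually (\<lambda>q. (\<Sum>i\<le>d. coeff (G q) i * s ^ i) = poly (G q) s) (at_right 0)"
   using ev by eventually_elim (simp add: poly_eq_sum_le[OF deg])
 qed
 show ?thesis
  by (rule that[OF deg0 co val]) (rule tendsto_unique[OF _ val lim], auto)
qed

section \<open>The slope of the exponent at zero\<close>

lemma char_derivative:
 fixes N :: "'a measure"
 assumes "prob_space N" and Y: "integrable N Y"
 shows "((\<lambda>u. ((\<integral>\<omega>. exp (\<i> * of_real u * of_real (Y \<omega>)) \<partial>N) - 1) / of_real u)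
  \<longlongrightarrow> \<i> * of_real (\<integral>\<omega>. Y \<omega> \<partial>N)) (at_right 0)"
proof (rule tendsto_at_right_sequentially[where b = 1])
 show "(0::real) < 1" by simp
next
 fix u :: "nat \<Rightarrow> real"
 assume u0: "\<And>n. 0 < u n" and "\<And>n. u n < 1" "decseq u" and u: "u \<longlonglongrightarrow> 0"
 interpret prob_space N by fact
 have [measurable]: "Y \<in> borel_measurable N" using Y by simp
 have bd: "norm (exp (\<i> * of_real v * of_real y) - 1) \<le> \<bar>v\<bar> * \<bar>y\<bar>" for v y :: real
 proof -
  have "norm (exp (\<i> * of_real v * of_real y) - exp 0) \<le> norm (\<i> * of_real v * of_real y - 0 :: complex)"
   by (rule norm_exp_diff_le) auto
  then show ?thesis by (simp add: norm_mult)
 qed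
 have "(\<lambda>n. \<integral>\<omega>. (exp (\<i> * of_real (u n) * of_real (Y \<omega>)) - 1) / of_real (u n) \<partial>N)
   \<longlonglongrightarrow> (\<integral>\<omega>. \<i> * of_real (Y \<omega>) \<partial>N)"
 proof (rule integral_dominated_convergence[where w = "\<lambda>\<omega>. \<bar>Y \<omega>\<bar>"])
  show "AE \<omega> in N. (\<lambda>n. (exp (\<i> * of_real (u n) * of_real (Y \<omega>)) - 1) / of_real (u n)) \<longlonglongrightarrow> \<i> * of_real (Y \<omega>)"
  proof (rule AE_I2)
   fix \<omega>
   have "((\<lambda>z. exp (\<i> * of_real (Y \<omega>) * z)) has_field_derivative \<i> * of_real (Y \<omega>)) (at 0)"
    by (auto intro!: derivative_eq_intros)
   then have "((\<lambda>z. (exp (\<i> * of_real (Y \<omega>) * z) - 1) / z) \<longlongrightarrow> \<i> * of_real (Y \<omega>)) (at 0)"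
    by (simp add: has_field_derivative_iff)
   moreover have "filterlim (\<lambda>n. complex_of_real (u n)) (at 0) sequentially"
    using tendsto_of_real[OF u, where 'a = complex] u0
    by (simp add: filterlim_at less_imp_neq[symmetric] eventually_sequentiallyI)
   ultimately have "(\<lambda>n. (exp (\<i> * of_real (Y \<omega>) * of_real (u n)) - 1) / of_real (u n)) \<longlonglongrightarrow> \<i> * of_real (Y \<omega>)"
    by (rule filterlim_compose)
   then show "(\<lambda>n. (exp (\<i> * of_real (u n) * of_real (Y \<omega>)) - 1) / of_real (u n)) \<longlonglongrightarrow> \<i> * of_real (Y \<omega>)"
    by (simp add: mult_ac)
  qed
  show "AE \<omega> in N. norm ((exp (\<i> * of_real (u n) * of_real (Y \<omega>)) - 1) / complex_of_real (u n)) \<le> \<bar>Y \<omega>\<bar>" for n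
  proof (rule AE_I2)
   fix \<omega>
   have "norm (exp (\<i> * of_real (u n) * of_real (Y \<omega>)) - 1) \<le> u n * \<bar>Y \<omega>\<bar>"
    using bd[of "u n" "Y \<omega>"] u0[of n] by simp
   then show "norm ((exp (\<i> * of_real (u n) * of_real (Y \<omega>)) - 1) / complex_of_real (u n)) \<le> \<bar>Y \<omega>\<bar>"
    using u0[of n] by (simp add: norm_divide divide_simps mult.commute)
  qed
 qed (use Y in auto)
 moreover have "(\<integral>\<omega>. (exp (\<i> * of_real (u n) * of_real (Y \<omega>)) - 1) / of_real (u n) \<partial>N)
   = ((\<integral>\<omega>. exp (\<i> * of_real (u n) * of_real (Y \<omega>)) \<partial>N) - 1) / of_real (u n)" for n
 proof -
  have "integrable N (\<lambda>\<omega>. exp (\<i> * of_real (u n) * of_real (Y \<omega>)))"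
   by (rule integrable_const_bound[where B = 1]) auto
  then show ?thesis by (simp add: prob_space)
 qed
 moreover have "(\<integral>\<omega>. \<i> * complex_of_real (Y \<omega>) \<partial>N) = \<i> * of_real (\<integral>\<omega>. Y \<omega> \<partial>N)" by simp
 ultimately show "(\<lambda>n. ((\<integral>\<omega>. exp (\<i> * of_real (u n) * of_real (Y \<omega>)) \<partial>N) - 1) / of_real (u n))
   \<longlonglongrightarrow> \<i> * of_real (\<integral>\<omega>. Y \<omega> \<partial>N)" by (simp only:)
qed

text \<open>\<open>exp w - 1\<close> equals \<open>w\<close> to first order. The quotient of the two
  is completed by 1 at 0, since \<open>w u\<close> may vanish.\<close>

lemma log_derivative_limit:
 fixes w :: "real \<Rightarrow> complex"
 assumes w: "(w \<longlongrightarrow> 0) F" and l: "((\<lambda>u. (exp (w u) - 1) / of_real u) \<longlongrightarrow> l) F"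
 shows "((\<lambda>u. w u / of_real u) \<longlongrightarrow> l) F"
proof -
 define k where "k z = (if z = 0 then 1 else (exp z - 1) / z)" for z :: complex
 have "((\<lambda>z. (exp z - 1) / z) \<longlongrightarrow> 1) (at (0::complex))"
  using DERIV_exp[of "0::complex"] by (simp add: has_field_derivative_iff)
 then have "(k \<longlongrightarrow> 1) (at 0)"
  by (rule Lim_transform_eventually) (auto simp: k_def eventually_at_filter)
 then have "isCont k 0" by (simp add: isCont_def k_def)
 then have k1: "((\<lambda>u. k (w u)) \<longlongrightarrow> 1) F"
  using isCont_tendsto_compose[OF _ w, of k] by (simp add: k_def)
 have "((\<lambda>u. ((exp (w u) - 1) / of_real u) / k (w u)) \<longlongrightarrow> l / 1) F"
  by (intro tendsto_divide l k1) simp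
 moreover have "eventually (\<lambda>u. ((exp (w u) - 1) / of_real u) / k (w u) = w u / of_real u) F"
 proof -
  have "eventually (\<lambda>u. k (w u) \<noteq> 0) F" using k1 by (rule tendsto_imp_eventually_ne) simp
  then show ?thesis by eventually_elim (auto simp: k_def)
 qed
 ultimately show ?thesis by (auto elim: Lim_transform_eventually)
qed

context model_setting
begin

text \<open>\<open>X 1\<close> is \<open>U - S 1\<close> with \<open>U\<close> independent of
  \<open>S 1\<close>. By Fubini, \<open>u - S 1\<close> is integrable for almost every value
  \<open>u\<close> of \<open>U\<close>, and a single such \<open>u\<close> is enough.\<close>

lemma integrable_S_1:
 assumes X: "integrable M (X 1)"
 shows "integrable M (S 1)"
proof -
 have ind: "indep_vars (\<lambda>_. borel) (\<lambda>k. part k 1) {..<3}"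
  by (rule indep_vars_of_indep_processes[OF indep_parts]) (rule measurable_process_events, simp)
 have "indep_vars (\<lambda>j. PiM (if j = (0::nat) then {0, 1} else {2::nat}) (\<lambda>_. borel))
   (\<lambda>j \<omega>. restrict (\<lambda>k. part k 1 \<omega>) (if j = 0 then {0, 1} else {2})) {0, 1}"
  by (rule indep_vars_restrict[OF ind]) (auto simp: disjoint_family_on_def)
 then have "indep_vars (\<lambda>_. borel) (\<lambda>j \<omega>. (if j = 0 then (\<lambda>f. drift p + gauss p * f 0 + f 1) else (\<lambda>f. f 2))
   (restrict (\<lambda>k. part k 1 \<omega>) (if j = 0 then {0, 1} else {2}))) {0, 1::nat}"
  by (rule indep_vars_compose2) auto
 from indep_var_of_indep_vars[OF this, of 0 1]
 have iv: "indep_var borel (\<lambda>\<omega>. drift p + gauss p * part 0 1 \<omega> + part 1 1 \<omega>) borel (part 2 1)"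
  by simp
 define U where "U \<omega> = drift p + gauss p * part 0 1 \<omega> + part 1 1 \<omega>" for \<omega>
 have [measurable]: "U \<in> borel_measurable M" "S 1 \<in> borel_measurable M"
  using iv unfolding U_def part_simps by (auto dest: indep_var_rv1 indep_var_rv2)
 have joint: "distr M (borel \<Otimes>\<^sub>M borel) (\<lambda>\<omega>. (U \<omega>, S 1 \<omega>)) = distr M borel U \<Otimes>\<^sub>M distr M borel (S 1)"
  using iv[folded U_def, unfolded part_simps, THEN indep_var_distribution_eq[THEN iffD1]] by simp
 interpret D1: prob_space "distr M borel U" by (rule prob_space_distr) simp
 interpret D2: prob_space "distr M borel (S 1)" by (rule prob_space_distr) simp
 interpret P: pair_prob_space "distr M borel U" "distr M borel (S 1)" ..
 have "integrable M (\<lambda>\<omega>. U \<omega> - S 1 \<omega>)"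
 proof -
  have "X 1 = (\<lambda>\<omega>. U \<omega> - S 1 \<omega>)" by (rule ext) (simp add: X_eq[of 1] U_def part_simps)
  then show ?thesis using X by simp
 qed
 then have "integrable (distr M (borel \<Otimes>\<^sub>M borel) (\<lambda>\<omega>. (U \<omega>, S 1 \<omega>))) (\<lambda>x. fst x - snd x)"
  by (subst integrable_distr_eq) auto
 then have "integrable (distr M borel U \<Otimes>\<^sub>M distr M borel (S 1)) (\<lambda>x. fst x - snd x)"
  by (simp add: joint)
 then have "AE u in distr M borel U. integrable (distr M borel (S 1)) (\<lambda>s. fst (u, s) - snd (u, s))"
  by (rule P.AE_integrable_fst')
 then obtain u where "integrable (distr M borel (S 1)) (\<lambda>s. u - s)"
  using D1.AE_False eventually_mono by fastforce
 then have "integrable M (\<lambda>\<omega>. u - S 1 \<omega>)" by (subst (asm) integrable_distr_eq) auto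
 then have "integrable M (\<lambda>\<omega>. u - (u - S 1 \<omega>))"
  by (rule Bochner_Integration.integrable_diff[OF integrable_const])
 moreover have "(\<lambda>\<omega>. u - (u - S 1 \<omega>)) = S 1" by (rule ext) simp
 ultimately show ?thesis by (simp only:)
qed

lemma Psi_S_real_0: "V.Psi_S_real 0 = 0"
 using V.Psi_S_of_real(2)[of 0] by simp

text \<open>For \<open>0 < r < 1\<close> the quotient \<open>(1 - exp (- r * s)) / r\<close> lies
  between \<open>1 - exp (- s)\<close>, by convexity, and \<open>s\<close>. Both are integrable at
  \<open>s = S 1\<close>, which may be negative; dominated convergence and the passage to the
  logarithm give the slope.\<close>

lemma Psi_S_real_derivative:
 assumes S: "integrable M (S 1)"
 shows "((\<lambda>r. V.Psi_S_real r / r) \<longlongrightarrow> expectation (S 1)) (at_right 0)"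
proof -
 have [measurable]: "S 1 \<in> borel_measurable M" using S by simp
 have "((\<lambda>r. (1 - exp (- V.Psi_S_real r)) / r) \<longlongrightarrow> expectation (S 1)) (at_right 0)"
 proof (rule tendsto_at_right_sequentially[where b = 1])
  show "(0::real) < 1" by simp
 next
  fix r :: "nat \<Rightarrow> real"
  assume r0: "\<And>n. 0 < r n" and r1: "\<And>n. r n < 1" and "decseq r" and r: "r \<longlonglongrightarrow> 0"
  have "(\<lambda>n. \<integral>\<omega>. (1 - exp (- r n * S 1 \<omega>)) / r n \<partial>M) \<longlonglongrightarrow> expectation (S 1)"
  proof (rule integral_dominated_convergence[where w = "\<lambda>\<omega>. \<bar>S 1 \<omega>\<bar> + \<bar>1 - exp (- S 1 \<omega>)\<bar>"])
   show "integrable M (\<lambda>\<omega>. \<bar>S 1 \<omega>\<bar> + \<bar>1 - exp (- S 1 \<omega>)\<bar>)"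
    using S integrable_exp_S(1)[of 1] by (auto intro!: Bochner_Integration.integrable_add integrable_abs)
   show "AE \<omega> in M. (\<lambda>n. (1 - exp (- r n * S 1 \<omega>)) / r n) \<longlonglongrightarrow> S 1 \<omega>"
   proof (rule AE_I2)
    fix \<omega>
    have "((\<lambda>t. 1 - exp (- t * S 1 \<omega>)) has_field_derivative S 1 \<omega>) (at 0)"
     by (auto intro!: derivative_eq_intros)
    then have "((\<lambda>t. (1 - exp (- t * S 1 \<omega>)) / t) \<longlongrightarrow> S 1 \<omega>) (at 0)"
     by (simp add: has_field_derivative_iff)
    moreover have "filterlim r (at 0) sequentially"
     using r r0 by (simp add: filterlim_at less_imp_neq[symmetric] eventually_sequentiallyI)
    ultimately show "(\<lambda>n. (1 - exp (- r n * S 1 \<omega>)) / r n) \<longlonglongrightarrow> S 1 \<omega>"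
     by (rule filterlim_compose)
   qed
   show "AE \<omega> in M. norm ((1 - exp (- r n * S 1 \<omega>)) / r n) \<le> \<bar>S 1 \<omega>\<bar> + \<bar>1 - exp (- S 1 \<omega>)\<bar>" for n
   proof (rule AE_I2)
    fix \<omega>
    let ?s = "S 1 \<omega>"
    have "1 - r n * ?s \<le> exp (- r n * ?s)" using exp_ge_add_one_self[of "- r n * ?s"] by simp
    then have 1: "(1 - exp (- r n * ?s)) / r n \<le> ?s" using r0[of n] by (simp add: field_simps)
    have "exp ((1 - r n) *\<^sub>R 0 + r n *\<^sub>R (- ?s)) \<le> (1 - r n) * exp 0 + r n * exp (- ?s)"
     using r0[of n] r1[of n] by (intro convex_onD[OF exp_convex]) auto
    then have "1 - exp (- r n * ?s) \<ge> r n * (1 - exp (- ?s))" by (simp add: algebra_simps)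
    then have 2: "1 - exp (- ?s) \<le> (1 - exp (- r n * ?s)) / r n" using r0[of n] by (simp add: field_simps)
    show "norm ((1 - exp (- r n * ?s)) / r n) \<le> \<bar>?s\<bar> + \<bar>1 - exp (- ?s)\<bar>"
     using 1 2 unfolding real_norm_def by linarith
   qed
  qed measurable
  moreover have "(\<integral>\<omega>. (1 - exp (- r n * S 1 \<omega>)) / r n \<partial>M) = (1 - exp (- V.Psi_S_real (r n))) / r n" for n
  proof -
   have "(\<integral>\<omega>. 1 - exp (- r n * S 1 \<omega>) \<partial>M) = 1 - exp (- V.Psi_S_real (r n))"
    using integrable_exp_S[of "r n"] r0[of n] by (simp add: prob_space)
   then show ?thesis by simp
  qed
  ultimately show "(\<lambda>n. (1 - exp (- V.Psi_S_real (r n))) / r n) \<longlonglongrightarrow> expectation (S 1)" by (simp only:)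
 qed
 then have "((\<lambda>r. complex_of_real (- ((1 - exp (- V.Psi_S_real r)) / r))) \<longlongrightarrow> of_real (- expectation (S 1))) (at_right 0)"
  by (intro tendsto_of_real tendsto_minus)
 then have 1: "((\<lambda>r. (exp (of_real (- V.Psi_S_real r)) - 1) / complex_of_real r) \<longlongrightarrow> of_real (- expectation (S 1))) (at_right 0)"
 proof (rule Lim_transform_eventually, intro always_eventually allI)
  fix r
  have "- ((1 - exp (- V.Psi_S_real r)) / r) = (exp (- V.Psi_S_real r) - 1) / r"
   by (simp add: minus_divide_left)
  then show "complex_of_real (- ((1 - exp (- V.Psi_S_real r)) / r)) = (exp (of_real (- V.Psi_S_real r)) - 1) / of_real r"
   by (simp only: exp_of_real of_real_divide of_real_diff of_real_1)
 qed
 have "continuous (at 0 within {0<..}) (\<lambda>r. Psi_S p (of_real r))"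
 proof -
  have "continuous_on {0..} (\<lambda>r. Psi_S p (complex_of_real r))"
   by (rule continuous_on_compose2[OF V.Psi_S_regular(1)]) (auto intro!: continuous_intros)
  then show ?thesis
   by (auto simp: continuous_on_eq_continuous_within intro: continuous_within_subset)
 qed
 then have "((\<lambda>r. Psi_S p (of_real r)) \<longlongrightarrow> 0) (at_right 0)"
  using V.Psi_S_of_real(1)[of 0] by (simp add: continuous_within Psi_S_real_0)
 then have "((\<lambda>r. - Psi_S p (of_real r)) \<longlongrightarrow> - 0) (at_right 0)" by (intro tendsto_minus)
 moreover have "eventually (\<lambda>r. - Psi_S p (of_real r) = complex_of_real (- V.Psi_S_real r)) (at_right 0)"
  using eventually_at_right_less[of 0] by eventually_elim (simp add: V.Psi_S_of_real(1))
 ultimately have 0: "((\<lambda>r. complex_of_real (- V.Psi_S_real r)) \<longlongrightarrow> 0) (at_right 0)"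
  by (auto elim: Lim_transform_eventually)
 have "((\<lambda>r. complex_of_real (- V.Psi_S_real r) / of_real r) \<longlongrightarrow> of_real (- expectation (S 1))) (at_right 0)"
  by (rule log_derivative_limit[OF 0 1])
 then have "((\<lambda>r. Re (- (complex_of_real (- V.Psi_S_real r) / of_real r))) \<longlongrightarrow> Re (- of_real (- expectation (S 1)))) (at_right 0)"
  by (intro tendsto_Re tendsto_minus)
 then show ?thesis by simp
qed

text \<open>The mean of \<open>X 1\<close> gives the slope of the exponent along the imaginary axis,
  while the positive axis is needed. Without the part of \<open>S\<close> the exponent is
  holomorphic near 0 and has the same derivative in all directions; the part of \<open>S\<close> is
  differentiated along each axis by itself, through its mean.\<close>

lemma exponent_derivative:
 assumes X: "integrable M (X 1)"
 shows "((\<lambda>s. Re (Psi_X p (of_real s)) / s) \<longlongrightarrow> expectation (X 1)) (at_right 0)"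
proof -
 note S = integrable_S_1[OF X]
 define R where "R z = Psi_X p z + Psi_S p z" for z
 have up0: "V.up_transform 0 = 1"
  using V.up_transform_eq[of 0] prob_space.prob_space[OF V.up_law_props(1)] by simp
 have R_eq: "R z = of_real (drift p) * z + of_real ((gauss p)\<^sup>2) * z\<^sup>2 + of_real (up_rate p) * (V.up_transform (- z) - 1)" for z
  by (simp add: R_def V.Psi_X_eq)
 define T where "T = {z::complex. (\<Prod>j=1..npoles p. (of_real (pole p j) + - z) ^ pole_order p j) \<noteq> 0}"
 have "open T" unfolding T_def by (intro open_Collect_neq continuous_intros)
 moreover have "R holomorphic_on T"
  unfolding R_eq[abs_def] V.up_transform_def by (intro holomorphic_intros) (auto simp: T_def)
 moreover have "0 \<in> T" using V.pole_pos by (fastforce simp: T_def)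
 ultimately have Rdiff: "R field_differentiable (at 0)"
  using holomorphic_on_imp_differentiable_at by blast
 from Rdiff obtain D where "(R has_field_derivative D) (at 0)" by (auto simp: field_differentiable_def)
 then have RD: "((\<lambda>z. R z / z) \<longlongrightarrow> D) (at 0)"
  by (simp add: has_field_derivative_iff R_eq up0)
 have im: "filterlim (\<lambda>u. \<i> * complex_of_real u) (at 0) (at_right 0)"
  unfolding filterlim_at using eventually_at_right_less[of "0::real"]
  by (auto intro!: tendsto_eq_intros elim: eventually_mono)
 have re: "filterlim (\<lambda>u. complex_of_real u) (at 0) (at_right 0)"
  unfolding filterlim_at using eventually_at_right_less[of "0::real"]
  by (auto intro!: tendsto_eq_intros elim: eventually_mono)
 have R0: "(R \<longlongrightarrow> 0) (at 0)"
  using field_differentiable_imp_continuous_at[OF Rdiff]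
  by (simp add: continuous_at R_eq up0)
 have S0: "((\<lambda>u. Psi_S p (\<i> * of_real u)) \<longlongrightarrow> 0) (at_right 0)"
 proof -
  have "continuous_on {0..} (\<lambda>u. Psi_S p (\<i> * complex_of_real u))"
   by (rule continuous_on_compose2[OF V.Psi_S_regular(1)]) (auto intro!: continuous_intros)
  then have "continuous (at 0 within {0<..}) (\<lambda>u. Psi_S p (\<i> * complex_of_real u))"
   by (auto simp: continuous_on_eq_continuous_within intro: continuous_within_subset)
  then show ?thesis
   using V.Psi_S_of_real(1)[of 0] by (simp add: continuous_within Psi_S_real_0)
 qed
 have X0: "((\<lambda>u. Psi_X p (\<i> * of_real u)) \<longlongrightarrow> 0) (at_right 0)"
  using tendsto_diff[OF filterlim_compose[OF R0 im] S0] by (simp add: R_def)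
 have m1: "((\<lambda>u. Psi_X p (\<i> * of_real u) / of_real u) \<longlongrightarrow> \<i> * of_real (expectation (X 1))) (at_right 0)"
  using char_derivative[OF prob_space_axioms X] exponent[of _ 0]
  by (intro log_derivative_limit[OF X0]) simp
 have m2: "((\<lambda>u. - Psi_S p (\<i> * of_real u) / of_real u) \<longlongrightarrow> - \<i> * of_real (expectation (S 1))) (at_right 0)"
 proof (rule log_derivative_limit)
  show "((\<lambda>u. - Psi_S p (\<i> * of_real u)) \<longlongrightarrow> 0) (at_right 0)" using tendsto_minus[OF S0] by simp
  have "((\<lambda>u. ((\<integral>\<omega>. exp (\<i> * of_real u * of_real (- S 1 \<omega>)) \<partial>M) - 1) / of_real u)
    \<longlongrightarrow> \<i> * of_real (\<integral>\<omega>. - S 1 \<omega> \<partial>M)) (at_right 0)"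
   by (rule char_derivative[OF prob_space_axioms]) (use S in simp)
  then show "((\<lambda>u. (exp (- Psi_S p (\<i> * of_real u)) - 1) / of_real u) \<longlongrightarrow> - \<i> * of_real (expectation (S 1))) (at_right 0)"
   using char_S[of _ 0] by simp
 qed
 have e1: "a / b / \<i> = a / (\<i> * b)" for a b :: complex by (metis divide_divide_eq_left mult.commute)
 have e2: "\<i> * a / \<i> = a" for a :: complex by simp
 note tendsto_diff[OF m1 m2]
 then have "((\<lambda>u. R (\<i> * of_real u) / of_real u) \<longlongrightarrow> \<i> * of_real (expectation (X 1) + expectation (S 1))) (at_right 0)"
  by (simp add: R_def add_divide_distrib algebra_simps)
 then have "((\<lambda>u. R (\<i> * of_real u) / of_real u / \<i>) \<longlongrightarrow> \<i> * of_real (expectation (X 1) + expectation (S 1)) / \<i>) (at_right 0)"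
  by (intro tendsto_divide tendsto_const) auto
 then have "((\<lambda>u. R (\<i> * of_real u) / (\<i> * of_real u)) \<longlongrightarrow> of_real (expectation (X 1) + expectation (S 1))) (at_right 0)"
  by (simp only: e1 e2)
 moreover have "((\<lambda>u. R (\<i> * of_real u) / (\<i> * of_real u)) \<longlongrightarrow> D) (at_right 0)"
  by (rule filterlim_compose[OF RD im])
 ultimately have D: "D = of_real (expectation (X 1) + expectation (S 1))"
  by (intro tendsto_unique[of "at_right (0::real)"]) auto
 have "((\<lambda>s. Re (R (of_real s) / of_real s)) \<longlongrightarrow> Re D) (at_right 0)"
  by (intro tendsto_Re filterlim_compose[OF RD re])
 then have "((\<lambda>s. Re (R (of_real s) / of_real s) - V.Psi_S_real s / s) \<longlongrightarrow> Re D - expectation (S 1)) (at_right 0)"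
  by (intro tendsto_diff Psi_S_real_derivative[OF S])
 moreover have "eventually (\<lambda>s. Re (R (of_real s) / of_real s) - V.Psi_S_real s / s = Re (Psi_X p (of_real s)) / s) (at_right 0)"
  using eventually_at_right_less[of 0]
  by eventually_elim (simp add: R_def V.Psi_S_real_def add_divide_distrib)
 ultimately show ?thesis by (auto simp: D elim: Lim_transform_eventually)
qed

end

lemma poly_eq_sum_Suc:
 fixes g :: "real poly"
 assumes "degree g \<le> Suc d"
 shows "poly g s = coeff g 0 + s * (\<Sum>i\<le>d. coeff g (Suc i) * s ^ i)"
 unfolding poly_eq_sum_le[OF assms] sum.atMost_Suc_shift
 by (simp add: sum_distrib_left mult_ac)

section \<open>The number of roots and the factorization at rate zero\<close>

context model_setting
begin

text \<open>Contains Case A and is disjoint from Cases B and C; it separates the two possible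
  numbers of roots.\<close>

definition plain :: bool where
 "plain \<longleftrightarrow> drift p = 0 \<and> gauss p = 0 \<and> driftless_subordinator p"

definition root_count :: nat where
 "root_count = (if plain then V.pole_count else Suc V.pole_count)"

text \<open>Common description of the situation for \<open>q > 0\<close> and for
  \<open>q = 0\<close>, so that transforms and densities can be treated for both at once. The
  cleared functions avoid exceptional points at the poles.\<close>

definition factors :: "real \<Rightarrow> real measure \<Rightarrow> real poly \<Rightarrow> bool" where
 "factors q \<mu> g \<longleftrightarrow> 0 \<le> q \<and> prob_space \<mu> \<and> sets \<mu> = sets borel \<and> emeasure \<mu> {..<0} = 0 \<and>
   degree g = root_count \<and> a_coef p q = (- 1) ^ root_count * coeff g root_count \<and> 0 < a_coef p q \<and>
   (\<forall>s\<ge>0. poly g s = (\<integral>y. exp (- s * y) \<partial>\<mu>) * (q * V.pole_real s - V.cleared_real s)) \<and>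
   (\<forall>s\<ge>0. kappa p q (- s) = poly g s / (a_coef p q * V.pole_real s))"

abbreviation psi :: "real \<Rightarrow> real" where
 "psi s \<equiv> Re (Psi_X p (of_real s))"

lemma pole_real_sign:
 assumes "\<And>j. j \<in> {1..npoles p} \<Longrightarrow> pole p j < s"
 shows "0 < (- 1) ^ V.pole_count * V.pole_real s"
proof -
 have "(- 1) ^ V.pole_count * V.pole_real s = (\<Prod>j=1..npoles p. (s - pole p j) ^ pole_order p j)"
 proof -
  have "(s - pole p j) ^ pole_order p j = (- 1) ^ pole_order p j * (pole p j - s) ^ pole_order p j" for j
   by (subst power_mult_distrib[symmetric]) simp
  then show ?thesis
   by (simp add: V.pole_count_def V.pole_real_def power_sum prod.distrib)
 qed
 then show ?thesis using assms by (auto intro!: prod_pos)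
qed

lemma poles_bounded: "\<exists>b. \<forall>s\<ge>b. \<forall>j\<in>{1..npoles p}. pole p j < s"
proof -
 define b where "b = (\<Sum>j=1..npoles p. pole p j) + 1"
 have "pole p j < s" if "b \<le> s" "j \<in> {1..npoles p}" for s j
 proof -
  have "pole p j \<le> (\<Sum>j=1..npoles p. pole p j)"
   using that(2) V.pole_pos by (intro member_le_sum) (auto intro: less_imp_le)
  then show ?thesis using that(1) by (simp add: b_def)
 qed
 then show ?thesis by blast
qed

lemma pole_real_nonzero_large:
 assumes "\<And>j. j \<in> {1..npoles p} \<Longrightarrow> pole p j < s"
 shows "V.pole_real s \<noteq> 0"
 using pole_real_sign[OF assms] by auto

text \<open>For large \<open>s\<close> the sign of \<open>(- 1) ^ pole_count * g s\<close> is that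
  of \<open>q - psi s\<close>, while \<open>(- 1) ^ degree g * g s\<close> is positive. In the plain
  case \<open>psi\<close> is eventually negative, otherwise it is eventually at least
  \<open>q\<close>, and this decides between the two degrees.\<close>

lemma degree_root_polynomial:
 assumes q: "0 < q" and deg: "degree g = V.pole_count \<or> degree g = Suc V.pole_count"
  and a: "0 < (- 1) ^ degree g * lead_coeff g"
  and val: "\<And>s. 0 \<le> s \<Longrightarrow> poly g s = (\<integral>y. exp (- s * y) \<partial>inf_law q) * (q * V.pole_real s - V.cleared_real s)"
 shows "degree g = root_count"
proof -
 obtain n where n: "\<And>s. n \<le> s \<Longrightarrow> 0 < (- 1) ^ degree g * poly g s"
 proof -
  have "0 < lead_coeff (smult ((- 1) ^ degree g) g)" using a by simp
  from poly_pinfty_gt_lc[OF this] obtain n where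
   "\<And>s. n \<le> s \<Longrightarrow> lead_coeff (smult ((- 1) ^ degree g) g) \<le> poly (smult ((- 1) ^ degree g) g) s" by blast
  then show thesis using a by (intro that[of n]) (force intro: less_le_trans)
 qed
 obtain b where b: "\<And>s j. b \<le> s \<Longrightarrow> j \<in> {1..npoles p} \<Longrightarrow> pole p j < s"
  using poles_bounded by blast
 have eq: "(- 1) ^ V.pole_count * poly g s
   = (\<integral>y. exp (- s * y) \<partial>inf_law q) * (q - psi s) * ((- 1) ^ V.pole_count * V.pole_real s)"
  and phi: "0 < (\<integral>y. exp (- s * y) \<partial>inf_law q)"
  and sgn: "0 < (- 1) ^ V.pole_count * V.pole_real s" if s: "0 \<le> s" "b \<le> s" for s
 proof -
  show "0 < (- 1) ^ V.pole_count * V.pole_real s" using b[OF s(2)] by (rule pole_real_sign)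
  show "0 < (\<integral>y. exp (- s * y) \<partial>inf_law q)" by (intro laplace_pos inf_law_props q s(1))
  have c: "V.cleared_real s = V.pole_real s * psi s"
   using pole_real_nonzero_large[OF b[OF s(2)]] by (intro V.cleared_real_eq s(1))
  show "(- 1) ^ V.pole_count * poly g s
   = (\<integral>y. exp (- s * y) \<partial>inf_law q) * (q - psi s) * ((- 1) ^ V.pole_count * V.pole_real s)"
   unfolding val[OF s(1)] c by algebra
 qed
 have pos: "0 < q - psi s" if "0 \<le> s" "b \<le> s" "0 < (- 1) ^ V.pole_count * poly g s" for s
  using that(3) unfolding eq[OF that(1,2)]
  by (rule zero_less_mult_pos[OF zero_less_mult_pos2[OF _ sgn[OF that(1,2)]] phi[OF that(1,2)]])
 have neg: "q - psi s < 0" if "0 \<le> s" "b \<le> s" "(- 1) ^ V.pole_count * poly g s < 0" for s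
 proof (rule ccontr)
  assume "\<not> q - psi s < 0"
  then have "0 \<le> (- 1) ^ V.pole_count * poly g s"
   unfolding eq[OF that(1,2)] not_less
   by (rule mult_nonneg_nonneg[OF mult_nonneg_nonneg[OF less_imp_le[OF phi[OF that(1,2)]]] less_imp_le[OF sgn[OF that(1,2)]]])
  then show False using that(3) by simp
 qed
 show ?thesis
 proof (cases plain)
  case True
  then obtain R where R: "\<And>z. Re z \<ge> 0 \<Longrightarrow> R \<le> norm z \<Longrightarrow> Re (Psi_X p z) < 0"
   using V.driftless_exponent_negative unfolding plain_def by blast
  define s where "s = max (max 0 b) (max n R)"
  have s: "0 \<le> s" "b \<le> s" "n \<le> s" "R \<le> s" by (auto simp: s_def)
  have "psi s < 0" using R[of "of_real s"] s by simp
  show ?thesis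
  proof (rule ccontr)
   assume "degree g \<noteq> root_count"
   then have "degree g = Suc V.pole_count" using deg True by (simp add: root_count_def)
   then have "(- 1) ^ V.pole_count * poly g s < 0" using n[OF s(3)] by simp
   then show False using neg[OF s(1,2)] \<open>psi s < 0\<close> q by linarith
  qed
 next
  case False
  then obtain R where R: "\<And>s. R \<le> s \<Longrightarrow> q \<le> psi s"
   using V.exponent_tends_to_infinity(2)[of q] unfolding plain_def by blast
  define s where "s = max (max 0 b) (max n R)"
  have s: "0 \<le> s" "b \<le> s" "n \<le> s" "R \<le> s" by (auto simp: s_def)
  show ?thesis
  proof (rule ccontr)
   assume "degree g \<noteq> root_count"
   then have "degree g = V.pole_count" using deg False by (simp add: root_count_def)
   then have "0 < (- 1) ^ V.pole_count * poly g s" using n[OF s(3)] by simp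
   then show False using pos[OF s(1,2)] R[OF s(4)] by linarith
  qed
 qed
qed

lemma root_polynomial_degree:
 assumes q: "0 < q"
 shows "\<exists>g :: real poly. degree g = root_count \<and>
  a_coef p q = (- 1) ^ root_count * coeff g root_count \<and> 0 < a_coef p q \<and>
  (\<forall>s. kappa_pos p q (- s) = poly g s / (a_coef p q * V.pole_real s)) \<and>
  (\<forall>s\<ge>0. poly g s = inf_laplace q s * (q * V.pole_real s - V.cleared_real s)) \<and>
  poly g 0 = q * V.pole_real 0 \<and>
  (\<forall>R. (\<forall>b\<in>roots p q. norm b \<le> R) \<longrightarrow> (\<forall>s\<ge>0. \<bar>poly g s\<bar> \<le> a_coef p q * (R + s) ^ root_count))"
proof -
 from root_polynomial[OF q] obtain g :: "real poly" where
  g: "degree g = V.pole_count \<or> degree g = Suc V.pole_count"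
   "a_coef p q = (- 1) ^ degree g * lead_coeff g" "0 < a_coef p q"
   "\<forall>s. kappa_pos p q (- s) = poly g s / (a_coef p q * V.pole_real s)"
   "\<forall>s\<ge>0. poly g s = (\<integral>y. exp (- s * y) \<partial>inf_law q) * (q * V.pole_real s - V.cleared_real s)"
   "poly g 0 = q * V.pole_real 0"
   "\<forall>R. (\<forall>b\<in>roots p q. norm b \<le> R) \<longrightarrow> (\<forall>s\<ge>0. \<bar>poly g s\<bar> \<le> a_coef p q * (R + s) ^ degree g)"
  by blast
 have d: "degree g = root_count"
  using g(2,3,5) by (intro degree_root_polynomial[OF q g(1)]) auto
 show ?thesis
  using g unfolding d inf_laplace_def by (intro exI[of _ g]) (simp add: d)
qed

lemma factors_inf_law:
 assumes q: "0 < q"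
 shows "\<exists>g. factors q (inf_law q) g"
proof -
 from root_polynomial_degree[OF q] obtain g where
  "degree g = root_count" "a_coef p q = (- 1) ^ root_count * coeff g root_count" "0 < a_coef p q"
  "\<forall>s. kappa_pos p q (- s) = poly g s / (a_coef p q * V.pole_real s)"
  "\<forall>s\<ge>0. poly g s = inf_laplace q s * (q * V.pole_real s - V.cleared_real s)" by blast
 then have "factors q (inf_law q) g"
  unfolding factors_def using inf_law_props[OF q] q by (simp add: inf_laplace_def kappa_def)
 then show ?thesis by blast
qed

text \<open>Outside a fixed disc the exponent has negative real part in the plain case and modulus
  at least 2 otherwise; neither is compatible with a value in the interval from 0 to 1, whatever
  \<open>q\<close> is.\<close>

lemma roots_bounded: "\<exists>R\<ge>0. \<forall>q b. 0 < q \<longrightarrow> q \<le> 1 \<longrightarrow> b \<in> roots p q \<longrightarrow> norm b \<le> R"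
proof (cases plain)
 case True
 then obtain R where R: "\<And>z. Re z \<ge> 0 \<Longrightarrow> R \<le> norm z \<Longrightarrow> Re (Psi_X p z) < 0"
  using V.driftless_exponent_negative unfolding plain_def by blast
 have "norm b \<le> max 0 R" if "0 < q" "b \<in> roots p q" for q b
 proof (rule ccontr)
  assume "\<not> norm b \<le> max 0 R"
  then have "Re (Psi_X p b) < 0" using R[of b] that(2) by (simp add: roots_def)
  then show False using that by (simp add: roots_def)
 qed
 then show ?thesis by (intro exI[of _ "max 0 R"]) auto
next
 case False
 then obtain R where R: "\<And>z. Re z \<ge> 0 \<Longrightarrow> R \<le> norm z \<Longrightarrow> 2 \<le> norm (Psi_X p z)"
  using V.exponent_tends_to_infinity(1)[of 2] unfolding plain_def by blast
 have "norm b \<le> max 0 R" if "0 < q" "q \<le> 1" "b \<in> roots p q" for q b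
 proof (rule ccontr)
  assume "\<not> norm b \<le> max 0 R"
  then have "2 \<le> norm (Psi_X p b)" using R[of b] that(3) by (simp add: roots_def)
  then show False using that by (simp add: roots_def)
 qed
 then show ?thesis by (intro exI[of _ "max 0 R"]) auto
qed

lemma continuous_pole_real: "continuous_on UNIV V.pole_real"
 unfolding V.pole_real_def[abs_def] by (intro continuous_intros)

definition global_law :: "real measure" where
 "global_law = distr M borel (\<lambda>\<omega>. - global_inf X \<omega>)"

text \<open>The limits of the transforms at positive \<open>s\<close> describe only a possibly
  defective law, whose mass is the limit of \<open>lim_laplace s\<close> at 0. That mass is the
  ratio of the slopes at 0 of the limit polynomial and of \<open>- pole_real s * psi s\<close>, and
  both slopes equal \<open>- m * pole_real 0\<close>.\<close>

lemma factors_global_law: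
 assumes pm: "positive_mean M X"
 shows "\<exists>g. factors 0 global_law g"
  and "AE \<omega> in M. bounded_path \<omega>"
  and "0 < s \<Longrightarrow> (\<integral>y. exp (- s * y) \<partial>global_law) = lim_laplace s"
proof -
 define m where "m = expectation (X 1)"
 have m: "0 < m" using pm by (simp add: m_def positive_mean_def)
 then have int: "integrable M (X 1)" unfolding m_def using not_integrable_integral_eq by fastforce
 have "\<forall>q. \<exists>g :: real poly. 0 < q \<longrightarrow> degree g = root_count \<and>
  a_coef p q = (- 1) ^ root_count * coeff g root_count \<and> 0 < a_coef p q \<and>
  (\<forall>s. kappa_pos p q (- s) = poly g s / (a_coef p q * V.pole_real s)) \<and>
  (\<forall>s\<ge>0. poly g s = inf_laplace q s * (q * V.pole_real s - V.cleared_real s)) \<and>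
  poly g 0 = q * V.pole_real 0 \<and>
  (\<forall>R. (\<forall>b\<in>roots p q. norm b \<le> R) \<longrightarrow> (\<forall>s\<ge>0. \<bar>poly g s\<bar> \<le> a_coef p q * (R + s) ^ root_count))"
  using root_polynomial_degree by blast
 from choice[OF this] obtain G :: "real \<Rightarrow> real poly" where
  deg: "\<And>q. 0 < q \<Longrightarrow> degree (G q) = root_count" and
  aq: "\<And>q. 0 < q \<Longrightarrow> a_coef p q = (- 1) ^ root_count * coeff (G q) root_count" and
  aq0: "\<And>q. 0 < q \<Longrightarrow> 0 < a_coef p q" and
  kq: "\<And>q s. 0 < q \<Longrightarrow> kappa_pos p q (- s) = poly (G q) s / (a_coef p q * V.pole_real s)" and
  val: "\<And>q s. 0 < q \<Longrightarrow> 0 \<le> s \<Longrightarrow> poly (G q) s = inf_laplace q s * (q * V.pole_real s - V.cleared_real s)" and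
  val0: "\<And>q. 0 < q \<Longrightarrow> poly (G q) 0 = q * V.pole_real 0" and
  bd: "\<And>q R s. 0 < q \<Longrightarrow> \<forall>b\<in>roots p q. norm b \<le> R \<Longrightarrow> 0 \<le> s \<Longrightarrow>
    \<bar>poly (G q) s\<bar> \<le> a_coef p q * (R + s) ^ root_count"
  by fast
 have ev: "eventually (\<lambda>q::real. 0 < q) (at_right 0)" by (simp add: eventually_at_right_less)
 have nb: "at_right (0::real) \<noteq> bot" by simp
 have q0: "((\<lambda>q::real. q) \<longlongrightarrow> 0) (at_right 0)" by (rule tendsto_ident_at)
 have lims: "((\<lambda>q. poly (G q) s) \<longlongrightarrow> lim_laplace s * (0 * V.pole_real s - V.cleared_real s)) (at_right 0)"
  if s: "0 < s" for s
 proof (rule Lim_transform_eventually)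
  show "((\<lambda>q. inf_laplace q s * (q * V.pole_real s - V.cleared_real s))
    \<longlongrightarrow> lim_laplace s * (0 * V.pole_real s - V.cleared_real s)) (at_right 0)"
   by (intro tendsto_intros inf_laplace_tendsto s)
  show "eventually (\<lambda>q. inf_laplace q s * (q * V.pole_real s - V.cleared_real s) = poly (G q) s) (at_right 0)"
   using ev by eventually_elim (use s in \<open>simp add: val\<close>)
 qed
 obtain G0 :: "real poly" where G0: "degree G0 \<le> root_count"
  and co: "\<And>i. ((\<lambda>q. coeff (G q) i) \<longlongrightarrow> coeff G0 i) (at_right 0)"
  and vl: "\<And>s. ((\<lambda>q. poly (G q) s) \<longlongrightarrow> poly G0 s) (at_right 0)"
  and G0v: "\<And>s. 0 < s \<Longrightarrow> poly G0 s = lim_laplace s * (0 * V.pole_real s - V.cleared_real s)"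
 proof (rule poly_coeff_convergence[of G root_count "\<lambda>s. lim_laplace s * (0 * V.pole_real s - V.cleared_real s)"])
  show "degree (G q) \<le> root_count" if "0 < q" for q using deg[OF that] by simp
  show "((\<lambda>q. poly (G q) s) \<longlongrightarrow> lim_laplace s * (0 * V.pole_real s - V.cleared_real s)) (at_right 0)"
   if "0 < s" for s by (rule lims[OF that])
 next
  fix G0 :: "real poly"
  assume "degree G0 \<le> root_count" "\<And>i. ((\<lambda>q. coeff (G q) i) \<longlongrightarrow> coeff G0 i) (at_right 0)"
   "\<And>s. ((\<lambda>q. poly (G q) s) \<longlongrightarrow> poly G0 s) (at_right 0)"
   "\<And>s. 0 < s \<Longrightarrow> poly G0 s = lim_laplace s * (0 * V.pole_real s - V.cleared_real s)"
  then show thesis by (rule that)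
 qed
 have G00: "poly G0 0 = 0"
 proof (rule tendsto_unique[OF nb vl])
  show "((\<lambda>q. poly (G q) 0) \<longlongrightarrow> 0) (at_right 0)"
  proof (rule Lim_transform_eventually)
   show "((\<lambda>q. q * V.pole_real 0) \<longlongrightarrow> 0) (at_right 0)" using tendsto_mult_left_zero[OF q0] by simp
   show "eventually (\<lambda>q. q * V.pole_real 0 = poly (G q) 0) (at_right 0)"
    using ev by eventually_elim (simp add: val0)
  qed
 qed
 have "0 < root_count" using V.degree_numer(2) by (simp add: root_count_def)
 then obtain d where d: "root_count = Suc d" by (cases root_count) auto
 have P0: "0 < V.pole_real 0" by (rule V.pole_real_pos) simp
 have Plim: "(V.pole_real \<longlongrightarrow> V.pole_real 0) (at_right 0)"
  using continuous_pole_real by (auto simp: continuous_on_eq_continuous_within continuous_within intro: tendsto_within_subset)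
 have dpsi: "((\<lambda>s. psi s / s) \<longlongrightarrow> m) (at_right 0)"
  unfolding m_def by (rule exponent_derivative[OF int])
 have evP: "eventually (\<lambda>s. 0 < s \<and> 0 < V.pole_real s \<and> 0 < psi s) (at_right 0)"
  using ev order_tendstoD(1)[OF Plim P0] order_tendstoD(1)[OF dpsi m]
  by eventually_elim (auto simp: zero_less_divide_iff)
 \<comment> \<open>Taking \<open>q = psi s\<close> makes \<open>s\<close> itself a root of the
   polynomial \<open>G q\<close>, without an inverse function of \<open>psi\<close>.\<close>
 have psi0: "filterlim psi (at_right 0) (at_right 0)"
  unfolding filterlim_at
 proof
  have "((\<lambda>s. psi s / s * s) \<longlongrightarrow> m * 0) (at_right 0)" by (intro tendsto_mult dpsi q0)
  moreover have "eventually (\<lambda>s. psi s / s * s = psi s) (at_right 0)"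
   using ev by eventually_elim simp
  ultimately show "(psi \<longlongrightarrow> 0) (at_right 0)" by (auto elim: Lim_transform_eventually)
  show "eventually (\<lambda>s. psi s \<in> {0<..} \<and> psi s \<noteq> 0) (at_right 0)"
   using evP by eventually_elim auto
 qed
 have cl: "V.cleared_real s = V.pole_real s * psi s" if "0 \<le> s" "0 < V.pole_real s" for s
  using that by (intro V.cleared_real_eq) auto
 text \<open>The real root of \<open>G q\<close> that tends to 0 determines the derivative of \<open>G0\<close> at 0.\<close>
 have c1: "coeff G0 1 = - (m * V.pole_real 0)"
 proof (rule tendsto_unique[OF nb])
  have "((\<lambda>s. \<Sum>i\<le>d. coeff (G (psi s)) (Suc i) * s ^ i) \<longlongrightarrow> (\<Sum>i\<le>d. coeff G0 (Suc i) * 0 ^ i)) (at_right 0)"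
   by (intro tendsto_sum tendsto_mult tendsto_power q0 filterlim_compose[OF co psi0])
  moreover have "(\<Sum>i\<le>d. coeff G0 (Suc i) * 0 ^ i) = coeff G0 1"
   by (simp add: power_0_left if_distrib[of "(*) _"] cong: if_cong)
  ultimately show "((\<lambda>s. \<Sum>i\<le>d. coeff (G (psi s)) (Suc i) * s ^ i) \<longlongrightarrow> coeff G0 1) (at_right 0)" by (simp only:)
  have "((\<lambda>s. - (psi s / s * V.pole_real 0)) \<longlongrightarrow> - (m * V.pole_real 0)) (at_right 0)"
   by (intro tendsto_intros dpsi)
  moreover have "eventually (\<lambda>s. - (psi s / s * V.pole_real 0) = (\<Sum>i\<le>d. coeff (G (psi s)) (Suc i) * s ^ i)) (at_right 0)"
   using evP
  proof eventually_elim
   case (elim s)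
   have dg: "degree (G (psi s)) \<le> Suc d" using deg[of "psi s"] elim d by simp
   have "poly (G (psi s)) s = 0" using val[of "psi s" s] elim cl[of s] by simp
   moreover have "coeff (G (psi s)) 0 = psi s * V.pole_real 0"
    using val0[of "psi s"] elim by (simp add: poly_0_coeff_0)
   ultimately have "s * (\<Sum>i\<le>d. coeff (G (psi s)) (Suc i) * s ^ i) = - (psi s * V.pole_real 0)"
    using poly_eq_sum_Suc[OF dg, of s] by simp
   then show ?case using elim by (simp add: field_simps)
  qed
  ultimately show "((\<lambda>s. \<Sum>i\<le>d. coeff (G (psi s)) (Suc i) * s ^ i) \<longlongrightarrow> - (m * V.pole_real 0)) (at_right 0)"
   by (rule Lim_transform_eventually)
 qed
 then have "coeff G0 1 \<noteq> 0" using m P0 by simp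
 then have G0nz: "G0 \<noteq> 0" by auto
 define a0 where "a0 = (- 1) ^ root_count * coeff G0 root_count"
 have alim: "((\<lambda>q. a_coef p q) \<longlongrightarrow> a0) (at_right 0)"
 proof (rule Lim_transform_eventually)
  show "((\<lambda>q. (- 1) ^ root_count * coeff (G q) root_count) \<longlongrightarrow> a0) (at_right 0)"
   unfolding a0_def by (intro tendsto_intros co)
  show "eventually (\<lambda>q. (- 1) ^ root_count * coeff (G q) root_count = a_coef p q) (at_right 0)"
   using ev by eventually_elim (simp add: aq)
 qed
 obtain R where R: "0 \<le> R" "\<And>q b. 0 < q \<Longrightarrow> q \<le> 1 \<Longrightarrow> b \<in> roots p q \<Longrightarrow> norm b \<le> R"
  using roots_bounded by blast
 have ev1: "eventually (\<lambda>q::real. q \<le> 1) (at_right 0)"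
  using order_tendstoD(2)[OF q0, of 1] by (auto elim: eventually_mono)
 have bd0: "\<bar>poly G0 s\<bar> \<le> a0 * (R + s) ^ root_count" if s: "0 \<le> s" for s
 proof (rule tendsto_le[OF nb])
  show "((\<lambda>q. a_coef p q * (R + s) ^ root_count) \<longlongrightarrow> a0 * (R + s) ^ root_count) (at_right 0)"
   by (intro tendsto_intros alim)
  show "((\<lambda>q. \<bar>poly (G q) s\<bar>) \<longlongrightarrow> \<bar>poly G0 s\<bar>) (at_right 0)" by (intro tendsto_intros vl)
  show "eventually (\<lambda>q. \<bar>poly (G q) s\<bar> \<le> a_coef p q * (R + s) ^ root_count) (at_right 0)"
   using ev ev1 by eventually_elim (intro bd ballI s R(2))
 qed
 \<comment> \<open>If \<open>a0\<close> were not positive, the bound by the roots would force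
   \<open>G0 = 0\<close>, contrary to its nonzero slope at 0.\<close>
 have a0: "0 < a0"
 proof (rule ccontr)
  assume "\<not> 0 < a0"
  then have "a0 * (R + s) ^ root_count \<le> 0" if "0 \<le> s" for s
   using that R(1) by (intro mult_nonpos_nonneg) auto
  then have "poly G0 s = 0" if "0 \<le> s" for s
   using bd0[OF that] that by (metis abs_le_zero_iff order.trans)
  then have "{0..} \<subseteq> {s. poly G0 s = 0}" by auto
  then have "finite {0::real..}" using poly_roots_finite[OF G0nz] finite_subset by blast
  then show False using infinite_Ici by blast
 qed
 have deg0: "degree G0 = root_count"
  using G0 a0 by (intro antisym le_degree) (auto simp: a0_def)
 have "((\<lambda>s. - (\<Sum>i\<le>d. coeff G0 (Suc i) * s ^ i) / (V.pole_real s * (psi s / s))) \<longlongrightarrow>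
   - (\<Sum>i\<le>d. coeff G0 (Suc i) * 0 ^ i) / (V.pole_real 0 * m)) (at_right 0)"
  using P0 m by (intro tendsto_intros Plim dpsi) auto
 moreover have "(\<Sum>i\<le>d. coeff G0 (Suc i) * 0 ^ i) = - (m * V.pole_real 0)"
  by (simp add: power_0_left if_distrib[of "(*) _"] c1[simplified] cong: if_cong)
 ultimately have l1: "((\<lambda>s. - (\<Sum>i\<le>d. coeff G0 (Suc i) * s ^ i) / (V.pole_real s * (psi s / s))) \<longlongrightarrow> 1) (at_right 0)"
  using P0 m by (simp add: mult.commute)
 \<comment> \<open>The expression in \<open>l1\<close> is \<open>lim_laplace s\<close>, which never
   exceeds the probability of a path bounded below; its limit 1 rules out a loss of mass.\<close>
 have "1 \<le> prob {\<omega> \<in> space M. bounded_path \<omega>}"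
 proof (rule tendsto_upperbound[OF l1 _ nb])
  show "eventually (\<lambda>s. - (\<Sum>i\<le>d. coeff G0 (Suc i) * s ^ i) / (V.pole_real s * (psi s / s))
    \<le> prob {\<omega> \<in> space M. bounded_path \<omega>}) (at_right 0)"
   using evP
  proof eventually_elim
   case (elim s)
   have "degree G0 \<le> Suc d" using G0 d by simp
   then have "poly G0 s = s * (\<Sum>i\<le>d. coeff G0 (Suc i) * s ^ i)"
    using poly_eq_sum_Suc[of G0 d s] G00 by (simp add: poly_0_coeff_0)
   then have "- (s * (\<Sum>i\<le>d. coeff G0 (Suc i) * s ^ i)) = lim_laplace s * (V.pole_real s * psi s)"
    using G0v[of s] elim cl[of s] by simp
   then have "- (\<Sum>i\<le>d. coeff G0 (Suc i) * s ^ i) = lim_laplace s * (V.pole_real s * (psi s / s))"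
    using elim by (simp add: field_simps)
   then have "- (\<Sum>i\<le>d. coeff G0 (Suc i) * s ^ i) / (V.pole_real s * (psi s / s)) = lim_laplace s"
    using elim by (simp add: divide_eq_eq)
   then show ?case using lim_laplace_le[of s] elim by simp
  qed
 qed
 then have "prob {\<omega> \<in> space M. bounded_path \<omega>} = 1" using prob_le_1 by (rule antisym[rotated])
 then show bdp: "AE \<omega> in M. bounded_path \<omega>"
  by (subst (asm) prob_Collect_eq_1) auto
 have tr: "(\<integral>y. exp (- s * y) \<partial>global_law) = (\<integral>\<omega>. exp (s * global_inf X \<omega>) \<partial>M)" for s
  unfolding global_law_def by (subst integral_distr) auto
 show trs: "(\<integral>y. exp (- s * y) \<partial>global_law) = lim_laplace s" if s: "0 < s" for s
  unfolding tr lim_laplace_def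
  by (rule integral_cong_AE) (use bdp in \<open>auto elim: eventually_mono\<close>)
 \<comment> \<open>The exponent vanishes at 0; here this is read off from the factorization at rate
   1.\<close>
 have c0: "V.cleared_real 0 = 0"
 proof -
  interpret I: prob_space "inf_law 1" by (rule inf_law_props) simp
  have "inf_laplace 1 0 = 1" by (simp add: inf_laplace_def I.prob_space)
  then show ?thesis using val[of 1 0] val0[of 1] by simp
 qed
 have "AE y in global_law. \<not> y < 0"
  unfolding global_law_def using global_inf_le_0 bdp
  by (subst AE_distr_iff) (auto elim: eventually_elim2)
 then have null: "emeasure global_law {..<0} = 0"
  by (subst (asm) AE_iff_measurable[OF _ refl]) (auto simp: global_law_def lessThan_def)
 have a0c: "a_coef p 0 = a0"
 proof -
  have "((\<lambda>q. q / kappa p q 0) \<longlongrightarrow> a0) (at_right 0)"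
  proof (rule Lim_transform_eventually[OF alim])
   show "eventually (\<lambda>q. a_coef p q = q / kappa p q 0) (at_right 0)"
    using ev by eventually_elim (simp add: a_coef_def)
  qed
  then show ?thesis by (simp add: a_coef_def tendsto_Lim)
 qed
 have k0: "kappa p 0 (- s) = poly G0 s / (a0 * V.pole_real s)" for s
 proof -
  have "((\<lambda>q. kappa_pos p q (- s)) \<longlongrightarrow> poly G0 s / (a0 * V.pole_real s)) (at_right 0)"
  proof (rule Lim_transform_eventually)
   show "((\<lambda>q. poly (G q) s / (a_coef p q * V.pole_real s)) \<longlongrightarrow> poly G0 s / (a0 * V.pole_real s)) (at_right 0)"
   proof (cases "V.pole_real s = 0")
    case False
    then show ?thesis using a0 by (intro tendsto_intros vl alim) auto
   qed simp
   show "eventually (\<lambda>q. poly (G q) s / (a_coef p q * V.pole_real s) = kappa_pos p q (- s)) (at_right 0)"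
    using ev by eventually_elim (simp add: kq)
  qed
  then show ?thesis by (simp add: kappa_def tendsto_Lim)
 qed
 have pg: "prob_space global_law" unfolding global_law_def by (rule prob_space_distr) simp
 have "poly G0 s = (\<integral>y. exp (- s * y) \<partial>global_law) * (0 * V.pole_real s - V.cleared_real s)" if "0 \<le> s" for s
  using that trs[of s] G0v[of s] G00 c0 by (cases "s = 0") auto
 then have "factors 0 global_law G0"
  unfolding factors_def using pg null deg0 a0 a0c k0
  by (simp add: global_law_def a0_def)
 then show "\<exists>g. factors 0 global_law g" by blast
qed

lemma lim_laplace_le_inf_laplace:
 assumes "0 < s" "0 < q"
 shows "lim_laplace s \<le> inf_laplace q s"
proof (rule tendsto_upperbound[OF inf_laplace_tendsto[OF assms(1)]])
 have "eventually (\<lambda>r::real. r < q) (at_right 0)"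
  using assms(2) by (rule order_tendstoD(2)[OF tendsto_ident_at])
 then show "eventually (\<lambda>r. inf_laplace r s \<le> inf_laplace q s) (at_right 0)"
  using eventually_at_right_less[of 0]
  by eventually_elim (use assms in \<open>intro inf_laplace_mono; simp\<close>)
qed simp

end

section \<open>Absolutely continuous parts\<close>

definition lap :: "real measure \<Rightarrow> real \<Rightarrow> real" where
 "lap N s = (\<integral>y. exp (- s * y) \<partial>N)"

definition half_line_measure :: "real measure \<Rightarrow> bool" where
 "half_line_measure N \<longleftrightarrow> finite_measure N \<and> sets N = sets borel \<and> emeasure N {..<0} = 0"

lemma half_line_measureD:
 assumes "half_line_measure N"
 shows "finite_measure N" "sets N = sets borel" "emeasure N {..<0} = 0" "space N = UNIV" "AE y in N. 0 \<le> y"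
proof -
 show 1: "finite_measure N" "sets N = sets borel" "emeasure N {..<0} = 0"
  using assms by (auto simp: half_line_measure_def)
 show "space N = UNIV" using sets_eq_imp_space_eq[OF 1(2)] by simp
 then show "AE y in N. 0 \<le> y"
  using 1 by (subst AE_iff_measurable[OF _ refl]) (auto simp: not_le lessThan_def)
qed

lemma half_line_prob: "prob_space N \<Longrightarrow> sets N = sets borel \<Longrightarrow> emeasure N {..<0} = 0 \<Longrightarrow> half_line_measure N"
 by (simp add: half_line_measure_def prob_space.finite_measure)

lemma nn_integral_lap:
 assumes N: "half_line_measure N" and s: "0 \<le> s"
 shows "(\<integral>\<^sup>+y. ennreal (exp (- s * y)) \<partial>N) = ennreal (lap N s)" "0 \<le> lap N s"
 unfolding lap_def using laplace_integrable_real[OF half_line_measureD(1-3)[OF N] s]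
 by (auto intro!: nn_integral_eq_integral)

definition add_measure :: "real measure \<Rightarrow> real measure \<Rightarrow> real measure" where
 "add_measure M N = measure_of UNIV (sets borel) (\<lambda>A. emeasure M A + emeasure N A)"

lemma sets_add_measure [simp, measurable_cong]: "sets (add_measure M N) = sets borel"
 unfolding add_measure_def by (metis sets.sets_measure_of_eq space_borel)

lemma space_add_measure [simp]: "space (add_measure M N) = UNIV"
 using sets_eq_imp_space_eq[OF sets_add_measure] by simp

lemma emeasure_add_measure:
 assumes M: "sets M = sets borel" and N: "sets N = sets borel" and A: "A \<in> sets borel"
 shows "emeasure (add_measure M N) A = emeasure M A + emeasure N A"
 unfolding add_measure_def
proof (rule emeasure_measure_of_sigma)
 show "sigma_algebra UNIV (sets (borel :: real measure))"
  using sets.sigma_algebra_axioms[of "borel :: real measure"] by simp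
 show "positive (sets borel) (\<lambda>A. emeasure M A + emeasure N A)" by (simp add: positive_def)
 show "countably_additive (sets borel) (\<lambda>A. emeasure M A + emeasure N A)"
 proof (rule countably_additiveI)
  fix F :: "nat \<Rightarrow> real set"
  assume F: "range F \<subseteq> sets borel" "disjoint_family F" "(\<Union>i. F i) \<in> sets borel"
  have "(\<Sum>i. emeasure M (F i) + emeasure N (F i)) = (\<Sum>i. emeasure M (F i)) + (\<Sum>i. emeasure N (F i))"
   by (rule suminf_add[symmetric]) auto
  also have "\<dots> = emeasure M (\<Union>i. F i) + emeasure N (\<Union>i. F i)"
   using F M N by (simp add: suminf_emeasure)
  finally show "(\<Sum>i. emeasure M (F i) + emeasure N (F i)) = emeasure M (\<Union>i. F i) + emeasure N (\<Union>i. F i)" .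
 qed
qed (use A in auto)

lemma nn_integral_add_measure:
 assumes M: "sets M = sets borel" and N: "sets N = sets borel" and f: "f \<in> borel_measurable borel"
 shows "(\<integral>\<^sup>+x. f x \<partial>add_measure M N) = (\<integral>\<^sup>+x. f x \<partial>M) + (\<integral>\<^sup>+x. f x \<partial>N)"
proof -
 have [measurable_cong]: "sets M = sets borel" "sets N = sets borel" by fact+
 show ?thesis using f
 proof (induction rule: borel_measurable_induct)
  case (cong f g)
  then show ?case by (simp add: fun_eq_iff[symmetric])
 next
  case (set A)
  then show ?case using M N by (simp add: emeasure_add_measure)
 next
  case (mult u c)
  then show ?case by (simp add: nn_integral_cmult M N distrib_left cong: measurable_cong_sets)
 next
  case (add u v)
  then show ?case by (simp add: nn_integral_add M N add_ac cong: measurable_cong_sets)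
 next
  case (seq U)
  have m: "U i \<in> borel_measurable K" if "sets K = sets borel" for i and K :: "real measure"
   using seq(1)[of i] unfolding measurable_cong_sets[OF that refl, of borel] .
  have inc: "incseq (\<lambda>i. \<integral>\<^sup>+x. U i x \<partial>K)" for K
   using seq(3) by (auto intro!: incseq_SucI nn_integral_mono simp: incseq_Suc_iff le_fun_def)
  have MC: "(\<integral>\<^sup>+x. (SUP i. U i x) \<partial>K) = (SUP i. \<integral>\<^sup>+x. U i x \<partial>K)" if "sets K = sets borel" for K :: "real measure"
   by (rule nn_integral_monotone_convergence_SUP[OF seq(3) m[OF that]])
  have "(\<integral>\<^sup>+x. (SUP i. U i) x \<partial>add_measure M N) = (SUP i. \<integral>\<^sup>+x. U i x \<partial>add_measure M N)"
   unfolding SUP_apply by (rule MC) simp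
  also have "\<dots> = (SUP i. (\<integral>\<^sup>+x. U i x \<partial>M) + (\<integral>\<^sup>+x. U i x \<partial>N))" using seq by simp
  also have "\<dots> = (SUP i. \<integral>\<^sup>+x. U i x \<partial>M) + (SUP i. \<integral>\<^sup>+x. U i x \<partial>N)"
   by (rule ennreal_SUP_add[OF inc inc])
  also have "\<dots> = (\<integral>\<^sup>+x. (SUP i. U i) x \<partial>M) + (\<integral>\<^sup>+x. (SUP i. U i) x \<partial>N)"
   unfolding SUP_apply MC[OF M] MC[OF N] ..
  finally show ?case .
 qed
qed

lemma half_line_add:
 assumes M: "half_line_measure M" and N: "half_line_measure N"
 shows "half_line_measure (add_measure M N)"
  and "0 \<le> s \<Longrightarrow> lap (add_measure M N) s = lap M s + lap N s"
proof -
 interpret M: finite_measure M by (rule half_line_measureD[OF M])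
 interpret N: finite_measure N by (rule half_line_measureD[OF N])
 note D = half_line_measureD[OF M] half_line_measureD[OF N]
 show H: "half_line_measure (add_measure M N)"
  unfolding half_line_measure_def
  using D M.emeasure_finite[of UNIV] N.emeasure_finite[of UNIV]
  by (auto simp: emeasure_add_measure intro!: finite_measureI)
 assume s: "0 \<le> s"
 have "ennreal (lap (add_measure M N) s) = ennreal (lap M s) + ennreal (lap N s)"
  unfolding nn_integral_lap(1)[OF H s, symmetric] nn_integral_lap(1)[OF M s, symmetric]
   nn_integral_lap(1)[OF N s, symmetric]
  using D by (intro nn_integral_add_measure) auto
 then show "lap (add_measure M N) s = lap M s + lap N s"
  using nn_integral_lap(2)[OF M s] nn_integral_lap(2)[OF N s] nn_integral_lap(2)[OF H s]
  by (simp add: ennreal_plus[symmetric] del: ennreal_plus)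
qed

lemma half_line_scale:
 assumes M: "half_line_measure M" and c: "0 \<le> c"
 shows "half_line_measure (scale_measure (ennreal c) M)"
  and "0 \<le> s \<Longrightarrow> lap (scale_measure (ennreal c) M) s = c * lap M s"
proof -
 interpret M: finite_measure M by (rule half_line_measureD[OF M])
 note D = half_line_measureD[OF M]
 show "half_line_measure (scale_measure (ennreal c) M)"
  unfolding half_line_measure_def using D M.emeasure_finite[of UNIV]
  by (auto intro!: finite_measureI simp: space_scale_measure ennreal_mult_eq_top_iff)
 show "lap (scale_measure (ennreal c) M) s = c * lap M s"
  unfolding scale_measure_eq_density lap_def
  by (subst integral_density) (use c D in \<open>auto cong: measurable_cong_sets\<close>)
qed

lemma half_line_convolution:
 assumes M: "half_line_measure M" and N: "half_line_measure N"
 shows "half_line_measure (M \<star> N)"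
  and "0 \<le> s \<Longrightarrow> lap (M \<star> N) s = lap M s * lap N s"
proof -
 note D = half_line_measureD[OF M] half_line_measureD[OF N]
 have [measurable_cong]: "sets M = sets borel" "sets N = sets borel" using D by auto
 have "(\<integral>\<^sup>+x. \<integral>\<^sup>+y. indicator {..<0} (x + y) \<partial>N \<partial>M) = (\<integral>\<^sup>+x. 0 \<partial>M)"
 proof (rule nn_integral_cong_AE)
  show "AE x in M. (\<integral>\<^sup>+y. indicator {..<0::real} (x + y) \<partial>N) = (0::ennreal)"
   using D(5)
  proof eventually_elim
   case (elim x)
   have "(\<integral>\<^sup>+y. indicator {..<0::real} (x + y) \<partial>N) = (\<integral>\<^sup>+y. 0 \<partial>N)"
    by (rule nn_integral_cong_AE) (use D(10) elim in \<open>auto elim: eventually_mono\<close>)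
   then show ?case by simp
  qed
 qed
 then show H: "half_line_measure (M \<star> N)"
  unfolding half_line_measure_def using D
  by (auto intro!: convolution_finite simp: convolution_emeasure')
 assume s: "0 \<le> s"
 have "ennreal (lap (M \<star> N) s) = (\<integral>\<^sup>+x. \<integral>\<^sup>+y. ennreal (exp (- s * (x + y))) \<partial>N \<partial>M)"
  unfolding nn_integral_lap(1)[OF H s, symmetric] using D by (intro nn_integral_convolution) auto
 also have "\<dots> = (\<integral>\<^sup>+x. ennreal (exp (- s * x)) * ennreal (lap N s) \<partial>M)"
 proof (rule nn_integral_cong)
  fix x
  have "(\<integral>\<^sup>+y. ennreal (exp (- s * (x + y))) \<partial>N) = (\<integral>\<^sup>+y. ennreal (exp (- s * x)) * ennreal (exp (- s * y)) \<partial>N)"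
   by (simp add: ennreal_mult[symmetric] exp_add[symmetric] algebra_simps)
  also have "\<dots> = ennreal (exp (- s * x)) * ennreal (lap N s)"
   by (subst nn_integral_cmult) (auto simp: nn_integral_lap(1)[OF N s, simplified])
  finally show "(\<integral>\<^sup>+y. ennreal (exp (- s * (x + y))) \<partial>N) = ennreal (exp (- s * x)) * ennreal (lap N s)" .
 qed
 also have "\<dots> = ennreal (lap M s) * ennreal (lap N s)"
  by (subst nn_integral_multc) (auto simp: nn_integral_lap(1)[OF M s, simplified])
 finally show "lap (M \<star> N) s = lap M s * lap N s"
  using nn_integral_lap(2)[OF M s] nn_integral_lap(2)[OF N s] nn_integral_lap(2)[OF H s]
  by (simp add: ennreal_mult[symmetric])
qed

section \<open>Transforms of absolutely continuous measures\<close>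

lemma absolutely_continuous_convolution:
 assumes M: "half_line_measure M" and N: "half_line_measure N" and ac: "absolutely_continuous lborel N"
 shows "absolutely_continuous lborel (M \<star> N)"
 unfolding absolutely_continuous_def
proof
 fix A assume A: "A \<in> null_sets (lborel :: real measure)"
 then have [measurable]: "A \<in> sets borel" by auto
 note D = half_line_measureD[OF M] half_line_measureD[OF N]
 have "emeasure N {a. a + x \<in> A} = 0" for x
 proof -
  have "{a. a - (- x) \<in> A} \<in> null_sets lborel" by (rule null_sets_translation[OF A])
  then show ?thesis using ac by (auto simp: absolutely_continuous_def)
 qed
 then show "A \<in> null_sets (M \<star> N)"
  using D by (intro null_setsI) (auto simp: convolution_emeasure)
qed

text \<open>Shifts the transform by 1 and keeps the null sets. Rational functions then come with
  denominators \<open>(1 + s) ^ n\<close>, whose reciprocals for positive \<open>n\<close> are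
  transforms of finite measures down to \<open>s = 0\<close>.\<close>

definition tilt :: "real measure \<Rightarrow> real measure" where
 "tilt N = density N (\<lambda>x. ennreal (exp (- x)))"

lemma tilt:
 assumes N: "half_line_measure N"
 shows "half_line_measure (tilt N)" and "lap (tilt N) s = lap N (1 + s)"
proof -
 note D = half_line_measureD[OF N]
 have [measurable_cong]: "sets N = sets borel" using D by auto
 have "(\<integral>\<^sup>+x. ennreal (exp (- x)) \<partial>N) = ennreal (lap N 1)"
  using nn_integral_lap(1)[OF N, of 1] by simp
 then have "finite_measure (tilt N)"
  unfolding tilt_def using D by (intro finite_measureI) (simp add: emeasure_density)
 moreover have "{..<0} \<in> null_sets N" using D by auto
 then have "emeasure (tilt N) {..<0} = 0"
  unfolding tilt_def by (subst emeasure_density) (auto simp: null_sets_def nn_integral_null_set mult.commute)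
 ultimately show "half_line_measure (tilt N)"
  by (simp add: half_line_measure_def tilt_def D)
 show "lap (tilt N) s = lap N (1 + s)"
  unfolding tilt_def lap_def by (subst integral_density) (auto simp: exp_add[symmetric] algebra_simps)
qed

text \<open>Transforms of finite absolutely continuous signed measures, written as differences. They
  form a vector space closed under multiplication by transforms of finite measures and can be
  discarded, like an ideal, when singular parts are compared.\<close>

definition ac_laplace :: "(real \<Rightarrow> real) \<Rightarrow> bool" where
 "ac_laplace h \<longleftrightarrow> (\<exists>F1 F2. half_line_measure F1 \<and> half_line_measure F2 \<and>
   absolutely_continuous lborel F1 \<and> absolutely_continuous lborel F2 \<and>
   (\<forall>s\<ge>0. h s = lap F1 s - lap F2 s))"

lemma ac_laplace_cong: "ac_laplace h \<Longrightarrow> (\<And>s. 0 \<le> s \<Longrightarrow> h s = k s) \<Longrightarrow> ac_laplace k"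
 unfolding ac_laplace_def by metis

lemma absolutely_continuous_add:
 assumes "half_line_measure M" "half_line_measure N"
  "absolutely_continuous lborel M" "absolutely_continuous lborel N"
 shows "absolutely_continuous lborel (add_measure M N)"
 using assms half_line_measureD(2)[OF assms(1)] half_line_measureD(2)[OF assms(2)]
 unfolding absolutely_continuous_def by (auto simp: null_sets_def emeasure_add_measure subset_iff)

lemma ac_laplace_add:
 assumes "ac_laplace h" "ac_laplace k"
 shows "ac_laplace (\<lambda>s. h s + k s)"
proof -
 obtain F1 F2 where F: "half_line_measure F1" "half_line_measure F2"
   "absolutely_continuous lborel F1" "absolutely_continuous lborel F2"
   "\<And>s. 0 \<le> s \<Longrightarrow> h s = lap F1 s - lap F2 s" using assms(1) unfolding ac_laplace_def by blast
 obtain K1 K2 where K: "half_line_measure K1" "half_line_measure K2"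
   "absolutely_continuous lborel K1" "absolutely_continuous lborel K2"
   "\<And>s. 0 \<le> s \<Longrightarrow> k s = lap K1 s - lap K2 s" using assms(2) unfolding ac_laplace_def by blast
 show ?thesis
  unfolding ac_laplace_def
  by (intro exI[of _ "add_measure F1 K1"] exI[of _ "add_measure F2 K2"] conjI
    half_line_add(1) absolutely_continuous_add F K)
   (simp add: half_line_add(2) F K)
qed

lemma ac_laplace_uminus:
 assumes "ac_laplace h"
 shows "ac_laplace (\<lambda>s. - h s)"
proof -
 obtain F1 F2 where F: "half_line_measure F1" "half_line_measure F2"
   "absolutely_continuous lborel F1" "absolutely_continuous lborel F2"
   "\<And>s. 0 \<le> s \<Longrightarrow> h s = lap F1 s - lap F2 s" using assms(1) unfolding ac_laplace_def by blast
 show ?thesis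
  unfolding ac_laplace_def using F by (intro exI[of _ F2] exI[of _ F1]) simp
qed

lemma ac_laplace_diff: "ac_laplace h \<Longrightarrow> ac_laplace k \<Longrightarrow> ac_laplace (\<lambda>s. h s - k s)"
 using ac_laplace_add[OF _ ac_laplace_uminus, of h k] by simp

lemma ac_laplace_mult_lap:
 assumes "ac_laplace h" and N: "half_line_measure N"
 shows "ac_laplace (\<lambda>s. lap N s * h s)"
proof -
 obtain F1 F2 where F: "half_line_measure F1" "half_line_measure F2"
   "absolutely_continuous lborel F1" "absolutely_continuous lborel F2"
   "\<And>s. 0 \<le> s \<Longrightarrow> h s = lap F1 s - lap F2 s" using assms(1) unfolding ac_laplace_def by blast
 show ?thesis
  unfolding ac_laplace_def
  by (intro exI[of _ "N \<star> F1"] exI[of _ "N \<star> F2"] conjI half_line_convolution(1)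
    absolutely_continuous_convolution F N)
   (simp add: half_line_convolution(2) F N right_diff_distrib)
qed

lemma ac_laplace_cmult:
 assumes "ac_laplace h"
 shows "ac_laplace (\<lambda>s. c * h s)"
proof -
 have pos: "ac_laplace (\<lambda>s. c * h s)" if "0 \<le> c" and "ac_laplace h" for c h
 proof -
  obtain F1 F2 where F: "half_line_measure F1" "half_line_measure F2"
    "absolutely_continuous lborel F1" "absolutely_continuous lborel F2"
    "\<And>s. 0 \<le> s \<Longrightarrow> h s = lap F1 s - lap F2 s" using \<open>ac_laplace h\<close> unfolding ac_laplace_def by blast
  have "absolutely_continuous lborel (scale_measure (ennreal c) F)" if "absolutely_continuous lborel F" for F :: "real measure"
   using that unfolding absolutely_continuous_def by (auto simp: null_sets_def)
  then show ?thesis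
   unfolding ac_laplace_def
   by (intro exI[of _ "scale_measure (ennreal c) F1"] exI[of _ "scale_measure (ennreal c) F2"] conjI
     half_line_scale(1) \<open>0 \<le> c\<close> F)
    (simp_all add: half_line_scale(2) F \<open>0 \<le> c\<close> right_diff_distrib)
 qed
 show ?thesis
 proof (cases "0 \<le> c")
  case False
  then show ?thesis using pos[OF _ ac_laplace_uminus[OF assms], of "- c"] by simp
 qed (use pos assms in blast)
qed

lemma ac_laplace_lap:
 assumes "half_line_measure F" "absolutely_continuous lborel F"
 shows "ac_laplace (lap F)"
proof -
 let ?Z = "null_measure borel :: real measure"
 have "half_line_measure ?Z"
  unfolding half_line_measure_def by (simp add: finite_measureI)
 moreover have "absolutely_continuous lborel ?Z"
  unfolding absolutely_continuous_def by (auto simp: null_sets_def)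
 moreover have "lap ?Z s = 0" for s by (simp add: lap_def)
 ultimately show ?thesis
  unfolding ac_laplace_def using assms by (intro exI[of _ F] exI[of _ ?Z]) simp
qed

text \<open>With negative terms moved to the other side, all terms are transforms of positive finite
  measures, and uniqueness gives an equality of measures. On a Lebesgue null set the absolutely
  continuous ones vanish.\<close>

lemma ac_laplace_null_sets:
 assumes N1: "half_line_measure N1" and N2: "half_line_measure N2" and ab: "0 \<le> a" "0 \<le> b"
  and ac: "ac_laplace (\<lambda>s. a * lap N1 s - b * lap N2 s)" and A: "A \<in> null_sets lborel"
 shows "a * measure N1 A = b * measure N2 A"
proof -
 interpret N1: finite_measure N1 by (rule half_line_measureD[OF N1])
 interpret N2: finite_measure N2 by (rule half_line_measureD[OF N2])
 obtain F1 F2 where F: "half_line_measure F1" "half_line_measure F2"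
   "absolutely_continuous lborel F1" "absolutely_continuous lborel F2"
   "\<And>s. 0 \<le> s \<Longrightarrow> a * lap N1 s - b * lap N2 s = lap F1 s - lap F2 s"
  using ac unfolding ac_laplace_def by blast
 let ?M1 = "add_measure (scale_measure (ennreal a) N1) F2"
 let ?M2 = "add_measure (scale_measure (ennreal b) N2) F1"
 note H1 = half_line_add[OF half_line_scale(1)[OF N1 ab(1)] F(2)]
 note H2 = half_line_add[OF half_line_scale(1)[OF N2 ab(2)] F(1)]
 have eq: "?M1 = ?M2"
 proof (rule laplace_transform_unique[OF half_line_measureD(1-3)[OF H1(1)] half_line_measureD(1-3)[OF H2(1)]])
  fix r :: real assume r: "0 \<le> r"
  show "(\<integral>x. exp (- r * x) \<partial>?M1) = (\<integral>x. exp (- r * x) \<partial>?M2)"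
   unfolding lap_def[symmetric] using F(5)[OF r] unfolding H1(2)[OF r] H2(2)[OF r] half_line_scale(2)[OF N1 ab(1) r] half_line_scale(2)[OF N2 ab(2) r]
   by linarith
 qed
 have A': "A \<in> sets borel" using A by auto
 have "emeasure F1 A = 0" "emeasure F2 A = 0"
  using F(3,4) A unfolding absolutely_continuous_def by auto
 then have "ennreal a * emeasure N1 A = ennreal b * emeasure N2 A"
  using arg_cong[OF eq, of "\<lambda>M. emeasure M A"] half_line_measureD(2)[OF N1] half_line_measureD(2)[OF N2]
   half_line_measureD(2)[OF F(1)] half_line_measureD(2)[OF F(2)] A'
  by (simp add: emeasure_add_measure)
 then show ?thesis
  using ab by (simp add: N1.emeasure_eq_measure N2.emeasure_eq_measure ennreal_mult[symmetric])
qed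

lemma lap_unit_exp:
 assumes s: "0 \<le> s"
 shows "half_line_measure unit_exp" "absolutely_continuous lborel unit_exp" "lap unit_exp s = 1 / (1 + s)"
proof -
 show ac: "absolutely_continuous lborel unit_exp"
  unfolding unit_exp_def by (rule absolutely_continuousI_density) simp
 interpret U: prob_space unit_exp by (rule prob_space_unit_exp)
 have z: "(\<integral>\<^sup>+x. ennreal (exponential_density 1 x) * indicator {..<0} x \<partial>lborel) = (\<integral>\<^sup>+x. 0 \<partial>(lborel :: real measure))"
  by (intro nn_integral_cong) (auto simp: exponential_density_def indicator_def)
 have "emeasure unit_exp {..<0} = 0"
  unfolding unit_exp_def by (subst emeasure_density) (auto simp: z)
 then show H: "half_line_measure unit_exp"
  unfolding half_line_measure_def
  using U.finite_measure_axioms by simp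
 interpret E: prob_space "density lborel (\<lambda>x. ennreal (exponential_density (1 + s) x))"
  by (rule prob_space_exponential_density) (use s in simp)
 have one: "(\<integral>\<^sup>+x. ennreal (exponential_density (1 + s) x) \<partial>lborel) = 1"
  using E.emeasure_space_1 by (simp add: emeasure_density)
 have nn: "(\<integral>\<^sup>+x. ennreal (exp (- s * x)) \<partial>unit_exp) = (\<integral>\<^sup>+x. ennreal (exponential_density 1 x) * ennreal (exp (- s * x)) \<partial>lborel)"
  unfolding unit_exp_def by (rule nn_integral_density) auto
 have "ennreal (lap unit_exp s) = (\<integral>\<^sup>+x. ennreal (exponential_density 1 x) * ennreal (exp (- s * x)) \<partial>lborel)"
  unfolding nn_integral_lap(1)[OF H s, symmetric] nn ..
 also have "\<dots> = (\<integral>\<^sup>+x. ennreal (1 / (1 + s)) * ennreal (exponential_density (1 + s) x) \<partial>lborel)"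
 proof (rule nn_integral_cong)
  fix x :: real
  have "exp (- x * 1) * exp (- s * x) = exp (- x * (1 + s))"
   by (simp add: exp_add[symmetric] algebra_simps)
  then have "exponential_density 1 x * exp (- s * x) = 1 / (1 + s) * exponential_density (1 + s) x"
   using s by (simp add: exponential_density_def)
  moreover have "0 \<le> exponential_density 1 x" "0 \<le> exponential_density (1 + s) x"
   using s by (auto simp: exponential_density_def)
  ultimately show "ennreal (exponential_density 1 x) * ennreal (exp (- s * x)) = ennreal (1 / (1 + s)) * ennreal (exponential_density (1 + s) x)"
   using s by (simp add: ennreal_mult[symmetric])
 qed
 also have "\<dots> = ennreal (1 / (1 + s))" by (subst nn_integral_cmult) (auto simp: one)
 finally show "lap unit_exp s = 1 / (1 + s)"
  using s nn_integral_lap(2)[OF H s] by simp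
qed

text \<open>These are the transforms of Gamma laws with integer shape, the convolution powers of the
  exponential law.\<close>

lemma ac_laplace_power: "ac_laplace (\<lambda>s. 1 / (1 + s) ^ Suc k)"
proof (induction k)
 case 0
 show ?case
  by (rule ac_laplace_cong[OF ac_laplace_lap[OF lap_unit_exp(1,2)[OF order.refl]]])
   (simp add: lap_unit_exp(3))
next
 case (Suc k)
 show ?case
  by (rule ac_laplace_cong[OF ac_laplace_mult_lap[OF Suc lap_unit_exp(1)[OF order.refl]]])
   (simp add: lap_unit_exp(3))
qed

lemma ac_laplace_sum:
 assumes "finite I" "\<And>i. i \<in> I \<Longrightarrow> ac_laplace (h i)"
 shows "ac_laplace (\<lambda>s. \<Sum>i\<in>I. h i s)"
 using assms
proof (induction I rule: finite_induct)
 case empty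
 show ?case using ac_laplace_cmult[OF ac_laplace_power[of 0], of 0] by simp
next
 case (insert i I)
 then show ?case using ac_laplace_add[of "h i" "\<lambda>s. \<Sum>i\<in>I. h i s"] by simp
qed

text \<open>The lower coefficients multiply transforms of Gamma laws. Only the top coefficient, the
  transform of a point mass at 0, has to be subtracted.\<close>

lemma ac_laplace_rational:
 fixes g :: "real poly"
 assumes g: "degree g \<le> n"
 shows "ac_laplace (\<lambda>s. poly g (1 + s) / (1 + s) ^ n - coeff g n)"
proof (rule ac_laplace_cong)
 show "ac_laplace (\<lambda>s. \<Sum>i<n. coeff g i * (1 / (1 + s) ^ Suc (n - Suc i)))"
  by (intro ac_laplace_sum ac_laplace_cmult ac_laplace_power) simp
 fix s :: real assume s: "0 \<le> s"
 have "poly g (1 + s) / (1 + s) ^ n = (\<Sum>i\<le>n. coeff g i * (1 + s) ^ i / (1 + s) ^ n)"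
  unfolding poly_eq_sum_le[OF g] by (simp add: sum_divide_distrib)
 also have "\<dots> = (\<Sum>i<n. coeff g i * (1 + s) ^ i / (1 + s) ^ n) + coeff g n"
  using s by (simp add: lessThan_Suc_atMost[symmetric])
 also have "(\<Sum>i<n. coeff g i * (1 + s) ^ i / (1 + s) ^ n) = (\<Sum>i<n. coeff g i * (1 / (1 + s) ^ Suc (n - Suc i)))"
 proof (rule sum.cong[OF refl])
  fix i assume "i \<in> {..<n}"
  then have "(1 + s) ^ n = (1 + s) ^ i * (1 + s) ^ Suc (n - Suc i)"
   by (subst power_add[symmetric]) simp
  then show "coeff g i * (1 + s) ^ i / (1 + s) ^ n = coeff g i * (1 / (1 + s) ^ Suc (n - Suc i))"
   using s by (simp del: power_Suc)
 qed
 finally show "(\<Sum>i<n. coeff g i * (1 / (1 + s) ^ Suc (n - Suc i))) = poly g (1 + s) / (1 + s) ^ n - coeff g n"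
  by simp
qed

section \<open>Generalized densities and inverse transforms\<close>

lemma generalized_density_exists:
 assumes N: "half_line_measure N"
  and null: "\<And>A. A \<in> null_sets lborel \<Longrightarrow> A \<subseteq> {0<..} \<Longrightarrow> emeasure N A = 0"
 shows "\<exists>w0 w. generalized_density N w0 w"
proof -
 note D = half_line_measureD[OF N]
 interpret N: finite_measure N by (rule D)
 have [measurable_cong]: "sets N = sets borel" by (rule D)
 define K where "K = density N (indicator {0<..})"
 have K: "emeasure K A = emeasure N (A \<inter> {0<..})" if "A \<in> sets borel" for A
  unfolding K_def using that by (subst emeasure_density) (auto simp: nn_integral_indicator[symmetric] indicator_inter_arith mult.commute)
 have "finite_measure K"
  using K[of UNIV] by (intro finite_measureI) (simp add: K_def D N.emeasure_finite)
 have "absolutely_continuous lborel K"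
  unfolding absolutely_continuous_def
 proof
  fix A assume A: "A \<in> null_sets (lborel :: real measure)"
  then have "A \<inter> {0<..} \<in> null_sets lborel" by (rule null_set_Int2) simp
  from null[OF this] show "A \<in> null_sets K" using A K[of A] by (auto simp: null_sets_def K_def D)
 qed
 then obtain f where f[measurable]: "f \<in> borel_measurable lborel" and fK: "density lborel f = K"
  using sigma_finite_measure.Radon_Nikodym[OF sigma_finite_lborel, of K] by (auto simp: K_def D)
 have "(\<integral>\<^sup>+x. f x \<partial>lborel) = emeasure K UNIV"
  unfolding fK[symmetric] by (subst emeasure_density) auto
 then have "(\<integral>\<^sup>+x. f x \<partial>lborel) \<noteq> \<infinity>"
  using finite_measure.emeasure_finite[OF \<open>finite_measure K\<close>, of UNIV] by simp
 \<comment> \<open>The derivative from Radon-Nikodym takes values in \<open>ennreal\<close>; the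
   finite total mass makes it finite almost everywhere, so that \<open>enn2real\<close> loses
   nothing.\<close>
 then have fin: "AE x in lborel. f x \<noteq> \<infinity>" by (intro nn_integral_PInf_AE) auto
 have "generalized_density N (measure N {0}) (\<lambda>x. enn2real (f x))"
  unfolding generalized_density_def
 proof (intro conjI allI ballI)
  fix A :: "real set" assume A[measurable]: "A \<in> sets borel"
  have "emeasure N A = emeasure N (A \<inter> {..<0}) + emeasure N (A \<inter> {0}) + emeasure N (A \<inter> {0<..})"
  proof -
   have "A = (A \<inter> {..<0} \<union> A \<inter> {0}) \<union> A \<inter> {0<..}" by auto
   then have "emeasure N A = emeasure N ((A \<inter> {..<0} \<union> A \<inter> {0}) \<union> A \<inter> {0<..})" by simp
   also have "\<dots> = emeasure N (A \<inter> {..<0} \<union> A \<inter> {0}) + emeasure N (A \<inter> {0<..})"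
    by (rule plus_emeasure[symmetric]) (auto simp: D)
   also have "emeasure N (A \<inter> {..<0} \<union> A \<inter> {0}) = emeasure N (A \<inter> {..<0}) + emeasure N (A \<inter> {0})"
    by (rule plus_emeasure[symmetric]) (auto simp: D)
   finally show ?thesis .
  qed
  also have "emeasure N (A \<inter> {..<0}) = 0"
   by (rule emeasure_eq_0[OF _ D(3)]) (auto simp: D)
  also have "emeasure N (A \<inter> {0}) = ennreal (measure N {0}) * indicator A 0"
   by (cases "0 \<in> A") (auto simp: N.emeasure_eq_measure)
  also have "emeasure N (A \<inter> {0<..}) = emeasure K (A \<inter> {0<..})" using K[of "A \<inter> {0<..}"] A by simp
  also have "\<dots> = (\<integral>\<^sup>+x\<in>A \<inter> {0<..}. f x \<partial>lborel)"
   unfolding fK[symmetric] by (subst emeasure_density) auto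
  also have "\<dots> = (\<integral>\<^sup>+x\<in>A \<inter> {0<..}. ennreal (enn2real (f x)) \<partial>lborel)"
   using fin by (intro nn_integral_cong_AE) (auto elim!: eventually_mono simp: less_top)
  finally show "emeasure N A = ennreal (measure N {0}) * indicator A 0
    + (\<integral>\<^sup>+x\<in>A \<inter> {0<..}. ennreal (enn2real (f x)) \<partial>lborel)" by simp
 qed auto
 then show ?thesis by blast
qed

lemma generalized_density_scale:
 assumes g: "generalized_density N w0 w" and c: "0 \<le> c"
 shows "generalized_density (scale_measure (ennreal c) N) (c * w0) (\<lambda>x. c * w x)"
proof -
 have [measurable]: "w \<in> borel_measurable borel" and w: "\<And>x. 0 \<le> w x" "0 \<le> w0"
  using g by (auto simp: generalized_density_def)
 have "emeasure (scale_measure (ennreal c) N) A = ennreal (c * w0) * indicator A 0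
   + (\<integral>\<^sup>+x\<in>A \<inter> {0<..}. ennreal (c * w x) \<partial>lborel)" if A[measurable]: "A \<in> sets borel" for A
 proof -
  have "(\<integral>\<^sup>+x\<in>A \<inter> {0<..}. ennreal (c * w x) \<partial>lborel) = ennreal c * (\<integral>\<^sup>+x\<in>A \<inter> {0<..}. ennreal (w x) \<partial>lborel)"
   using c w by (subst nn_integral_cmult[symmetric]) (auto simp: ennreal_mult mult.assoc)
  then show ?thesis
   using g A c w by (simp add: generalized_density_def ennreal_mult distrib_left mult.assoc)
 qed
 then show ?thesis
  using w c by (auto simp: generalized_density_def)
qed

lemma inverse_laplace_half_line: "inverse_laplace F W \<Longrightarrow> half_line_measure W"
proof -
 assume W: "inverse_laplace F W"
 then have "has_bochner_integral W (\<lambda>x. 1) (F 0)" unfolding inverse_laplace_def by (force dest: spec[of _ 0])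
 then have "integrable W (\<lambda>x. 1 :: real)" by (rule integrable.intros)
 then have "emeasure W (space W) < \<infinity>"
  by (simp add: integrable_iff_bounded)
 then have "finite_measure W" by (intro finite_measureI) (auto simp: less_top)
 then show ?thesis using W by (simp add: inverse_laplace_def half_line_measure_def)
qed

lemma inverse_laplace_unique:
 assumes "inverse_laplace F W1" "inverse_laplace F W2"
 shows "W1 = W2"
proof (rule laplace_transform_unique)
 note H = half_line_measureD[OF inverse_laplace_half_line]
 show "finite_measure W1" "sets W1 = sets borel" "emeasure W1 {..<0} = 0"
  "finite_measure W2" "sets W2 = sets borel" "emeasure W2 {..<0} = 0" by (rule H assms)+
 fix r :: real assume "0 \<le> r"
 then show "(\<integral>x. exp (- r * x) \<partial>W1) = (\<integral>x. exp (- r * x) \<partial>W2)"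
  using assms by (auto simp: inverse_laplace_def dest!: spec[of _ r] has_bochner_integral_integral_eq)
qed

lemma inverse_laplace_measure:
 assumes N: "half_line_measure N" and F: "\<And>r. 0 \<le> r \<Longrightarrow> F r = lap N r / a" and a: "0 < a"
 shows "inverse_laplace F (scale_measure (ennreal (1 / a)) N)"
  and "(THE W. inverse_laplace F W) = scale_measure (ennreal (1 / a)) N"
  and "scale_measure (ennreal a) (scale_measure (ennreal (1 / a)) N) = N"
proof -
 let ?W = "scale_measure (ennreal (1 / a)) N"
 have a': "0 \<le> 1 / a" using a by simp
 note H = half_line_scale[OF N a']
 show 1: "inverse_laplace F ?W"
  unfolding inverse_laplace_def
 proof (intro conjI allI impI)
  show "sets ?W = sets borel" "emeasure ?W {..<0} = 0" using half_line_measureD[OF H(1)] by auto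
  fix r :: real assume r: "0 \<le> r"
  have "integrable ?W (\<lambda>x. exp (- r * x))"
   by (rule laplace_integrable_real[OF half_line_measureD(1-3)[OF H(1)] r])
  then have "has_bochner_integral ?W (\<lambda>x. exp (- r * x)) (lap ?W r)"
   unfolding lap_def by (rule has_bochner_integral_integrable)
  then show "has_bochner_integral ?W (\<lambda>x. exp (- r * x)) (F r)" using H(2)[OF r] F[OF r] by simp
 qed
 then show "(THE W. inverse_laplace F W) = ?W" by (intro the_equality inverse_laplace_unique[of F])
 show "scale_measure (ennreal a) ?W = N"
  using a by (simp add: ennreal_mult[symmetric])
qed

section \<open>Scale functions and densities\<close>

context model_setting
begin

lemma factorsD:
 assumes "factors q \<mu> g"
 shows "0 \<le> q" "half_line_measure \<mu>" "degree g = root_count" "0 < a_coef p q"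
  "coeff g root_count = (- 1) ^ root_count * a_coef p q"
  "0 \<le> s \<Longrightarrow> poly g s = lap \<mu> s * (q * V.pole_real s - V.cleared_real s)"
  "0 \<le> s \<Longrightarrow> kappa p q (- s) = poly g s / (a_coef p q * V.pole_real s)"
  "0 \<le> s \<Longrightarrow> 0 < lap \<mu> s" "g \<noteq> 0"
proof -
 show "0 \<le> q" "half_line_measure \<mu>" "degree g = root_count" "0 < a_coef p q"
  "0 \<le> s \<Longrightarrow> poly g s = lap \<mu> s * (q * V.pole_real s - V.cleared_real s)"
  "0 \<le> s \<Longrightarrow> kappa p q (- s) = poly g s / (a_coef p q * V.pole_real s)"
  using assms by (auto simp: factors_def half_line_prob lap_def)
 have a: "a_coef p q = (- 1) ^ root_count * coeff g root_count" "0 < a_coef p q"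
  using assms by (auto simp: factors_def)
 then show "coeff g root_count = (- 1) ^ root_count * a_coef p q" by (simp add: power_mult_distrib[symmetric])
 show "g \<noteq> 0" using a by auto
 show "0 \<le> s \<Longrightarrow> 0 < lap \<mu> s"
  using assms unfolding lap_def by (intro laplace_pos) (auto simp: factors_def)
qed

text \<open>Off the finite set \<open>E\<close> of zeros of \<open>g\<close> and poles the defining
  quotient is already \<open>lap \<mu> s / a_coef p q\<close>; at the exceptional points the limit
  in \<open>W_hat\<close> and the continuity of \<open>lap \<mu>\<close> give the same
  value.\<close>

lemma W_hat_factors:
 assumes f: "factors q \<mu> g" and r: "0 \<le> r"
 shows "W_hat p q r = lap \<mu> r / a_coef p q"
proof -
 note F = factorsD[OF f]
 define E where "E = {s. poly g s = 0} \<union> pole p ` {1..npoles p}"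
 have fin: "finite E" unfolding E_def using poly_roots_finite[OF F(9)] by simp
 have val: "lap \<mu> s / a_coef p q = kappa p q (- s) / (q - Re (Psi_X p (of_real s)))" if s: "0 \<le> s" "s \<notin> E" for s
 proof -
  have P: "V.pole_real s \<noteq> 0" using s(2) by (auto simp: E_def V.pole_real_def)
  have G: "poly g s = lap \<mu> s * (V.pole_real s * (q - psi s))"
   using F(6)[OF s(1)] V.cleared_real_eq[OF s(1) P] by (simp add: algebra_simps)
  moreover have "poly g s \<noteq> 0" using s(2) by (auto simp: E_def)
  ultimately have "q - psi s \<noteq> 0" by auto
  then show ?thesis using F(4) P unfolding F(7)[OF s(1)] G by simp
 qed
 have "continuous_on {0..} (\<lambda>s. Re (\<integral>y. exp (- complex_of_real s * of_real y) \<partial>\<mu>))"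
  by (intro continuous_intros
    continuous_on_compose2[OF laplace_measure_regular(1)[OF half_line_measureD(1-3)[OF F(2)]]])
   auto
 then have "continuous_on {0..} (lap \<mu>)"
  unfolding lap_def[abs_def] laplace_of_real by simp
 then have "(lap \<mu> \<longlongrightarrow> lap \<mu> r) (at r within {0..})"
  using r by (simp add: continuous_on_def)
 then have lim: "((\<lambda>s. lap \<mu> s / a_coef p q) \<longlongrightarrow> lap \<mu> r / a_coef p q) (at r within {0..})"
  using F(4) by (intro tendsto_intros) auto
 have "eventually (\<lambda>s. s \<notin> E) (at r)"
  using islimpt_finite[OF fin] islimpt_iff_eventually by blast
 then have "eventually (\<lambda>s. s \<notin> E) (at r within {0..})"
  using filter_leD[OF at_le[OF subset_UNIV]] by blast
 moreover have "eventually (\<lambda>s. s \<in> {0..}) (at r within {0..})" by (auto simp: eventually_at_filter)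
 ultimately have "eventually (\<lambda>s. lap \<mu> s / a_coef p q = kappa p q (- s) / (q - Re (Psi_X p (of_real s)))) (at r within {0..})"
  by eventually_elim (use val in auto)
 then have "((\<lambda>s. kappa p q (- s) / (q - Re (Psi_X p (of_real s)))) \<longlongrightarrow> lap \<mu> r / a_coef p q) (at r within {0..})"
  by (rule Lim_transform_eventually[OF lim])
 moreover have "at r within {0..} \<noteq> bot"
 proof
  assume "at r within {0..} = bot"
  moreover have "at_right r \<le> at r within {0..}" using r by (intro at_le) auto
  ultimately have "at_right r = bot" by (simp add: bot_unique)
  then show False by simp
 qed
 ultimately show ?thesis unfolding W_hat_def by (intro tendsto_Lim)
qed

lemma W_measure_factors:
 assumes f: "factors q \<mu> g"
 shows "inverse_laplace (W_hat p q) (W_measure p q)"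
  and "W_measure p q = scale_measure (ennreal (1 / a_coef p q)) \<mu>"
  and "scale_measure (ennreal (a_coef p q)) (W_measure p q) = \<mu>"
proof -
 note F = factorsD[OF f]
 note I = inverse_laplace_measure[OF F(2) W_hat_factors[OF f] F(4)]
 show W: "W_measure p q = scale_measure (ennreal (1 / a_coef p q)) \<mu>"
  unfolding W_measure_def by (rule I(2))
 show "inverse_laplace (W_hat p q) (W_measure p q)" unfolding W by (rule I(1))
 show "scale_measure (ennreal (a_coef p q)) (W_measure p q) = \<mu>" unfolding W by (rule I(3))
qed

section \<open>Singular parts outside the plain case\<close>

definition pole_rpoly :: "real poly" where
 "pole_rpoly = (\<Prod>j=1..npoles p. [: pole p j, - 1 :] ^ pole_order p j)"

lemma pole_rpoly:
 "poly pole_rpoly s = V.pole_real s" "degree pole_rpoly = V.pole_count"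
 "coeff pole_rpoly V.pole_count = (- 1) ^ V.pole_count"
proof -
 show "poly pole_rpoly s = V.pole_real s" by (simp add: pole_rpoly_def V.pole_real_def poly_prod)
 show d: "degree pole_rpoly = V.pole_count"
  unfolding pole_rpoly_def V.pole_count_def
  by (subst degree_prod_eq_sum_degree) (auto simp: degree_power_eq)
 have "lead_coeff pole_rpoly = (\<Prod>j=1..npoles p. lead_coeff ([: pole p j, - 1 :] ^ pole_order p j))"
  unfolding pole_rpoly_def by (rule lead_coeff_prod)
 also have "\<dots> = (\<Prod>j=1..npoles p. (- 1) ^ pole_order p j)"
  by (intro prod.cong refl) (simp only: lead_coeff_power, simp)
 finally show "coeff pole_rpoly V.pole_count = (- 1) ^ V.pole_count"
  unfolding d by (simp only: V.pole_count_def power_sum)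
qed

text \<open>For large \<open>s\<close>, \<open>a_coef p q\<close> measures
  \<open>lap \<mu> s * (psi s - q)\<close> on a scale common to both rates. As \<open>psi\<close>
  tends to infinity, the difference of the rates becomes negligible and the comparison of the
  transforms decides.\<close>

lemma a_coef_mono:
 assumes f: "factors q \<mu> g" and f': "factors q' \<mu>' g'" and q: "q \<le> q'" and np: "\<not> plain"
  and le: "\<And>s. 0 < s \<Longrightarrow> lap \<mu> s \<le> lap \<mu>' s"
 shows "a_coef p q \<le> a_coef p q'"
proof (rule ccontr)
 assume "\<not> a_coef p q \<le> a_coef p q'"
 then have lt: "a_coef p q' < a_coef p q" by simp
 note F = factorsD[OF f] and F' = factorsD[OF f']
 \<comment> \<open>\<open>c * a_coef p q\<close> is the midpoint between the two coefficients. The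
   room \<open>1 - c\<close> absorbs the difference of the rates once \<open>psi s\<close> is
   large.\<close>
 define c where "c = (a_coef p q' + a_coef p q) / (2 * a_coef p q)"
 have c: "0 < c" "c < 1" "a_coef p q' < c * a_coef p q"
  using lt F(4) F'(4) by (auto simp: c_def field_simps)
 define h where "h = smult ((- 1) ^ root_count) (smult c g - g')"
 have "coeff h root_count = c * a_coef p q - a_coef p q'"
  unfolding h_def coeff_smult coeff_diff F(5) F'(5) by (simp add: algebra_simps power_mult_distrib[symmetric])
 then have hc: "0 < coeff h root_count" using c by simp
 have "degree h = root_count"
  using hc F(3) F'(3)
  by (intro antisym le_degree) (auto simp: h_def intro!: degree_diff_le order.trans[OF degree_smult_le])
 then have "0 < lead_coeff h" using hc by simp
 from poly_pinfty_gt_lc[OF this] obtain n where n: "\<And>s. n \<le> s \<Longrightarrow> 0 < poly h s"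
  using \<open>0 < lead_coeff h\<close> by (meson less_le_trans)
 obtain b where b: "\<And>s j. b \<le> s \<Longrightarrow> j \<in> {1..npoles p} \<Longrightarrow> pole p j < s"
  using poles_bounded by blast
 obtain R where R: "\<And>s. R \<le> s \<Longrightarrow> (q' - c * q) / (1 - c) \<le> psi s"
  using V.exponent_tends_to_infinity(2) np unfolding plain_def by blast
 obtain R' where R': "\<And>s. R' \<le> s \<Longrightarrow> q' \<le> psi s"
  using V.exponent_tends_to_infinity(2) np unfolding plain_def by blast
 define s where "s = max (max 1 b) (max n (max R R'))"
 have s: "0 < s" "b \<le> s" "n \<le> s" "R \<le> s" "R' \<le> s" by (auto simp: s_def)
 define \<sigma> where "\<sigma> = (- 1) ^ V.pole_count * V.pole_real s"
 have \<sigma>: "0 < \<sigma>" unfolding \<sigma>_def by (rule pole_real_sign[OF b[OF s(2)]])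
 have cl: "V.cleared_real s = V.pole_real s * psi s"
  using s(1) pole_real_nonzero_large[OF b[OF s(2)]] by (intro V.cleared_real_eq) auto
 have rc: "(- 1 :: real) ^ root_count = - ((- 1) ^ V.pole_count)" using np by (simp add: root_count_def)
 have "poly h s = (- 1) ^ root_count * (c * (lap \<mu> s * (q * V.pole_real s - V.cleared_real s))
   - lap \<mu>' s * (q' * V.pole_real s - V.cleared_real s))"
  unfolding h_def poly_smult poly_diff F(6)[OF less_imp_le[OF s(1)]] F'(6)[OF less_imp_le[OF s(1)]] ..
 also have "\<dots> = \<sigma> * (c * lap \<mu> s * (psi s - q) - lap \<mu>' s * (psi s - q'))"
  unfolding cl rc \<sigma>_def by algebra
 finally have "0 < \<sigma> * (c * lap \<mu> s * (psi s - q) - lap \<mu>' s * (psi s - q'))" using n[OF s(3)] by simp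
 then have 1: "lap \<mu>' s * (psi s - q') < c * lap \<mu> s * (psi s - q)"
  using \<sigma> by (simp add: zero_less_mult_iff)
 have "lap \<mu> s * (psi s - q') \<le> lap \<mu>' s * (psi s - q')"
  using le[OF s(1)] R'[OF s(5)] by (intro mult_right_mono) auto
 then have "lap \<mu> s * (psi s - q') < lap \<mu> s * (c * (psi s - q))" using 1 by (simp add: mult_ac)
 then have "psi s - q' < c * (psi s - q)" using F(8)[OF less_imp_le[OF s(1)]] by simp
 then have "(1 - c) * psi s < q' - c * q" by (simp add: algebra_simps)
 moreover have "q' - c * q \<le> (1 - c) * psi s" using R[OF s(4)] c(2) by (simp add: field_simps)
 ultimately show False by simp
qed

text \<open>Eliminating \<open>cleared_real\<close> from the two factorizations leaves \<open>lap
  \<mu> * g' - lap \<mu>' * g = (q' - q) * lap \<mu> * lap \<mu>' * pole_rpoly\<close>. Over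
  \<open>(1 + s) ^ root_count\<close> each polynomial is its top coefficient plus an absolutely
  continuous transform. The degree of \<open>pole_rpoly\<close> is too small for a top coefficient,
  so those of \<open>g\<close> and \<open>g'\<close> alone give the claim.\<close>

lemma singular_parts:
 assumes f: "factors q \<mu> g" and f': "factors q' \<mu>' g'" and np: "\<not> plain" and A: "A \<in> null_sets lborel"
 shows "a_coef p q * measure (tilt \<mu>') A = a_coef p q' * measure (tilt \<mu>) A"
proof -
 note F = factorsD[OF f] and F' = factorsD[OF f']
 let ?d = root_count
 let ?h = "\<lambda>g s. poly g (1 + s) / (1 + s) ^ ?d - coeff g ?d"
 have dp: "degree pole_rpoly < ?d" using np by (simp add: pole_rpoly(2) root_count_def)
 have ac: "ac_laplace (?h g)" "ac_laplace (?h g')" "ac_laplace (?h pole_rpoly)"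
  using F(3) F'(3) dp by (auto intro!: ac_laplace_rational)
 note T = tilt(1)[OF F(2)] and T' = tilt(1)[OF F'(2)]
 have "ac_laplace (\<lambda>s. (- 1) ^ ?d * (lap (tilt \<mu>) s * ?h g' s - lap (tilt \<mu>') s * ?h g s
   - (q' - q) * (lap (tilt \<mu>) s * (lap (tilt \<mu>') s * ?h pole_rpoly s))))"
  by (intro ac_laplace_cmult ac_laplace_diff ac_laplace_mult_lap ac T T')
 then have "ac_laplace (\<lambda>s. a_coef p q * lap (tilt \<mu>') s - a_coef p q' * lap (tilt \<mu>) s)"
 proof (rule ac_laplace_cong)
  fix s :: real assume s: "0 \<le> s"
  then have t: "0 \<le> 1 + s" by simp
  have D: "(1 + s) ^ ?d \<noteq> 0" using s by simp
  have cp: "coeff pole_rpoly ?d = 0" using dp by (rule coeff_eq_0)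
  have tl: "lap (tilt \<mu>) s = lap \<mu> (1 + s)" "lap (tilt \<mu>') s = lap \<mu>' (1 + s)"
   by (rule tilt(2)[OF F(2)], rule tilt(2)[OF F'(2)])
  have id: "lap \<mu> (1 + s) * poly g' (1 + s) - lap \<mu>' (1 + s) * poly g (1 + s)
    - (q' - q) * (lap \<mu> (1 + s) * (lap \<mu>' (1 + s) * poly pole_rpoly (1 + s))) = 0"
   unfolding F(6)[OF t] F'(6)[OF t] pole_rpoly(1) by algebra
  have "lap \<mu> (1 + s) * (poly g' (1 + s) / (1 + s) ^ ?d) - lap \<mu>' (1 + s) * (poly g (1 + s) / (1 + s) ^ ?d)
    - (q' - q) * (lap \<mu> (1 + s) * (lap \<mu>' (1 + s) * (poly pole_rpoly (1 + s) / (1 + s) ^ ?d))) = 0 / (1 + s) ^ ?d"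
   unfolding id[symmetric] diff_divide_distrib by simp
  then have "lap \<mu> (1 + s) * ?h g' s - lap \<mu>' (1 + s) * ?h g s
    - (q' - q) * (lap \<mu> (1 + s) * (lap \<mu>' (1 + s) * ?h pole_rpoly s))
    = lap \<mu>' (1 + s) * coeff g ?d - lap \<mu> (1 + s) * coeff g' ?d"
   unfolding cp right_diff_distrib by simp
  then have "(- 1) ^ ?d * (lap (tilt \<mu>) s * ?h g' s - lap (tilt \<mu>') s * ?h g s
    - (q' - q) * (lap (tilt \<mu>) s * (lap (tilt \<mu>') s * ?h pole_rpoly s)))
    = (- 1) ^ ?d * (lap \<mu>' (1 + s) * coeff g ?d - lap \<mu> (1 + s) * coeff g' ?d)"
   unfolding tl by (simp only:)
  also have "\<dots> = a_coef p q * lap (tilt \<mu>') s - a_coef p q' * lap (tilt \<mu>) s"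
   unfolding tl F(5) F'(5) by (simp add: algebra_simps power_mult_distrib[symmetric])
  finally show "(- 1) ^ ?d * (lap (tilt \<mu>) s * ?h g' s - lap (tilt \<mu>') s * ?h g s
    - (q' - q) * (lap (tilt \<mu>) s * (lap (tilt \<mu>') s * ?h pole_rpoly s)))
    = a_coef p q * lap (tilt \<mu>') s - a_coef p q' * lap (tilt \<mu>) s" .
 qed
 then show ?thesis
  using F(4) F'(4) by (intro ac_laplace_null_sets T T' A) auto
qed

lemma emeasure_tilt_eq_0:
 assumes "half_line_measure N" "A \<in> sets borel" "emeasure (tilt N) A = 0"
 shows "emeasure N A = 0"
proof -
 note D = half_line_measureD[OF assms(1)]
 have [measurable_cong]: "sets N = sets borel" by (rule D)
 have "A \<in> null_sets (tilt N)" using assms D by (intro null_setsI) (auto simp: tilt_def)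
 then have "AE x in N. x \<in> A \<longrightarrow> ennreal (exp (- x)) = 0"
  unfolding tilt_def by (subst (asm) null_sets_density_iff) auto
 then have "AE x in N. x \<notin> A" by eventually_elim (auto simp: ennreal_eq_0_iff)
 then show ?thesis using assms(2) D by (subst (asm) AE_iff_null_sets[symmetric]) auto
qed

text \<open>On null sets the tilted laws at two rates are proportional to \<open>a_coef\<close>,
  which does not decrease in the rate; so the mass at rate \<open>q\<close> is at most that at any
  larger rate. Away from 0 the latter tends to 0 as the rate grows.\<close>

lemma density_unbounded_exponent:
 assumes f: "factors q \<mu> g" and np: "\<not> plain"
  and le: "\<And>s q'. 0 < s \<Longrightarrow> q \<le> q' \<Longrightarrow> 0 < q' \<Longrightarrow> lap \<mu> s \<le> inf_laplace q' s"
  and A: "A \<in> null_sets lborel" "A \<subseteq> {0<..}"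
 shows "emeasure \<mu> A = 0"
proof -
 note F = factorsD[OF f]
 note D = half_line_measureD[OF F(2)]
 have Ab: "A \<in> sets borel" using A by auto
 interpret T: finite_measure "tilt \<mu>" by (rule half_line_measureD[OF tilt(1)[OF F(2)]])
 have zero: "measure (tilt \<mu>) (A \<inter> {e<..}) = 0" if e: "0 < e" for e
 proof -
  let ?A = "A \<inter> {e<..}"
  have A': "?A \<in> null_sets lborel" using A(1) by (rule null_set_Int2) simp
  have step: "measure (tilt \<mu>) ?A \<le> measure (inf_law (real (Suc n))) {e<..}" if n: "q \<le> real (Suc n)" for n
  proof -
   have q': "0 < real (Suc n)" by simp
   obtain g' where f': "factors (real (Suc n)) (inf_law (real (Suc n))) g'"
    using factors_inf_law[OF q'] by blast
   note F' = factorsD[OF f']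
   note D' = half_line_measureD[OF F'(2)]
   interpret I: finite_measure "inf_law (real (Suc n))" by (rule D')
   interpret T': finite_measure "tilt (inf_law (real (Suc n)))" by (rule half_line_measureD[OF tilt(1)[OF F'(2)]])
   have mono: "a_coef p q \<le> a_coef p (real (Suc n))"
    using le[OF _ n q'] by (intro a_coef_mono[OF f f' n np]) (simp add: lap_def inf_laplace_def)
   have "a_coef p q * measure (tilt \<mu>) ?A \<le> a_coef p (real (Suc n)) * measure (tilt \<mu>) ?A"
    by (rule mult_right_mono[OF mono measure_nonneg])
   also have "\<dots> = a_coef p q * measure (tilt (inf_law (real (Suc n)))) ?A"
    by (rule singular_parts[OF f f' np A', symmetric])
   finally have "measure (tilt \<mu>) ?A \<le> measure (tilt (inf_law (real (Suc n)))) ?A" using F(4) by simp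
   also have "\<dots> \<le> measure (tilt (inf_law (real (Suc n)))) {e<..}"
    by (intro T'.finite_measure_mono) (auto simp: tilt_def D' simp del: of_nat_Suc)
   also have "\<dots> \<le> measure (inf_law (real (Suc n))) {e<..}"
   proof -
    have "emeasure (tilt (inf_law (real (Suc n)))) {e<..}
      = (\<integral>\<^sup>+x. ennreal (exp (- x)) * indicator {e<..} x \<partial>inf_law (real (Suc n)))"
     unfolding tilt_def by (rule emeasure_density) (auto simp: D' simp del: of_nat_Suc cong: measurable_cong_sets)
    also have "\<dots> \<le> (\<integral>\<^sup>+x. indicator {e<..} x \<partial>inf_law (real (Suc n)))"
     using e by (intro nn_integral_mono) (auto simp: indicator_def)
    also have "\<dots> = emeasure (inf_law (real (Suc n))) {e<..}"
     by (rule nn_integral_indicator) (subst D'(2), simp)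
    finally show ?thesis by (simp add: I.emeasure_eq_measure T'.emeasure_eq_measure del: of_nat_Suc)
   qed
   finally show ?thesis .
  qed
  have "eventually (\<lambda>n. measure (tilt \<mu>) ?A \<le> measure (inf_law (real (Suc n))) {e<..}) sequentially"
   using eventually_ge_at_top[of "nat \<lceil>q\<rceil>"]
  proof eventually_elim
   case (elim n)
   then have "q \<le> real (Suc n)" by linarith
   then show ?case by (rule step)
  qed
  then have "measure (tilt \<mu>) ?A \<le> 0"
   by (rule tendsto_lowerbound[OF inf_law_tail_tendsto_0[OF e]]) simp
  then show ?thesis using measure_nonneg[of "tilt \<mu>" ?A] by linarith
 qed
 have sT: "sets (tilt \<mu>) = sets borel" by (rule half_line_measureD[OF tilt(1)[OF F(2)]])
 have z: "emeasure (tilt \<mu>) (\<Union>n. A \<inter> {1 / real (Suc n)<..}) = 0"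
  using Ab zero by (intro emeasure_UN_eq_0) (auto simp: T.emeasure_eq_measure sT)
 have sub: "A \<subseteq> (\<Union>n. A \<inter> {1 / real (Suc n)<..})"
 proof
  fix x assume x: "x \<in> A"
  then obtain n where "1 / real (Suc n) < x"
   using A(2) nat_approx_posE[of x] by auto
  then show "x \<in> (\<Union>n. A \<inter> {1 / real (Suc n)<..})" using x by auto
 qed
 have "emeasure (tilt \<mu>) A = 0"
  by (rule emeasure_eq_0[OF _ z sub]) (use Ab in \<open>auto simp: sT\<close>)
 then show ?thesis by (rule emeasure_tilt_eq_0[OF F(2) Ab])
qed

end

section \<open>Densities in the plain case\<close>

context model_setting
begin

lemma cleared_real_plain:
 assumes pl: plain and s: "0 \<le> s"
 shows "V.cleared_real s = V.pole_real s * (- up_rate p - (\<integral>x. 1 - exp (- s * x) \<partial>V.\<nu>)) + up_rate p * poly (numer p) (- s)"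
  and "integrable V.\<nu> (\<lambda>x. 1 - exp (- s * x))"
proof -
 have bv: "V.bounded_variation" and jd: "V.jump_drift = 0" and dg: "drift p = 0" "gauss p = 0"
  using pl V.driftless_iff by (auto simp: plain_def)
 have eq: "Re (1 - exp (- complex_of_real s * of_real x)) = 1 - exp (- s * x)" for x
  by (metis Re_complex_of_real exp_of_real minus_complex.simps(1) of_real_minus of_real_mult one_complex.simps(1))
 have i: "integrable V.\<nu> (\<lambda>x. 1 - exp (- complex_of_real s * of_real x))"
  using V.integrable_one_minus_exp[OF bv, of "of_real s"] s by simp
 from integrable_Re[OF i] show "integrable V.\<nu> (\<lambda>x. 1 - exp (- s * x))" unfolding eq .
 have "V.Psi_S_real s = Re (G_S p (of_real s))"
  unfolding V.Psi_S_real_def using V.Psi_S_bounded_variation[OF bv, of "of_real s"] s jd by simp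
 also have "\<dots> = (\<integral>x. 1 - exp (- s * x) \<partial>V.\<nu>)"
  unfolding G_S_def integral_Re[OF i, symmetric] eq ..
 finally show "V.cleared_real s = V.pole_real s * (- up_rate p - (\<integral>x. 1 - exp (- s * x) \<partial>V.\<nu>)) + up_rate p * poly (numer p) (- s)"
  by (simp add: V.cleared_real_def dg)
qed

text \<open>Finite even if \<open>down_measure p\<close> is not, because
  \<open>1 - exp (- x)\<close> is integrable in the plain case. Its transform is the unit increment
  of the exponent of the downward jumps.\<close>

definition jump_tilt :: "real measure" where
 "jump_tilt = density V.\<nu> (\<lambda>x. ennreal (1 - exp (- x)))"

lemma jump_tilt:
 assumes pl: plain
 shows "half_line_measure jump_tilt"
  and "0 \<le> s \<Longrightarrow> lap jump_tilt s = (\<integral>x. 1 - exp (- (s + 1) * x) \<partial>V.\<nu>) - (\<integral>x. 1 - exp (- s * x) \<partial>V.\<nu>)"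
  and "absolutely_continuous lborel V.\<nu> \<Longrightarrow> absolutely_continuous lborel jump_tilt"
proof -
 note int = cleared_real_plain(2)[OF pl]
 have nn: "AE x in V.\<nu>. 0 \<le> 1 - exp (- x)" using V.AE_nu by eventually_elim simp
 have "(\<integral>\<^sup>+x. ennreal (1 - exp (- x)) \<partial>V.\<nu>) = ennreal (\<integral>x. 1 - exp (- x) \<partial>V.\<nu>)"
  using int[of 1] nn by (intro nn_integral_eq_integral) auto
 then have fin: "finite_measure jump_tilt"
  unfolding jump_tilt_def by (intro finite_measureI) (simp add: emeasure_density)
 have z: "(\<integral>\<^sup>+x. ennreal (1 - exp (- x)) * indicator {..<0} x \<partial>V.\<nu>) = (\<integral>\<^sup>+x. 0 \<partial>V.\<nu>)"
  using V.AE_nu by (intro nn_integral_cong_AE) (auto elim!: eventually_mono)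
 have "emeasure jump_tilt {..<0} = 0"
  unfolding jump_tilt_def by (subst emeasure_density) (auto simp: z)
 with fin show "half_line_measure jump_tilt" by (simp add: half_line_measure_def jump_tilt_def)
 show "lap jump_tilt s = (\<integral>x. 1 - exp (- (s + 1) * x) \<partial>V.\<nu>) - (\<integral>x. 1 - exp (- s * x) \<partial>V.\<nu>)" if s: "0 \<le> s"
 proof -
  have "lap jump_tilt s = (\<integral>x. (1 - exp (- x)) *\<^sub>R exp (- s * x) \<partial>V.\<nu>)"
   unfolding lap_def jump_tilt_def using nn by (intro integral_density) auto
  also have "\<dots> = (\<integral>x. (1 - exp (- (s + 1) * x)) - (1 - exp (- s * x)) \<partial>V.\<nu>)"
   by (intro Bochner_Integration.integral_cong refl) (simp add: exp_add[symmetric] algebra_simps)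
  also have "\<dots> = (\<integral>x. 1 - exp (- (s + 1) * x) \<partial>V.\<nu>) - (\<integral>x. 1 - exp (- s * x) \<partial>V.\<nu>)"
   using s by (intro Bochner_Integration.integral_diff int) auto
  finally show ?thesis .
 qed
 show "absolutely_continuous lborel jump_tilt" if "absolutely_continuous lborel V.\<nu>"
 proof -
  have "absolutely_continuous V.\<nu> jump_tilt"
   unfolding jump_tilt_def by (rule absolutely_continuousI_density) simp
  then show ?thesis using that by (auto simp: absolutely_continuous_def)
 qed
qed

text \<open>Differences between the points \<open>s\<close> and \<open>s + 1\<close> replace the derivative in \<open>s\<close>: only the
 finite measure \<open>jump_tilt\<close> is left of the Levy measure.\<close>

lemma density_plain:
 assumes f: "factors q \<mu> g" and pl: plain and ac: "absolutely_continuous lborel (down_measure p)"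
  and A: "A \<in> null_sets lborel" "A \<subseteq> {0<..}"
 shows "emeasure \<mu> A = 0"
proof -
 note F = factorsD[OF f]
 have Ab: "A \<in> sets borel" using A by auto
 define m where "m = V.pole_count"
 have rc: "root_count = m" using pl by (simp add: root_count_def m_def)
 have m1: "1 \<le> m" using V.degree_numer(2) by (simp add: m_def)
 define n where "n = pcompose (numer p) [:0, - 1:]"
 have nv: "poly n s = poly (numer p) (- s)" for s by (simp add: n_def poly_pcompose)
 have dn: "degree n < m"
  using V.degree_numer(1) m1 unfolding n_def m_def by (simp add: degree_pcompose)
 define sh where "sh f = pcompose f [:1, 1:]" for f :: "real poly"
 have shv: "poly (sh f) s = poly f (s + 1)" for f s by (simp add: sh_def poly_pcompose add.commute)
 have shd: "degree (sh f) = degree f" for f by (simp add: sh_def degree_pcompose)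
 have shl: "coeff (sh f) (degree f) = coeff f (degree f)" for f
  using lead_coeff_comp[of "[:1, 1:]" f] by (simp add: sh_def degree_pcompose)
 let ?P = pole_rpoly
 have dP: "degree ?P = m" and cP: "coeff ?P m = (- 1) ^ m" using pole_rpoly by (auto simp: m_def)
 have dg: "degree g = m" and cg: "coeff g m = (- 1) ^ m * a_coef p q" using F(3,5) by (auto simp: rc)
 \<comment> \<open>Products from cross-multiplying the factorizations at \<open>t\<close> and at
   \<open>t + 1\<close>. The signs \<open>(- 1) ^ m\<close> cancel, so \<open>U\<close> and
   \<open>U'\<close> have the same top coefficient \<open>a_coef p q\<close>.\<close>
 define U where "U = ?P * sh g"
 define U' where "U' = sh ?P * g"
 define Vp where "Vp = ?P * sh ?P"
 define Wp where "Wp = ?P * sh n - sh ?P * n"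
 have dU: "degree U \<le> 2 * m" "degree U' \<le> 2 * m" "degree Vp \<le> 2 * m"
  unfolding U_def U'_def Vp_def
  by (rule order.trans[OF degree_mult_le], simp add: shd dP dg)+
 have cm: "coeff (f * h) (2 * m) = coeff f m * coeff h m" if "degree f = m" "degree h = m" for f h :: "real poly"
  using coeff_mult_degree_sum[of f h] that by (simp add: mult_2)
 have cU: "coeff U (2 * m) = a_coef p q" "coeff U' (2 * m) = a_coef p q" "coeff Vp (2 * m) = 1"
  using shl[of g] shl[of ?P] unfolding U_def U'_def Vp_def
  by (subst cm; simp add: shd dP dg cP cg power_mult_distrib[symmetric])+
 \<comment> \<open>The numerator of the upward transform has degree below \<open>m\<close>, so the
   upward jumps leave no constant term behind.\<close>
 have dW: "degree Wp < 2 * m"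
 proof -
  have "degree (?P * sh n) < 2 * m" "degree (sh ?P * n) < 2 * m"
   using degree_mult_le[of ?P "sh n"] degree_mult_le[of "sh ?P" n] dn by (auto simp: shd dP)
  then show ?thesis unfolding Wp_def by (rule degree_diff_less)
 qed
 have cW: "coeff Wp (2 * m) = 0" using dW by (rule coeff_eq_0)
 let ?h = "\<lambda>f s. poly f (1 + s) / (1 + s) ^ (2 * m) - coeff f (2 * m)"
 have ach: "ac_laplace (?h U)" "ac_laplace (?h U')" "ac_laplace (?h Vp)" "ac_laplace (?h Wp)"
  using dU dW by (auto intro!: ac_laplace_rational)
 define T1 where "T1 = tilt \<mu>"
 define T2 where "T2 = tilt (tilt \<mu>)"
 define L where "L = tilt jump_tilt"
 have T1: "half_line_measure T1" "lap T1 s = lap \<mu> (1 + s)" for s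
  unfolding T1_def using tilt[OF F(2)] by auto
 have T2: "half_line_measure T2" "lap T2 s = lap \<mu> (1 + s + 1)" for s
  unfolding T2_def using tilt[OF tilt(1)[OF F(2)]] tilt(2)[OF F(2)] by (auto simp: add_ac)
 have L: "half_line_measure L" "lap L s = lap jump_tilt (1 + s)" for s
  unfolding L_def using tilt[OF jump_tilt(1)[OF pl]] by auto
 have "absolutely_continuous jump_tilt L"
  unfolding L_def tilt_def
  by (rule absolutely_continuousI_density) (simp add: jump_tilt_def)
 then have acL: "absolutely_continuous lborel L"
  using jump_tilt(3)[OF pl ac] by (auto simp: absolutely_continuous_def)
 have acl: "ac_laplace (lap L)" by (rule ac_laplace_lap[OF L(1) acL])
 \<comment> \<open>The separate summand \<open>lap L s\<close> restores the top coefficient 1 of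
   \<open>Vp\<close> that \<open>?h Vp\<close> has removed; it is admissible because absolute
   continuity of \<open>down_measure p\<close> passes to \<open>L\<close>.\<close>
 have "ac_laplace (\<lambda>s. lap T1 s * (lap T2 s * (lap L s * ?h Vp s + lap L s - up_rate p * ?h Wp s))
   - lap T1 s * ?h U s + lap T2 s * ?h U' s)"
  by (intro ac_laplace_add ac_laplace_diff ac_laplace_mult_lap ac_laplace_cmult ach acl T1 T2 L(1))
 then have "ac_laplace (\<lambda>s. a_coef p q * lap T1 s - a_coef p q * lap T2 s)"
 proof (rule ac_laplace_cong)
  fix s :: real assume s: "0 \<le> s"
  define t where "t = 1 + s"
  have t: "0 \<le> t" "0 \<le> t + 1" "t \<noteq> 0" using s by (auto simp: t_def)
  have N: "t ^ (2 * m) \<noteq> 0" using t(3) by simp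
  define H where "H s = (\<integral>x. 1 - exp (- s * x) \<partial>V.\<nu>)" for s
  define l where "l = lap jump_tilt t"
  have l: "H (t + 1) = H t + l" using jump_tilt(2)[OF pl t(1)] by (simp add: l_def H_def)
  have g1: "poly g t = lap \<mu> t * (poly ?P t * (q + up_rate p + H t) - up_rate p * poly n t)"
   unfolding F(6)[OF t(1)] cleared_real_plain(1)[OF pl t(1)] pole_rpoly nv H_def by algebra
  have g2: "poly g (t + 1) = lap \<mu> (t + 1) * (poly ?P (t + 1) * (q + up_rate p + (H t + l)) - up_rate p * poly n (t + 1))"
   unfolding F(6)[OF t(2)] cleared_real_plain(1)[OF pl t(2)] pole_rpoly nv l[symmetric]
   unfolding H_def by algebra
  \<comment> \<open>Cross-multiplication cancels the common part \<open>q + up_rate p + H t\<close>;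
    of the Levy measure only the increment \<open>l\<close> is left.\<close>
  have id: "lap \<mu> t * poly U t - lap \<mu> (t + 1) * poly U' t
    = lap \<mu> t * (lap \<mu> (t + 1) * (l * poly Vp t - up_rate p * poly Wp t))"
   unfolding U_def U'_def Vp_def Wp_def poly_mult poly_diff shv g1 g2 by algebra
  have "lap \<mu> t * (poly U t / t ^ (2 * m)) - lap \<mu> (t + 1) * (poly U' t / t ^ (2 * m))
    = (lap \<mu> t * poly U t - lap \<mu> (t + 1) * poly U' t) / t ^ (2 * m)"
   by (simp add: diff_divide_distrib)
  also have "\<dots> = lap \<mu> t * (lap \<mu> (t + 1) * (l * (poly Vp t / t ^ (2 * m)) - up_rate p * (poly Wp t / t ^ (2 * m))))"
   unfolding id by (simp add: diff_divide_distrib right_diff_distrib)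
  finally have id2: "lap \<mu> t * (poly U t / t ^ (2 * m)) - lap \<mu> (t + 1) * (poly U' t / t ^ (2 * m))
    = lap \<mu> t * (lap \<mu> (t + 1) * (l * (poly Vp t / t ^ (2 * m)) - up_rate p * (poly Wp t / t ^ (2 * m))))" .
  show "lap T1 s * (lap T2 s * (lap L s * ?h Vp s + lap L s - up_rate p * ?h Wp s))
   - lap T1 s * ?h U s + lap T2 s * ?h U' s = a_coef p q * lap T1 s - a_coef p q * lap T2 s"
   unfolding T1(2) T2(2) L(2) cU cW t_def[symmetric] l_def[symmetric]
   using id2 by (simp add: algebra_simps)
 qed
 \<comment> \<open>\<open>T2\<close> has the density \<open>exp (- x)\<close> with respect to
   \<open>T1\<close>, which is below 1 on the positive half-line. Equal masses on \<open>A\<close>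
   therefore force \<open>A\<close> to be null.\<close>
 then have eq: "a_coef p q * measure T1 A = a_coef p q * measure T2 A"
  using F(4) by (intro ac_laplace_null_sets T1 T2 A) auto
 interpret T1: finite_measure T1 by (rule half_line_measureD[OF T1(1)])
 interpret T2: finite_measure T2 by (rule half_line_measureD[OF T2(1)])
 note D = half_line_measureD[OF T1(1)]
 have [measurable_cong]: "sets T1 = sets borel" by (rule D)
 have "emeasure T2 A = (\<integral>\<^sup>+x. ennreal (exp (- x)) * indicator A x \<partial>T1)"
  unfolding T2_def T1_def[symmetric] unfolding tilt_def
  by (rule emeasure_density) (auto simp: Ab D(2))
 moreover have "emeasure T2 A = emeasure T1 A"
  using eq F(4) by (simp add: T1.emeasure_eq_measure T2.emeasure_eq_measure)
 ultimately have e: "(\<integral>\<^sup>+x. ennreal (exp (- x)) * indicator A x \<partial>T1) = emeasure T1 A" by simp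
 have "(\<integral>\<^sup>+x. indicator A x - ennreal (exp (- x)) * indicator A x \<partial>T1)
   = (\<integral>\<^sup>+x. indicator A x \<partial>T1) - (\<integral>\<^sup>+x. ennreal (exp (- x)) * indicator A x \<partial>T1)"
 proof (rule nn_integral_diff)
  show "(\<integral>\<^sup>+x. ennreal (exp (- x)) * indicator A x \<partial>T1) \<noteq> \<infinity>" unfolding e by simp
  show "AE x in T1. ennreal (exp (- x)) * indicator A x \<le> indicator A x"
   using A(2) by (intro AE_I2) (auto simp: indicator_def)
 qed (use Ab in measurable)
 also have "\<dots> = 0" using Ab D by (simp add: e T1.emeasure_eq_measure)
 finally have "AE x in T1. indicator A x - ennreal (exp (- x)) * indicator A x = 0"
  using Ab by (subst (asm) nn_integral_0_iff_AE) auto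
 then have "AE x in T1. x \<notin> A"
 proof eventually_elim
  case (elim x)
  show ?case
  proof
   assume x: "x \<in> A"
   then have "0 < x" using A(2) by auto
   then have "ennreal (exp (- x)) < ennreal 1" by (intro ennreal_lessI) auto
   then have "0 < ennreal 1 - ennreal (exp (- x))" by (simp add: diff_gr0_ennreal)
   then show False using elim x by simp
  qed
 qed
 then have "emeasure T1 A = 0" using Ab D by (subst (asm) AE_iff_null_sets[symmetric]) auto
 then show ?thesis unfolding T1_def by (rule emeasure_tilt_eq_0[OF F(2) Ab])
qed

lemma generalized_density_law:
 assumes f: "factors q \<mu> g"
  and le: "\<And>s q'. 0 < s \<Longrightarrow> q \<le> q' \<Longrightarrow> 0 < q' \<Longrightarrow> lap \<mu> s \<le> inf_laplace q' s"
  and cases: "\<not> plain \<or> absolutely_continuous lborel (down_measure p)"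
 shows "\<exists>w0 w. generalized_density (W_measure p q) w0 w \<and>
  generalized_density \<mu> (a_coef p q * w0) (\<lambda>x. a_coef p q * w x)"
proof -
 note F = factorsD[OF f]
 note W = W_measure_factors[OF f]
 have null: "emeasure \<mu> A = 0" if "A \<in> null_sets lborel" "A \<subseteq> {0<..}" for A
  using density_unbounded_exponent[OF f _ le that] density_plain[OF f _ _ that] cases by blast
 have "0 \<le> 1 / a_coef p q" using F(4) by simp
 from half_line_scale(1)[OF F(2) this] have H: "half_line_measure (W_measure p q)"
  unfolding W(2) .
 have "\<exists>w0 w. generalized_density (W_measure p q) w0 w"
  by (rule generalized_density_exists[OF H]) (simp add: W(2) null)
 then obtain w0 w where w: "generalized_density (W_measure p q) w0 w" by blast
 from generalized_density_scale[OF w less_imp_le[OF F(4)]]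
 have "generalized_density \<mu> (a_coef p q * w0) (\<lambda>x. a_coef p q * w x)" unfolding W(3) .
 with w show ?thesis by blast
qed

text \<open>Besides the law, the density argument takes from the paths a comparison with all larger
  rates: it stems from the coupling of exponential times for \<open>q > 0\<close> and from the limit
  of that coupling for \<open>q = 0\<close>.\<close>

lemma neg_infimum_law:
 assumes Y: "neg_infimum M X q Y"
 obtains \<mu> g where "factors q \<mu> g" "Y \<in> borel_measurable M" "distr M borel Y = \<mu>"
  "\<And>s q'. 0 < s \<Longrightarrow> q \<le> q' \<Longrightarrow> 0 < q' \<Longrightarrow> lap \<mu> s \<le> inf_laplace q' s"
proof -
 consider e where "0 < q" "indep_exponential M X q e" "Y = (\<lambda>\<omega>. - running_inf X (e \<omega>) \<omega>)"
  | "q = 0" "positive_mean M X" "Y = (\<lambda>\<omega>. - global_inf X \<omega>)"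
  using Y unfolding neg_infimum_def by blast
 then show thesis
 proof cases
  case 1
  obtain g where g: "factors q (inf_law q) g" using factors_inf_law[OF 1(1)] by blast
  note I = inf_law_indep_exponential[OF 1(1,2)]
  show thesis
  proof (rule that[OF g])
   show "Y \<in> borel_measurable M" unfolding 1(3) using I(1) by simp
   show "distr M borel Y = inf_law q" unfolding 1(3) by (rule I(2))
   show "lap (inf_law q) s \<le> inf_laplace q' s" if "0 < s" "q \<le> q'" "0 < q'" for s q'
    using inf_laplace_mono[OF 1(1) that(2), of s] that(1) by (simp add: lap_def inf_laplace_def)
  qed
 next
  case 2
  obtain g where g: "factors 0 global_law g" using factors_global_law(1)[OF 2(2)] by blast
  show thesis
  proof (rule that)
   show "factors q global_law g" using g 2(1) by simp
   show "Y \<in> borel_measurable M" unfolding 2(3) by simp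
   show "distr M borel Y = global_law" unfolding 2(3) global_law_def ..
   show "lap global_law s \<le> inf_laplace q' s" if "0 < s" "q \<le> q'" "0 < q'" for s q'
    unfolding lap_def factors_global_law(3)[OF 2(2) that(1)] using that by (intro lim_laplace_le_inf_laplace)
  qed
 qed
qed

lemma neg_infimum_laplace:
 assumes Y: "neg_infimum M X q Y" and r: "0 \<le> r"
 shows "expectation (\<lambda>\<omega>. exp (- r * Y \<omega>)) = a_coef p q * W_hat p q r"
proof -
 obtain \<mu> g where f: "factors q \<mu> g" and m: "Y \<in> borel_measurable M" and d: "distr M borel Y = \<mu>"
  using neg_infimum_law[OF Y] by metis
 have "lap \<mu> r = expectation (\<lambda>\<omega>. exp (- r * Y \<omega>))"
  unfolding lap_def d[symmetric] by (rule integral_distr[OF m]) simp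
 then show ?thesis using W_hat_factors[OF f r] factorsD(4)[OF f] by simp
qed

lemma not_plain:
 assumes "case_B p \<or> case_C M p X"
 shows "\<not> plain"
 using assms by (auto simp: plain_def case_B_def case_C_def case_A_def)

end

text \<open>The clause on densities restricts Case A: there \<open>X\<close> moves by jumps alone,
  and an atom of \<open>down_measure p\<close> can reappear as an atom of the law, while a
  generalized density admits an atom at 0 only.\<close>

theorem lemma4:
  fixes M :: "'a measure" and p :: model and B Z S X :: "real \<Rightarrow> 'a \<Rightarrow> real"
  assumes "levy_model M p B Z S X"
    and "case_A M p X \<or> case_B p \<or> case_C M p X"
  shows "(\<forall>q>0. \<forall>e. indep_exponential M X q e \<longrightarrow>
            (\<forall>r\<ge>0. prob_space.expectation M (\<lambda>\<omega>. exp (- r * (- running_inf X (e \<omega>) \<omega>)))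
                     = a_coef p q * W_hat p q r))
       \<and> (positive_mean M X \<longrightarrow>
            (\<forall>r\<ge>0. prob_space.expectation M (\<lambda>\<omega>. exp (- r * (- global_inf X \<omega>)))
                     = a_coef p 0 * W_hat p 0 r))
       \<and> (\<forall>q Y. neg_infimum M X q Y \<longrightarrow>
            inverse_laplace (W_hat p q) (W_measure p q) \<and>
            Y \<in> borel_measurable M \<and>
            distr M borel Y = scale_measure (ennreal (a_coef p q)) (W_measure p q) \<and>
            (case_B p \<or> case_C M p X \<or> absolutely_continuous lborel (down_measure p) \<longrightarrow>
              (\<exists>w0 w. generalized_density (W_measure p q) w0 w \<and>
                      generalized_density (distr M borel Y) (a_coef p q * w0)
                        (\<lambda>x. a_coef p q * w x))))"
proof -
 interpret model_setting M p B Z S X by unfold_locales (rule assms(1))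
 show ?thesis
 proof (intro conjI allI impI)
  fix q e r :: real and e' assume q: "0 < q" "indep_exponential M X q e'" and r: "0 \<le> r"
  have "neg_infimum M X q (\<lambda>\<omega>. - running_inf X (e' \<omega>) \<omega>)" using q by (auto simp: neg_infimum_def)
  from neg_infimum_laplace[OF this r]
  show "expectation (\<lambda>\<omega>. exp (- r * (- running_inf X (e' \<omega>) \<omega>))) = a_coef p q * W_hat p q r" .
 next
  fix r :: real assume m: "positive_mean M X" and r: "0 \<le> r"
  have "neg_infimum M X 0 (\<lambda>\<omega>. - global_inf X \<omega>)" using m by (simp add: neg_infimum_def)
  from neg_infimum_laplace[OF this r]
  show "expectation (\<lambda>\<omega>. exp (- r * (- global_inf X \<omega>))) = a_coef p 0 * W_hat p 0 r" .
 next
  fix q Y assume Y: "neg_infimum M X q Y"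
  obtain \<mu> g where f: "factors q \<mu> g" and m: "Y \<in> borel_measurable M" and d: "distr M borel Y = \<mu>"
   and le: "\<And>s q'. 0 < s \<Longrightarrow> q \<le> q' \<Longrightarrow> 0 < q' \<Longrightarrow> lap \<mu> s \<le> inf_laplace q' s"
   using neg_infimum_law[OF Y] by metis
  note W = W_measure_factors[OF f]
  show "inverse_laplace (W_hat p q) (W_measure p q)" by (rule W(1))
  show "Y \<in> borel_measurable M" by (rule m)
  show "distr M borel Y = scale_measure (ennreal (a_coef p q)) (W_measure p q)" unfolding d W(3) ..
  assume "case_B p \<or> case_C M p X \<or> absolutely_continuous lborel (down_measure p)"
  then have "\<not> plain \<or> absolutely_continuous lborel (down_measure p)" using not_plain by blast
  from generalized_density_law[OF f le this]
  show "\<exists>w0 w. generalized_density (W_measure p q) w0 w \<and>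
    generalized_density (distr M borel Y) (a_coef p q * w0) (\<lambda>x. a_coef p q * w x)"
   unfolding d .
 qed
qed

end
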